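(* Let $u_0\in L^2(\Omega)$. Let $u$ be the solution to $$\sum_{j=1}^\ell q_j\partial_t^{\alpha_j}(u-u_0)+A(x)u=0\ \text{ in }\Omega\times(0,T),\qquad u(x,0)=u_0(x)\ \text{ in }\Omega,\qquad u=0\ \text{ on }\partial\Omega\times(0,T),$$ and let $w$ be the solution to $$\partial_t w+A(x)w=0\ \text{ in }\Omega\times(0,\infty),\qquad w(x,0)=u_0(x)\ \text{ in }\Omega,\qquad w=0\ \text{ on }\partial\Omega\times(0,\infty).$$ Put $Q(s):=\sum_{j=1}^\ell q_js^{\alpha_j}$. Then, for every $s_0>0$ and every $t\in(0,T]$, $$u(t)=\int_0^\infty w(\tau)\left(\frac1{2\pi i}\int_{s_0-i\infty}^{s_0+i\infty}s^{-1}Q(s)\,e^{st-Q(s)\tau}\,ds\right)d\tau .$$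
   Context: $T>0$ is given, $\Omega\subset\mathbb R^d$ is a bounded domain (open, connected) with sufficiently smooth boundary $\partial\Omega$. The numbers $q_1,\dots,q_\ell$ are positive constants and $0<\alpha_\ell<\cdots<\alpha_1<1$. The operator $A$ has domain $D(A)=\{\psi\in H^2(\Omega):\psi=0\text{ on }\partial\Omega\}$ and is given by $A\psi(x)=-\sum_{i,j=1}^d\partial_j(a_{ij}(x)\partial_i\psi(x))+c(x)\psi(x)$, where $a_{ij}=a_{ji}\in C^1(\overline\Omega)$, $c\in L^\infty(\Omega)$, $c\ge0$, and there is $a_0>0$ with $\sum_{i,j}a_{ij}(x)\xi_i\xi_j\ge a_0\sum_i\xi_i^2$ for all $x\in\overline\Omega$, $\xi\in\mathbb R^d$. For $\alpha>0$, $J^\alpha g(t)=\frac1{\Gamma(\alpha)}\int_0^t(t-\tau)^{\alpha-1}g(\tau)\,d\tau$ is the Riemann-Liouville integral; $J^\alpha:L^2(0,T)\to\mathcal R(J^\alpha)$ is bijective onto its range. For $0<\alpha<1$, $\partial_t^\alpha:=(J^\alpha)^{-1}$ on $\mathcal R(J^\alpha)$, and $H_\alpha(0,T)$ denotes $\mathcal R(J^\alpha)$ with norm $\|(J^{\alpha})^{-1}\phi\|_{L^2(0,T)}$. The solution $u$ is understood in the sense that $u(x,\cdot)-u_0(x)\in H_{\alpha_1}(0,T)$ for almost all $x\in\Omega$ (this encodes the initial condition), the equation holds in $\Omega\times(0,T)$, and $u=0$ on $\partial\Omega\times(0,T)$; moreover $u\in C((0,T];H^2(\Omega)\cap H_0^1(\Omega))$.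 Here $u(t)=u(\cdot,t)$, $w(\tau)=w(\cdot,\tau)$ are regarded as $L^2(\Omega)$-valued functions, and powers $s^{\alpha}$ are taken with the principal branch.
   Formalization: The initial condition u(x,0)=u_0(x) is also required as u(t)→u_0 in L^2(Ω) as t→0+, besides u(x,·)−u_0(x)∈H_{α_1}(0,T) for a.e. x; without it nonzero solutions with u_0=0 exist and "the solution" is not unique. *)

theory Defs
  imports "HOL-Complex_Analysis.Complex_Analysis"
begin

subsection \<open>Square-integrable functions and the Hilbert space of their classes\<close>

definition L2_fun :: "'a::euclidean_space set \<Rightarrow> ('a \<Rightarrow> complex) \<Rightarrow> bool" where
  "L2_fun S f \<longleftrightarrow> f \<in> borel_measurable (lebesgue_on S) \<and>
     integrable (lebesgue_on S) (\<lambda>x. (norm (f x))\<^sup>2)"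

lemma L2_fun_UNIV:
  "L2_fun UNIV f \<longleftrightarrow> f \<in> borel_measurable lebesgue \<and> integrable lebesgue (\<lambda>x. (norm (f x))\<^sup>2)"
  by (simp add: L2_fun_def lebesgue_on_UNIV_eq)

lemma L2_fun_zero: "L2_fun UNIV (\<lambda>_. 0)"
  by (simp add: L2_fun_UNIV)

lemma L2_fun_inner:
  assumes "L2_fun UNIV f" "L2_fun UNIV g"
  shows "integrable lebesgue (\<lambda>x. f x \<bullet> g x)"
proof (rule Bochner_Integration.integrable_bound)
  show "integrable lebesgue (\<lambda>x. (norm (f x))\<^sup>2 + (norm (g x))\<^sup>2)"
    using assms by (auto simp: L2_fun_UNIV)
  have [measurable]: "f \<in> borel_measurable lebesgue" "g \<in> borel_measurable lebesgue"
    using assms by (auto simp: L2_fun_UNIV)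
  show "(\<lambda>x. f x \<bullet> g x) \<in> borel_measurable lebesgue" by measurable
  have "\<bar>f x \<bullet> g x\<bar> \<le> (norm (f x))\<^sup>2 + (norm (g x))\<^sup>2" for x
  proof -
    have "\<bar>f x \<bullet> g x\<bar> \<le> norm (f x) * norm (g x)" by (rule Cauchy_Schwarz_ineq2)
    also have "\<dots> \<le> (norm (f x))\<^sup>2 + (norm (g x))\<^sup>2"
      using sum_squares_bound[of "norm (f x)" "norm (g x)"]
        mult_nonneg_nonneg[OF norm_ge_zero[of "f x"] norm_ge_zero[of "g x"]] by linarith
    finally show ?thesis .
  qed
  then show "AE x in lebesgue. norm (f x \<bullet> g x) \<le> norm ((norm (f x))\<^sup>2 + (norm (g x))\<^sup>2)"
    by (auto simp: abs_of_nonneg)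
qed

lemma L2_fun_scaleR: "L2_fun UNIV f \<Longrightarrow> L2_fun UNIV (\<lambda>x. r *\<^sub>R f x)"
  by (auto simp: L2_fun_UNIV power_mult_distrib)

lemma L2_fun_add:
  assumes "L2_fun UNIV f" "L2_fun UNIV g"
  shows "L2_fun UNIV (\<lambda>x. f x + g x)"
proof -
  have "(\<lambda>x. (norm (f x + g x))\<^sup>2) = (\<lambda>x. (norm (f x))\<^sup>2 + 2 * (f x \<bullet> g x) + (norm (g x))\<^sup>2)"
    by (auto simp: power2_norm_eq_inner inner_add inner_commute)
  with assms L2_fun_inner[OF assms] show ?thesis
    by (auto simp: L2_fun_UNIV)
qed

lemma L2_fun_minus: "L2_fun UNIV f \<Longrightarrow> L2_fun UNIV (\<lambda>x. - f x)"
  by (auto simp: L2_fun_UNIV)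

lemma L2_fun_diff: "L2_fun UNIV f \<Longrightarrow> L2_fun UNIV g \<Longrightarrow> L2_fun UNIV (\<lambda>x. f x - g x)"
  using L2_fun_add[of f "\<lambda>x. - g x"] L2_fun_minus[of g] by simp

definition L2_rel :: "('a::euclidean_space \<Rightarrow> complex) \<Rightarrow> ('a \<Rightarrow> complex) \<Rightarrow> bool" where
  "L2_rel f g \<longleftrightarrow> L2_fun UNIV f \<and> L2_fun UNIV g \<and> (AE x in lebesgue. f x = g x)"

quotient_type (overloaded) 'a L2 = "'a::euclidean_space \<Rightarrow> complex" / partial: L2_rel
proof (rule part_equivpI)
  show "\<exists>x. L2_rel x x" using L2_fun_zero by (auto simp: L2_rel_def)
  show "symp L2_rel" by (auto simp: L2_rel_def symp_def eq_commute)
  show "transp L2_rel"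
    unfolding transp_def L2_rel_def by (auto elim: AE_mp)
qed

instantiation L2 :: (euclidean_space) real_inner
begin

lift_definition zero_L2 :: "'a L2" is "\<lambda>_. 0"
  by (simp add: L2_rel_def L2_fun_zero)

lift_definition plus_L2 :: "'a L2 \<Rightarrow> 'a L2 \<Rightarrow> 'a L2" is "\<lambda>f g x. f x + g x"
  by (auto simp: L2_rel_def L2_fun_add)

lift_definition minus_L2 :: "'a L2 \<Rightarrow> 'a L2 \<Rightarrow> 'a L2" is "\<lambda>f g x. f x - g x"
  by (auto simp: L2_rel_def L2_fun_diff)

lift_definition uminus_L2 :: "'a L2 \<Rightarrow> 'a L2" is "\<lambda>f x. - f x"
  by (auto simp: L2_rel_def L2_fun_minus)

lift_definition scaleR_L2 :: "real \<Rightarrow> 'a L2 \<Rightarrow> 'a L2" is "\<lambda>r f x. r *\<^sub>R f x"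
  by (auto simp: L2_rel_def L2_fun_scaleR simp del: scaleR_conv_of_real)

lift_definition inner_L2 :: "'a L2 \<Rightarrow> 'a L2 \<Rightarrow> real"
  is "\<lambda>f g. integral\<^sup>L lebesgue (\<lambda>x. f x \<bullet> g x)"
proof -
  fix f f' g g' :: "'a \<Rightarrow> complex"
  assume *: "L2_rel f f'" "L2_rel g g'"
  then have **: "L2_fun UNIV f" "L2_fun UNIV g" "L2_fun UNIV f'" "L2_fun UNIV g'"
    by (auto simp: L2_rel_def)
  show "integral\<^sup>L lebesgue (\<lambda>x. f x \<bullet> g x) = integral\<^sup>L lebesgue (\<lambda>x. f' x \<bullet> g' x)"
  proof (rule integral_cong_AE)
    show "AE x in lebesgue. f x \<bullet> g x = f' x \<bullet> g' x"
      using * by (auto simp: L2_rel_def)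
  qed (use L2_fun_inner ** in \<open>auto dest: borel_measurable_integrable\<close>)
qed

definition norm_L2 :: "'a L2 \<Rightarrow> real" where "norm_L2 f = sqrt (inner f f)"
definition dist_L2 :: "'a L2 \<Rightarrow> 'a L2 \<Rightarrow> real" where "dist_L2 f g = norm (f - g)"
definition sgn_L2 :: "'a L2 \<Rightarrow> 'a L2" where "sgn_L2 f = inverse (norm f) *\<^sub>R f"
definition uniformity_L2 :: "('a L2 \<times> 'a L2) filter" where
  "uniformity_L2 = (INF e\<in>{0<..}. principal {(x, y). dist x y < e})"
definition open_L2 :: "'a L2 set \<Rightarrow> bool" where
  "open_L2 U = (\<forall>x\<in>U. \<forall>\<^sub>F (x', y) in uniformity. x' = x \<longrightarrow> y \<in> U)"

instance
proof
  fix f g h :: "'a L2" and a b :: real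
  show "f + g + h = f + (g + h)" by transfer (auto simp: L2_rel_def add.assoc L2_fun_add)
  show "f + g = g + f" by transfer (auto simp: L2_rel_def add.commute L2_fun_add)
  show "0 + f = f" by transfer (auto simp: L2_rel_def)
  show "- f + f = 0" by transfer (auto simp: L2_rel_def L2_fun_zero)
  show "f - g = f + - g" by transfer (auto simp: L2_rel_def L2_fun_diff)
  show "a *\<^sub>R (f + g) = a *\<^sub>R f + a *\<^sub>R g"
    by transfer (auto simp: L2_rel_def scaleR_add_right simp del: scaleR_conv_of_real
        intro!: L2_fun_add L2_fun_scaleR)
  show "(a + b) *\<^sub>R f = a *\<^sub>R f + b *\<^sub>R f"
    by transfer (auto simp: L2_rel_def scaleR_add_left simp del: scaleR_conv_of_real
        intro!: L2_fun_add L2_fun_scaleR)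
  show "a *\<^sub>R b *\<^sub>R f = (a * b) *\<^sub>R f"
    by transfer (auto simp: L2_rel_def simp del: scaleR_conv_of_real intro!: L2_fun_scaleR)
  show "1 *\<^sub>R f = f" by transfer (auto simp: L2_rel_def)
  show "dist f g = norm (f - g)" by (rule dist_L2_def)
  show "sgn f = inverse (norm f) *\<^sub>R f" by (rule sgn_L2_def)
  show "uniformity = (INF e\<in>{0<..}. principal {(x::'a L2, y). dist x y < e})"
    by (rule uniformity_L2_def)
  show "open U = (\<forall>x\<in>U. \<forall>\<^sub>F (x', y) in uniformity. x' = x \<longrightarrow> y \<in> U)" for U :: "'a L2 set"
    by (rule open_L2_def)
  show "inner f g = inner g f" by transfer (simp add: inner_commute)
  show "inner (f + g) h = inner f h + inner g h"
    by transfer (simp add: L2_rel_def inner_add_left L2_fun_inner)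
  show "inner (a *\<^sub>R f) g = a * inner f g"
    by transfer (simp add: L2_rel_def L2_fun_inner del: scaleR_conv_of_real)
  show "0 \<le> inner f f" by transfer simp
  show "inner f f = 0 \<longleftrightarrow> f = 0"
  proof transfer
    fix f :: "'a \<Rightarrow> complex" assume "L2_rel f f"
    then have f: "L2_fun UNIV f" by (simp add: L2_rel_def)
    show "integral\<^sup>L lebesgue (\<lambda>x. f x \<bullet> f x) = 0 \<longleftrightarrow> L2_rel f (\<lambda>_. 0)"
      using integral_nonneg_eq_0_iff_AE[OF L2_fun_inner[OF f f]] f
      by (simp add: L2_rel_def L2_fun_zero)
  qed
  show "norm f = sqrt (inner f f)" by (rule norm_L2_def)
qed

end

lemma L2_fun_extend:
  assumes S: "S \<in> sets lebesgue" and f: "L2_fun S f"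
  shows "L2_fun UNIV (\<lambda>x. if x \<in> S then f x else 0)"
proof -
  have "(\<lambda>x. (norm (if x \<in> S then f x else 0))\<^sup>2) = (\<lambda>x. if x \<in> S then (norm (f x))\<^sup>2 else 0)"
    by auto
  then show ?thesis
    using S f Lebesgue_Measure.integrable_restrict_UNIV[OF S, of "\<lambda>x. (norm (f x))\<^sup>2"]
      borel_measurable_if_I[of f S]
    by (simp add: L2_fun_def lebesgue_on_UNIV_eq)
qed

text \<open>The class of \<open>f \<in> L\<^sup>2(S)\<close>: \<open>L\<^sup>2(S)\<close> is identified, by extension by zero, with the closed
  subspace of \<open>L\<^sup>2\<close> of the whole space consisting of the classes vanishing outside \<open>S\<close>. The
  value for \<open>f \<notin> L\<^sup>2(S)\<close> is a dummy.\<close>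

lift_definition L2_of :: "'a::euclidean_space set \<Rightarrow> ('a \<Rightarrow> complex) \<Rightarrow> 'a L2"
  is "\<lambda>S f. if S \<in> sets lebesgue \<and> L2_fun S f then (\<lambda>x. if x \<in> S then f x else 0) else (\<lambda>_. 0)"
  by (auto simp: L2_rel_def L2_fun_zero L2_fun_extend)

lemma norm_L2_of:
  assumes "S \<in> sets lebesgue" "L2_fun S f"
  shows "norm (L2_of S f) = sqrt (integral\<^sup>L (lebesgue_on S) (\<lambda>x. (norm (f x))\<^sup>2))"
proof -
  have "(L2_of S f) \<bullet> (L2_of S f) =
      integral\<^sup>L lebesgue (\<lambda>x. if x \<in> S then (norm (f x))\<^sup>2 else 0)"
    using assms
    by transfer (auto intro!: Bochner_Integration.integral_cong simp: power2_norm_eq_inner)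
  also have "\<dots> = integral\<^sup>L (lebesgue_on S) (\<lambda>x. (norm (f x))\<^sup>2)"
    using assms(1) by (simp add: Lebesgue_Measure.integral_restrict_UNIV)
  finally show ?thesis by (simp add: norm_eq_sqrt_inner)
qed

lemma L2_of_eq_iff:
  assumes "S \<in> sets lebesgue" "L2_fun S f" "L2_fun S g"
  shows "L2_of S f = L2_of S g \<longleftrightarrow> (AE x in lebesgue_on S. f x = g x)"
proof -
  have "L2_of S f = L2_of S g \<longleftrightarrow>
      (AE x in lebesgue. (if x \<in> S then f x else 0) = (if x \<in> S then g x else 0))"
    using assms
  proof transfer
    fix S :: "'a set" and f g :: "'a \<Rightarrow> complex"
    assume S: "S \<in> sets lebesgue" and f: "L2_fun S f" and g: "L2_fun S g"
    show "L2_rel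
        (if S \<in> sets lebesgue \<and> L2_fun S f then (\<lambda>x. if x \<in> S then f x else 0) else (\<lambda>_. 0))
        (if S \<in> sets lebesgue \<and> L2_fun S g then (\<lambda>x. if x \<in> S then g x else 0) else (\<lambda>_. 0)) \<longleftrightarrow>
        (AE x in lebesgue. (if x \<in> S then f x else 0) = (if x \<in> S then g x else 0))"
      using L2_fun_extend[OF S f] L2_fun_extend[OF S g] S f g by (simp add: L2_rel_def)
  qed
  also have "\<dots> \<longleftrightarrow> (AE x in lebesgue_on S. f x = g x)"
    using assms(1) by (subst AE_restrict_space_iff) (auto intro!: AE_cong)
  finally show ?thesis .
qed

subsection \<open>Classical and weak differentiation, Sobolev spaces\<close>

definition partial :: "'d::finite \<Rightarrow> (real^'d \<Rightarrow> 'b::real_normed_vector) \<Rightarrow> real^'d \<Rightarrow> 'b" where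
  "partial i f x = frechet_derivative f (at x) (axis i 1)"

text \<open>\<open>C\<^sup>k\<close> functions on an open set.\<close>

fun Ck_on :: "nat \<Rightarrow> (real^'d::finite) set \<Rightarrow> (real^'d \<Rightarrow> 'b::real_normed_vector) \<Rightarrow> bool" where
  "Ck_on 0 S f = continuous_on S f"
| "Ck_on (Suc k) S f = (f differentiable_on S \<and> (\<forall>i. Ck_on k S (partial i f)))"

definition test_fun :: "(real^'d::finite) set \<Rightarrow> (real^'d \<Rightarrow> 'b::real_normed_vector) \<Rightarrow> bool" where
  "test_fun \<Omega> \<phi> \<longleftrightarrow> (\<forall>k. Ck_on k UNIV \<phi>) \<and> (\<exists>K. compact K \<and> K \<subseteq> \<Omega> \<and> (\<forall>x. x \<notin> K \<longrightarrow> \<phi> x = 0))"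

definition locally_integrable :: "(real^'d::finite) set \<Rightarrow> (real^'d \<Rightarrow> complex) \<Rightarrow> bool" where
  "locally_integrable \<Omega> f \<longleftrightarrow> (\<forall>K. compact K \<and> K \<subseteq> \<Omega> \<longrightarrow> integrable (lebesgue_on K) f)"

definition has_weak_partial ::
    "(real^'d::finite) set \<Rightarrow> 'd \<Rightarrow> (real^'d \<Rightarrow> complex) \<Rightarrow> (real^'d \<Rightarrow> complex) \<Rightarrow> bool" where
  "has_weak_partial \<Omega> i f g \<longleftrightarrow> locally_integrable \<Omega> f \<and> locally_integrable \<Omega> g \<and>
     (\<forall>\<phi> :: real^'d \<Rightarrow> real. test_fun \<Omega> \<phi> \<longrightarrow>
        integral\<^sup>L (lebesgue_on \<Omega>) (\<lambda>x. partial i \<phi> x *\<^sub>R f x) =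
        - integral\<^sup>L (lebesgue_on \<Omega>) (\<lambda>x. \<phi> x *\<^sub>R g x))"

text \<open>A representative of the weak derivative; the latter is only determined up to null sets.\<close>

definition weak_partial ::
    "(real^'d::finite) set \<Rightarrow> 'd \<Rightarrow> (real^'d \<Rightarrow> complex) \<Rightarrow> real^'d \<Rightarrow> complex" where
  "weak_partial \<Omega> i f = (SOME g. has_weak_partial \<Omega> i f g)"

definition H1 :: "(real^'d::finite) set \<Rightarrow> (real^'d \<Rightarrow> complex) set" where
  "H1 \<Omega> = {f. L2_fun \<Omega> f \<and> (\<forall>i. \<exists>g. L2_fun \<Omega> g \<and> has_weak_partial \<Omega> i f g)}"

definition H1_norm :: "(real^'d::finite) set \<Rightarrow> (real^'d \<Rightarrow> complex) \<Rightarrow> real" where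
  "H1_norm \<Omega> f = sqrt ((norm (L2_of \<Omega> f))\<^sup>2 + (\<Sum>i\<in>UNIV. (norm (L2_of \<Omega> (weak_partial \<Omega> i f)))\<^sup>2))"

definition H10 :: "(real^'d::finite) set \<Rightarrow> (real^'d \<Rightarrow> complex) set" where
  "H10 \<Omega> = {f \<in> H1 \<Omega>. \<forall>e>0. \<exists>\<phi>. test_fun \<Omega> \<phi> \<and> H1_norm \<Omega> (\<lambda>x. f x - \<phi> x) < e}"

definition H2 :: "(real^'d::finite) set \<Rightarrow> (real^'d \<Rightarrow> complex) set" where
  "H2 \<Omega> = {f \<in> H1 \<Omega>. \<forall>i. weak_partial \<Omega> i f \<in> H1 \<Omega>}"

definition H2_norm :: "(real^'d::finite) set \<Rightarrow> (real^'d \<Rightarrow> complex) \<Rightarrow> real" where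
  "H2_norm \<Omega> f = sqrt ((norm (L2_of \<Omega> f))\<^sup>2
     + (\<Sum>i\<in>UNIV. (norm (L2_of \<Omega> (weak_partial \<Omega> i f)))\<^sup>2)
     + (\<Sum>i\<in>UNIV. \<Sum>j\<in>UNIV. (norm (L2_of \<Omega> (weak_partial \<Omega> j (weak_partial \<Omega> i f))))\<^sup>2))"

text \<open>\<open>v \<in> C(I; H\<^sup>2(\<Omega>) \<inter> H\<^sup>1\<^sub>0(\<Omega>))\<close>; for \<open>\<psi> \<in> H\<^sup>2(\<Omega>)\<close> the boundary condition \<open>\<psi> = 0\<close> on
  \<open>\<partial>\<Omega>\<close> is understood in the sense of traces, i.e. as \<open>\<psi> \<in> H\<^sup>1\<^sub>0(\<Omega>)\<close>.\<close>

definition continuous_into_H2_H10 ::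
    "(real^'d::finite) set \<Rightarrow> real set \<Rightarrow> (real \<Rightarrow> real^'d \<Rightarrow> complex) \<Rightarrow> bool" where
  "continuous_into_H2_H10 \<Omega> I v \<longleftrightarrow> (\<forall>t\<in>I. v t \<in> H2 \<Omega> \<inter> H10 \<Omega> \<and>
     ((\<lambda>r. H2_norm \<Omega> (\<lambda>x. v r x - v t x)) \<longlongrightarrow> 0) (at t within I))"

subsection \<open>The domain and the elliptic operator\<close>

text \<open>\<open>\<partial>\<Omega>\<close> of class \<open>C\<^sup>2\<close>, by local defining functions with nonvanishing gradient.\<close>

definition C2_boundary :: "(real^'d::finite) set \<Rightarrow> bool" where
  "C2_boundary \<Omega> \<longleftrightarrow> (\<forall>p\<in>frontier \<Omega>. \<exists>U (\<rho> :: real^'d \<Rightarrow> real).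
     open U \<and> p \<in> U \<and> Ck_on 2 U \<rho> \<and> (\<forall>x\<in>U. \<exists>i. partial i \<rho> x \<noteq> 0) \<and>
     \<Omega> \<inter> U = {x\<in>U. \<rho> x < 0} \<and> frontier \<Omega> \<inter> U = {x\<in>U. \<rho> x = 0})"

text \<open>\<open>f \<in> C\<^sup>1\<close> up to the boundary: \<open>f\<close> is continuous on the closure and its first derivatives in
  \<open>\<Omega>\<close> extend continuously to the closure.\<close>

definition C1_closure :: "(real^'d::finite) set \<Rightarrow> (real^'d \<Rightarrow> real) \<Rightarrow> bool" where
  "C1_closure \<Omega> f \<longleftrightarrow> continuous_on (closure \<Omega>) f \<and> f differentiable_on \<Omega> \<and>
     (\<forall>i. \<exists>g. continuous_on (closure \<Omega>) g \<and> (\<forall>x\<in>\<Omega>. partial i f x = g x))"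

definition admissible_coeffs ::
    "(real^'d::finite) set \<Rightarrow> ('d \<Rightarrow> 'd \<Rightarrow> real^'d \<Rightarrow> real) \<Rightarrow> (real^'d \<Rightarrow> real) \<Rightarrow> bool" where
  "admissible_coeffs \<Omega> a c \<longleftrightarrow>
     (\<forall>i j. C1_closure \<Omega> (a i j)) \<and> (\<forall>i j. \<forall>x\<in>closure \<Omega>. a i j x = a j i x) \<and>
     (\<exists>a0>0. \<forall>x\<in>closure \<Omega>. \<forall>\<xi> :: real^'d.
        (\<Sum>i\<in>UNIV. \<Sum>j\<in>UNIV. a i j x * \<xi> $ i * \<xi> $ j) \<ge> a0 * (\<Sum>i\<in>UNIV. (\<xi> $ i)\<^sup>2)) \<and>
     c \<in> borel_measurable (lebesgue_on \<Omega>) \<and> (\<exists>M. AE x in lebesgue_on \<Omega>. \<bar>c x\<bar> \<le> M) \<and>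
     (AE x in lebesgue_on \<Omega>. 0 \<le> c x)"

definition elliptic_op ::
    "(real^'d::finite) set \<Rightarrow> ('d \<Rightarrow> 'd \<Rightarrow> real^'d \<Rightarrow> real) \<Rightarrow> (real^'d \<Rightarrow> real) \<Rightarrow>
     (real^'d \<Rightarrow> complex) \<Rightarrow> real^'d \<Rightarrow> complex" where
  "elliptic_op \<Omega> a c \<psi> x =
     - (\<Sum>i\<in>UNIV. \<Sum>j\<in>UNIV. weak_partial \<Omega> j (\<lambda>y. a i j y *\<^sub>R weak_partial \<Omega> i \<psi> y) x)
     + c x *\<^sub>R \<psi> x"

subsection \<open>Fractional calculus in time\<close>

definition RL_integral :: "real \<Rightarrow> (real \<Rightarrow> complex) \<Rightarrow> real \<Rightarrow> complex" where
  "RL_integral \<alpha> g t =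
     (1 / Gamma \<alpha>) *\<^sub>R integral\<^sup>L (lebesgue_on {0..t}) (\<lambda>\<tau>. ((t - \<tau>) powr (\<alpha> - 1)) *\<^sub>R g \<tau>)"

definition RL_preimage :: "real \<Rightarrow> real \<Rightarrow> (real \<Rightarrow> complex) \<Rightarrow> (real \<Rightarrow> complex) \<Rightarrow> bool" where
  "RL_preimage \<alpha> T \<phi> g \<longleftrightarrow> L2_fun {0<..<T} g \<and> (AE t in lebesgue_on {0<..<T}. \<phi> t = RL_integral \<alpha> g t)"

definition H_frac :: "real \<Rightarrow> real \<Rightarrow> (real \<Rightarrow> complex) set" where
  "H_frac \<alpha> T = {\<phi>. \<exists>g. RL_preimage \<alpha> T \<phi> g}"

text \<open>A representative of the inverse image of \<open>\<phi> \<in> H_frac \<alpha> T\<close> under \<open>J\<^sup>\<alpha>\<close> on \<open>L\<^sup>2(0,T)\<close>.\<close>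

definition frac_deriv :: "real \<Rightarrow> real \<Rightarrow> (real \<Rightarrow> complex) \<Rightarrow> real \<Rightarrow> complex" where
  "frac_deriv \<alpha> T \<phi> = (SOME g. RL_preimage \<alpha> T \<phi> g)"

subsection \<open>The two initial-boundary value problems\<close>

text \<open>Functions of \<open>(x,t)\<close> are written with the time argument first, so that \<open>u t\<close> is \<open>u(\<cdot>,t)\<close>.

  The fractional derivatives are determined only up to a null set of times for each \<open>x\<close>, and
  \<open>A u(t)\<close> only up to a null set of points for each \<open>t\<close>. The equation therefore refers to jointly
  measurable versions \<open>g j\<close> of the fractional derivatives.

  The convergence \<open>u(t) \<rightarrow> u\<^sub>0\<close> in \<open>L\<^sup>2(\<Omega>)\<close> cannot be omitted: without it nonzero solutions for
  \<open>u\<^sub>0 = 0\<close> exist. For \<open>\<ell> = 1\<close>, \<open>q\<^sub>1 = 1\<close> and dimension at most \<open>3\<close>, the solution of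
  \<open>\<partial>\<^sub>t\<^sup>\<alpha> y + A y = \<delta>(t) \<delta>(x - p)\<close> with \<open>p \<in> \<Omega>\<close> and smooth coefficients lies in
  \<open>C((0,T]; H\<^sup>2 \<inter> H\<^sup>1\<^sub>0)\<close>, satisfies the homogeneous equation, and has \<open>y(x,\<cdot>) \<in> H_frac \<alpha> T\<close>
  for every \<open>x \<noteq> p\<close>.\<close>

definition fractional_solution ::
    "(real^'d::finite) set \<Rightarrow> real \<Rightarrow> ('d \<Rightarrow> 'd \<Rightarrow> real^'d \<Rightarrow> real) \<Rightarrow> (real^'d \<Rightarrow> real) \<Rightarrow>
     nat \<Rightarrow> (nat \<Rightarrow> real) \<Rightarrow> (nat \<Rightarrow> real) \<Rightarrow> (real^'d \<Rightarrow> complex) \<Rightarrow>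
     (real \<Rightarrow> real^'d \<Rightarrow> complex) \<Rightarrow> bool" where
  "fractional_solution \<Omega> T a c l q \<alpha> u0 u \<longleftrightarrow>
     (\<lambda>(x, t). u t x) \<in> borel_measurable (lebesgue_on (\<Omega> \<times> {0<..<T})) \<and>
     (AE x in lebesgue_on \<Omega>. (\<lambda>t. u t x - u0 x) \<in> H_frac (\<alpha> 1) T) \<and>
     (\<exists>g. (\<forall>j\<in>{1..l}. (\<lambda>(x, t). g j t x) \<in> borel_measurable (lebesgue_on (\<Omega> \<times> {0<..<T})) \<and>
              (AE x in lebesgue_on \<Omega>. AE t in lebesgue_on {0<..<T}.
                 g j t x = frac_deriv (\<alpha> j) T (\<lambda>t. u t x - u0 x) t)) \<and>
          (AE t in lebesgue_on {0<..<T}. AE x in lebesgue_on \<Omega>.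
             (\<Sum>j=1..l. q j *\<^sub>R g j t x) + elliptic_op \<Omega> a c (u t) x = 0)) \<and>
     ((\<lambda>t. L2_of \<Omega> (u t)) \<longlongrightarrow> L2_of \<Omega> u0) (at_right 0) \<and>
     continuous_into_H2_H10 \<Omega> {0<..T} u"

text \<open>The classical (semigroup) solution:
  \<open>w \<in> C([0,\<infinity>); L\<^sup>2) \<inter> C((0,\<infinity>); H\<^sup>2 \<inter> H\<^sup>1\<^sub>0) \<inter> C\<^sup>1((0,\<infinity>); L\<^sup>2)\<close>; continuity of the time
  derivative follows from the equation.\<close>

definition heat_solution ::
    "(real^'d::finite) set \<Rightarrow> ('d \<Rightarrow> 'd \<Rightarrow> real^'d \<Rightarrow> real) \<Rightarrow> (real^'d \<Rightarrow> real) \<Rightarrow>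
     (real^'d \<Rightarrow> complex) \<Rightarrow> (real \<Rightarrow> real^'d \<Rightarrow> complex) \<Rightarrow> bool" where
  "heat_solution \<Omega> a c u0 w \<longleftrightarrow>
     continuous_into_H2_H10 \<Omega> {0<..} w \<and>
     (\<forall>t>0. ((\<lambda>r. L2_of \<Omega> (w r)) has_vector_derivative
              - L2_of \<Omega> (elliptic_op \<Omega> a c (w t))) (at t)) \<and>
     ((\<lambda>t. L2_of \<Omega> (w t)) \<longlongrightarrow> L2_of \<Omega> u0) (at_right 0)"

subsection \<open>The subordination kernel\<close>

definition Q_sym :: "nat \<Rightarrow> (nat \<Rightarrow> real) \<Rightarrow> (nat \<Rightarrow> real) \<Rightarrow> complex \<Rightarrow> complex" where
  "Q_sym l q \<alpha> s = (\<Sum>j=1..l. of_real (q j) * s powr of_real (\<alpha> j))"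

definition has_vline_integral :: "(complex \<Rightarrow> complex) \<Rightarrow> real \<Rightarrow> complex \<Rightarrow> bool" where
  "has_vline_integral f s0 I \<longleftrightarrow>
     ((\<lambda>R. contour_integral (linepath (Complex s0 (- R)) (Complex s0 R)) f) \<longlongrightarrow> I) at_top"

definition vline_integral :: "real \<Rightarrow> (complex \<Rightarrow> complex) \<Rightarrow> complex" where
  "vline_integral s0 f = (THE I. has_vline_integral f s0 I)"

definition kernel_integrand ::
    "nat \<Rightarrow> (nat \<Rightarrow> real) \<Rightarrow> (nat \<Rightarrow> real) \<Rightarrow> real \<Rightarrow> real \<Rightarrow> complex \<Rightarrow> complex" where
  "kernel_integrand l q \<alpha> t \<tau> s =
     inverse s * Q_sym l q \<alpha> s * exp (s * of_real t - Q_sym l q \<alpha> s * of_real \<tau>)"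

definition subordination_kernel ::
    "nat \<Rightarrow> (nat \<Rightarrow> real) \<Rightarrow> (nat \<Rightarrow> real) \<Rightarrow> real \<Rightarrow> real \<Rightarrow> real \<Rightarrow> complex" where
  "subordination_kernel l q \<alpha> s0 t \<tau> =
     1 / (2 * of_real pi * \<i>) * vline_integral s0 (kernel_integrand l q \<alpha> t \<tau>)"

end

theory Submission
  imports Defs
begin

text \<open>No spectral theory is needed. For real \<open>s > 0\<close> let \<open>X(s)\<close> be the Laplace transform of \<open>u\<close> truncated
  at \<open>T\<close>. Integrating the equation in time shows that \<open>Q(s) X(s) + A X(s) - Q(s)/s u\<^sub>0\<close> is
  \<open>O(e\<^sup>-\<^sup>s\<^sup>T)\<close>, while \<open>Z(s) = Q(s)/s \<integral> e\<^bsup>-Q(s)\<tau>\<^esup> w(\<tau>) d\<tau>\<close> satisfies \<open>Q(s) Z + A Z = Q(s)/s u\<^sub>0\<close>. Since the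
  closure of the weak operator \<open>A\<close> is accretive, \<open>X - Z = O(e\<^sup>-\<^sup>s\<^sup>T)\<close>. By Cauchy's theorem the inverse
  Laplace integral \<open>\<kappa>(t,\<tau>)\<close> has transform \<open>Q(s)/s e\<^bsup>-Q(s)\<tau>\<^esup>\<close> in \<open>t\<close>, so \<open>Z\<close> is the transform of
  \<open>\<integral> w(\<tau>) \<kappa>(t,\<tau>) d\<tau>\<close>. A function on \<open>(0,T]\<close> whose truncated transform is \<open>O(s e\<^sup>-\<^sup>s\<^sup>T)\<close> vanishes.\<close>

subsection \<open>Completeness of \<open>L\<^sup>2\<close>\<close>

text \<open>The function \<open>u\<close> is given on (0,T] only, so its Laplace transform has to be
  cut at T. This costs errors of order e^(-sT), which is exactly what uniqueness on (0,T] tolerates.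
  Three obstacles shape the rest. Near time 0 the norm of A u(t) is not controlled, so its transform
  is an improper integral; convergence is read off from the primitive, a sum of Riemann-Liouville
  integrals of u - u0 that tends to 0 at time 0. The fractional derivatives live on each fixed x
  while A acts at each fixed t; Borel versions and Fubini, after pairing with a fixed element of L2,
  connect the two. The direct bound on the kernel behaves like \<tau>^(-3/2) at \<tau> = 0 and the
  one after integration by parts like 1/t at t = 0; neither is integrable, but their geometric mean
  is. The classes form a real inner product space of complex functions, so the kernel must be real
  to act by scalars. Completeness of this space and a graph closed under limits are what allow A to
  be interchanged with the integrals.\<close>

lemma AE_summable_subseq_Cauchy:
  fixes d :: "nat \<Rightarrow> 'a \<Rightarrow> complex"
  assumes [measurable]: "\<And>k. d k \<in> borel_measurable M"
    and d: "\<And>k. (\<integral>\<^sup>+x. ennreal ((norm (d k x))\<^sup>2) \<partial>M) \<le> ennreal ((1/4)^k)"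
  shows "AE x in M. summable (\<lambda>k. d k x)"
proof -
  have "(\<integral>\<^sup>+x. (\<Sum>k. ennreal (2^k * (norm (d k x))\<^sup>2)) \<partial>M) = (\<Sum>k. \<integral>\<^sup>+x. ennreal (2^k * (norm (d k x))\<^sup>2) \<partial>M)"
    by (rule nn_integral_suminf) simp
  also have "\<dots> \<le> (\<Sum>k. ennreal ((1/2)^k))"
  proof (rule suminf_le)
    fix k
    have "(\<integral>\<^sup>+x. ennreal (2^k * (norm (d k x))\<^sup>2) \<partial>M) = ennreal (2^k) * (\<integral>\<^sup>+x. ennreal ((norm (d k x))\<^sup>2) \<partial>M)"
      by (simp add: ennreal_mult nn_integral_cmult)
    also have "\<dots> \<le> ennreal (2^k) * ennreal ((1/4)^k)" using d by (intro mult_left_mono) auto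
    also have "\<dots> = ennreal ((1/2)^k)"
      by (simp add: ennreal_mult[symmetric] power_mult_distrib[symmetric])
    finally show "(\<integral>\<^sup>+x. ennreal (2^k * (norm (d k x))\<^sup>2) \<partial>M) \<le> ennreal ((1/2)^k)" .
  qed auto
  also have "\<dots> = ennreal (\<Sum>k. (1/2)^k)"
    by (rule suminf_ennreal_eq[of _ ]) (auto intro: summable_sums summable_geometric)
  also have "\<dots> < \<infinity>" by simp
  \<comment> \<open>The weights 2^k still leave a convergent series of integrals. Where the weighted
    sum of squares is finite its terms are bounded, so |d k x| is at most a constant times 2^(-k/2),
    a geometric majorant.\<close>
  finally have "AE x in M. (\<Sum>k. ennreal (2^k * (norm (d k x))\<^sup>2)) \<noteq> \<infinity>"
    by (intro nn_integral_noteq_infinite) auto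
  then show ?thesis
  proof eventually_elim
    case (elim x)
    note fin = elim
    then have s: "summable (\<lambda>k. 2^k * (norm (d k x))\<^sup>2)" by (intro summable_suminf_not_top) auto
    obtain C where C: "\<And>k. norm (2^k * (norm (d k x))\<^sup>2) \<le> C"
      using summable_imp_bounded[OF s] by (auto simp: bounded_iff)
    show ?case
    proof (rule summable_comparison_test'[where N=0])
      show "summable (\<lambda>k. sqrt C * (1 / sqrt 2)^k)" by (intro summable_mult summable_geometric) auto
      fix k :: nat
      have "(norm (d k x))\<^sup>2 \<le> C * (1/2)^k" using C[of k] by (simp add: field_simps)
      then have "norm (d k x) \<le> sqrt (C * (1/2)^k)" using real_le_rsqrt by blast
      also have "\<dots> = sqrt C * (1 / sqrt 2)^k"
        by (simp add: real_sqrt_mult real_sqrt_power real_sqrt_divide)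
      finally show "norm (d k x) \<le> sqrt C * (1 / sqrt 2)^k" .
    qed
  qed
qed

lemma L2_fun_rep: "L2_fun UNIV (rep_L2 X)"
  using Quotient3_rel_rep[OF Quotient3_L2] Quotient3_rep_reflp[OF Quotient3_L2, of X] by (simp add: L2_rel_def)

lemma inner_L2_rep: "X \<bullet> Y = (LINT x|lebesgue. rep_L2 X x \<bullet> rep_L2 Y x)"
  by (simp add: inner_L2_def)

lemma L2_rep_AE_abs:
  assumes "L2_fun UNIV f"
  shows "AE x in lebesgue. rep_L2 (abs_L2 f) x = f x"
  using rep_abs_rsp[OF Quotient3_L2, of f f] assms by (auto simp: L2_rel_def elim: AE_mp)

lemma norm_L2_abs_diff:
  assumes "L2_fun UNIV f"
  shows "(norm (abs_L2 f - X))\<^sup>2 = (LINT x|lebesgue. (norm (f x - rep_L2 X x))\<^sup>2)"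
proof -
  have X: "X = abs_L2 (rep_L2 X)" by (simp add: Quotient3_abs_rep[OF Quotient3_L2])
  have "abs_L2 f - X = abs_L2 (\<lambda>x. f x - rep_L2 X x)"
    by (subst X, rule minus_L2.abs_eq) (use assms L2_fun_rep in \<open>auto simp: eq_onp_def L2_rel_def\<close>)
  moreover have "abs_L2 g \<bullet> abs_L2 g = (LINT x|lebesgue. g x \<bullet> g x)" if "L2_fun UNIV g" for g :: "'a \<Rightarrow> complex"
    by (rule inner_L2.abs_eq) (use that in \<open>auto simp: eq_onp_def L2_rel_def\<close>)
  ultimately show ?thesis
    using L2_fun_diff[OF assms L2_fun_rep[of X]] by (simp add: power2_norm_eq_inner)
qed

lemma L2_norm_diff_nn:
  "(\<integral>\<^sup>+x. ennreal ((norm (rep_L2 X x - rep_L2 Y x))\<^sup>2) \<partial>lebesgue) = ennreal ((norm (X - Y))\<^sup>2)"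
proof -
  have "X = abs_L2 (rep_L2 X)" by (simp add: Quotient3_abs_rep[OF Quotient3_L2])
  then have "(norm (X - Y))\<^sup>2 = (LINT x|lebesgue. (norm (rep_L2 X x - rep_L2 Y x))\<^sup>2)"
    using norm_L2_abs_diff[OF L2_fun_rep[of X], of Y] by simp
  moreover have "integrable lebesgue (\<lambda>x. (norm (rep_L2 X x - rep_L2 Y x))\<^sup>2)"
    using L2_fun_diff[OF L2_fun_rep[of X] L2_fun_rep[of Y]] by (simp add: L2_fun_UNIV)
  ultimately show ?thesis by (simp add: nn_integral_eq_integral)
qed

text \<open>Riesz-Fischer. A subsequence with increments below 2^(-k) converges pointwise almost
  everywhere, and Fatou's lemma turns the Cauchy property into convergence in norm to the pointwise
  limit.\<close>

instance L2 :: (euclidean_space) banach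
proof
  fix X :: "nat \<Rightarrow> 'a L2" assume X: "Cauchy X"
  have "\<exists>N. \<forall>m\<ge>N. \<forall>n\<ge>N. norm (X m - X n) < (1/2)^k" for k :: nat
    using X unfolding Cauchy_iff by (metis half_gt_zero_iff zero_less_one zero_less_power)
  then obtain r where r: "\<And>k m n. m \<ge> r k \<Longrightarrow> n \<ge> r k \<Longrightarrow> norm (X m - X n) < (1/2)^k" by metis
  \<comment> \<open>Beyond \<open>r k\<close> all distances are below 2^(-k); the maximum with
    \<open>Suc p\<close> makes the chosen indices strictly increasing.\<close>
  define s where "s = rec_nat (r 0) (\<lambda>k p. max (r (Suc k)) (Suc p))"
  have s_r: "s k \<ge> r k" for k by (cases k) (auto simp: s_def)
  have s_Suc: "s (Suc k) > s k" for k by (auto simp: s_def)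
  then have s_ge: "s k \<ge> k" for k using strict_mono_Suc_iff seq_suble by blast
  have s_mono: "s (Suc k) \<ge> r k" for k using s_r[of k] s_Suc[of k] by linarith
  define f where "f k = rep_L2 (X (s k))" for k
  have f[measurable]: "f k \<in> borel_measurable lebesgue" for k
    using L2_fun_rep[of "X (s k)"] by (simp add: f_def L2_fun_UNIV)
  have "AE x in lebesgue. summable (\<lambda>k. f (Suc k) x - f k x)"
  proof (rule AE_summable_subseq_Cauchy)
    fix k
    have "(\<integral>\<^sup>+x. ennreal ((norm (f (Suc k) x - f k x))\<^sup>2) \<partial>lebesgue) = ennreal ((norm (X (s (Suc k)) - X (s k)))\<^sup>2)"
      unfolding f_def by (rule L2_norm_diff_nn)
    also have "\<dots> \<le> ennreal (((1/2)^k)\<^sup>2)"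
      using r[OF s_mono s_r] by (intro ennreal_leI power_mono) (auto intro: less_imp_le)
    also have "((1/2)^k)\<^sup>2 = ((1/4)^k :: real)"
      by (simp add: power2_eq_square power_mult_distrib[symmetric])
    finally show "(\<integral>\<^sup>+x. ennreal ((norm (f (Suc k) x - f k x))\<^sup>2) \<partial>lebesgue) \<le> ennreal ((1/4)^k)" .
  qed auto
  then have conv: "AE x in lebesgue. convergent (\<lambda>k. f k x)"
  proof eventually_elim
    case (elim x)
    then have "convergent (\<lambda>n. \<Sum>k<n. f (Suc k) x - f k x)" by (simp add: summable_iff_convergent)
    then have "convergent (\<lambda>n. f n x - f 0 x)" by (subst (asm) sum_lessThan_telescope)
    then show ?case
      using convergent_add[of "\<lambda>n. f n x - f 0 x" "\<lambda>_. f 0 x"] by (auto simp: convergent_const)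
  qed
  define F where "F x = lim (\<lambda>k. f k x)" for x
  have F[measurable]: "F \<in> borel_measurable lebesgue" unfolding F_def by measurable
  \<comment> \<open>Fatou along the subsequence: a bound for the distances from \<open>X m\<close>
    to all late members passes to the pointwise limit \<open>F\<close>. With bound 1 it shows that
    \<open>F\<close> is square integrable, with e/2 it gives convergence.\<close>
  have fat: "(\<integral>\<^sup>+x. ennreal ((norm (F x - rep_L2 (X m) x))\<^sup>2) \<partial>lebesgue) \<le> ennreal (e\<^sup>2)"
    if "e > 0" and N: "\<And>n. n \<ge> N \<Longrightarrow> norm (X n - X m) \<le> e" for e m N
  proof -
    have [measurable]: "rep_L2 (X m) \<in> borel_measurable lebesgue"
      using L2_fun_rep[of "X m"] by (simp add: L2_fun_UNIV)
    have "(\<integral>\<^sup>+x. ennreal ((norm (F x - rep_L2 (X m) x))\<^sup>2) \<partial>lebesgue)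
        = (\<integral>\<^sup>+x. liminf (\<lambda>k. ennreal ((norm (f k x - rep_L2 (X m) x))\<^sup>2)) \<partial>lebesgue)"
    proof (rule nn_integral_cong_AE)
      show "AE x in lebesgue. ennreal ((norm (F x - rep_L2 (X m) x))\<^sup>2)
          = liminf (\<lambda>k. ennreal ((norm (f k x - rep_L2 (X m) x))\<^sup>2))" using conv
      proof eventually_elim
        case (elim x)
        then have "(\<lambda>k. f k x) \<longlonglongrightarrow> F x" by (simp add: F_def convergent_LIMSEQ_iff)
        then have "(\<lambda>k. ennreal ((norm (f k x - rep_L2 (X m) x))\<^sup>2)) \<longlonglongrightarrow> ennreal ((norm (F x - rep_L2 (X m) x))\<^sup>2)"
          by (intro tendsto_intros)
        then show ?case by (intro lim_imp_Liminf[symmetric]) auto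
      qed
    qed
    also have "\<dots> \<le> liminf (\<lambda>k. \<integral>\<^sup>+x. ennreal ((norm (f k x - rep_L2 (X m) x))\<^sup>2) \<partial>lebesgue)"
      by (rule nn_integral_liminf) simp
    also have "\<dots> = liminf (\<lambda>k. ennreal ((norm (X (s k) - X m))\<^sup>2))" by (simp add: f_def L2_norm_diff_nn)
    also have "\<dots> \<le> liminf (\<lambda>k. ennreal (e\<^sup>2))"
    proof (rule Liminf_mono)
      show "\<forall>\<^sub>F k in sequentially. ennreal ((norm (X (s k) - X m))\<^sup>2) \<le> ennreal (e\<^sup>2)"
        using eventually_ge_at_top[of N]
      proof eventually_elim
        case (elim k)
        then have "norm (X (s k) - X m) \<le> e" using N s_ge[of k] by force
        then show ?case by (intro ennreal_leI power_mono) auto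
      qed
    qed
    also have "\<dots> = ennreal (e\<^sup>2)" by (simp add: Liminf_const)
    finally show ?thesis .
  qed
  obtain N1 where N1: "\<And>m n. m \<ge> N1 \<Longrightarrow> n \<ge> N1 \<Longrightarrow> norm (X m - X n) < 1"
    using X unfolding Cauchy_iff by (metis zero_less_one)
  have "L2_fun UNIV (\<lambda>x. F x - rep_L2 (X N1) x)"
  proof -
    have [measurable]: "rep_L2 (X N1) \<in> borel_measurable lebesgue"
      using L2_fun_rep[of "X N1"] by (simp add: L2_fun_UNIV)
    have "(\<integral>\<^sup>+x. ennreal ((norm (F x - rep_L2 (X N1) x))\<^sup>2) \<partial>lebesgue) \<le> ennreal (1\<^sup>2)"
      by (rule fat[of 1 N1]) (use N1 in \<open>auto intro: less_imp_le\<close>)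
    also have "\<dots> < \<infinity>" by simp
    finally show ?thesis by (auto simp: L2_fun_UNIV integrable_iff_bounded)
  qed
  from L2_fun_add[OF this L2_fun_rep[of "X N1"]] have LF: "L2_fun UNIV F" by simp
  have "X \<longlonglongrightarrow> abs_L2 F" unfolding LIMSEQ_iff
  proof (intro allI impI)
    fix e :: real assume "e > 0"
    then obtain N where N: "\<And>m n. m \<ge> N \<Longrightarrow> n \<ge> N \<Longrightarrow> norm (X m - X n) < e/2"
      using X unfolding Cauchy_iff by (metis half_gt_zero)
    show "\<exists>no. \<forall>n\<ge>no. norm (X n - abs_L2 F) < e"
    proof (intro exI allI impI)
      fix m assume m: "m \<ge> N"
      have int: "integrable lebesgue (\<lambda>x. (norm (F x - rep_L2 (X m) x))\<^sup>2)"
        using L2_fun_diff[OF LF L2_fun_rep[of "X m"]] by (simp add: L2_fun_UNIV)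
      have "ennreal ((norm (abs_L2 F - X m))\<^sup>2) = (\<integral>\<^sup>+x. ennreal ((norm (F x - rep_L2 (X m) x))\<^sup>2) \<partial>lebesgue)"
        using int by (simp add: norm_L2_abs_diff[OF LF] nn_integral_eq_integral)
      also have "\<dots> \<le> ennreal ((e/2)\<^sup>2)"
        by (rule fat[of _ N]) (use N[OF _ m] \<open>e > 0\<close> in \<open>auto intro: less_imp_le\<close>)
      finally have "(norm (abs_L2 F - X m))\<^sup>2 \<le> (e/2)\<^sup>2" by simp
      then have "norm (abs_L2 F - X m) \<le> e/2"
        using \<open>e > 0\<close> by (simp add: abs_le_square_iff[symmetric] abs_of_pos)
      then show "norm (X m - abs_L2 F) < e" using \<open>e > 0\<close> by (simp add: norm_minus_commute)
    qed
  qed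
  then show "convergent X" by (auto simp: convergent_def)
qed

section \<open>Inner products, sums and bounded multipliers of classes\<close>

lemma abs_L2_rep: "abs_L2 (rep_L2 X) = X"
  by (simp add: Quotient3_abs_rep[OF Quotient3_L2])

lemma L2_of_eq_abs:
  assumes "S \<in> sets lebesgue" "L2_fun S f"
  shows "L2_of S f = abs_L2 (\<lambda>x. if x \<in> S then f x else 0)"
  using assms by (simp add: L2_of.abs_eq)

lemma inner_abs_L2:
  assumes "L2_fun UNIV f" "L2_fun UNIV g"
  shows "abs_L2 f \<bullet> abs_L2 g = (LINT x|lebesgue. f x \<bullet> g x)"
  by (rule inner_L2.abs_eq) (use assms in \<open>auto simp: eq_onp_def L2_rel_def\<close>)

lemma inner_L2_of_left:
  assumes S: "S \<in> sets lebesgue" and f: "L2_fun S f"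
  shows "L2_of S f \<bullet> X = (LINT x|lebesgue. (if x \<in> S then f x \<bullet> rep_L2 X x else 0))"
proof -
  have "L2_of S f \<bullet> X = abs_L2 (\<lambda>x. if x \<in> S then f x else 0) \<bullet> abs_L2 (rep_L2 X)"
    by (simp add: L2_of_eq_abs[OF assms] abs_L2_rep)
  also have "\<dots> = (LINT x|lebesgue. (if x \<in> S then f x else 0) \<bullet> rep_L2 X x)"
    by (rule inner_abs_L2[OF L2_fun_extend[OF assms] L2_fun_rep])
  also have "\<dots> = (LINT x|lebesgue. (if x \<in> S then f x \<bullet> rep_L2 X x else 0))"
    by (rule Bochner_Integration.integral_cong) auto
  finally show ?thesis .
qed

lemma inner_L2_of:
  assumes S: "S \<in> sets lebesgue" and f: "L2_fun S f" and g: "L2_fun S g"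
  shows "L2_of S f \<bullet> L2_of S g = (LINT x|lebesgue_on S. f x \<bullet> g x)"
proof -
  have "L2_of S f \<bullet> L2_of S g = (LINT x|lebesgue. (if x \<in> S then f x else 0) \<bullet> (if x \<in> S then g x else 0))"
    by (simp add: L2_of_eq_abs S f g inner_abs_L2[OF L2_fun_extend[OF S f] L2_fun_extend[OF S g]])
  also have "\<dots> = (LINT x|lebesgue. (if x \<in> S then f x \<bullet> g x else 0))"
    by (rule Bochner_Integration.integral_cong) auto
  also have "\<dots> = (LINT x|lebesgue_on S. f x \<bullet> g x)"
    using S by (simp add: Lebesgue_Measure.integral_restrict_UNIV)
  finally show ?thesis .
qed

lemma L2_fun_restrict: "S \<in> sets lebesgue \<Longrightarrow> L2_fun S f \<longleftrightarrow> L2_fun UNIV (\<lambda>x. if x \<in> S then f x else 0)"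
proof
  assume S: "S \<in> sets lebesgue" and L: "L2_fun UNIV (\<lambda>x. if x \<in> S then f x else 0)"
  then have m: "(\<lambda>x. if x \<in> S then f x else 0) \<in> borel_measurable lebesgue"
    and i: "integrable lebesgue (\<lambda>x. (norm (if x \<in> S then f x else 0))\<^sup>2)"
    by (auto simp: L2_fun_UNIV)
  have "(\<lambda>x. (norm (if x \<in> S then f x else 0))\<^sup>2) = (\<lambda>x. if x \<in> S then (norm (f x))\<^sup>2 else 0)" by auto
  with i have "integrable (lebesgue_on S) (\<lambda>x. (norm (f x))\<^sup>2)"
    using Lebesgue_Measure.integrable_restrict_UNIV[OF S, of "\<lambda>x. (norm (f x))\<^sup>2"] by simp
  moreover have "f \<in> borel_measurable (lebesgue_on S)" using m borel_measurable_if[OF S, of f] by simp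
  ultimately show "L2_fun S f" by (simp add: L2_fun_def)
qed (rule L2_fun_extend)

lemma L2_of_add:
  assumes S: "S \<in> sets lebesgue" and f: "L2_fun S f" and g: "L2_fun S g"
  shows "L2_fun S (\<lambda>x. f x + g x)" "L2_of S (\<lambda>x. f x + g x) = L2_of S f + L2_of S g"
proof -
  have e: "(\<lambda>x. if x \<in> S then f x + g x else 0) = (\<lambda>x. (if x \<in> S then f x else 0) + (if x \<in> S then g x else 0))"
    by auto
  show *: "L2_fun S (\<lambda>x. f x + g x)"
    unfolding L2_fun_restrict[OF S] e by (rule L2_fun_add[OF L2_fun_extend[OF S f] L2_fun_extend[OF S g]])
  show "L2_of S (\<lambda>x. f x + g x) = L2_of S f + L2_of S g"
    unfolding L2_of_eq_abs[OF S *] L2_of_eq_abs[OF S f] L2_of_eq_abs[OF S g] e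
    by (rule plus_L2.abs_eq[symmetric])
       (use L2_fun_extend[OF S f] L2_fun_extend[OF S g] in \<open>auto simp: eq_onp_def L2_rel_def\<close>)
qed

lemma L2_of_scaleR:
  assumes S: "S \<in> sets lebesgue" and f: "L2_fun S f"
  shows "L2_fun S (\<lambda>x. r *\<^sub>R f x)" "L2_of S (\<lambda>x. r *\<^sub>R f x) = r *\<^sub>R L2_of S f"
proof -
  have e: "(\<lambda>x. if x \<in> S then r *\<^sub>R f x else 0) = (\<lambda>x. r *\<^sub>R (if x \<in> S then f x else 0))" by auto
  show *: "L2_fun S (\<lambda>x. r *\<^sub>R f x)"
    unfolding L2_fun_restrict[OF S] e by (rule L2_fun_scaleR[OF L2_fun_extend[OF S f]])
  show "L2_of S (\<lambda>x. r *\<^sub>R f x) = r *\<^sub>R L2_of S f" unfolding L2_of_eq_abs[OF S *] L2_of_eq_abs[OF S f] e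
    by (rule scaleR_L2.abs_eq[symmetric])
       (use L2_fun_extend[OF S f] in \<open>auto simp: eq_onp_def L2_rel_def\<close>)
qed

lemma L2_of_diff:
  assumes S: "S \<in> sets lebesgue" and f: "L2_fun S f" and g: "L2_fun S g"
  shows "L2_fun S (\<lambda>x. f x - g x)" "L2_of S (\<lambda>x. f x - g x) = L2_of S f - L2_of S g"
  using L2_of_add[OF S f L2_of_scaleR(1)[OF S g, of "-1"]] L2_of_scaleR[OF S g, of "-1"] by auto

text \<open>Lebesgue measure is complete, so equality almost everywhere transports measurability as
  well.\<close>

lemma L2_of_AE_cong:
  assumes S: "S \<in> sets lebesgue" and f: "L2_fun S f" and ae: "AE x in lebesgue_on S. f x = g x"
  shows "L2_fun S g" "L2_of S g = L2_of S f"
proof -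
  have ae': "AE x in lebesgue. (if x \<in> S then f x else 0) = (if x \<in> S then g x else 0)"
    using ae S by (subst (asm) AE_restrict_space_iff) (auto elim!: AE_mp)
  have f': "L2_fun UNIV (\<lambda>x. if x \<in> S then f x else 0)" by (rule L2_fun_extend[OF S f])
  have m: "(\<lambda>x. if x \<in> S then g x else 0) \<in> borel_measurable lebesgue"
    by (rule borel_measurable_AE[OF _ ae']) (use f' in \<open>simp add: L2_fun_UNIV\<close>)
  have "integrable lebesgue (\<lambda>x. (norm (if x \<in> S then f x else 0))\<^sup>2)"
    using f' by (simp add: L2_fun_UNIV)
  then have "integrable lebesgue (\<lambda>x. (norm (if x \<in> S then g x else 0))\<^sup>2)"
  proof (rule integrable_cong_AE_imp)
    show "(\<lambda>x. (norm (if x \<in> S then g x else 0))\<^sup>2) \<in> borel_measurable lebesgue" using m by measurable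
    show "AE x in lebesgue. (norm (if x \<in> S then f x else 0))\<^sup>2 = (norm (if x \<in> S then g x else 0))\<^sup>2"
      using ae' by eventually_elim simp
  qed
  with m show g: "L2_fun S g" by (simp add: L2_fun_restrict[OF S] L2_fun_UNIV)
  show "L2_of S g = L2_of S f" unfolding L2_of_eq_iff[OF S g f] using ae by (auto elim: AE_mp)
qed

lemma L2_fun_mult_bounded:
  fixes b :: "'a::euclidean_space \<Rightarrow> real"
  assumes S: "S \<in> sets lebesgue" and f: "L2_fun S f" and b: "b \<in> borel_measurable (lebesgue_on S)"
    and B: "AE x in lebesgue_on S. \<bar>b x\<bar> \<le> B"
  shows "L2_fun S (\<lambda>x. b x *\<^sub>R f x)" "norm (L2_of S (\<lambda>x. b x *\<^sub>R f x)) \<le> \<bar>B\<bar> * norm (L2_of S f)"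
proof -
  have [measurable]: "f \<in> borel_measurable (lebesgue_on S)" "b \<in> borel_measurable (lebesgue_on S)"
    and i: "integrable (lebesgue_on S) (\<lambda>x. (norm (f x))\<^sup>2)"
    using f b by (auto simp: L2_fun_def)
  have le: "AE x in lebesgue_on S. (norm (b x *\<^sub>R f x))\<^sup>2 \<le> B\<^sup>2 * (norm (f x))\<^sup>2" using B
  proof eventually_elim
    case (elim x)
    then have "(\<bar>b x\<bar>)\<^sup>2 \<le> B\<^sup>2" by (intro power_mono) auto
    then show ?case by (simp add: power_mult_distrib mult_right_mono)
  qed
  have i2: "integrable (lebesgue_on S) (\<lambda>x. (norm (b x *\<^sub>R f x))\<^sup>2)"
    by (rule Bochner_Integration.integrable_bound[OF integrable_mult_right[OF i, of "B\<^sup>2"]])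
       (use le in \<open>auto simp del: norm_scaleR\<close>)
  then show L: "L2_fun S (\<lambda>x. b x *\<^sub>R f x)" by (simp add: L2_fun_def del: norm_scaleR)
  have "(LINT x|lebesgue_on S. (norm (b x *\<^sub>R f x))\<^sup>2) \<le> (LINT x|lebesgue_on S. B\<^sup>2 * (norm (f x))\<^sup>2)"
    by (rule integral_mono_AE[OF i2 integrable_mult_right[OF i] le])
  then have "sqrt ((LINT x|lebesgue_on S. (norm (b x *\<^sub>R f x))\<^sup>2)) \<le> sqrt (B\<^sup>2 * (LINT x|lebesgue_on S. (norm (f x))\<^sup>2))"
    by (simp del: norm_scaleR)
  then show "norm (L2_of S (\<lambda>x. b x *\<^sub>R f x)) \<le> \<bar>B\<bar> * norm (L2_of S f)"
    by (simp add: norm_L2_of[OF S L] norm_L2_of[OF S f] real_sqrt_mult del: norm_scaleR)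
qed

section \<open>Calculus of \<open>Ck_on\<close> on the whole space\<close>

lemma partial_eq:
  assumes "(f has_derivative f') (at x)"
  shows "partial i f x = f' (axis i 1)"
  using frechet_derivative_at[OF assms] by (simp add: partial_def)

lemma Ck_on_Suc_imp: "open S \<Longrightarrow> Ck_on (Suc k) S f \<Longrightarrow> Ck_on k S f"
  by (induction k arbitrary: f) (auto simp: differentiable_imp_continuous_on)

lemma Ck_on_continuous: "open S \<Longrightarrow> Ck_on k S f \<Longrightarrow> continuous_on S f"
  by (cases k) (auto simp: differentiable_imp_continuous_on)

text \<open>Lets an explicit derivative be used in inductions on k, in place of the
  \<open>frechet_derivative\<close> hidden in \<open>partial\<close>; uniqueness of the derivative
  identifies the two.\<close>

lemma Ck_UNIV_Suc_I:
  assumes "\<And>x. (f has_derivative f' x) (at x)" "\<And>i. Ck_on k UNIV (\<lambda>x. f' x (axis i 1))"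
  shows "Ck_on (Suc k) UNIV f"
proof -
  have "partial i f = (\<lambda>x. f' x (axis i 1))" for i using partial_eq[OF assms(1)] by auto
  moreover have "f differentiable_on UNIV"
    using assms(1) by (auto simp: differentiable_on_def differentiable_def)
  ultimately show ?thesis using assms(2) by simp
qed

lemma Ck_UNIV_Suc_E:
  assumes "Ck_on (Suc k) UNIV f"
  obtains f' where "\<And>x. (f has_derivative f' x) (at x)" "\<And>i. Ck_on k UNIV (\<lambda>x. f' x (axis i 1))"
    "\<And>i. partial i f = (\<lambda>x. f' x (axis i 1))"
proof
  show d: "(f has_derivative frechet_derivative f (at x)) (at x)" for x
    using assms by (auto simp: differentiable_on_def frechet_derivative_works)
  show p: "partial i f = (\<lambda>x. frechet_derivative f (at x) (axis i 1))" for i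
    using partial_eq[OF d] by auto
  show "Ck_on k UNIV (\<lambda>x. frechet_derivative f (at x) (axis i 1))" for i
    using assms unfolding p[of i, symmetric] by simp
qed

lemma Ck_const: "Ck_on k UNIV (\<lambda>_. c)"
  proof (induction k arbitrary: c)
  case (Suc k)
  show ?case by (rule Ck_UNIV_Suc_I[where f' = "\<lambda>_ _. 0"]) (auto intro: Suc)
qed auto

lemma Ck_add:
  assumes "Ck_on k UNIV h" "Ck_on k UNIV h'"
  shows "Ck_on k UNIV (\<lambda>x. h x + h' x)"
  using assms
  proof (induction k arbitrary: h h')
    case 0 then show ?case by (auto intro: continuous_intros)
  next
    case (Suc k)
    from Suc.prems(1) obtain f' where f: "\<And>x. (h has_derivative f' x) (at x)" "\<And>i. Ck_on k UNIV (\<lambda>x. f' x (axis i 1))"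
      by (rule Ck_UNIV_Suc_E) blast
    from Suc.prems(2) obtain g' where g: "\<And>x. (h' has_derivative g' x) (at x)" "\<And>i. Ck_on k UNIV (\<lambda>x. g' x (axis i 1))"
      by (rule Ck_UNIV_Suc_E) blast
    show ?case by (rule Ck_UNIV_Suc_I[where f' = "\<lambda>x y. f' x y + g' x y"])
         (auto intro: f g derivative_intros Suc.IH)
  qed

lemma Ck_bilinear:
  assumes B: "bounded_bilinear pr"
  assumes "Ck_on k UNIV f" "Ck_on k UNIV g"
  shows "Ck_on k UNIV (\<lambda>x. pr (f x) (g x))"
proof -
  interpret bounded_bilinear pr by fact
  show "Ck_on k UNIV (\<lambda>x. pr (f x) (g x))" using assms(2-)
  proof (induction k arbitrary: f g)
    case 0 then show ?case by (auto intro: continuous_on)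
  next
    case (Suc k)
    from Suc.prems(1) obtain f' where f: "\<And>x. (f has_derivative f' x) (at x)" "\<And>i. Ck_on k UNIV (\<lambda>x. f' x (axis i 1))"
      by (rule Ck_UNIV_Suc_E) blast
    from Suc.prems(2) obtain g' where g: "\<And>x. (g has_derivative g' x) (at x)" "\<And>i. Ck_on k UNIV (\<lambda>x. g' x (axis i 1))"
      by (rule Ck_UNIV_Suc_E) blast
    show ?case
    proof (rule Ck_UNIV_Suc_I)
      show "((\<lambda>x. pr (f x) (g x)) has_derivative (\<lambda>h. pr (f x) (g' x h) + pr (f' x h) (g x))) (at x)" for x
        by (rule FDERIV[OF f(1) g(1)])
      show "Ck_on k UNIV (\<lambda>x. pr (f x) (g' x (axis i 1)) + pr (f' x (axis i 1)) (g x))" for i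
        by (intro Ck_add Suc.IH f g Ck_on_Suc_imp[OF open_UNIV Suc.prems(1)] Ck_on_Suc_imp[OF open_UNIV Suc.prems(2)])
    qed
  qed
qed

lemmas Ck_mult = Ck_bilinear[OF bounded_bilinear_mult]

lemma Ck_bounded_linear:
  assumes L: "bounded_linear L" and f: "Ck_on k UNIV f"
  shows "Ck_on k UNIV (\<lambda>x. L (f x))"
proof -
  interpret L: bounded_linear L by fact
  have "Ck_on k UNIV (\<lambda>x. L (f x))" using f
  proof (induction k arbitrary: f)
    case 0 then show ?case by (auto intro: L.continuous_on)
  next
    case (Suc k)
    from Suc.prems obtain f' where f: "\<And>x. (f has_derivative f' x) (at x)" "\<And>i. Ck_on k UNIV (\<lambda>x. f' x (axis i 1))"
      by (rule Ck_UNIV_Suc_E) blast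
    show ?case
      by (rule Ck_UNIV_Suc_I[where f' = "\<lambda>x y. L (f' x y)"]) (auto intro: f L.has_derivative Suc.IH)
  qed
  then show ?thesis .
qed

lemma Ck_prod:
  fixes f :: "'i \<Rightarrow> real^'d \<Rightarrow> real"
  assumes "\<And>i. i \<in> I \<Longrightarrow> Ck_on k UNIV (f i)"
  shows "Ck_on k UNIV (\<lambda>x. \<Prod>i\<in>I. f i x)"
  using assms by (induction I rule: infinite_finite_induct) (auto intro: Ck_const Ck_mult)

text \<open>The whole tower \<open>D\<close> of successive derivatives is assumed at once: one
  differentiation replaces \<open>D n\<close> by a constant times \<open>D (Suc n)\<close>, so the
  induction on k runs for all n simultaneously.\<close>

lemma Ck_affine:
  assumes "\<And>n x. (D n has_real_derivative D (Suc n) x) (at x)"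
  shows "Ck_on k UNIV (\<lambda>x::real^'d. D n (c * (x $ i) + b))"
proof (induction k arbitrary: n)
  case 0
  have "continuous_on UNIV (D n)"
    using assms by (meson DERIV_continuous_on has_field_derivative_at_within)
  then show ?case by (auto intro!: continuous_intros continuous_on_compose2[of UNIV "D n"])
next
  case (Suc k)
  show ?case
  proof (rule Ck_UNIV_Suc_I)
    show "((\<lambda>x::real^'d. D n (c * (x $ i) + b)) has_derivative (\<lambda>h. (c * h $ i) * D (Suc n) (c * (x $ i) + b))) (at x)" for x
      by (rule has_derivative_compose[of "\<lambda>x. c * (x $ i) + b", OF _ assms[unfolded has_field_derivative_def], THEN has_derivative_eq_rhs])
         (auto intro!: derivative_eq_intros bounded_linear.has_derivative[OF bounded_linear_vec_nth] simp: mult_ac)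
    show "Ck_on k UNIV (\<lambda>x. c * axis j 1 $ i * D (Suc n) (c * x $ i + b))" for j
      by (intro Ck_mult Ck_const Suc)
  qed
qed

subsection \<open>Smooth bump functions\<close>

text \<open>The polynomial factor of the n-th derivative of exp(-1/s): differentiating p(1/s)
  exp(-1/s) gives (1/s)^2 (p - p')(1/s) exp(-1/s), and this step is iterated.\<close>

definition bump_poly :: "nat \<Rightarrow> real poly" where
  "bump_poly n = ((\<lambda>p. [:0,0,1:] * (p - pderiv p)) ^^ n) 1"

definition bump_deriv :: "nat \<Rightarrow> real \<Rightarrow> real" where
  "bump_deriv n s = (if s > 0 then poly (bump_poly n) (1/s) * exp (-1/s) else 0)"

abbreviation bump :: "real \<Rightarrow> real" where "bump \<equiv> bump_deriv 0"

lemma bump_eq: "bump s = (if s > 0 then exp (-1/s) else 0)"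
  by (simp add: bump_deriv_def bump_poly_def)

lemma poly_times_exp_tendsto_0: "((\<lambda>x::real. poly p x * exp (-x)) \<longlongrightarrow> 0) at_top"
proof -
  have "((\<lambda>x. \<Sum>i\<le>degree p. coeff p i * (x ^ i / exp x)) \<longlongrightarrow> (\<Sum>i\<le>degree p. coeff p i * 0)) at_top"
    by (intro tendsto_intros tendsto_power_div_exp_0)
  moreover have "(\<lambda>x. \<Sum>i\<le>degree p. coeff p i * (x ^ i / exp x)) = (\<lambda>x. poly p x * exp (-x))"
    by (auto simp: poly_altdef sum_distrib_right exp_minus field_simps sum_divide_distrib)
  ultimately show ?thesis by simp
qed

text \<open>Only the origin is delicate. From the right the difference quotient is again a
  polynomial in 1/s times exp(-1/s), the factor 1/s being absorbed into the polynomial, and hence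
  tends to 0; from the left it is 0.\<close>

lemma bump_deriv_DERIV: "(bump_deriv n has_real_derivative bump_deriv (Suc n) x) (at x)"
proof -
  consider "x < 0" | "x = 0" | "x > 0" by linarith
  then show ?thesis
  proof cases
    case 1
    have "((\<lambda>_. 0) has_real_derivative bump_deriv (Suc n) x) (at x)"
      using 1 by (auto simp: bump_deriv_def)
    then show ?thesis by (rule DERIV_cong_ev[THEN iffD1, rotated -1])
         (use 1 in \<open>auto simp: bump_deriv_def intro!: eventually_mono[OF eventually_nhds_in_open[of "{..<0}" x]]\<close>)
  next
    case 3
    have "((\<lambda>s. poly (bump_poly n) (1/s) * exp (-1/s)) has_real_derivative bump_deriv (Suc n) x) (at x)"
      using 3
      by (auto intro!: derivative_eq_intros DERIV_chain2[OF poly_DERIV] simp: bump_deriv_def bump_poly_def)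
         (auto simp: field_simps power2_eq_square)
    then show ?thesis by (rule DERIV_cong_ev[THEN iffD1, rotated -1])
         (use 3 in \<open>auto simp: bump_deriv_def intro!: eventually_mono[OF eventually_nhds_in_open[of "{0<..}" x]]\<close>)
  next
    case 2
    have "((\<lambda>s. poly ([:0,1:] * bump_poly n) (1/s) * exp (-(1/s))) \<longlongrightarrow> 0) (at_right 0)"
      by (rule filterlim_compose[OF poly_times_exp_tendsto_0])
         (use filterlim_inverse_at_top_right in \<open>simp add: inverse_eq_divide\<close>)
    then have r: "((\<lambda>s. bump_deriv n s / s) \<longlongrightarrow> 0) (at_right 0)" by (rule Lim_transform_eventually)
         (auto intro!: eventually_at_rightI[of 0 1] simp: bump_deriv_def)
    have l: "((\<lambda>s. bump_deriv n s / s) \<longlongrightarrow> 0) (at_left 0)"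
      by (rule Lim_transform_eventually[OF tendsto_const])
         (auto intro!: eventually_at_leftI[of "-1" 0] simp: bump_deriv_def)
    from l r have "((\<lambda>s. bump_deriv n s / s) \<longlongrightarrow> 0) (at 0)" using filterlim_split_at by blast
    with 2 show ?thesis by (simp add: has_field_derivative_iff bump_deriv_def)
  qed
qed

text \<open>One one-sided bump for each face of the box from a to b. The parameter n > 0 is a
  steepness: as it grows, the functions tend to the indicator of the open box while staying between
  0 and 1. The arguments are written in the form expected by \<open>Ck_affine\<close>.\<close>

definition box_bump :: "real^'d \<Rightarrow> real^'d \<Rightarrow> real \<Rightarrow> real^'d \<Rightarrow> real" where
  "box_bump a b n x = (\<Prod>i\<in>UNIV. bump (n * (x $ i) + (- n * a $ i)) * bump ((-n) * (x $ i) + n * b $ i))"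

lemma Ck_box_bump: "Ck_on k UNIV (box_bump a b n)"
  unfolding box_bump_def[abs_def] by (intro Ck_prod Ck_mult Ck_affine bump_deriv_DERIV)

lemma bump_bounds: "0 \<le> bump s" "bump s \<le> 1" "s > 0 \<Longrightarrow> bump s > 0" "s \<le> 0 \<Longrightarrow> bump s = 0"
  by (auto simp: bump_eq)

lemma box_bump_outside: "n > 0 \<Longrightarrow> x \<notin> box a b \<Longrightarrow> box_bump a b n x = 0"
proof -
  assume n: "n > 0" and "x \<notin> box a b"
  then obtain i where "x $ i \<le> a $ i \<or> b $ i \<le> x $ i" by (auto simp: mem_box_cart not_less)
  then have "n * (x $ i) + (- n * a $ i) \<le> 0 \<or> (-n) * (x $ i) + n * b $ i \<le> 0" using n by auto
  then show ?thesis unfolding box_bump_def by (intro prod_zero bexI[of _ i]) (auto simp: bump_bounds)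
qed

lemma box_bump_nonneg: "0 \<le> box_bump a b n x"
  unfolding box_bump_def by (intro prod_nonneg mult_nonneg_nonneg ballI) (auto simp: bump_bounds)

lemma box_bump_le_1: "box_bump a b n x \<le> 1"
  unfolding box_bump_def by (intro prod_le_1) (auto simp: bump_bounds intro: mult_le_one)

lemma box_bump_pos: "n > 0 \<Longrightarrow> x \<in> box a b \<Longrightarrow> box_bump a b n x > 0"
  unfolding box_bump_def by (intro prod_pos ballI mult_pos_pos bump_bounds(3)) (auto simp: mem_box_cart)

lemma bump_scaled_tendsto: "(\<lambda>n. bump (real n * s)) \<longlonglongrightarrow> (if s > 0 then 1 else 0)"
proof (cases "s > 0")
  case True
  have "(\<lambda>n. exp (- (1/s) * (1/real n))) \<longlonglongrightarrow> exp (- (1/s) * 0)" by (intro tendsto_intros lim_1_over_n)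
  then have "(\<lambda>n. exp (- (1/s) * (1/real n))) \<longlonglongrightarrow> (if s > 0 then 1 else 0)" using True by simp
  then show ?thesis by (rule Lim_transform_eventually)
       (use True in \<open>auto intro!: eventually_mono[OF eventually_gt_at_top[of 0]] simp: bump_eq field_simps\<close>)
qed (auto simp: bump_eq zero_less_mult_iff)

lemma box_bump_tendsto: "(\<lambda>n. box_bump a b (real n) x) \<longlonglongrightarrow> indicator (box a b) x"
proof -
  have "(\<lambda>n. \<Prod>i\<in>UNIV. bump (real n * (x $ i - a $ i)) * bump (real n * (b $ i - x $ i)))
     \<longlonglongrightarrow> (\<Prod>i\<in>UNIV. (if x $ i - a $ i > 0 then 1 else 0) * (if b $ i - x $ i > 0 then 1 else 0))"
    by (intro tendsto_intros bump_scaled_tendsto)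
  also have "(\<Prod>i\<in>UNIV. (if x $ i - a $ i > 0 then 1 else 0) * (if b $ i - x $ i > 0 then 1 else 0)) = (indicator (box a b) x :: real)"
    by (auto simp: indicator_def mem_box_cart intro!: prod_zero)
  finally show ?thesis by (simp add: box_bump_def algebra_simps)
qed

lemma test_fun_box_bump:
  assumes "n > 0" "cbox a b \<subseteq> \<Omega>"
  shows "test_fun \<Omega> (box_bump a b n)"
proof -
  have "box_bump a b n x = 0" if "x \<notin> cbox a b" for x
    using that box_subset_cbox[of a b] by (intro box_bump_outside[OF assms(1)]) auto
  then show ?thesis unfolding test_fun_def using assms(2) compact_cbox[of a b] Ck_box_bump by blast
qed

subsection \<open>The fundamental lemma of the calculus of variations\<close>

lemma sigma_finite_lebesgue: "sigma_finite_measure (lebesgue :: 'a::euclidean_space measure)"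
proof
  obtain A :: "'a set set" where A: "countable A" "A \<subseteq> sets lborel" "\<Union>A = space lborel" "\<forall>a\<in>A. emeasure lborel a \<noteq> \<infinity>"
    using lborel.sigma_finite_countable by blast
  then show "\<exists>A. countable A \<and> A \<subseteq> sets lebesgue \<and> \<Union>A = space lebesgue \<and> (\<forall>a\<in>A. emeasure (lebesgue :: 'a measure) a \<noteq> \<infinity>)"
    by (intro exI[of _ A]) auto
qed

text \<open>Once the total integral is 0, the Borel sets over which F integrates to 0 form a Dynkin
  system, and the open boxes are an intersection-stable generator. A Lebesgue set differs from its
  Borel main part only by a null set.\<close>

lemma AE_zero_of_box_integrals:
  fixes F :: "'a::euclidean_space \<Rightarrow> complex"
  assumes F: "integrable lebesgue F" and tot: "integral\<^sup>L lebesgue F = 0"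
    and bx: "\<And>a b. (\<integral>x\<in>box a b. F x \<partial>lebesgue) = 0"
  shows "AE x in lebesgue. F x = 0"
proof (rule sigma_finite_measure.density_zero[OF sigma_finite_lebesgue F])
  have Int_stable_boxes: "Int_stable (range (\<lambda>(a, b). box a b :: 'a set))"
    by (auto simp: Int_stable_def box_Int_box)
  have B: "(\<integral>x\<in>S. F x \<partial>lebesgue) = 0" if "S \<in> sets borel" for S
  proof -
    have S: "S \<in> sigma_sets UNIV (range (\<lambda>(a, b). box a b :: 'a set))"
      using that by (simp add: borel_eq_box)
    show ?thesis
    proof (rule sigma_sets_induct_disjoint[OF Int_stable_boxes _ S, where P = "\<lambda>S. (\<integral>x\<in>S. F x \<partial>lebesgue) = 0"])
      fix A :: "'a set" assume A: "A \<in> sigma_sets UNIV (range (\<lambda>(a, b). box a b))" "(\<integral>x\<in>A. F x \<partial>lebesgue) = 0"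
      then have [measurable]: "A \<in> sets borel" by (simp add: borel_eq_box)
      then have mA: "A \<in> sets lebesgue" "UNIV - A \<in> sets lebesgue" by (auto intro: borel_comp simp: Compl_eq_Diff_UNIV[symmetric])
      have "integral\<^sup>L lebesgue F = (LINT x|lebesgue. indicator A x *\<^sub>R F x + indicator (UNIV - A) x *\<^sub>R F x)"
        by (intro Bochner_Integration.integral_cong) (auto simp: indicator_def)
      also have "\<dots> = (\<integral>x\<in>A. F x \<partial>lebesgue) + (\<integral>x\<in>UNIV - A. F x \<partial>lebesgue)"
        unfolding set_lebesgue_integral_def
        by (intro Bochner_Integration.integral_add integrable_mult_indicator F mA)
      finally have "integral\<^sup>L lebesgue F = (\<integral>x\<in>A. F x \<partial>lebesgue) + (\<integral>x\<in>UNIV - A. F x \<partial>lebesgue)" .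
      with A tot show "(\<integral>x\<in>UNIV - A. F x \<partial>lebesgue) = 0" by simp
    next
      fix A :: "nat \<Rightarrow> 'a set"
      assume A: "disjoint_family A" "range A \<subseteq> sigma_sets UNIV (range (\<lambda>(a, b). box a b))"
        "\<And>i. (\<integral>x\<in>A i. F x \<partial>lebesgue) = 0"
      then have "A i \<in> sets borel" for i by (auto simp: borel_eq_box)
      then have m: "A i \<in> sets lebesgue" for i by simp
      have "(\<integral>x\<in>(\<Union>i. A i). F x \<partial>lebesgue) = (\<Sum>i. (\<integral>x\<in>A i. F x \<partial>lebesgue))"
      proof (rule lebesgue_integral_countable_add[OF m])
        show "A i \<inter> A j = {}" if "i \<noteq> j" for i j using A(1) that by (auto simp: disjoint_family_on_def)
        show "set_integrable lebesgue (\<Union>i. A i) F"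
          unfolding set_integrable_def using m by (intro integrable_mult_indicator F) auto
      qed
      then show "(\<integral>x\<in>(\<Union>i. A i). F x \<partial>lebesgue) = 0" using A by simp
    qed (use bx in \<open>auto simp: set_lebesgue_integral_def\<close>)
  qed
  fix S :: "'a set" assume S: "S \<in> sets lebesgue"
  then have "main_part lborel S \<in> sets borel" using main_part_sets[of S lborel] by simp
  from B[OF this] have "(\<integral>x\<in>main_part lborel S. F x \<partial>lebesgue) = 0" .
  moreover have "(\<integral>x\<in>main_part lborel S. F x \<partial>lebesgue) = (\<integral>x\<in>S. F x \<partial>lebesgue)"
  proof -
    have [measurable]: "F \<in> borel_measurable lebesgue" using F by auto
    have "main_part lborel S \<in> sets lebesgue" using \<open>main_part lborel S \<in> sets borel\<close> by simp
    moreover obtain N where N: "N \<in> null_sets lborel" "null_part lborel S \<subseteq> N"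
      using null_part[OF S] by blast
    then have "AE x in lebesgue. x \<notin> N" by (intro AE_not_in) (simp add: null_sets_completionI)
    then have "AE x in lebesgue. indicator (main_part lborel S) x *\<^sub>R F x = indicator S x *\<^sub>R F x"
      by eventually_elim (use N main_part_null_part_Un[OF S] in \<open>auto simp: indicator_def\<close>)
    ultimately show ?thesis unfolding set_lebesgue_integral_def using S
      by (intro integral_cong_AE borel_measurable_scaleR borel_measurable_indicator) auto
  qed
  ultimately show "(\<integral>x\<in>S. F x \<partial>lebesgue) = 0" by simp
qed

text \<open>Steep bumps tend boundedly to indicators of boxes, so f integrates to 0 over every open
  box whose closed box lies in \<Omega>. Intersections of boxes are boxes, which gives f = 0 almost
  everywhere in each of them; countably many closed boxes exhaust \<Omega>, and their frontiers are
  null.\<close>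

lemma fundamental_lemma:
  fixes f :: "real^'d \<Rightarrow> complex"
  assumes "open \<Omega>" and f: "locally_integrable \<Omega> f"
    and z: "\<And>\<phi>. test_fun \<Omega> \<phi> \<Longrightarrow> (LINT x|lebesgue_on \<Omega>. \<phi> x *\<^sub>R f x) = 0"
  shows "AE x in lebesgue_on \<Omega>. f x = 0"
proof -
  have O: "\<Omega> \<in> sets lebesgue" using \<open>open \<Omega>\<close> by auto
  have fi: "integrable lebesgue (\<lambda>x. if x \<in> cbox a b then f x else 0)" if "cbox a b \<subseteq> \<Omega>" for a b
    using f that Lebesgue_Measure.integrable_restrict_UNIV[of "cbox a b" f]
    by (auto simp: locally_integrable_def)
  have bx: "(\<integral>x. indicator (box a b) x *\<^sub>R f x \<partial>lebesgue) = 0" if ab: "cbox a b \<subseteq> \<Omega>" for a b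
  proof -
    let ?F = "\<lambda>x. if x \<in> cbox a b then f x else 0"
    have [measurable]: "?F \<in> borel_measurable lebesgue" using fi[OF ab] by (rule borel_measurable_integrable)
    have mb[measurable]: "box_bump a b c \<in> borel_measurable lebesgue" for c
    proof -
      have "continuous_on UNIV (box_bump a b c)" using Ck_on_continuous[OF open_UNIV Ck_box_bump[of 0]] .
      then show ?thesis by (intro measurable_completion) (simp add: borel_measurable_continuous_onI)
    qed
    have "(\<lambda>n. \<integral>x. box_bump a b (real (Suc n)) x *\<^sub>R ?F x \<partial>lebesgue) \<longlonglongrightarrow> (\<integral>x. indicator (box a b) x *\<^sub>R ?F x \<partial>lebesgue)"
    proof (rule integral_dominated_convergence)
      show "integrable lebesgue (\<lambda>x. norm (?F x))" using fi[OF ab] by auto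
      show "AE x in lebesgue. (\<lambda>n. box_bump a b (real (Suc n)) x *\<^sub>R ?F x) \<longlonglongrightarrow> indicator (box a b) x *\<^sub>R ?F x"
        by (intro AE_I2 tendsto_intros LIMSEQ_Suc box_bump_tendsto)
      have "box a b \<in> sets lebesgue" by simp
      then show "(\<lambda>x. indicator (box a b) x *\<^sub>R ?F x) \<in> borel_measurable lebesgue" by measurable
      show "AE x in lebesgue. norm (box_bump a b (real (Suc n)) x *\<^sub>R ?F x) \<le> norm (?F x)" for n
        by (auto simp: abs_of_nonneg box_bump_nonneg intro!: mult_left_le_one_le box_bump_le_1)
      show "(\<lambda>x. box_bump a b (real (Suc n)) x *\<^sub>R ?F x) \<in> borel_measurable lebesgue" for n
        using mb by measurable
    qed
    moreover have "(\<integral>x. box_bump a b (real (Suc n)) x *\<^sub>R ?F x \<partial>lebesgue) = 0" for n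
    proof -
      have "0 = (LINT x|lebesgue_on \<Omega>. box_bump a b (real (Suc n)) x *\<^sub>R f x)"
        using z[OF test_fun_box_bump[OF _ ab, of "real (Suc n)"]] by simp
      also have "\<dots> = (\<integral>x. (if x \<in> \<Omega> then box_bump a b (real (Suc n)) x *\<^sub>R f x else 0) \<partial>lebesgue)"
        using O by (simp add: Lebesgue_Measure.integral_restrict_UNIV)
      also have "\<dots> = (\<integral>x. box_bump a b (real (Suc n)) x *\<^sub>R ?F x \<partial>lebesgue)"
        using ab box_bump_outside[of "real (Suc n)" _ a b] box_subset_cbox[of a b]
        by (intro Bochner_Integration.integral_cong) auto
      finally show ?thesis by simp
    qed
    ultimately have "(\<integral>x. indicator (box a b) x *\<^sub>R ?F x \<partial>lebesgue) = 0" by (simp add: LIMSEQ_const_iff)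
    also have "(\<integral>x. indicator (box a b) x *\<^sub>R ?F x \<partial>lebesgue) = (\<integral>x. indicator (box a b) x *\<^sub>R f x \<partial>lebesgue)"
      using box_subset_cbox[of a b] by (intro Bochner_Integration.integral_cong) (auto simp: indicator_def)
    finally show ?thesis .
  qed
  have loc: "AE x in lebesgue. x \<in> box c d \<longrightarrow> f x = 0" if cd: "cbox c d \<subseteq> \<Omega>" for c d
  proof -
    let ?F = "\<lambda>x. indicator (box c d) x *\<^sub>R (if x \<in> cbox c d then f x else 0)"
    have "AE x in lebesgue. ?F x = 0"
    proof (rule AE_zero_of_box_integrals)
      show "integrable lebesgue ?F" by (rule integrable_mult_indicator[OF _ fi[OF cd]]) simp
      have e: "?F = (\<lambda>x. indicator (box c d) x *\<^sub>R f x)"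
      proof
        fix x show "?F x = indicator (box c d) x *\<^sub>R f x"
          using box_subset_cbox[of c d] by (cases "x \<in> box c d") auto
      qed
      show "integral\<^sup>L lebesgue ?F = 0" unfolding e by (rule bx[OF cd])
      fix a b
      define a' where "a' = (\<chi> i. max (a $ i) (c $ i))"
      define b' where "b' = (\<chi> i. min (b $ i) (d $ i))"
      have "box a b \<inter> box c d = box a' b'" "cbox a' b' \<subseteq> cbox c d"
        by (auto simp: mem_box_cart a'_def b'_def)
      then have "(\<integral>x\<in>box a b. ?F x \<partial>lebesgue) = (\<integral>x. indicator (box a' b') x *\<^sub>R f x \<partial>lebesgue)"
        unfolding set_lebesgue_integral_def e
        by (intro Bochner_Integration.integral_cong) (auto simp: indicator_def set_eq_iff)
      then show "(\<integral>x\<in>box a b. ?F x \<partial>lebesgue) = 0" using bx[of a' b'] \<open>cbox a' b' \<subseteq> cbox c d\<close> cd by auto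
    qed
    then show ?thesis
      by eventually_elim (use box_subset_cbox[of c d] in \<open>auto simp: indicator_def split: if_splits\<close>)
  qed
  obtain \<D> where D: "countable \<D>" "\<D> \<subseteq> Pow \<Omega>" "\<And>X. X \<in> \<D> \<Longrightarrow> \<exists>a b. X = cbox a b" "\<Union>\<D> = \<Omega>"
    by (rule open_countable_Union_open_cbox[OF \<open>open \<Omega>\<close>]) (erule that)
  have "AE x in lebesgue. \<forall>X\<in>\<D>. x \<in> X \<longrightarrow> f x = 0"
  proof (subst AE_ball_countable[OF D(1)], intro ballI)
    fix X assume "X \<in> \<D>"
    with D obtain c d where X: "X = cbox c d" "cbox c d \<subseteq> \<Omega>" by blast
    have "AE x in lebesgue. x \<notin> cbox c d - box c d"
      by (intro AE_not_in) (use negligible_frontier_interval[of c d] in \<open>simp add: negligible_iff_null_sets\<close>)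
    with loc[OF X(2)] show "AE x in lebesgue. x \<in> X \<longrightarrow> f x = 0" by eventually_elim (use X in auto)
  qed
  then have "AE x in lebesgue. x \<in> \<Omega> \<longrightarrow> f x = 0" by eventually_elim (use D(4) in blast)
  then show ?thesis using O by (simp add: AE_restrict_space_iff)
qed

subsection \<open>Translation and integrals of partial derivatives\<close>

lemma integrable_lborel_compact_support:
  fixes h :: "real^'d \<Rightarrow> 'b::euclidean_space"
  assumes "continuous_on UNIV h" "compact K" "\<And>x. x \<notin> K \<Longrightarrow> h x = 0"
  shows "integrable lborel h"
proof -
  have "integrable lborel (\<lambda>x. indicator K x *\<^sub>R h x)"
    by (rule borel_integrable_compact[OF assms(2)]) (rule continuous_on_subset[OF assms(1)], simp)
  moreover have "(\<lambda>x. indicator K x *\<^sub>R h x) = h" using assms(3) by (auto simp: indicator_def)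
  ultimately show ?thesis by simp
qed

lemma integral_lborel_shift:
  fixes h :: "'a::euclidean_space \<Rightarrow> 'b::euclidean_space"
  assumes "h \<in> borel_measurable borel"
  shows "(LBINT x. h (c + x)) = (LBINT x. h x)"
proof -
  have "(LBINT x. h x) = (\<integral>x. h x \<partial>distr lborel borel ((+) c))" by (simp add: lborel_distr_plus)
  also have "\<dots> = (LBINT x. h (c + x))" by (rule integral_distr) (use assms in auto)
  finally show ?thesis by simp
qed

lemma has_vector_derivative_along_axis:
  assumes "(H has_derivative H') (at (x + s *\<^sub>R axis j 1))"
  shows "((\<lambda>r. H (x + r *\<^sub>R axis j 1)) has_vector_derivative partial j H (x + s *\<^sub>R axis j 1)) (at s)"
proof -
  interpret bounded_linear H' using assms by (rule has_derivative_bounded_linear)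
  have "((\<lambda>r. H (x + r *\<^sub>R axis j 1)) has_derivative (\<lambda>r. H' (r *\<^sub>R axis j 1))) (at s)"
    by (rule has_derivative_compose[of "\<lambda>r. x + r *\<^sub>R axis j 1", OF _ assms])
       (auto intro!: derivative_eq_intros)
  then show ?thesis by (simp add: has_vector_derivative_def scaleR partial_eq[OF assms])
qed

text \<open>The difference quotients in direction j have integral 0 by translation invariance. They
  converge dominatedly to the partial derivative: the mean value estimate bounds them by
  \<open>M\<close>, and all of them live on one compact set.\<close>

lemma integral_partial_eq_0:
  fixes H :: "real^'d \<Rightarrow> 'b::euclidean_space"
  assumes H: "\<And>x. H differentiable (at x)" and c: "continuous_on UNIV (partial j H)"
    and K: "compact K" "\<And>x. x \<notin> K \<Longrightarrow> H x = 0"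
  shows "(LBINT x. partial j H x) = 0"
proof -
  let ?e = "axis j 1 :: real^'d"
  have ch: "continuous_on UNIV H"
    using H by (auto simp: continuous_on_eq_continuous_at intro: differentiable_imp_continuous_within)
  have [measurable]: "H \<in> borel_measurable borel" "partial j H \<in> borel_measurable borel"
    using ch c by (auto intro: borel_measurable_continuous_onI)
  have pz: "partial j H x = 0" if "x \<notin> K" for x
  proof -
    have "(H has_derivative (\<lambda>_. 0)) (at x)"
    proof (rule has_derivative_transform_within_open[of "\<lambda>_. 0" "\<lambda>_. 0" x UNIV "- K"])
      show "open (- K)" using K(1) by (simp add: compact_imp_closed open_Compl)
      show "x \<in> - K" using that by simp
      show "0 = H y" if "y \<in> - K" for y using K(2)[of y] that by simp
    qed simp_all
    from partial_eq[OF this] show ?thesis by simp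
  qed
  obtain M where M: "\<And>x. norm (partial j H x) \<le> M" "M \<ge> 0"
  proof -
    have "bounded (partial j H ` K)"
      by (intro compact_imp_bounded compact_continuous_image K(1) continuous_on_subset[OF c]) auto
    then obtain M where "\<And>x. x \<in> K \<Longrightarrow> norm (partial j H x) \<le> M" "M > 0" by (auto simp: bounded_pos)
    then show ?thesis using pz by (intro that[of M]) (metis norm_zero less_imp_le, simp)
  qed
  \<comment> \<open>\<open>K\<close> smeared along the axis by all shifts of length at most 1; it
    contains the supports of all difference quotients with step 1/(n+1).\<close>
  define K' where "K' = (\<lambda>(x, r). x - r *\<^sub>R ?e) ` (K \<times> {0..1})"
  have K': "compact K'"
    unfolding K'_def by (intro compact_continuous_image compact_Times K(1)) (auto intro!: continuous_intros simp: case_prod_unfold)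
  have KK': "K \<subseteq> K'" unfolding K'_def by force
  define D where "D n x = real (Suc n) *\<^sub>R (H ((1 / real (Suc n)) *\<^sub>R ?e + x) - H x)" for n x
  have D0: "(LBINT x. D n x) = 0" for n
  proof -
    have 1: "integrable lborel H" by (rule integrable_lborel_compact_support[OF ch K])
    have 2: "integrable lborel (\<lambda>x. H ((1 / real (Suc n)) *\<^sub>R ?e + x))"
    proof (rule integrable_lborel_compact_support[OF _ K'])
      show "continuous_on UNIV (\<lambda>x. H ((1 / real (Suc n)) *\<^sub>R ?e + x))"
        by (intro continuous_on_compose2[OF ch] continuous_intros) auto
      fix x assume x: "x \<notin> K'"
      have "(1 / real (Suc n)) *\<^sub>R ?e + x \<notin> K"
      proof
        assume "(1 / real (Suc n)) *\<^sub>R ?e + x \<in> K"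
        then have "(\<lambda>(x, r). x - r *\<^sub>R ?e) ((1 / real (Suc n)) *\<^sub>R ?e + x, 1 / real (Suc n)) \<in> K'"
          unfolding K'_def by (intro imageI) auto
        with x show False by simp
      qed
      then show "H ((1 / real (Suc n)) *\<^sub>R ?e + x) = 0" by (rule K(2))
    qed
    show ?thesis unfolding D_def using 1 2 integral_lborel_shift[of H "(1 / real (Suc n)) *\<^sub>R ?e"]
      by (simp del: of_nat_Suc)
  qed
  have "(\<lambda>n. LBINT x. D n x) \<longlonglongrightarrow> (LBINT x. partial j H x)"
  proof (rule integral_dominated_convergence)
    show "integrable lborel (\<lambda>x. indicator K' x * M)"
      using borel_integrable_compact[OF K', of "\<lambda>_. M"] by simp
    show "AE x in lborel. (\<lambda>n. D n x) \<longlonglongrightarrow> partial j H x"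
    proof (rule AE_I2)
      fix x
      have "((\<lambda>r. H (x + r *\<^sub>R ?e)) has_vector_derivative partial j H (x + 0 *\<^sub>R ?e)) (at 0)"
        using H[of "x + 0 *\<^sub>R ?e"] has_vector_derivative_along_axis[of H _ x 0 j]
        unfolding differentiable_def by blast
      then have "((\<lambda>r. (1 / r) *\<^sub>R (H (x + r *\<^sub>R ?e) - H x)) \<longlongrightarrow> partial j H x) (at 0)"
      proof -
        assume "((\<lambda>r. H (x + r *\<^sub>R ?e)) has_vector_derivative partial j H (x + 0 *\<^sub>R ?e)) (at 0)"
        then have l: "((\<lambda>r. norm (H (x + r *\<^sub>R ?e) - H x - r *\<^sub>R partial j H x) / \<bar>r\<bar>) \<longlongrightarrow> 0) (at 0)"
          by (simp add: has_vector_derivative_def has_derivative_iff_norm)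
        have "((\<lambda>r. norm ((1 / r) *\<^sub>R (H (x + r *\<^sub>R ?e) - H x) - partial j H x)) \<longlongrightarrow> 0) (at 0)"
        proof (rule Lim_transform_eventually[OF l])
          have "norm (H (x + r *\<^sub>R ?e) - H x - r *\<^sub>R partial j H x) / \<bar>r\<bar> = norm ((1 / r) *\<^sub>R (H (x + r *\<^sub>R ?e) - H x) - partial j H x)" if "r \<noteq> 0" for r
          proof -
            have "(1 / r) *\<^sub>R (H (x + r *\<^sub>R ?e) - H x) - partial j H x = (1 / r) *\<^sub>R (H (x + r *\<^sub>R ?e) - H x - r *\<^sub>R partial j H x)"
              using that by (simp add: algebra_simps)
            then show ?thesis by simp
          qed
          then show "\<forall>\<^sub>F r in at 0. norm (H (x + r *\<^sub>R ?e) - H x - r *\<^sub>R partial j H x) / \<bar>r\<bar> = norm ((1 / r) *\<^sub>R (H (x + r *\<^sub>R ?e) - H x) - partial j H x)"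
            by (auto simp: eventually_at_filter)
        qed
        then show ?thesis by (rule LIM_zero_cancel[OF tendsto_norm_zero_cancel])
      qed
      moreover have "filterlim (\<lambda>n. 1 / real (Suc n)) (at 0) sequentially"
        by (intro filterlim_atI LIMSEQ_Suc lim_1_over_n) auto
      ultimately have "(\<lambda>n. (1 / (1 / real (Suc n))) *\<^sub>R (H (x + (1 / real (Suc n)) *\<^sub>R ?e) - H x)) \<longlonglongrightarrow> partial j H x"
        by (rule filterlim_compose)
      then show "(\<lambda>n. D n x) \<longlonglongrightarrow> partial j H x" by (simp add: D_def add.commute)
    qed
    show "AE x in lborel. norm (D n x) \<le> indicator K' x * M" for n
    proof (rule AE_I2)
      fix x
      let ?s = "1 / real (Suc n)"
      show "norm (D n x) \<le> indicator K' x * M"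
      proof (cases "x \<in> K'")
        case False
        have "(\<lambda>(x, r). x - r *\<^sub>R ?e) (?s *\<^sub>R ?e + x, ?s) \<in> K'" if "?s *\<^sub>R ?e + x \<in> K"
          unfolding K'_def using that by (intro imageI) auto
        then have "?s *\<^sub>R ?e + x \<notin> K" "x \<notin> K" using False KK' by auto
        then show ?thesis using K(2) M(2) False by (simp add: D_def)
      next
        case True
        have "norm (H (x + ?s *\<^sub>R ?e) - H (x + 0 *\<^sub>R ?e)) \<le> M * norm (?s - 0)"
        proof (rule differentiable_bound[of UNIV "\<lambda>r. H (x + r *\<^sub>R ?e)" "\<lambda>s r. r *\<^sub>R partial j H (x + s *\<^sub>R ?e)"])
          fix s :: real
          show "((\<lambda>r. H (x + r *\<^sub>R ?e)) has_derivative (\<lambda>r. r *\<^sub>R partial j H (x + s *\<^sub>R ?e))) (at s within UNIV)"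
            using H[of "x + s *\<^sub>R ?e"] has_vector_derivative_along_axis[of H _ x s j]
            unfolding differentiable_def has_vector_derivative_def by auto
          show "onorm (\<lambda>r. r *\<^sub>R partial j H (x + s *\<^sub>R ?e)) \<le> M"
            by (rule onorm_bound) (simp_all add: M mult.commute[of M] mult_left_mono)
        qed auto
        then have "norm (H (?s *\<^sub>R ?e + x) - H x) \<le> M * ?s" by (simp add: add.commute)
        then have "real (Suc n) * norm (H (?s *\<^sub>R ?e + x) - H x) \<le> real (Suc n) * (M * ?s)"
          by (intro mult_left_mono) auto
        moreover have "real (Suc n) * (M * ?s) = M" by simp
        moreover have "norm (D n x) = real (Suc n) * norm (H (?s *\<^sub>R ?e + x) - H x)"
          unfolding D_def norm_scaleR by simp
        ultimately show ?thesis using True by (simp del: of_nat_Suc)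
      qed
    qed
    show "D n \<in> borel_measurable lborel" for n unfolding D_def[abs_def] by measurable
  qed auto
  then show ?thesis using D0 by (simp add: LIMSEQ_const_iff)
qed

subsection \<open>Mollification\<close>

lemma has_derivative_eq_sum_partial:
  fixes f :: "real^'d \<Rightarrow> 'b::real_normed_vector"
  assumes "(f has_derivative f') (at x)"
  shows "f' = (\<lambda>v. \<Sum>i\<in>UNIV. (v $ i) *\<^sub>R partial i f x)"
proof
  fix v :: "real^'d"
  interpret bounded_linear f' using assms by (rule has_derivative_bounded_linear)
  have "f' v = f' (\<Sum>i\<in>UNIV. (v $ i) *\<^sub>R axis i 1)"
    using basis_expansion[of v] by (simp add: vector_scalar_mult_def[symmetric] scalar_mult_eq_scaleR)
  then show "f' v = (\<Sum>i\<in>UNIV. (v $ i) *\<^sub>R partial i f x)" by (simp add: sum scaleR partial_eq[OF assms])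
qed

text \<open>Differentiation under the integral puts the derivative on \<beta>, so h is only asked to
  be continuous. The box of integration is fixed and compact to fit the Leibniz rule, whose
  derivative is assembled from its coordinates as a bounded linear map.\<close>

lemma convolution_has_derivative:
  fixes h \<beta> :: "real^'d \<Rightarrow> real"
  assumes h: "continuous_on UNIV h" and b: "Ck_on (Suc 0) UNIV \<beta>"
  shows "((\<lambda>x. integral (cbox p q) (\<lambda>y. h y * \<beta> (x - y))) has_derivative
     (\<lambda>v. \<Sum>i\<in>UNIV. (v $ i) *\<^sub>R integral (cbox p q) (\<lambda>y. h y * partial i \<beta> (x - y)))) (at x)"
proof -
  define B where "B i = Blinfun (\<lambda>v::real^'d. v $ i)" for i
  have B: "blinfun_apply (B i) v = v $ i" for i v
    unfolding B_def by (simp add: bounded_linear_Blinfun_apply bounded_linear_vec_nth)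
  define fx where "fx x y = (\<Sum>i\<in>UNIV. (h y * partial i \<beta> (x - y)) *\<^sub>R B i)" for x y
  have bd: "\<beta> differentiable at x" for x using b by (auto simp: differentiable_on_def)
  have cb: "continuous_on UNIV \<beta>"
    using bd by (auto simp: continuous_on_eq_continuous_at intro: differentiable_imp_continuous_within)
  have cp: "continuous_on UNIV (partial i \<beta>)" for i using b by simp
  have cfx: "continuous_on (UNIV \<times> cbox p q) (\<lambda>(x, y). fx x y)" unfolding fx_def case_prod_unfold
    by (intro continuous_intros continuous_on_compose2[OF cp] continuous_on_compose2[OF h]) auto
  have "((\<lambda>x. integral (cbox p q) (\<lambda>y. h y * \<beta> (x - y))) has_derivative
     blinfun_apply (integral (cbox p q) (fx x))) (at x within UNIV)"
  proof (rule leibniz_rule[OF _ _ cfx])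
    fix x y
    obtain b' where b': "(\<beta> has_derivative b') (at (x - y))" using bd unfolding differentiable_def by blast
    have "((\<lambda>x. h y * \<beta> (x - y)) has_derivative (\<lambda>v. h y * b' v)) (at x)"
      by (intro has_derivative_mult_right has_derivative_compose[of "\<lambda>x. x - y", OF _ b'])
         (auto intro!: derivative_eq_intros)
    moreover have "(\<lambda>v. h y * b' v) = blinfun_apply (fx x y)"
      by (auto simp: fx_def blinfun.sum_left blinfun.scaleR_left B has_derivative_eq_sum_partial[OF b'] sum_distrib_left mult_ac)
    ultimately show "((\<lambda>x. h y * \<beta> (x - y)) has_derivative blinfun_apply (fx x y)) (at x within UNIV)" by simp
  next
    fix x
    show "(\<lambda>y. h y * \<beta> (x - y)) integrable_on cbox p q"
      by (intro integrable_continuous continuous_intros continuous_on_compose2[OF cb] continuous_on_subset[OF h]) auto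
  qed auto
  moreover have "blinfun_apply (integral (cbox p q) (fx x)) =
     (\<lambda>v. \<Sum>i\<in>UNIV. (v $ i) *\<^sub>R integral (cbox p q) (\<lambda>y. h y * partial i \<beta> (x - y)))"
  proof
    fix v
    have "fx x integrable_on cbox p q"
      by (rule integrable_continuous) (rule continuous_on_compose2[OF cfx, of _ "\<lambda>y. (x, y)", simplified], auto intro!: continuous_intros)
    then have "blinfun_apply (integral (cbox p q) (fx x)) v = integral (cbox p q) (\<lambda>y. blinfun_apply (fx x y) v)"
      by (rule blinfun_apply_integral)
    also have "\<dots> = integral (cbox p q) (\<lambda>y. \<Sum>i\<in>UNIV. (v $ i) *\<^sub>R (h y * partial i \<beta> (x - y)))"
      by (simp add: fx_def blinfun.sum_left blinfun.scaleR_left B mult_ac)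
    also have "\<dots> = (\<Sum>i\<in>UNIV. integral (cbox p q) (\<lambda>y. (v $ i) *\<^sub>R (h y * partial i \<beta> (x - y))))"
      by (intro integral_sum integrable_continuous continuous_intros continuous_on_compose2[OF cp] continuous_on_subset[OF h]) auto
    finally show "blinfun_apply (integral (cbox p q) (fx x)) v = (\<Sum>i\<in>UNIV. (v $ i) *\<^sub>R integral (cbox p q) (\<lambda>y. h y * partial i \<beta> (x - y)))"
      by simp
  qed
  ultimately show ?thesis by simp
qed

lemma Ck_convolution:
  fixes h \<beta> :: "real^'d \<Rightarrow> real"
  assumes h: "continuous_on UNIV h" and b: "\<And>k. Ck_on k UNIV \<beta>"
  shows "Ck_on k UNIV (\<lambda>x. integral (cbox p q) (\<lambda>y. h y * \<beta> (x - y)))"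
  using b
proof (induction k arbitrary: \<beta>)
  case 0
  show ?case using convolution_has_derivative[OF h 0]
    by (auto simp: continuous_on_eq_continuous_at intro: has_derivative_continuous)
next
  case (Suc k)
  show ?case
  proof (rule Ck_UNIV_Suc_I[OF convolution_has_derivative[OF h Suc.prems]])
    fix i
    have "Ck_on k UNIV (\<lambda>x. integral (cbox p q) (\<lambda>y. h y * partial i \<beta> (x - y)))"
      by (rule Suc.IH) (metis Suc.prems Ck_on.simps(2))
    moreover have "(\<lambda>x. \<Sum>j\<in>UNIV. axis i 1 $ j *\<^sub>R integral (cbox p q) (\<lambda>y. h y * partial j \<beta> (x - y)))
        = (\<lambda>x. integral (cbox p q) (\<lambda>y. h y * partial i \<beta> (x - y)))"
      by (auto simp: axis_def if_distrib[of "\<lambda>r. r * _"] sum.delta cong: if_cong)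
    ultimately show "Ck_on k UNIV (\<lambda>x. \<Sum>j\<in>UNIV. axis i 1 $ j *\<^sub>R integral (cbox p q) (\<lambda>y. h y * partial j \<beta> (x - y)))"
      by simp
  qed
qed

definition cube_bump :: "real \<Rightarrow> real^'d \<Rightarrow> real" where
  "cube_bump e = box_bump (\<chi> i. - e) (\<chi> i. e) 1"

text \<open>Convolution with the bump of a cube of half side e, divided by its total mass; the
  division makes the value at x a weighted mean of values of k near x.\<close>

definition smoothing :: "real \<Rightarrow> (real^'d \<Rightarrow> real) \<Rightarrow> real^'d \<Rightarrow> real" where
  "smoothing e k x = (LBINT y. k y * cube_bump e (x - y)) / (LBINT y. cube_bump e (y::real^'d))"

lemma cube_bump_minus: "cube_bump e (- x) = cube_bump e x"
  by (simp add: cube_bump_def box_bump_def mult.commute)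

lemma cube_bump_nonneg: "0 \<le> cube_bump e x"
  by (simp add: cube_bump_def box_bump_nonneg)

lemma Ck_cube_bump: "Ck_on k UNIV (cube_bump e)"
  by (simp add: cube_bump_def Ck_box_bump)

lemma continuous_cube_bump: "continuous_on UNIV (cube_bump e)"
  using Ck_on_continuous[OF open_UNIV Ck_cube_bump[of 0]] .

text \<open>The support is a cube, and the Euclidean norm is at most the sum of the moduli of the
  coordinates; hence the factor \<open>CARD('d)\<close> in all later radii.\<close>

lemma cube_bump_support:
  fixes x :: "real^'d"
  assumes "cube_bump e x \<noteq> 0"
  shows "norm x \<le> real CARD('d) * e"
proof -
  have "x \<in> box (\<chi> i. - e) (\<chi> i. e)"
    using assms box_bump_outside[of 1 x "\<chi> i. - e" "\<chi> i. e"] by (auto simp: cube_bump_def)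
  then have "\<bar>x $ i\<bar> \<le> e" for i by (auto simp: mem_box_cart abs_le_iff less_imp_le minus_le_iff)
  then have "(\<Sum>i\<in>UNIV. \<bar>x $ i\<bar>) \<le> (\<Sum>i\<in>(UNIV::'d set). e)" by (intro sum_mono)
  then show ?thesis using norm_le_l1_cart[of x] by simp
qed

lemma integrable_times_cube_bump:
  fixes f :: "real^'d \<Rightarrow> real"
  assumes "continuous_on UNIV f"
  shows "integrable lborel (\<lambda>y. f y * cube_bump e (x - y))"
proof (rule integrable_lborel_compact_support)
  show "continuous_on UNIV (\<lambda>y. f y * cube_bump e (x - y))"
    by (intro continuous_intros assms continuous_on_compose2[OF continuous_cube_bump]) auto
  show "compact (cball x (real CARD('d) * e))" by simp
  show "f y * cube_bump e (x - y) = 0" if "y \<notin> cball x (real CARD('d) * e)" for y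
    using that cube_bump_support[of e "x - y"] by (auto simp: dist_norm)
qed

lemma integral_cube_bump_shift:
  fixes x :: "real^'d"
  shows "(LBINT y. cube_bump e (x - y)) = (LBINT y. cube_bump e (y::real^'d))"
proof -
  have "cube_bump e (x - y) = cube_bump e (- x + y)" for y using cube_bump_minus[of e "x - y"] by simp
  then have "(LBINT y. cube_bump e (x - y)) = (LBINT y. cube_bump e (- x + y))" by simp
  also have "\<dots> = (LBINT y. cube_bump e (y::real^'d))"
    using integral_lborel_shift[OF borel_measurable_continuous_onI[OF continuous_cube_bump], of e "- x"] by simp
  finally show ?thesis .
qed

text \<open>A vanishing integral of the nonnegative bump would make the nonempty open cube
  negligible.\<close>

lemma integral_cube_bump_pos:
  assumes "e > 0"
  shows "(LBINT y. cube_bump e (y::real^'d)) > 0"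
proof -
  have i: "integrable lborel (cube_bump e :: real^'d \<Rightarrow> real)"
    using integrable_times_cube_bump[of "\<lambda>_. 1" e 0] by (simp add: cube_bump_minus)
  have "(LBINT y. cube_bump e (y::real^'d)) \<noteq> 0"
  proof
    assume "(LBINT y. cube_bump e (y::real^'d)) = 0"
    then have "AE y::real^'d in lborel. cube_bump e y = 0"
      using integral_nonneg_eq_0_iff_AE[OF i] by (simp add: cube_bump_nonneg)
    then have ae: "AE y::real^'d in lborel. y \<notin> box (\<chi> i. - e) (\<chi> i. e)"
      by eventually_elim (use box_bump_pos[of 1] in \<open>force simp: cube_bump_def\<close>)
    then have "AE y::real^'d in lebesgue. y \<notin> box (\<chi> i. - e) (\<chi> i. e)" by (rule AE_completion)
    then have "negligible (box (\<chi> i. - e) (\<chi> i. e) :: (real^'d) set)"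
      by (subst (asm) AE_iff_null_sets[symmetric]) (auto simp: negligible_iff_null_sets)
    moreover have "0 \<in> (box (\<chi> i. - e) (\<chi> i. e) :: (real^'d) set)"
      using assms by (simp add: mem_box_cart)
    ultimately show False using open_not_negligible[OF open_box] by blast
  qed
  moreover have "(LBINT y. cube_bump e (y::real^'d)) \<ge> 0"
    by (intro Bochner_Integration.integral_nonneg cube_bump_nonneg)
  ultimately show ?thesis by linarith
qed

text \<open>A weighted mean of numbers within \<delta> of z is itself within \<delta> of z. This one
  estimate yields both the uniform bound and the pointwise convergence of mollifications.\<close>

lemma smoothing_close:
  fixes k :: "real^'d \<Rightarrow> real"
  assumes k: "continuous_on UNIV k" and e: "e > 0"
    and d: "\<And>y. cube_bump e (x - y) \<noteq> 0 \<Longrightarrow> \<bar>k y - z\<bar> \<le> \<delta>"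
  shows "\<bar>smoothing e k x - z\<bar> \<le> \<delta>"
proof -
  let ?c = "LBINT y. cube_bump e (y::real^'d)"
  note c = integral_cube_bump_pos[OF e, where 'd = 'd]
  have i: "integrable lborel (\<lambda>y. k y * cube_bump e (x - y))" "integrable lborel (\<lambda>y. z * cube_bump e (x - y))"
     "integrable lborel (\<lambda>y. \<delta> * cube_bump e (x - y))" "integrable lborel (\<lambda>y. (k y - z) * cube_bump e (x - y))"
    by (intro integrable_times_cube_bump k continuous_intros)+
  have "smoothing e k x - z = (LBINT y. k y * cube_bump e (x - y)) / ?c - (LBINT y. z * cube_bump e (x - y)) / ?c"
    using c by (simp add: smoothing_def integral_cube_bump_shift)
  also have "\<dots> = (LBINT y. (k y - z) * cube_bump e (x - y)) / ?c"
    unfolding left_diff_distrib Bochner_Integration.integral_diff[OF i(1,2)] by (simp add: diff_divide_distrib)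
  finally have "\<bar>smoothing e k x - z\<bar> = \<bar>LBINT y. (k y - z) * cube_bump e (x - y)\<bar> / ?c" using c by simp
  also have "\<bar>LBINT y. (k y - z) * cube_bump e (x - y)\<bar> \<le> (LBINT y. \<bar>(k y - z) * cube_bump e (x - y)\<bar>)"
    by (rule integral_abs_bound)
  also have "\<dots> \<le> (LBINT y. \<delta> * cube_bump e (x - y))"
  proof (rule integral_mono)
    show "integrable lborel (\<lambda>y. \<bar>(k y - z) * cube_bump e (x - y)\<bar>)" using i(4) by simp
    show "\<bar>(k y - z) * cube_bump e (x - y)\<bar> \<le> \<delta> * cube_bump e (x - y)" for y
      using d[of y] cube_bump_nonneg[of e "x - y"] by (cases "cube_bump e (x - y) = 0") (auto simp: abs_mult intro: mult_right_mono)
  qed (rule i)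
  also have "\<dots> = \<delta> * ?c" by (simp add: integral_cube_bump_shift)
  finally show ?thesis using c by (simp add: divide_right_mono)
qed

lemma smoothing_bound:
  fixes k :: "real^'d \<Rightarrow> real"
  assumes "continuous_on UNIV k" "e > 0" "\<And>y. \<bar>k y\<bar> \<le> M"
  shows "\<bar>smoothing e k x\<bar> \<le> M"
  using smoothing_close[of k e x 0 M] assms by simp

lemma smoothing_tendsto:
  fixes k :: "real^'d \<Rightarrow> real"
  assumes k: "continuous_on UNIV k" and e: "\<And>n. e n > 0" "e \<longlonglongrightarrow> 0"
  shows "(\<lambda>n. smoothing (e n) k x) \<longlonglongrightarrow> k x"
proof (rule LIMSEQ_I)
  fix r :: real assume r: "r > 0"
  have "isCont k x" using k by (simp add: continuous_on_eq_continuous_at)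
  then obtain s where s: "s > 0" "\<And>y. dist y x < s \<Longrightarrow> dist (k y) (k x) < r/2"
    using r unfolding continuous_at_eps_delta by (metis half_gt_zero)
  have "(\<lambda>n. real CARD('d) * e n) \<longlonglongrightarrow> real CARD('d) * 0" by (intro tendsto_intros e)
  then have "eventually (\<lambda>n. real CARD('d) * e n < s) sequentially"
    by (rule order_tendstoD) (use s in simp)
  then obtain N where N: "\<And>n. n \<ge> N \<Longrightarrow> real CARD('d) * e n < s" by (auto simp: eventually_sequentially)
  have "norm (smoothing (e n) k x - k x) \<le> r/2" if "n \<ge> N" for n unfolding real_norm_def
  proof (rule smoothing_close[OF k e(1)])
    fix y assume "cube_bump (e n) (x - y) \<noteq> 0"
    from cube_bump_support[OF this] N[OF that] have "dist y x < s" by (simp add: dist_norm norm_minus_commute)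
    from s(2)[OF this] show "\<bar>k y - k x\<bar> \<le> r/2" by (simp add: dist_real_def)
  qed
  then show "\<exists>no. \<forall>n\<ge>no. norm (smoothing (e n) k x - k x) < r"
    using r by (metis half_gt_zero_iff less_le_trans linorder_not_less field_sum_of_halves less_add_same_cancel1 order.strict_trans1)
qed

lemma smoothing_support:
  fixes x :: "real^'d"
  assumes "smoothing e k x \<noteq> 0"
  shows "\<exists>y. k y \<noteq> 0 \<and> norm (x - y) \<le> real CARD('d) * e"
proof (rule ccontr)
  assume "\<not> ?thesis"
  then have "k y * cube_bump e (x - y) = 0" for y using cube_bump_support[of e "x - y"] by auto
  then have "smoothing e k x = 0" unfolding smoothing_def by (simp only: Bochner_Integration.integral_zero div_0)
  then show False using assms by simp
qed

lemma partial_support: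
  assumes "closed K" "\<And>x. x \<notin> K \<Longrightarrow> H x = 0" "x \<notin> K"
  shows "partial j H x = 0"
proof -
  have "(H has_derivative (\<lambda>_. 0)) (at x)"
  proof (rule has_derivative_transform_within_open[of "\<lambda>_. 0" "\<lambda>_. 0" x UNIV "- K"])
    show "open (- K)" using assms(1) by (simp add: open_Compl)
    show "x \<in> - K" using assms(3) by simp
    show "0 = H y" if "y \<in> - K" for y using assms(2)[of y] that by simp
  qed simp_all
  from partial_eq[OF this] show ?thesis by simp
qed

text \<open>Links the gauge integral over a box, which can be differentiated by the Leibniz rule,
  with the Lebesgue integral over the whole space in \<open>smoothing\<close>.\<close>

lemma smoothing_eq_convolution:
  fixes h :: "real^'d \<Rightarrow> real"
  assumes h: "continuous_on UNIV h" and K: "\<And>x. x \<notin> cbox p q \<Longrightarrow> h x = 0" and b: "continuous_on UNIV \<beta>"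
  shows "integral (cbox p q) (\<lambda>y. h y * \<beta> (x - y)) = (LBINT y. h y * \<beta> (x - y))"
proof -
  have "integral (cbox p q) (\<lambda>y. h y * \<beta> (x - y)) = integral UNIV (\<lambda>y. if y \<in> cbox p q then h y * \<beta> (x - y) else 0)"
    by (simp add: integral_restrict_UNIV)
  also have "(\<lambda>y. if y \<in> cbox p q then h y * \<beta> (x - y) else 0) = (\<lambda>y. h y * \<beta> (x - y))" using K by auto
  also have "integral UNIV (\<lambda>y. h y * \<beta> (x - y)) = (LBINT y. h y * \<beta> (x - y))"
  proof (intro integral_lborel integrable_lborel_compact_support[of _ "cbox p q"])
    show "continuous_on UNIV (\<lambda>y. h y * \<beta> (x - y))"
      by (intro continuous_intros h continuous_on_compose2[OF b]) auto
  qed (use K in auto)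
  finally show ?thesis .
qed

lemma smoothing_smooth:
  fixes h :: "real^'d \<Rightarrow> real"
  assumes h: "continuous_on UNIV h" and K: "compact K" "\<And>x. x \<notin> K \<Longrightarrow> h x = 0"
  shows "Ck_on k UNIV (smoothing e h)"
proof -
  obtain p where p: "K \<subseteq> cbox (-p) p"
    using bounded_subset_cbox_symmetric[OF compact_imp_bounded[OF K(1)]] by blast
  then have hz: "\<And>x. x \<notin> cbox (-p) p \<Longrightarrow> h x = 0" using K(2) by blast
  have "smoothing e h = (\<lambda>x. (1 / (LBINT y. cube_bump e (y::real^'d))) * integral (cbox (-p) p) (\<lambda>y. h y * cube_bump e (x - y)))"
    using smoothing_eq_convolution[OF h hz continuous_cube_bump] unfolding smoothing_def
    by (auto simp: fun_eq_iff)
  then show ?thesis by (simp only: Ck_mult[OF Ck_const Ck_convolution[OF h Ck_cube_bump]])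
qed

text \<open>The derivative of the convolution first falls on the bump. The product of h with the
  reflected bump has a partial derivative with integral 0, and this moves the derivative over to
  h.\<close>

lemma partial_smoothing:
  fixes h :: "real^'d \<Rightarrow> real"
  assumes d: "\<And>x. h differentiable (at x)" and c: "continuous_on UNIV (partial j h)"
    and K: "compact K" "\<And>x. x \<notin> K \<Longrightarrow> h x = 0"
  shows "partial j (smoothing e h) = smoothing e (partial j h)"
proof
  fix x
  let ?b = "cube_bump e" and ?c = "(LBINT y. cube_bump e (y::real^'d))"
  have h: "continuous_on UNIV h"
    using d by (auto simp: continuous_on_eq_continuous_at intro: differentiable_imp_continuous_within)
  obtain p where p: "K \<subseteq> cbox (-p) p"
    using bounded_subset_cbox_symmetric[OF compact_imp_bounded[OF K(1)]] by blast
  then have hz: "\<And>x. x \<notin> cbox (-p) p \<Longrightarrow> h x = 0" using K(2) by blast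
  have sm: "smoothing e h = (\<lambda>x. (1 / ?c) * integral (cbox (-p) p) (\<lambda>y. h y * ?b (x - y)))"
    using smoothing_eq_convolution[OF h hz continuous_cube_bump] unfolding smoothing_def
    by (auto simp: fun_eq_iff)
  have pb: "continuous_on UNIV (partial j ?b)" using Ck_cube_bump[of "Suc 0" e] by (metis Ck_on.simps)
  have "(smoothing e h has_derivative (\<lambda>v. (1 / ?c) * (\<Sum>i\<in>UNIV. (v $ i) *\<^sub>R integral (cbox (-p) p) (\<lambda>y. h y * partial i ?b (x - y))))) (at x)"
    unfolding sm by (intro has_derivative_mult_right convolution_has_derivative[OF h Ck_cube_bump])
  from partial_eq[OF this, of j]
  have "partial j (smoothing e h) x = (1 / ?c) * integral (cbox (-p) p) (\<lambda>y. h y * partial j ?b (x - y))"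
    by (auto simp: axis_def if_distrib[of "\<lambda>r. r * _"] sum.delta cong: if_cong)
  also have "\<dots> = (1 / ?c) * (LBINT y. h y * partial j ?b (x - y))"
    by (simp add: smoothing_eq_convolution[OF h hz pb])
  also have "(LBINT y. h y * partial j ?b (x - y)) = (LBINT y. partial j h y * ?b (x - y))"
  proof -
    let ?H = "\<lambda>y. h y * ?b (x - y)"
    have bd: "?b differentiable (at z)" for z
      using Ck_cube_bump[of "Suc 0" e] by (auto simp: differentiable_on_def)
    have Hd: "(?H has_derivative (\<lambda>v. h y * - frechet_derivative ?b (at (x - y)) v + frechet_derivative h (at y) v * ?b (x - y))) (at y)" for y
    proof -
      have 1: "(h has_derivative frechet_derivative h (at y)) (at y)" using d frechet_derivative_works by blast
      have 2: "(?b has_derivative frechet_derivative ?b (at (x - y))) (at (x - y))" using bd frechet_derivative_works by blast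
      have linear_uminus: "frechet_derivative ?b (at (x - y)) (- v) = - frechet_derivative ?b (at (x - y)) v" for v
        using has_derivative_linear[OF 2] by (rule linear_neg)
      have "((\<lambda>y. ?b (x - y)) has_derivative (\<lambda>v. frechet_derivative ?b (at (x - y)) (- v))) (at y)"
        by (rule has_derivative_compose[of "\<lambda>y. x - y", OF _ 2]) (auto intro!: derivative_eq_intros)
      from has_derivative_mult[OF 1 this] show ?thesis by (simp add: linear_uminus)
    qed
    have pH: "partial j ?H = (\<lambda>y. partial j h y * ?b (x - y) - h y * partial j ?b (x - y))"
      by (auto simp: fun_eq_iff partial_eq[OF Hd]) (simp add: partial_def)
    have i1: "integrable lborel (\<lambda>y. partial j h y * ?b (x - y))" by (rule integrable_times_cube_bump[OF c])
    have i2: "integrable lborel (\<lambda>y. h y * partial j ?b (x - y))"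
      by (rule integrable_lborel_compact_support[OF _ K(1)])
         (auto simp: K(2) intro!: continuous_intros h continuous_on_compose2[OF pb])
    have "(LBINT y. partial j ?H y) = 0"
    proof (rule integral_partial_eq_0[OF _ _ K(1)])
      show "?H differentiable (at y)" for y using Hd unfolding differentiable_def by blast
      show "continuous_on UNIV (partial j ?H)"
        unfolding pH by (intro continuous_intros c h continuous_on_compose2[OF pb] continuous_on_compose2[OF continuous_cube_bump]) auto
    qed (use K in auto)
    then show ?thesis unfolding pH Bochner_Integration.integral_diff[OF i1 i2] by simp
  qed
  finally show "partial j (smoothing e h) x = smoothing e (partial j h) x"
    by (simp add: smoothing_def[of e "partial j h"])
qed

lemma integral_compact_restrict:
  fixes f :: "real^'d \<Rightarrow> complex" and \<phi> :: "real^'d \<Rightarrow> real"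
  assumes "\<Omega> \<in> sets lebesgue" "K \<subseteq> \<Omega>" "\<And>x. x \<notin> K \<Longrightarrow> \<phi> x = 0"
  shows "(LINT x|lebesgue_on \<Omega>. \<phi> x *\<^sub>R f x) = (LINT x|lebesgue. \<phi> x *\<^sub>R (if x \<in> K then f x else 0))"
proof -
  have "(LINT x|lebesgue_on \<Omega>. \<phi> x *\<^sub>R f x) = (LINT x|lebesgue. (if x \<in> \<Omega> then \<phi> x *\<^sub>R f x else 0))"
    using assms(1) by (simp add: Lebesgue_Measure.integral_restrict_UNIV)
  also have "\<dots> = (LINT x|lebesgue. \<phi> x *\<^sub>R (if x \<in> K then f x else 0))"
    using assms(2,3) by (intro Bochner_Integration.integral_cong) auto
  finally show ?thesis .
qed

text \<open>Weak derivatives are tested with smooth functions, but a test function times a C^1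
  coefficient is only C^1. Mollifying h and letting the radius tend to 0 closes the gap; both
  integrals pass to the limit by dominated convergence on a compact set slightly larger than
  K.\<close>

theorem weak_partial_C1_test:
  fixes h :: "real^'d \<Rightarrow> real"
  assumes "open \<Omega>" and w: "has_weak_partial \<Omega> j f g"
    and d: "\<And>x. h differentiable (at x)" and c: "continuous_on UNIV (partial j h)"
    and K: "compact K" "K \<subseteq> \<Omega>" "\<And>x. x \<notin> K \<Longrightarrow> h x = 0"
  shows "(LINT x|lebesgue_on \<Omega>. partial j h x *\<^sub>R f x) = - (LINT x|lebesgue_on \<Omega>. h x *\<^sub>R g x)"
proof (cases "K = {}")
  \<comment> \<open>The separation of K from the complement of \<Omega> used below asks for a
    nonempty set; for empty K the function h is 0.\<close>
  case True
  then have "h = (\<lambda>_. 0)" using K(3) by auto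
  moreover have "partial j (\<lambda>_::real^'d. 0::real) = (\<lambda>_. 0)"
    using partial_eq[OF has_derivative_const] by (auto simp: fun_eq_iff)
  ultimately show ?thesis by simp
next
  case False
  have O: "\<Omega> \<in> sets lebesgue" using \<open>open \<Omega>\<close> by auto
  have h: "continuous_on UNIV h"
    using d by (auto simp: continuous_on_eq_continuous_at intro: differentiable_imp_continuous_within)
  have pz: "\<And>x. x \<notin> K \<Longrightarrow> partial j h x = 0"
    by (rule partial_support[of K h]) (use K in \<open>auto intro: compact_imp_closed\<close>)
  have bnd: "\<exists>M. \<forall>y. \<bar>k y\<bar> \<le> M" if "continuous_on UNIV k" "\<And>x. x \<notin> K \<Longrightarrow> k x = 0" for k :: "real^'d \<Rightarrow> real"
  proof -
    have "bounded (k ` K)"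
      by (intro compact_imp_bounded compact_continuous_image K(1) continuous_on_subset[OF that(1)]) auto
    then obtain M where "\<And>x. x \<in> K \<Longrightarrow> norm (k x) \<le> M" "M > 0" by (auto simp: bounded_pos)
    then show ?thesis using that(2) by (intro exI[of _ M]) (metis abs_zero less_imp_le real_norm_def)
  qed
  obtain \<delta> where \<delta>: "\<delta> > 0" "{x. infdist x K \<le> \<delta>} \<subseteq> \<Omega>"
    by (rule compact_in_open_separated[OF False K(1) \<open>open \<Omega>\<close> K(2)])
  define K' where "K' = {x. infdist x K \<le> \<delta>}"
  have K': "compact K'" "K' \<subseteq> \<Omega>"
    unfolding K'_def using compact_infdist_le[OF False K(1) \<delta>(1)] \<delta>(2) by auto
  \<comment> \<open>The radii are divided by the dimension so that, by
    \<open>cube_bump_support\<close>, every mollification of a function supported in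
    \<open>K\<close> vanishes outside the \<delta>-neighbourhood \<open>K'\<close>.\<close>
  define e where "e n = (\<delta> / real CARD('d)) * (1 / real (Suc n))" for n
  have e0: "e n > 0" for n using \<delta>(1) by (simp add: e_def)
  have e\<delta>: "real CARD('d) * e n \<le> \<delta>" for n
  proof -
    have "real CARD('d) * e n = \<delta> * (1 / real (Suc n))" by (simp add: e_def)
    also have "\<dots> \<le> \<delta> * 1" using \<delta>(1) by (intro mult_left_mono) auto
    finally show ?thesis by simp
  qed
  have elim: "e \<longlonglongrightarrow> 0"
  proof -
    have "(\<lambda>n. (\<delta> / real CARD('d)) * (1 / real (Suc n))) \<longlonglongrightarrow> (\<delta> / real CARD('d)) * 0"
      by (intro tendsto_intros LIMSEQ_Suc lim_1_over_n)
    then show ?thesis by (simp add: e_def[abs_def])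
  qed
  have supp: "smoothing (e n) k x = 0" if "\<And>x. x \<notin> K \<Longrightarrow> k x = 0" "x \<notin> K'" for k n x
  proof (rule ccontr)
    assume "smoothing (e n) k x \<noteq> 0"
    then obtain y where "k y \<noteq> 0" "norm (x - y) \<le> real CARD('d) * e n" using smoothing_support by blast
    with that(1) e\<delta>[of n] have "y \<in> K" "dist x y \<le> \<delta>" by (auto simp: dist_norm)
    then have "infdist x K \<le> \<delta>" by (rule infdist_le2)
    with that(2) show False by (simp add: K'_def)
  qed
  have conv: "(\<lambda>n. (LINT x|lebesgue_on \<Omega>. smoothing (e n) k x *\<^sub>R F x)) \<longlonglongrightarrow> (LINT x|lebesgue_on \<Omega>. k x *\<^sub>R F x)"
    if k: "continuous_on UNIV k" "\<And>x. x \<notin> K \<Longrightarrow> k x = 0" and km: "\<And>n. continuous_on UNIV (smoothing (e n) k)"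
     and F: "locally_integrable \<Omega> F" for k F
  proof -
    let ?F = "\<lambda>x. if x \<in> K' then F x else 0"
    obtain M where M: "\<And>y. \<bar>k y\<bar> \<le> M" using bnd[OF k] by blast
    have Fi: "integrable lebesgue ?F"
      using F K' Lebesgue_Measure.integrable_restrict_UNIV[OF lmeasurable_compact[OF K'(1), THEN fmeasurableD], of F] by (auto simp: locally_integrable_def)
    have mF[measurable]: "?F \<in> borel_measurable lebesgue" using Fi by (rule borel_measurable_integrable)
    have m: "u \<in> borel_measurable lebesgue" if "continuous_on UNIV u" for u :: "real^'d \<Rightarrow> real"
      using that by (intro measurable_completion) (simp add: borel_measurable_continuous_onI)
    have KK': "K \<subseteq> K'" using \<delta>(1) by (auto simp: K'_def)
    have "(\<lambda>n. (LINT x|lebesgue. smoothing (e n) k x *\<^sub>R ?F x)) \<longlonglongrightarrow> (LINT x|lebesgue. k x *\<^sub>R ?F x)"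
    proof (rule integral_dominated_convergence)
      show "integrable lebesgue (\<lambda>x. M * norm (?F x))" using Fi by (intro integrable_mult_right integrable_norm)
      show "(\<lambda>x. k x *\<^sub>R ?F x) \<in> borel_measurable lebesgue" using m[OF k(1)] by measurable
      show "(\<lambda>x. smoothing (e n) k x *\<^sub>R ?F x) \<in> borel_measurable lebesgue" for n using m[OF km] by measurable
      show "AE x in lebesgue. (\<lambda>n. smoothing (e n) k x *\<^sub>R ?F x) \<longlonglongrightarrow> k x *\<^sub>R ?F x"
        by (intro AE_I2 tendsto_intros smoothing_tendsto k(1) e0 elim)
      show "AE x in lebesgue. norm (smoothing (e n) k x *\<^sub>R ?F x) \<le> M * norm (?F x)" for n
        unfolding norm_scaleR by (intro AE_I2 mult_right_mono smoothing_bound k(1) e0 M norm_ge_zero)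
    qed
    moreover have "(LINT x|lebesgue_on \<Omega>. smoothing (e n) k x *\<^sub>R F x) = (LINT x|lebesgue. smoothing (e n) k x *\<^sub>R ?F x)" for n
      by (rule integral_compact_restrict[OF O K'(2)]) (rule supp[OF k(2)])
    moreover have "(LINT x|lebesgue_on \<Omega>. k x *\<^sub>R F x) = (LINT x|lebesgue. k x *\<^sub>R ?F x)"
      by (rule integral_compact_restrict[OF O K'(2)]) (use KK' k(2) in blast)
    ultimately show ?thesis by simp
  qed
  have ck: "Ck_on k UNIV (smoothing (e n) h)" for k n by (rule smoothing_smooth[OF h K(1,3)])
  have ps: "partial j (smoothing (e n) h) = smoothing (e n) (partial j h)" for n
    by (rule partial_smoothing[OF d c K(1,3)])
  have t: "test_fun \<Omega> (smoothing (e n) h)" for n unfolding test_fun_def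
  proof (intro conjI allI ck exI[of _ K'] K' impI)
    show "smoothing (e n) h x = 0" if "x \<notin> K'" for x by (rule supp[OF K(3) that])
  qed
  have eq: "(LINT x|lebesgue_on \<Omega>. smoothing (e n) (partial j h) x *\<^sub>R f x) = - (LINT x|lebesgue_on \<Omega>. smoothing (e n) h x *\<^sub>R g x)" for n
    using w t[of n] unfolding has_weak_partial_def ps[symmetric] by blast
  have "(\<lambda>n. (LINT x|lebesgue_on \<Omega>. smoothing (e n) (partial j h) x *\<^sub>R f x)) \<longlonglongrightarrow> (LINT x|lebesgue_on \<Omega>. partial j h x *\<^sub>R f x)"
  proof (rule conv[OF c pz])
    show "continuous_on UNIV (smoothing (e n) (partial j h))" for n
      using ck[of "Suc 0" n] unfolding ps[symmetric] by simp
  qed (use w in \<open>auto simp: has_weak_partial_def\<close>)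
  moreover have "(\<lambda>n. (LINT x|lebesgue_on \<Omega>. smoothing (e n) h x *\<^sub>R g x)) \<longlonglongrightarrow> (LINT x|lebesgue_on \<Omega>. h x *\<^sub>R g x)"
    by (rule conv[OF h K(3)]) (use w ck[of 0] in \<open>auto simp: has_weak_partial_def\<close>)
  then have "(\<lambda>n. - (LINT x|lebesgue_on \<Omega>. smoothing (e n) h x *\<^sub>R g x)) \<longlonglongrightarrow> - (LINT x|lebesgue_on \<Omega>. h x *\<^sub>R g x)"
    by (rule tendsto_minus)
  ultimately show ?thesis unfolding eq using LIMSEQ_unique by blast
qed

section \<open>Weak derivatives: uniqueness, test functions, product rule\<close>

lemma test_fun_partial:
  assumes "test_fun \<Omega> \<phi>"
  shows "test_fun \<Omega> (partial i \<phi>)"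
proof -
  from assms obtain K where K: "compact K" "K \<subseteq> \<Omega>" "\<And>x. x \<notin> K \<Longrightarrow> \<phi> x = 0" and C: "\<And>k. Ck_on k UNIV \<phi>"
    unfolding test_fun_def by blast
  have "Ck_on k UNIV (partial i \<phi>)" for k using C[of "Suc k"] by simp
  moreover have "partial i \<phi> x = 0" if "x \<notin> K" for x
    by (rule partial_support[of K \<phi>]) (use K that in \<open>auto intro: compact_imp_closed\<close>)
  ultimately show ?thesis unfolding test_fun_def using K by blast
qed

lemma test_fun_continuous: "test_fun \<Omega> \<phi> \<Longrightarrow> continuous_on UNIV \<phi>"
  unfolding test_fun_def using Ck_on_continuous[OF open_UNIV] by blast

lemma test_fun_differentiable: "test_fun \<Omega> \<phi> \<Longrightarrow> \<phi> differentiable (at x)"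
  unfolding test_fun_def by (metis Ck_on.simps(2) UNIV_I differentiable_on_def)

lemma test_fun_linear:
  assumes L: "bounded_linear L" and t: "test_fun \<Omega> \<phi>"
  shows "test_fun \<Omega> (\<lambda>x. L (\<phi> x))" "partial i (\<lambda>x. L (\<phi> x)) = (\<lambda>x. L (partial i \<phi> x))"
proof -
  interpret bounded_linear L by fact
  from t obtain K where K: "compact K" "K \<subseteq> \<Omega>" "\<And>x. x \<notin> K \<Longrightarrow> \<phi> x = 0" and C: "\<And>k. Ck_on k UNIV \<phi>"
    unfolding test_fun_def by blast
  have "L (\<phi> x) = 0" if "x \<notin> K" for x using K(3)[OF that] by (simp add: zero)
  then show "test_fun \<Omega> (\<lambda>x. L (\<phi> x))"
    unfolding test_fun_def using K(1,2) Ck_bounded_linear[OF L C] by blast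
  show "partial i (\<lambda>x. L (\<phi> x)) = (\<lambda>x. L (partial i \<phi> x))"
  proof
    fix x
    have d: "(\<phi> has_derivative frechet_derivative \<phi> (at x)) (at x)"
      using test_fun_differentiable[OF t] frechet_derivative_works by blast
    from partial_eq[OF has_derivative[OF d]] show "partial i (\<lambda>x. L (\<phi> x)) x = L (partial i \<phi> x)"
      by (simp add: partial_def)
  qed
qed

lemma bounded_compact_support:
  fixes \<phi> :: "'a::euclidean_space \<Rightarrow> 'b::real_normed_vector"
  assumes "continuous_on UNIV \<phi>" "compact K" "\<And>x. x \<notin> K \<Longrightarrow> \<phi> x = 0"
  obtains M where "\<And>x. norm (\<phi> x) \<le> M" "M > 0"
proof -
  have "bounded (\<phi> ` K)"
    by (intro compact_imp_bounded compact_continuous_image assms(2) continuous_on_subset[OF assms(1)]) auto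
  then obtain M where M: "\<And>x. x \<in> K \<Longrightarrow> norm (\<phi> x) \<le> M" "M > 0" by (auto simp: bounded_pos)
  have "norm (\<phi> x) \<le> M" for x using M assms(3)[of x] by (cases "x \<in> K") auto
  then show ?thesis using M(2) that by blast
qed

lemma continuous_lebesgue_measurable:
  fixes u :: "'a::euclidean_space \<Rightarrow> 'b::euclidean_space"
  shows "continuous_on UNIV u \<Longrightarrow> u \<in> borel_measurable lebesgue"
  by (intro measurable_completion) (simp add: borel_measurable_continuous_onI)

lemma test_integrable:
  fixes \<phi> :: "real^'d \<Rightarrow> real"
  assumes O: "\<Omega> \<in> sets lebesgue" and t: "test_fun \<Omega> \<phi>" and f: "locally_integrable \<Omega> f"
  shows "integrable (lebesgue_on \<Omega>) (\<lambda>x. \<phi> x *\<^sub>R f x)"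
proof -
  from t obtain K where K: "compact K" "K \<subseteq> \<Omega>" "\<And>x. x \<notin> K \<Longrightarrow> \<phi> x = 0" unfolding test_fun_def by blast
  obtain M where M: "\<And>x. norm (\<phi> x) \<le> M" "M > 0"
    using bounded_compact_support[OF test_fun_continuous[OF t] K(1,3)] by blast
  have Fi: "integrable lebesgue (\<lambda>x. if x \<in> K then f x else 0)"
    using f K Lebesgue_Measure.integrable_restrict_UNIV[OF lmeasurable_compact[OF K(1), THEN fmeasurableD], of f] by (auto simp: locally_integrable_def)
  have [measurable]: "\<phi> \<in> borel_measurable lebesgue" "(\<lambda>x. if x \<in> K then f x else 0) \<in> borel_measurable lebesgue"
    using borel_measurable_integrable[OF Fi] continuous_lebesgue_measurable[OF test_fun_continuous[OF t]] by auto
  have "integrable lebesgue (\<lambda>x. \<phi> x *\<^sub>R (if x \<in> K then f x else 0))"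
  proof (rule Bochner_Integration.integrable_bound)
    show "integrable lebesgue (\<lambda>x. M * norm (if x \<in> K then f x else 0))"
      using Fi by (intro integrable_mult_right integrable_norm)
    show "AE x in lebesgue. norm (\<phi> x *\<^sub>R (if x \<in> K then f x else 0)) \<le> norm (M * norm (if x \<in> K then f x else 0))"
      using M by (intro AE_I2) (auto simp: abs_mult intro!: mult_right_mono)
  qed measurable
  moreover have "(\<lambda>x. \<phi> x *\<^sub>R (if x \<in> K then f x else 0)) = (\<lambda>x. if x \<in> \<Omega> then \<phi> x *\<^sub>R f x else 0)"
    using K(2,3) by (auto simp: fun_eq_iff)
  ultimately show ?thesis using O by (simp add: Lebesgue_Measure.integrable_restrict_UNIV)
qed

lemma locally_integrable_add: "locally_integrable \<Omega> f \<Longrightarrow> locally_integrable \<Omega> g \<Longrightarrow> locally_integrable \<Omega> (\<lambda>x. f x + g x)"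
  unfolding locally_integrable_def by auto

lemma locally_integrable_scaleR: "locally_integrable \<Omega> f \<Longrightarrow> locally_integrable \<Omega> (\<lambda>x. r *\<^sub>R f x)"
  unfolding locally_integrable_def by (auto simp del: scaleR_conv_of_real)

lemma has_weak_partial_lincomb:
  assumes O: "\<Omega> \<in> sets lebesgue" and w: "has_weak_partial \<Omega> i f g" "has_weak_partial \<Omega> i f' g'"
  shows "has_weak_partial \<Omega> i (\<lambda>x. f x + r *\<^sub>R f' x) (\<lambda>x. g x + r *\<^sub>R g' x)"
  unfolding has_weak_partial_def
proof (intro conjI allI impI locally_integrable_add locally_integrable_scaleR)
  fix \<phi> :: "real^'a \<Rightarrow> real" assume t: "test_fun \<Omega> \<phi>"
  note tp = test_fun_partial[OF t, of i]
  have l: "locally_integrable \<Omega> f" "locally_integrable \<Omega> f'" "locally_integrable \<Omega> g" "locally_integrable \<Omega> g'"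
    using w by (auto simp: has_weak_partial_def)
  have "(LINT x|lebesgue_on \<Omega>. partial i \<phi> x *\<^sub>R (f x + r *\<^sub>R f' x)) =
     (LINT x|lebesgue_on \<Omega>. partial i \<phi> x *\<^sub>R f x + r *\<^sub>R (partial i \<phi> x *\<^sub>R f' x))"
    by (simp add: scaleR_add_right mult.commute)
  also have "\<dots> = (LINT x|lebesgue_on \<Omega>. partial i \<phi> x *\<^sub>R f x) + r *\<^sub>R (LINT x|lebesgue_on \<Omega>. partial i \<phi> x *\<^sub>R f' x)"
    using test_integrable[OF O tp l(1)] test_integrable[OF O tp l(2)]
    by (subst Bochner_Integration.integral_add) (auto simp del: scaleR_conv_of_real scaleR_scaleR)
  also have "\<dots> = - ((LINT x|lebesgue_on \<Omega>. \<phi> x *\<^sub>R g x) + r *\<^sub>R (LINT x|lebesgue_on \<Omega>. \<phi> x *\<^sub>R g' x))"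
    using w t by (simp add: has_weak_partial_def)
  also have "\<dots> = - (LINT x|lebesgue_on \<Omega>. \<phi> x *\<^sub>R g x + r *\<^sub>R (\<phi> x *\<^sub>R g' x))"
    using test_integrable[OF O t l(3)] test_integrable[OF O t l(4)]
    by (subst Bochner_Integration.integral_add) (auto simp del: scaleR_conv_of_real scaleR_scaleR)
  also have "\<dots> = - (LINT x|lebesgue_on \<Omega>. \<phi> x *\<^sub>R (g x + r *\<^sub>R g' x))"
    by (simp add: scaleR_add_right mult.commute)
  finally show "(LINT x|lebesgue_on \<Omega>. partial i \<phi> x *\<^sub>R (f x + r *\<^sub>R f' x)) = - (LINT x|lebesgue_on \<Omega>. \<phi> x *\<^sub>R (g x + r *\<^sub>R g' x))" .
qed (use w in \<open>auto simp: has_weak_partial_def\<close>)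

lemma has_weak_partial_unique:
  assumes "open \<Omega>" and w: "has_weak_partial \<Omega> i f g" "has_weak_partial \<Omega> i f g'"
  shows "AE x in lebesgue_on \<Omega>. g x = g' x"
proof -
  have O: "\<Omega> \<in> sets lebesgue" using \<open>open \<Omega>\<close> by auto
  from has_weak_partial_lincomb[OF O w, of "-1"]
  have w0: "has_weak_partial \<Omega> i (\<lambda>x. 0) (\<lambda>x. g x - g' x)" by simp
  have "AE x in lebesgue_on \<Omega>. g x - g' x = 0"
    by (rule fundamental_lemma[OF \<open>open \<Omega>\<close>]) (use w0 in \<open>auto simp: has_weak_partial_def\<close>)
  then show ?thesis by simp
qed

text \<open>Once some weak derivative exists, the choice in \<open>weak_partial\<close> is a weak
  derivative too, and the fundamental lemma forces agreement almost everywhere.\<close>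

lemma weak_partial_AE:
  assumes "open \<Omega>" "has_weak_partial \<Omega> i f g"
  shows "has_weak_partial \<Omega> i f (weak_partial \<Omega> i f)" "AE x in lebesgue_on \<Omega>. g x = weak_partial \<Omega> i f x"
proof -
  show "has_weak_partial \<Omega> i f (weak_partial \<Omega> i f)"
    unfolding weak_partial_def by (rule someI[of "has_weak_partial \<Omega> i f", OF assms(2)])
  from has_weak_partial_unique[OF assms this] show "AE x in lebesgue_on \<Omega>. g x = weak_partial \<Omega> i f x" .
qed

lemma weak_partial_L2:
  assumes "open \<Omega>" "has_weak_partial \<Omega> i f g" "L2_fun \<Omega> g"
  shows "L2_fun \<Omega> (weak_partial \<Omega> i f)" "L2_of \<Omega> (weak_partial \<Omega> i f) = L2_of \<Omega> g"
  using L2_of_AE_cong[OF _ assms(3) weak_partial_AE(2)[OF assms(1,2)]] assms(1) by auto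

lemma H1_weak_partial:
  assumes "open \<Omega>" "f \<in> H1 \<Omega>"
  shows "L2_fun \<Omega> f" "has_weak_partial \<Omega> i f (weak_partial \<Omega> i f)" "L2_fun \<Omega> (weak_partial \<Omega> i f)"
proof -
  show "L2_fun \<Omega> f" using assms by (simp add: H1_def)
  obtain g where "L2_fun \<Omega> g" "has_weak_partial \<Omega> i f g" using assms by (auto simp: H1_def)
  then show "has_weak_partial \<Omega> i f (weak_partial \<Omega> i f)" "L2_fun \<Omega> (weak_partial \<Omega> i f)"
    using weak_partial_AE(1)[OF assms(1)] weak_partial_L2(1)[OF assms(1)] by metis+
qed

lemma L2_fun_UNIV_restrict:
  assumes S: "S \<in> sets lebesgue" and f: "L2_fun UNIV f"
  shows "L2_fun S f"
proof -
  have [measurable]: "f \<in> borel_measurable lebesgue" and i: "integrable lebesgue (\<lambda>x. (norm (f x))\<^sup>2)"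
    using f by (auto simp: L2_fun_UNIV)
  have "integrable (lebesgue_on S) (\<lambda>x. (norm (f x))\<^sup>2)"
    using S integrable_mult_indicator[OF S i] by (intro integrable_restrict_space[THEN iffD2]) auto
  moreover have "f \<in> borel_measurable (lebesgue_on S)" by (rule measurable_restrict_space1) measurable
  ultimately show ?thesis by (simp add: L2_fun_def)
qed

lemma L2_fun_subset:
  assumes "S \<in> sets lebesgue" "T \<in> sets lebesgue" "S \<subseteq> T" "L2_fun T f"
  shows "L2_fun S f"
proof -
  have "L2_fun S (\<lambda>x. if x \<in> T then f x else 0)"
    by (rule L2_fun_UNIV_restrict[OF assms(1) L2_fun_extend[OF assms(2,4)]])
  then show ?thesis
    by (rule L2_of_AE_cong(1)[OF assms(1)]) (use assms(3) in \<open>auto simp: space_restrict_space intro!: AE_I2\<close>)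
qed

text \<open>|f| \<le> 1 + |f|^2, and constants are integrable on compact sets.\<close>

lemma L2_imp_locally_integrable:
  assumes O: "\<Omega> \<in> sets lebesgue" and f: "L2_fun \<Omega> f"
  shows "locally_integrable \<Omega> f"
  unfolding locally_integrable_def
proof (intro allI impI)
  fix K assume K: "compact K \<and> K \<subseteq> \<Omega>"
  then have mK: "K \<in> sets lebesgue" "K \<in> lmeasurable" by (auto intro: lmeasurable_compact fmeasurableD)
  have "L2_fun K f" by (rule L2_fun_subset[OF mK(1) O _ f]) (use K in simp)
  then have [measurable]: "f \<in> borel_measurable (lebesgue_on K)" and i: "integrable (lebesgue_on K) (\<lambda>x. (norm (f x))\<^sup>2)"
    by (auto simp: L2_fun_def)
  have c: "integrable (lebesgue_on K) (\<lambda>x. 1::real)"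
    using mK(2) by (simp add: integrable_const_ivl fmeasurable_def emeasure_restrict_space space_restrict_space integrable_iff_bounded mK)
  show "integrable (lebesgue_on K) f"
  proof (rule Bochner_Integration.integrable_bound[OF Bochner_Integration.integrable_add[OF c i]])
    have "norm (f x) \<le> 1 + (norm (f x))\<^sup>2" for x
      using sum_squares_bound[of 1 "norm (f x)"] by (simp add: power2_eq_square) (smt (verit) norm_ge_zero)
    then show "AE x in lebesgue_on K. norm (f x) \<le> norm (1 + (norm (f x))\<^sup>2)"
      by (intro AE_I2) (smt (verit) real_norm_def)
  qed measurable
qed

lemma test_fun_L2:
  fixes \<phi> :: "real^'d \<Rightarrow> complex"
  assumes "test_fun \<Omega> \<phi>" and S: "S \<in> sets lebesgue"
  shows "L2_fun S \<phi>"
proof (rule L2_fun_UNIV_restrict[OF S])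
  from assms obtain K where K: "compact K" "\<And>x. x \<notin> K \<Longrightarrow> \<phi> x = 0" unfolding test_fun_def by blast
  note c = test_fun_continuous[OF assms(1)]
  have "integrable lborel (\<lambda>x. (norm (\<phi> x))\<^sup>2)"
    by (rule integrable_lborel_compact_support[OF _ K(1)]) (use K(2) in \<open>auto intro!: continuous_intros c\<close>)
  moreover have "(\<lambda>x. (norm (\<phi> x))\<^sup>2) \<in> borel_measurable borel"
    by (intro borel_measurable_continuous_onI continuous_intros c)
  ultimately show "L2_fun UNIV \<phi>"
    using continuous_lebesgue_measurable[OF c] by (simp add: L2_fun_UNIV integrable_completion)
qed

text \<open>The product of the real test function with \<phi> is C^1 with compact support, so its
  partial derivative has integral 0. With this the \<open>H1_norm\<close> distance to a test
  function can be evaluated through classical derivatives.\<close>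

lemma test_fun_weak_partial:
  fixes \<phi> :: "real^'d \<Rightarrow> complex"
  assumes O: "\<Omega> \<in> sets lebesgue" and p: "test_fun \<Omega>' \<phi>"
  shows "has_weak_partial \<Omega> i \<phi> (partial i \<phi>)"
  unfolding has_weak_partial_def
proof (intro conjI allI impI)
  show l: "locally_integrable \<Omega> \<phi>" "locally_integrable \<Omega> (partial i \<phi>)"
    by (rule L2_imp_locally_integrable[OF O], rule test_fun_L2[OF _ O], rule p test_fun_partial[OF p])+
  fix \<zeta> :: "real^'d \<Rightarrow> real" assume t: "test_fun \<Omega> \<zeta>"
  then obtain K where K: "compact K" "K \<subseteq> \<Omega>" "\<And>x. x \<notin> K \<Longrightarrow> \<zeta> x = 0" unfolding test_fun_def by blast
  have dz: "(\<zeta> has_derivative frechet_derivative \<zeta> (at x)) (at x)" for x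
    using test_fun_differentiable[OF t] frechet_derivative_works by blast
  have dp: "(\<phi> has_derivative frechet_derivative \<phi> (at x)) (at x)" for x
    using test_fun_differentiable[OF p] frechet_derivative_works by blast
  let ?H = "\<lambda>x. \<zeta> x *\<^sub>R \<phi> x"
  note dH = has_derivative_scaleR[OF dz dp]
  have pH: "partial i ?H = (\<lambda>x. \<zeta> x *\<^sub>R partial i \<phi> x + partial i \<zeta> x *\<^sub>R \<phi> x)"
    using partial_eq[OF dH] by (auto simp: partial_def fun_eq_iff)
  have "(LBINT x. partial i ?H x) = 0"
  proof (rule integral_partial_eq_0[OF _ _ K(1)])
    show "?H differentiable (at x)" for x using dH unfolding differentiable_def by blast
    show "continuous_on UNIV (partial i ?H)"
      unfolding pH by (intro continuous_intros test_fun_continuous[OF t] test_fun_continuous[OF p]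
        test_fun_continuous[OF test_fun_partial[OF t]] test_fun_continuous[OF test_fun_partial[OF p]])
  qed (simp add: K(3))
  also have "(LBINT x. partial i ?H x) = (\<integral>x. partial i ?H x \<partial>lebesgue)"
  proof -
    have "continuous_on UNIV (partial i ?H)"
      unfolding pH by (intro continuous_intros test_fun_continuous[OF t] test_fun_continuous[OF p]
        test_fun_continuous[OF test_fun_partial[OF t]] test_fun_continuous[OF test_fun_partial[OF p]])
    then show ?thesis
      by (intro integral_completion[symmetric]) (simp add: borel_measurable_continuous_onI)
  qed
  also have "\<dots> = (\<integral>x. (if x \<in> \<Omega> then partial i ?H x else 0) \<partial>lebesgue)"
  proof -
    have "partial i \<zeta> x = 0" if "x \<notin> K" for x
      by (rule partial_support[of K \<zeta>]) (use K that in \<open>auto intro: compact_imp_closed\<close>)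
    then have "(\<lambda>x. if x \<in> \<Omega> then partial i ?H x else 0) = partial i ?H"
      using K(2,3) unfolding pH by (metis (no_types, lifting) add.right_neutral scaleR_zero_left subsetD)
    then show ?thesis by simp
  qed
  also have "\<dots> = integral\<^sup>L (lebesgue_on \<Omega>) (partial i ?H)"
    using O by (simp add: Lebesgue_Measure.integral_restrict_UNIV)
  also have "\<dots> = (LINT x|lebesgue_on \<Omega>. \<zeta> x *\<^sub>R partial i \<phi> x) + (LINT x|lebesgue_on \<Omega>. partial i \<zeta> x *\<^sub>R \<phi> x)"
    unfolding pH by (rule Bochner_Integration.integral_add) (intro test_integrable[OF O] t test_fun_partial l)+
  finally show "(LINT x|lebesgue_on \<Omega>. partial i \<zeta> x *\<^sub>R \<phi> x) = - (LINT x|lebesgue_on \<Omega>. \<zeta> x *\<^sub>R partial i \<phi> x)"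
    by (simp add: eq_neg_iff_add_eq_0 add.commute)
qed

text \<open>The closure of \<Omega> is compact, so the coefficient is bounded there, and so is the
  first derivative through its continuous extension.\<close>

lemma C1_closure_bounded:
  assumes "bounded \<Omega>" "open \<Omega>" and a: "C1_closure \<Omega> a"
  shows "a \<in> borel_measurable (lebesgue_on \<Omega>)" "\<exists>B. \<forall>x\<in>\<Omega>. \<bar>a x\<bar> \<le> B"
    "partial j a \<in> borel_measurable (lebesgue_on \<Omega>)" "\<exists>B. \<forall>x\<in>\<Omega>. \<bar>partial j a x\<bar> \<le> B"
    "continuous_on \<Omega> (partial j a)" "continuous_on \<Omega> a" "x \<in> \<Omega> \<Longrightarrow> a differentiable (at x)"
proof -
  have bd: "\<exists>B. \<forall>x\<in>\<Omega>. \<bar>k x\<bar> \<le> B" if "continuous_on (closure \<Omega>) k" for k :: "real^'a \<Rightarrow> real"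
  proof -
    have "compact (closure \<Omega>)" using assms(1) by simp
    then have "bounded (k ` closure \<Omega>)" using that by (intro compact_imp_bounded compact_continuous_image)
    then show ?thesis using closure_subset[of \<Omega>] unfolding bounded_iff real_norm_def by (metis image_eqI subset_iff)
  qed
  obtain g where g: "continuous_on (closure \<Omega>) g" "\<And>x. x \<in> \<Omega> \<Longrightarrow> partial j a x = g x"
    using a unfolding C1_closure_def by blast
  have ca: "continuous_on (closure \<Omega>) a" using a by (simp add: C1_closure_def)
  show c1: "continuous_on \<Omega> a" by (rule continuous_on_subset[OF ca closure_subset])
  have "continuous_on \<Omega> g" by (rule continuous_on_subset[OF g(1) closure_subset])
  then show c2: "continuous_on \<Omega> (partial j a)" using g(2) by (simp cong: continuous_on_cong)
  show "a \<in> borel_measurable (lebesgue_on \<Omega>)" "partial j a \<in> borel_measurable (lebesgue_on \<Omega>)"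
    by (intro continuous_imp_measurable_on_sets_lebesgue c1 c2; use assms(2) in auto)+
  show "\<exists>B. \<forall>x\<in>\<Omega>. \<bar>a x\<bar> \<le> B" by (rule bd[OF ca])
  show "\<exists>B. \<forall>x\<in>\<Omega>. \<bar>partial j a x\<bar> \<le> B" using bd[OF g(1)] g(2) by simp
  show "a differentiable (at x)" if "x \<in> \<Omega>"
  proof -
    have "a differentiable_on \<Omega>" using a by (simp add: C1_closure_def)
    then have "a differentiable (at x within \<Omega>)" using that by (simp add: differentiable_on_def)
    then show ?thesis by (simp add: at_within_open[OF that assms(2)])
  qed
qed

lemma L2_fun_mult_bounded':
  assumes "S \<in> sets lebesgue" "L2_fun S f" "b \<in> borel_measurable (lebesgue_on S)" "\<exists>B. \<forall>x\<in>S. \<bar>b x\<bar> \<le> B"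
  shows "L2_fun S (\<lambda>x. b x *\<^sub>R f x)"
proof -
  obtain B where "\<forall>x\<in>S. \<bar>b x\<bar> \<le> B" using assms(4) by blast
  then have "AE x in lebesgue_on S. \<bar>b x\<bar> \<le> B" by (intro AE_I2) (auto simp: space_restrict_space)
  then show ?thesis by (rule L2_fun_mult_bounded(1)[OF assms(1-3)])
qed

text \<open>The coefficient is moved onto the test function: a times \<phi> is an admissible C^1
  function for \<open>weak_partial_C1_test\<close>.\<close>

lemma weak_partial_product:
  assumes "open \<Omega>" "bounded \<Omega>" and a: "C1_closure \<Omega> a"
    and w: "has_weak_partial \<Omega> j f g" and f: "L2_fun \<Omega> f" and g: "L2_fun \<Omega> g"
  shows "has_weak_partial \<Omega> j (\<lambda>x. a x *\<^sub>R f x) (\<lambda>x. partial j a x *\<^sub>R f x + a x *\<^sub>R g x)"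
    "L2_fun \<Omega> (\<lambda>x. a x *\<^sub>R f x)" "L2_fun \<Omega> (\<lambda>x. partial j a x *\<^sub>R f x)" "L2_fun \<Omega> (\<lambda>x. a x *\<^sub>R g x)"
proof -
  note A = C1_closure_bounded[OF assms(2,1) a]
  have O: "\<Omega> \<in> sets lebesgue" using \<open>open \<Omega>\<close> by auto
  show L: "L2_fun \<Omega> (\<lambda>x. a x *\<^sub>R f x)" "L2_fun \<Omega> (\<lambda>x. partial j a x *\<^sub>R f x)" "L2_fun \<Omega> (\<lambda>x. a x *\<^sub>R g x)"
    by (intro L2_fun_mult_bounded'[OF O] f g A)+
  show "has_weak_partial \<Omega> j (\<lambda>x. a x *\<^sub>R f x) (\<lambda>x. partial j a x *\<^sub>R f x + a x *\<^sub>R g x)"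
    unfolding has_weak_partial_def
  proof (intro conjI allI impI)
    show l: "locally_integrable \<Omega> (\<lambda>x. a x *\<^sub>R f x)" "locally_integrable \<Omega> (\<lambda>x. partial j a x *\<^sub>R f x + a x *\<^sub>R g x)"
      by (intro L2_imp_locally_integrable[OF O] L2_of_add(1)[OF O] L)+
    have l2: "locally_integrable \<Omega> (\<lambda>x. partial j a x *\<^sub>R f x)" "locally_integrable \<Omega> (\<lambda>x. a x *\<^sub>R g x)"
      by (intro L2_imp_locally_integrable[OF O] L)+
    fix \<phi> :: "real^'a \<Rightarrow> real" assume t: "test_fun \<Omega> \<phi>"
    then obtain K where K: "compact K" "K \<subseteq> \<Omega>" "\<And>x. x \<notin> K \<Longrightarrow> \<phi> x = 0" unfolding test_fun_def by blast
    have pz: "partial j \<phi> x = 0" if "x \<notin> K" for x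
      by (rule partial_support[of K \<phi>]) (use K that in \<open>auto intro: compact_imp_closed\<close>)
    \<comment> \<open>The coefficient is differentiable on \<Omega> only, but h vanishes off the
      compact set \<open>K\<close>. The open sets \<Omega> and \<open>- K\<close> cover the space,
      and h is C^1 on each of them.\<close>
    define h where "h x = a x * \<phi> x" for x
    have hz: "h x = 0" if "x \<notin> K" for x using K(3)[OF that] by (simp add: h_def)
    have oK: "open (- K)" using K(1) by (simp add: compact_imp_closed open_Compl)
    have h1: "(h has_derivative (\<lambda>v. a x * frechet_derivative \<phi> (at x) v + frechet_derivative a (at x) v * \<phi> x)) (at x)" if "x \<in> \<Omega>" for x
    proof -
      have 1: "(\<phi> has_derivative frechet_derivative \<phi> (at x)) (at x)"
        using test_fun_differentiable[OF t] frechet_derivative_works by blast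
      have 2: "(a has_derivative frechet_derivative a (at x)) (at x)"
        using A(7)[OF that] frechet_derivative_works by blast
      from has_derivative_mult[OF 2 1] show ?thesis unfolding h_def[abs_def] .
    qed
    have h2: "(h has_derivative (\<lambda>_. 0)) (at x)" if "x \<notin> \<Omega>" for x
    proof (rule has_derivative_transform_within_open[of "\<lambda>_. 0" "\<lambda>_. 0" x UNIV "- K"])
      show "x \<in> - K" using that K(2) by auto
      show "0 = h y" if "y \<in> - K" for y using hz[of y] that by simp
    qed (simp_all add: oK)
    have ph: "partial j h x = partial j a x * \<phi> x + a x * partial j \<phi> x" for x
    proof (cases "x \<in> \<Omega>")
      case True
      from partial_eq[OF h1[OF True], of j] show ?thesis by (simp add: partial_def)
    next
      case False
      then have "x \<notin> K" using K(2) by auto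
      then show ?thesis using partial_eq[OF h2[OF False], of j] K(3) pz by simp
    qed
    have cph: "continuous_on UNIV (partial j h)"
    proof -
      have "continuous_on \<Omega> (partial j h)"
        unfolding ph[abs_def] by (intro continuous_intros A continuous_on_subset[OF test_fun_continuous[OF t]]
          continuous_on_subset[OF test_fun_continuous[OF test_fun_partial[OF t]]]) auto
      moreover have "continuous_on (- K) (partial j h)"
        by (rule continuous_on_eq[of _ "\<lambda>_. 0"]) (use K(3) pz in \<open>auto simp: ph\<close>)
      ultimately have "continuous_on (\<Omega> \<union> - K) (partial j h)"
        using oK \<open>open \<Omega>\<close> by (intro continuous_on_open_Un)
      moreover have "\<Omega> \<union> - K = UNIV" using K(2) by auto
      ultimately show ?thesis by simp
    qed
    have "(LINT x|lebesgue_on \<Omega>. partial j h x *\<^sub>R f x) = - (LINT x|lebesgue_on \<Omega>. h x *\<^sub>R g x)"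
      by (rule weak_partial_C1_test[OF \<open>open \<Omega>\<close> w _ cph K(1,2) hz])
         (use h1 h2 in \<open>auto simp: differentiable_def\<close>)
    moreover have "(LINT x|lebesgue_on \<Omega>. partial j h x *\<^sub>R f x) = (LINT x|lebesgue_on \<Omega>. \<phi> x *\<^sub>R (partial j a x *\<^sub>R f x) + partial j \<phi> x *\<^sub>R (a x *\<^sub>R f x))"
      by (simp add: ph algebra_simps)
    moreover have "\<dots> = (LINT x|lebesgue_on \<Omega>. \<phi> x *\<^sub>R (partial j a x *\<^sub>R f x)) + (LINT x|lebesgue_on \<Omega>. partial j \<phi> x *\<^sub>R (a x *\<^sub>R f x))"
      by (rule Bochner_Integration.integral_add) (intro test_integrable[OF O] t test_fun_partial l l2)+
    moreover have "(LINT x|lebesgue_on \<Omega>. h x *\<^sub>R g x) = (LINT x|lebesgue_on \<Omega>. \<phi> x *\<^sub>R (a x *\<^sub>R g x))"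
      by (simp add: h_def mult.commute)
    moreover have "(LINT x|lebesgue_on \<Omega>. \<phi> x *\<^sub>R (partial j a x *\<^sub>R f x + a x *\<^sub>R g x)) = (LINT x|lebesgue_on \<Omega>. \<phi> x *\<^sub>R (partial j a x *\<^sub>R f x)) + (LINT x|lebesgue_on \<Omega>. \<phi> x *\<^sub>R (a x *\<^sub>R g x))"
      unfolding scaleR_add_right by (rule Bochner_Integration.integral_add) (intro test_integrable[OF O] t test_fun_partial l l2)+
    ultimately show "(LINT x|lebesgue_on \<Omega>. partial j \<phi> x *\<^sub>R (a x *\<^sub>R f x)) = - (LINT x|lebesgue_on \<Omega>. \<phi> x *\<^sub>R (partial j a x *\<^sub>R f x + a x *\<^sub>R g x))"
      by (simp add: algebra_simps)
  qed
qed

lemma rep_L2_add: "AE x in lebesgue. rep_L2 (X + Y) x = rep_L2 X x + rep_L2 Y x"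
proof -
  have "abs_L2 (rep_L2 X) + abs_L2 (rep_L2 Y) = abs_L2 (\<lambda>x. rep_L2 X x + rep_L2 Y x)"
    by (rule plus_L2.abs_eq) (use L2_fun_rep in \<open>auto simp: L2_rel_def\<close>)
  then have "X + Y = abs_L2 (\<lambda>x. rep_L2 X x + rep_L2 Y x)" by (simp add: abs_L2_rep)
  then show ?thesis using L2_rep_AE_abs[OF L2_fun_add[OF L2_fun_rep[of X] L2_fun_rep[of Y]]] by simp
qed

lemma rep_L2_scaleR: "AE x in lebesgue. rep_L2 (r *\<^sub>R X) x = r *\<^sub>R rep_L2 X x"
proof -
  have "r *\<^sub>R abs_L2 (rep_L2 X) = abs_L2 (\<lambda>x. r *\<^sub>R rep_L2 X x)"
    by (rule scaleR_L2.abs_eq) (use L2_fun_rep in \<open>auto simp: L2_rel_def\<close>)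
  then have "r *\<^sub>R X = abs_L2 (\<lambda>x. r *\<^sub>R rep_L2 X x)" by (simp add: abs_L2_rep)
  then show ?thesis using L2_rep_AE_abs[OF L2_fun_scaleR[OF L2_fun_rep[of X], of r]] by simp
qed

lemma rep_L2_of:
  assumes "S \<in> sets lebesgue" "L2_fun S f"
  shows "AE x in lebesgue. rep_L2 (L2_of S f) x = (if x \<in> S then f x else 0)"
  unfolding L2_of_eq_abs[OF assms] by (rule L2_rep_AE_abs[OF L2_fun_extend[OF assms]])

lemma AE_lebesgue_on: "S \<in> sets lebesgue \<Longrightarrow> AE x in lebesgue. P x \<Longrightarrow> AE x in lebesgue_on S. P x"
  by (subst AE_restrict_space_iff) (auto elim: AE_mp)

subsection \<open>The weak elliptic operator\<close>

text \<open>Acts on classes through \<open>rep_L2\<close>, so that it is defined for every class;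
  for essentially bounded b it is a bounded linear operator and agrees with pointwise multiplication
  on \<open>L2_of\<close>.\<close>

definition mult_L2 :: "'a::euclidean_space set \<Rightarrow> ('a \<Rightarrow> real) \<Rightarrow> 'a L2 \<Rightarrow> 'a L2" where
  "mult_L2 S b X = L2_of S (\<lambda>x. b x *\<^sub>R rep_L2 X x)"

context
  fixes S :: "'a::euclidean_space set" and b :: "'a \<Rightarrow> real" and B :: real
  assumes S: "S \<in> sets lebesgue" and b: "b \<in> borel_measurable (lebesgue_on S)"
    and B: "AE x in lebesgue_on S. \<bar>b x\<bar> \<le> B"
begin

lemma mult_L2_fun: "L2_fun S (\<lambda>x. b x *\<^sub>R rep_L2 X x)"
  by (rule L2_fun_mult_bounded(1)[OF S L2_fun_UNIV_restrict[OF S L2_fun_rep] b B])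

lemma bounded_linear_mult_L2: "bounded_linear (mult_L2 S b)"
proof (rule bounded_linear_intro[where K = "\<bar>B\<bar>"])
  fix X Y :: "'a L2" and r :: real
  have "mult_L2 S b (X + Y) = L2_of S (\<lambda>x. b x *\<^sub>R rep_L2 X x + b x *\<^sub>R rep_L2 Y x)"
    unfolding mult_L2_def by (rule L2_of_AE_cong(2)[OF S])
       (use AE_lebesgue_on[OF S rep_L2_add[of X Y]] in \<open>auto intro!: L2_of_add(1)[OF S] mult_L2_fun elim!: AE_mp simp: scaleR_add_right\<close>)
  then show "mult_L2 S b (X + Y) = mult_L2 S b X + mult_L2 S b Y"
    by (simp add: mult_L2_def L2_of_add(2)[OF S mult_L2_fun mult_L2_fun])
  have "mult_L2 S b (r *\<^sub>R X) = L2_of S (\<lambda>x. r *\<^sub>R (b x *\<^sub>R rep_L2 X x))" unfolding mult_L2_def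
    by (rule L2_of_AE_cong(2)[OF S L2_of_scaleR(1)[OF S mult_L2_fun]])
       (use AE_lebesgue_on[OF S rep_L2_scaleR[of r X]] in \<open>auto elim!: AE_mp simp: mult.commute\<close>)
  then show "mult_L2 S b (r *\<^sub>R X) = r *\<^sub>R mult_L2 S b X"
    by (simp add: mult_L2_def L2_of_scaleR(2)[OF S mult_L2_fun] del: scaleR_scaleR)
  have "norm (L2_of S (rep_L2 X)) \<le> norm X"
  proof -
    have r: "L2_fun S (rep_L2 X)" by (rule L2_fun_UNIV_restrict[OF S L2_fun_rep])
    have i: "integrable lebesgue (\<lambda>x. (norm (rep_L2 X x))\<^sup>2)" using L2_fun_rep[of X] by (simp add: L2_fun_UNIV)
    have "(norm (L2_of S (rep_L2 X)))\<^sup>2 = (LINT x|lebesgue_on S. (norm (rep_L2 X x))\<^sup>2)"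
      by (simp add: norm_L2_of[OF S r] Bochner_Integration.integral_nonneg)
    also have "\<dots> = (LINT x|lebesgue. indicator S x *\<^sub>R (norm (rep_L2 X x))\<^sup>2)"
      using S by (subst integral_restrict_space) auto
    also have "\<dots> \<le> (LINT x|lebesgue. (norm (rep_L2 X x))\<^sup>2)"
      by (rule integral_mono[OF integrable_mult_indicator[OF S i] i]) (auto simp: indicator_def)
    also have "\<dots> = (norm X)\<^sup>2" by (simp add: power2_norm_eq_inner inner_L2_rep[of X X])
    finally show ?thesis by (simp add: abs_le_square_iff[symmetric])
  qed
  then show "norm (mult_L2 S b X) \<le> norm X * \<bar>B\<bar>"
    using L2_fun_mult_bounded(2)[OF S L2_fun_UNIV_restrict[OF S L2_fun_rep] b B, of X]
    unfolding mult_L2_def by (smt (verit) abs_ge_zero mult.commute mult_left_mono)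
qed

lemma mult_L2_of:
  assumes "L2_fun S f"
  shows "mult_L2 S b (L2_of S f) = L2_of S (\<lambda>x. b x *\<^sub>R f x)"
  unfolding mult_L2_def by (rule L2_of_AE_cong(2)[OF S L2_fun_mult_bounded(1)[OF S assms b B]])
     (use rep_L2_of[OF S assms] S in \<open>auto simp: AE_restrict_space_iff elim!: AE_mp\<close>)

lemma inner_mult_L2:
  "mult_L2 S b X \<bullet> Y = (LINT x|lebesgue_on S. b x * (rep_L2 X x \<bullet> rep_L2 Y x))"
  "integrable (lebesgue_on S) (\<lambda>x. b x * (rep_L2 X x \<bullet> rep_L2 Y x))"
proof -
  have "mult_L2 S b X \<bullet> Y = (LINT x|lebesgue. (if x \<in> S then (b x *\<^sub>R rep_L2 X x) \<bullet> rep_L2 Y x else 0))"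
    unfolding mult_L2_def by (rule inner_L2_of_left[OF S mult_L2_fun])
  also have "\<dots> = (LINT x|lebesgue_on S. b x * (rep_L2 X x \<bullet> rep_L2 Y x))"
    using S by (simp add: Lebesgue_Measure.integral_restrict_UNIV del: scaleR_conv_of_real)
  finally show "mult_L2 S b X \<bullet> Y = (LINT x|lebesgue_on S. b x * (rep_L2 X x \<bullet> rep_L2 Y x))" .
  have "integrable lebesgue (\<lambda>x. (if x \<in> S then b x *\<^sub>R rep_L2 X x else 0) \<bullet> rep_L2 Y x)"
    by (rule L2_fun_inner[OF L2_fun_extend[OF S mult_L2_fun] L2_fun_rep])
  also have "(\<lambda>x. (if x \<in> S then b x *\<^sub>R rep_L2 X x else 0) \<bullet> rep_L2 Y x) = (\<lambda>x. if x \<in> S then b x * (rep_L2 X x \<bullet> rep_L2 Y x) else 0)"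
    by auto
  finally show "integrable (lebesgue_on S) (\<lambda>x. b x * (rep_L2 X x \<bullet> rep_L2 Y x))"
    using S by (simp add: Lebesgue_Measure.integrable_restrict_UNIV)
qed

end

text \<open>The real part of the sesquilinear form of A. The gradients P and R are separate
  arguments because a class carries no derivative of its own; linear combinations and limits can
  then be taken within L2.\<close>

definition elliptic_form ::
    "(real^'d::finite) set \<Rightarrow> ('d \<Rightarrow> 'd \<Rightarrow> real^'d \<Rightarrow> real) \<Rightarrow> (real^'d \<Rightarrow> real) \<Rightarrow>
     (real^'d) L2 \<Rightarrow> ('d \<Rightarrow> (real^'d) L2) \<Rightarrow> (real^'d) L2 \<Rightarrow> ('d \<Rightarrow> (real^'d) L2) \<Rightarrow> real" where
  "elliptic_form \<Omega> a c X P Y R =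
     (\<Sum>i\<in>UNIV. \<Sum>j\<in>UNIV. mult_L2 \<Omega> (a i j) (P i) \<bullet> R j) + mult_L2 \<Omega> c X \<bullet> Y"

text \<open>\<open>X\<close> is the limit in \<open>H\<^sup>1\<close> of test functions, which encodes the boundary condition; \<open>P i\<close> is then its
  \<open>i\<close>-th weak derivative.\<close>

definition weak_graph ::
    "(real^'d::finite) set \<Rightarrow> ('d \<Rightarrow> 'd \<Rightarrow> real^'d \<Rightarrow> real) \<Rightarrow> (real^'d \<Rightarrow> real) \<Rightarrow>
     ((real^'d) L2 \<times> (real^'d) L2) set" where
  "weak_graph \<Omega> a c = {(X, Y). \<exists>P \<phi>. (\<forall>n. test_fun \<Omega> (\<phi> n)) \<and>
     (\<lambda>n::nat. L2_of \<Omega> (\<phi> n)) \<longlonglongrightarrow> X \<and> (\<forall>i. (\<lambda>n. L2_of \<Omega> (partial i (\<phi> n))) \<longlonglongrightarrow> P i) \<and>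
     (\<forall>\<psi>. test_fun \<Omega> \<psi> \<longrightarrow> Y \<bullet> L2_of \<Omega> \<psi> =
        elliptic_form \<Omega> a c X P (L2_of \<Omega> \<psi>) (\<lambda>i. L2_of \<Omega> (partial i \<psi>)))}"

locale elliptic =
  fixes \<Omega> :: "(real^'d::finite) set" and a :: "'d \<Rightarrow> 'd \<Rightarrow> real^'d \<Rightarrow> real" and c :: "real^'d \<Rightarrow> real"
  assumes open_dom: "open \<Omega>" and bounded_dom: "bounded \<Omega>" and coeffs: "admissible_coeffs \<Omega> a c"
begin

lemma dom_sets: "\<Omega> \<in> sets lebesgue" using open_dom by auto

lemma a_C1: "C1_closure \<Omega> (a i j)" using coeffs by (simp add: admissible_coeffs_def)

lemma a_meas: "a i j \<in> borel_measurable (lebesgue_on \<Omega>)"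
  by (rule C1_closure_bounded(1)[OF bounded_dom open_dom a_C1])

lemma bounded_AE: "\<exists>B. \<forall>x\<in>\<Omega>. \<bar>b x\<bar> \<le> B \<Longrightarrow> \<exists>B. AE x in lebesgue_on \<Omega>. \<bar>b x\<bar> \<le> (B::real)"
  by (metis AE_I2 space_restrict_space IntD1 lebesgue_on_UNIV_eq space_lebesgue_on)

lemma a_bd: "\<exists>B. AE x in lebesgue_on \<Omega>. \<bar>a i j x\<bar> \<le> B"
  by (rule bounded_AE[OF C1_closure_bounded(2)[OF bounded_dom open_dom a_C1]])

lemma c_meas: "c \<in> borel_measurable (lebesgue_on \<Omega>)"
  and c_bd: "\<exists>B. AE x in lebesgue_on \<Omega>. \<bar>c x\<bar> \<le> B"
  and c_nonneg: "AE x in lebesgue_on \<Omega>. 0 \<le> c x"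
  using coeffs by (auto simp: admissible_coeffs_def)

lemma bl_a: "bounded_linear (mult_L2 \<Omega> (a i j))"
  using a_bd bounded_linear_mult_L2[OF dom_sets a_meas] by blast

lemma bl_c: "bounded_linear (mult_L2 \<Omega> c)"
  using c_bd bounded_linear_mult_L2[OF dom_sets c_meas] by blast

text \<open>Ellipticity is assumed for real vectors. The real inner product of complex numbers is
  the product of the real parts plus that of the imaginary parts, so the form at a complex gradient
  is the sum of the forms at its real and imaginary parts.\<close>

lemma elliptic_form_nonneg: "elliptic_form \<Omega> a c X P X P \<ge> 0"
proof -
  have ia: "mult_L2 \<Omega> (a i j) (P i) \<bullet> P j = (LINT x|lebesgue_on \<Omega>. a i j x * (rep_L2 (P i) x \<bullet> rep_L2 (P j) x))"
     "integrable (lebesgue_on \<Omega>) (\<lambda>x. a i j x * (rep_L2 (P i) x \<bullet> rep_L2 (P j) x))" for i j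
    using a_bd[of i j] inner_mult_L2[OF dom_sets a_meas] by blast+
  have ic: "mult_L2 \<Omega> c X \<bullet> X = (LINT x|lebesgue_on \<Omega>. c x * (rep_L2 X x \<bullet> rep_L2 X x))"
    using c_bd inner_mult_L2[OF dom_sets c_meas] by blast
  obtain a0 where a0: "a0 > 0" "\<And>x \<xi>::real^'d. x \<in> closure \<Omega> \<Longrightarrow>
        (\<Sum>i\<in>UNIV. \<Sum>j\<in>UNIV. a i j x * \<xi> $ i * \<xi> $ j) \<ge> a0 * (\<Sum>i\<in>UNIV. (\<xi> $ i)\<^sup>2)"
    using coeffs unfolding admissible_coeffs_def by blast
  have nn: "(\<Sum>i\<in>UNIV. \<Sum>j\<in>UNIV. a i j x * (p i * p j)) \<ge> 0" if "x \<in> \<Omega>" for x p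
  proof -
    have "0 \<le> a0 * (\<Sum>i\<in>UNIV. ((\<chi> i. p i) $ i)\<^sup>2)" using a0(1) by (intro mult_nonneg_nonneg sum_nonneg) auto
    also have "\<dots> \<le> (\<Sum>i\<in>UNIV. \<Sum>j\<in>UNIV. a i j x * (\<chi> i. p i) $ i * (\<chi> i. p i) $ j)"
      using a0(2)[of x "\<chi> i. p i"] that closure_subset by blast
    finally show ?thesis by (simp add: mult.assoc)
  qed
  have "(\<Sum>i\<in>UNIV. \<Sum>j\<in>UNIV. mult_L2 \<Omega> (a i j) (P i) \<bullet> P j) =
    (LINT x|lebesgue_on \<Omega>. (\<Sum>i\<in>UNIV. \<Sum>j\<in>UNIV. a i j x * (rep_L2 (P i) x \<bullet> rep_L2 (P j) x)))"
    using ia by (simp add: Bochner_Integration.integral_sum)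
  also have "\<dots> \<ge> 0"
  proof (rule integral_nonneg_AE, rule AE_I2)
    fix x assume "x \<in> space (lebesgue_on \<Omega>)"
    then have x: "x \<in> \<Omega>" by (simp add: space_restrict_space)
    have "(\<Sum>i\<in>UNIV. \<Sum>j\<in>UNIV. a i j x * (rep_L2 (P i) x \<bullet> rep_L2 (P j) x)) =
      (\<Sum>i\<in>UNIV. \<Sum>j\<in>UNIV. a i j x * (Re (rep_L2 (P i) x) * Re (rep_L2 (P j) x))) +
      (\<Sum>i\<in>UNIV. \<Sum>j\<in>UNIV. a i j x * (Im (rep_L2 (P i) x) * Im (rep_L2 (P j) x)))"
      by (simp add: inner_complex_def distrib_left sum.distrib)
    then show "0 \<le> (\<Sum>i\<in>UNIV. \<Sum>j\<in>UNIV. a i j x * (rep_L2 (P i) x \<bullet> rep_L2 (P j) x))"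
      using nn[OF x, of "\<lambda>i. Re (rep_L2 (P i) x)"] nn[OF x, of "\<lambda>i. Im (rep_L2 (P i) x)"] by simp
  qed
  moreover have "mult_L2 \<Omega> c X \<bullet> X \<ge> 0"
    unfolding ic by (rule integral_nonneg_AE) (use c_nonneg in \<open>auto elim!: AE_mp\<close>)
  ultimately show ?thesis by (simp add: elliptic_form_def)
qed

lemma elliptic_form_lin:
  "elliptic_form \<Omega> a c (X + r *\<^sub>R X') (\<lambda>i. P i + r *\<^sub>R P' i) Y R = elliptic_form \<Omega> a c X P Y R + r * elliptic_form \<Omega> a c X' P' Y R"
proof -
  interpret c: bounded_linear "mult_L2 \<Omega> c" by (rule bl_c)
  have *: "mult_L2 \<Omega> (a i j) (P i + r *\<^sub>R P' i) = mult_L2 \<Omega> (a i j) (P i) + r *\<^sub>R mult_L2 \<Omega> (a i j) (P' i)" for i j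
  proof -
    interpret a: bounded_linear "mult_L2 \<Omega> (a i j)" by (rule bl_a)
    show ?thesis by (simp add: a.add a.scaleR)
  qed
  show ?thesis
    unfolding elliptic_form_def * by (simp add: c.add c.scaleR inner_add_left sum.distrib sum_distrib_left distrib_left)
qed

lemma weak_graph_lincomb:
  assumes "(X, Y) \<in> weak_graph \<Omega> a c" "(X', Y') \<in> weak_graph \<Omega> a c"
  shows "(X + r *\<^sub>R X', Y + r *\<^sub>R Y') \<in> weak_graph \<Omega> a c"
proof -
  from assms(1) obtain P \<phi> where 1: "\<And>n. test_fun \<Omega> (\<phi> n)" "(\<lambda>n::nat. L2_of \<Omega> (\<phi> n)) \<longlonglongrightarrow> X"
    "\<And>i. (\<lambda>n. L2_of \<Omega> (partial i (\<phi> n))) \<longlonglongrightarrow> P i"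
    "\<And>\<psi>. test_fun \<Omega> \<psi> \<Longrightarrow> Y \<bullet> L2_of \<Omega> \<psi> = elliptic_form \<Omega> a c X P (L2_of \<Omega> \<psi>) (\<lambda>i. L2_of \<Omega> (partial i \<psi>))"
    unfolding weak_graph_def by blast
  from assms(2) obtain P' \<phi>' where 2: "\<And>n. test_fun \<Omega> (\<phi>' n)" "(\<lambda>n::nat. L2_of \<Omega> (\<phi>' n)) \<longlonglongrightarrow> X'"
    "\<And>i. (\<lambda>n. L2_of \<Omega> (partial i (\<phi>' n))) \<longlonglongrightarrow> P' i"
    "\<And>\<psi>. test_fun \<Omega> \<psi> \<Longrightarrow> Y' \<bullet> L2_of \<Omega> \<psi> = elliptic_form \<Omega> a c X' P' (L2_of \<Omega> \<psi>) (\<lambda>i. L2_of \<Omega> (partial i \<psi>))"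
    unfolding weak_graph_def by blast
  define \<eta> where "\<eta> n x = \<phi> n x + r *\<^sub>R \<phi>' n x" for n x
  have t: "test_fun \<Omega> (\<eta> n)" for n
  proof -
    from 1(1)[of n] obtain K where K: "compact K" "K \<subseteq> \<Omega>" "\<And>x. x \<notin> K \<Longrightarrow> \<phi> n x = 0" and C: "\<And>k. Ck_on k UNIV (\<phi> n)"
      unfolding test_fun_def by blast
    from 2(1)[of n] obtain K' where K': "compact K'" "K' \<subseteq> \<Omega>" "\<And>x. x \<notin> K' \<Longrightarrow> \<phi>' n x = 0" and C': "\<And>k. Ck_on k UNIV (\<phi>' n)"
      unfolding test_fun_def by blast
    have "Ck_on k UNIV (\<eta> n)" for k
      unfolding \<eta>_def[abs_def] by (intro Ck_add C Ck_bounded_linear[OF bounded_linear_scaleR_right] C')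
    moreover have "\<eta> n x = 0" if "x \<notin> K \<union> K'" for x using K(3) K'(3) that by (simp add: \<eta>_def)
    ultimately show ?thesis unfolding test_fun_def
      using compact_Un[OF K(1) K'(1)] K(2) K'(2) by (metis Un_least)
  qed
  have p: "partial i (\<eta> n) = (\<lambda>x. partial i (\<phi> n) x + r *\<^sub>R partial i (\<phi>' n) x)" for i n
  proof
    fix x
    have "(\<phi> n has_derivative frechet_derivative (\<phi> n) (at x)) (at x)" "(\<phi>' n has_derivative frechet_derivative (\<phi>' n) (at x)) (at x)"
      using test_fun_differentiable 1(1) 2(1) frechet_derivative_works by blast+
    then have "(\<eta> n has_derivative (\<lambda>v. frechet_derivative (\<phi> n) (at x) v + r *\<^sub>R frechet_derivative (\<phi>' n) (at x) v)) (at x)"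
      unfolding \<eta>_def[abs_def] by (intro derivative_intros)
    from partial_eq[OF this] show "partial i (\<eta> n) x = partial i (\<phi> n) x + r *\<^sub>R partial i (\<phi>' n) x"
      by (simp add: partial_def)
  qed
  note L = test_fun_L2[OF _ dom_sets] and tp = test_fun_partial
  have s: "L2_of \<Omega> (\<lambda>x. f x + r *\<^sub>R g x) = L2_of \<Omega> f + r *\<^sub>R L2_of \<Omega> g" if "L2_fun \<Omega> f" "L2_fun \<Omega> g" for f g
    using that by (simp add: L2_of_add(2)[OF dom_sets that(1) L2_of_scaleR(1)[OF dom_sets that(2)]] L2_of_scaleR(2)[OF dom_sets that(2)] del: scaleR_conv_of_real)
  have 3: "(\<lambda>n. L2_of \<Omega> (\<eta> n)) \<longlonglongrightarrow> X + r *\<^sub>R X'"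
    unfolding \<eta>_def[abs_def] s[OF L[OF 1(1)] L[OF 2(1)]] by (intro tendsto_intros 1 2)
  have 4: "(\<lambda>n. L2_of \<Omega> (partial i (\<eta> n))) \<longlonglongrightarrow> P i + r *\<^sub>R P' i" for i
    unfolding p s[OF L[OF tp[OF 1(1)]] L[OF tp[OF 2(1)]]] by (intro tendsto_intros 1 2)
  have 5: "(Y + r *\<^sub>R Y') \<bullet> L2_of \<Omega> \<psi> = elliptic_form \<Omega> a c (X + r *\<^sub>R X') (\<lambda>i. P i + r *\<^sub>R P' i) (L2_of \<Omega> \<psi>) (\<lambda>i. L2_of \<Omega> (partial i \<psi>))"
    if "test_fun \<Omega> \<psi>" for \<psi> by (simp add: elliptic_form_lin 1(4)[OF that] 2(4)[OF that] inner_add_left)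
  show ?thesis unfolding weak_graph_def mem_Collect_eq prod.case
    by (rule exI[of _ "\<lambda>i. P i + r *\<^sub>R P' i"], rule exI[of _ \<eta>]) (intro conjI allI impI t 3 4 5)
qed

text \<open>The defining identity holds for test functions. Along the test functions that converge
  to X together with their gradients it passes to the limit, so Y \<bullet> X is the value of the
  form at X itself.\<close>

lemma weak_graph_accretive:
  assumes "(X, Y) \<in> weak_graph \<Omega> a c"
  shows "X \<bullet> Y \<ge> 0"
proof -
  from assms(1) obtain P \<phi> where 1: "\<And>n. test_fun \<Omega> (\<phi> n)" "(\<lambda>n::nat. L2_of \<Omega> (\<phi> n)) \<longlonglongrightarrow> X"
    "\<And>i. (\<lambda>n. L2_of \<Omega> (partial i (\<phi> n))) \<longlonglongrightarrow> P i"
    "\<And>\<psi>. test_fun \<Omega> \<psi> \<Longrightarrow> Y \<bullet> L2_of \<Omega> \<psi> = elliptic_form \<Omega> a c X P (L2_of \<Omega> \<psi>) (\<lambda>i. L2_of \<Omega> (partial i \<psi>))"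
    unfolding weak_graph_def by blast
  have "(\<lambda>n. Y \<bullet> L2_of \<Omega> (\<phi> n)) \<longlonglongrightarrow> Y \<bullet> X" by (intro tendsto_intros 1)
  moreover have "(\<lambda>n. elliptic_form \<Omega> a c X P (L2_of \<Omega> (\<phi> n)) (\<lambda>i. L2_of \<Omega> (partial i (\<phi> n)))) \<longlonglongrightarrow> elliptic_form \<Omega> a c X P X P"
    unfolding elliptic_form_def by (intro tendsto_intros 1)
  ultimately have "Y \<bullet> X = elliptic_form \<Omega> a c X P X P" using LIMSEQ_unique 1(4)[OF 1(1)] by simp
  then show ?thesis using elliptic_form_nonneg[of X P] by (simp add: inner_commute)
qed

text \<open>Collects what the product rule provides for one summand of the divergence term. The
  point is that the weak derivative of the coefficient times \<open>d i\<close> exists, so that the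
  choice hidden in \<open>elliptic_op\<close> is meaningful and its class is the expanded
  derivative.\<close>

lemma elliptic_term:
  assumes "\<psi> \<in> H2 \<Omega>"
  defines "d \<equiv> \<lambda>i. weak_partial \<Omega> i \<psi>"
  shows "has_weak_partial \<Omega> j (\<lambda>y. a i j y *\<^sub>R d i y) (weak_partial \<Omega> j (\<lambda>y. a i j y *\<^sub>R d i y))"
    "L2_fun \<Omega> (weak_partial \<Omega> j (\<lambda>y. a i j y *\<^sub>R d i y))"
    "L2_of \<Omega> (weak_partial \<Omega> j (\<lambda>y. a i j y *\<^sub>R d i y)) =
       L2_of \<Omega> (\<lambda>x. partial j (a i j) x *\<^sub>R d i x + a i j x *\<^sub>R weak_partial \<Omega> j (d i) x)"
    "L2_fun \<Omega> (\<lambda>y. a i j y *\<^sub>R d i y)" "L2_fun \<Omega> \<psi>" "L2_fun \<Omega> (d i)"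
    "L2_fun \<Omega> (weak_partial \<Omega> j (d i))"
    "has_weak_partial \<Omega> i \<psi> (d i)" "has_weak_partial \<Omega> j (d i) (weak_partial \<Omega> j (d i))"
proof -
  have H: "\<psi> \<in> H1 \<Omega>" "d i \<in> H1 \<Omega>" using assms by (auto simp: H2_def)
  note h = H1_weak_partial[OF open_dom H(1)] and h' = H1_weak_partial[OF open_dom H(2)]
  show "L2_fun \<Omega> \<psi>" "L2_fun \<Omega> (d i)" "L2_fun \<Omega> (weak_partial \<Omega> j (d i))"
     "has_weak_partial \<Omega> i \<psi> (d i)" "has_weak_partial \<Omega> j (d i) (weak_partial \<Omega> j (d i))"
    using h h' by (auto simp: d_def)
  note p = weak_partial_product[OF open_dom bounded_dom a_C1[of i j] h'(2)[of j] h'(1) h'(3)[of j]]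
  show "L2_fun \<Omega> (\<lambda>y. a i j y *\<^sub>R d i y)" by (rule p(2))
  note w = weak_partial_AE[OF open_dom p(1)] weak_partial_L2[OF open_dom p(1) L2_of_add(1)[OF dom_sets p(3,4)]]
  show "has_weak_partial \<Omega> j (\<lambda>y. a i j y *\<^sub>R d i y) (weak_partial \<Omega> j (\<lambda>y. a i j y *\<^sub>R d i y))"
    "L2_fun \<Omega> (weak_partial \<Omega> j (\<lambda>y. a i j y *\<^sub>R d i y))"
    "L2_of \<Omega> (weak_partial \<Omega> j (\<lambda>y. a i j y *\<^sub>R d i y)) =
       L2_of \<Omega> (\<lambda>x. partial j (a i j) x *\<^sub>R d i x + a i j x *\<^sub>R weak_partial \<Omega> j (d i) x)"
    using w by auto
qed

text \<open>Weak derivatives are tested with real functions while \<zeta> is complex. The real inner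
  product separates into pairings with the real and the imaginary part of \<zeta>, each of which is
  a real test function.\<close>

lemma inner_weak_partial:
  assumes w: "has_weak_partial \<Omega> j f g" and f: "L2_fun \<Omega> f" and g: "L2_fun \<Omega> g" and t: "test_fun \<Omega> \<zeta>"
  shows "L2_of \<Omega> g \<bullet> L2_of \<Omega> \<zeta> = - (L2_of \<Omega> f \<bullet> L2_of \<Omega> (partial j \<zeta>))"
proof -
  have split: "L2_of \<Omega> k \<bullet> L2_of \<Omega> \<xi> = Re ((LINT x|lebesgue_on \<Omega>. Re (\<xi> x) *\<^sub>R k x)) + Im ((LINT x|lebesgue_on \<Omega>. Im (\<xi> x) *\<^sub>R k x))"
    if k: "L2_fun \<Omega> k" and t: "test_fun \<Omega> \<xi>" for k \<xi>
  proof -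
    have l: "locally_integrable \<Omega> k" by (rule L2_imp_locally_integrable[OF dom_sets k])
    note i1 = test_integrable[OF dom_sets test_fun_linear(1)[OF bounded_linear_Re t] l]
    note i2 = test_integrable[OF dom_sets test_fun_linear(1)[OF bounded_linear_Im t] l]
    have "L2_of \<Omega> k \<bullet> L2_of \<Omega> \<xi> = (LINT x|lebesgue_on \<Omega>. k x \<bullet> \<xi> x)"
      by (rule inner_L2_of[OF dom_sets k test_fun_L2[OF t dom_sets]])
    also have "\<dots> = (LINT x|lebesgue_on \<Omega>. Re (Re (\<xi> x) *\<^sub>R k x) + Im (Im (\<xi> x) *\<^sub>R k x))"
      by (simp add: inner_complex_def mult.commute)
    also have "\<dots> = (LINT x|lebesgue_on \<Omega>. Re (Re (\<xi> x) *\<^sub>R k x)) + (LINT x|lebesgue_on \<Omega>. Im (Im (\<xi> x) *\<^sub>R k x))"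
      by (rule Bochner_Integration.integral_add) (intro integrable_Re integrable_Im i1 i2)+
    also have "\<dots> = Re ((LINT x|lebesgue_on \<Omega>. Re (\<xi> x) *\<^sub>R k x)) + Im ((LINT x|lebesgue_on \<Omega>. Im (\<xi> x) *\<^sub>R k x))"
      using integral_Re[OF i1] integral_Im[OF i2] by simp
    finally show ?thesis .
  qed
  have wd: "(LINT x|lebesgue_on \<Omega>. \<xi> x *\<^sub>R g x) = - (LINT x|lebesgue_on \<Omega>. partial j \<xi> x *\<^sub>R f x)"
    if "test_fun \<Omega> \<xi>" for \<xi> :: "real^'d \<Rightarrow> real" using w that by (simp add: has_weak_partial_def)
  show ?thesis unfolding split[OF g t] split[OF f test_fun_partial[OF t]]
      wd[OF test_fun_linear(1)[OF bounded_linear_Re t]] wd[OF test_fun_linear(1)[OF bounded_linear_Im t]]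
      test_fun_linear(2)[OF bounded_linear_Re t] test_fun_linear(2)[OF bounded_linear_Im t] by simp
qed

lemma L2_of_sum:
  assumes "finite I" "\<And>i. i \<in> I \<Longrightarrow> L2_fun \<Omega> (f i)"
  shows "L2_fun \<Omega> (\<lambda>x. \<Sum>i\<in>I. f i x) \<and> L2_of \<Omega> (\<lambda>x. \<Sum>i\<in>I. f i x) = (\<Sum>i\<in>I. L2_of \<Omega> (f i))"
  using assms
proof (induction I rule: finite_induct)
  case empty
  have "L2_fun \<Omega> (\<lambda>_. 0)" by (rule L2_fun_UNIV_restrict[OF dom_sets L2_fun_zero])
  then show ?case using L2_of_scaleR(2)[OF dom_sets, of "\<lambda>_. 0" 0] by simp
next
  case (insert i I)
  then show ?case using L2_of_add[OF dom_sets, of "f i" "\<lambda>x. \<Sum>i\<in>I. f i x"] by simp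
qed

lemma c_term:
  assumes "L2_fun \<Omega> \<psi>"
  shows "L2_fun \<Omega> (\<lambda>x. c x *\<^sub>R \<psi> x)" "L2_of \<Omega> (\<lambda>x. c x *\<^sub>R \<psi> x) = mult_L2 \<Omega> c (L2_of \<Omega> \<psi>)"
  using c_bd L2_fun_mult_bounded(1)[OF dom_sets assms c_meas] mult_L2_of[OF dom_sets c_meas _ assms] by metis+

lemma da_meas: "partial j (a i j) \<in> borel_measurable (lebesgue_on \<Omega>)"
  by (rule C1_closure_bounded(3)[OF bounded_dom open_dom a_C1])

lemma da_bd: "\<exists>B. AE x in lebesgue_on \<Omega>. \<bar>partial j (a i j) x\<bar> \<le> B"
  by (rule bounded_AE[OF C1_closure_bounded(4)[OF bounded_dom open_dom a_C1]])

lemma bl_da: "bounded_linear (mult_L2 \<Omega> (partial j (a i j)))"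
  using da_bd bounded_linear_mult_L2[OF dom_sets da_meas] by blast

text \<open>The divergence form is the one to integrate by parts. The expanded form writes A through
  bounded operators applied to \<psi> and its first and second derivatives, from which continuity in
  time follows.\<close>

lemma elliptic_op_L2:
  assumes "\<psi> \<in> H2 \<Omega>"
  shows "L2_fun \<Omega> (elliptic_op \<Omega> a c \<psi>)"
    "L2_of \<Omega> (elliptic_op \<Omega> a c \<psi>) = - (\<Sum>i\<in>UNIV. \<Sum>j\<in>UNIV. L2_of \<Omega> (weak_partial \<Omega> j (\<lambda>y. a i j y *\<^sub>R weak_partial \<Omega> i \<psi> y)))
       + mult_L2 \<Omega> c (L2_of \<Omega> \<psi>)"
    "L2_of \<Omega> (elliptic_op \<Omega> a c \<psi>) = - (\<Sum>i\<in>UNIV. \<Sum>j\<in>UNIV. mult_L2 \<Omega> (partial j (a i j)) (L2_of \<Omega> (weak_partial \<Omega> i \<psi>))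
         + mult_L2 \<Omega> (a i j) (L2_of \<Omega> (weak_partial \<Omega> j (weak_partial \<Omega> i \<psi>))))
       + mult_L2 \<Omega> c (L2_of \<Omega> \<psi>)"
proof -
  note T = elliptic_term[OF assms]
  define g where "g i j = weak_partial \<Omega> j (\<lambda>y. a i j y *\<^sub>R weak_partial \<Omega> i \<psi> y)" for i j
  have g: "L2_fun \<Omega> (g i j)" for i j unfolding g_def by (rule T(2))
  have gi: "L2_fun \<Omega> (\<lambda>x. \<Sum>j\<in>UNIV. g i j x) \<and> L2_of \<Omega> (\<lambda>x. \<Sum>j\<in>UNIV. g i j x) = (\<Sum>j\<in>UNIV. L2_of \<Omega> (g i j))" for i
    by (rule L2_of_sum) (auto intro: g)
  have gg: "L2_fun \<Omega> (\<lambda>x. \<Sum>i\<in>UNIV. \<Sum>j\<in>UNIV. g i j x) \<and> L2_of \<Omega> (\<lambda>x. \<Sum>i\<in>UNIV. \<Sum>j\<in>UNIV. g i j x) = (\<Sum>i\<in>UNIV. L2_of \<Omega> (\<lambda>x. \<Sum>j\<in>UNIV. g i j x))"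
    by (rule L2_of_sum) (use gi in auto)
  have e: "elliptic_op \<Omega> a c \<psi> = (\<lambda>x. c x *\<^sub>R \<psi> x - (\<Sum>i\<in>UNIV. \<Sum>j\<in>UNIV. g i j x))"
    by (simp add: elliptic_op_def fun_eq_iff g_def)
  note D = L2_of_diff[OF dom_sets c_term(1)[OF T(5)] conjunct1[OF gg]]
  show "L2_fun \<Omega> (elliptic_op \<Omega> a c \<psi>)" unfolding e by (rule D)
  show 1: "L2_of \<Omega> (elliptic_op \<Omega> a c \<psi>) = - (\<Sum>i\<in>UNIV. \<Sum>j\<in>UNIV. L2_of \<Omega> (weak_partial \<Omega> j (\<lambda>y. a i j y *\<^sub>R weak_partial \<Omega> i \<psi> y)))
       + mult_L2 \<Omega> c (L2_of \<Omega> \<psi>)" unfolding e D(2) c_term(2)[OF T(5)] using gg gi by (simp add: g_def)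
  have "L2_of \<Omega> (weak_partial \<Omega> j (\<lambda>y. a i j y *\<^sub>R weak_partial \<Omega> i \<psi> y)) =
      mult_L2 \<Omega> (partial j (a i j)) (L2_of \<Omega> (weak_partial \<Omega> i \<psi>)) + mult_L2 \<Omega> (a i j) (L2_of \<Omega> (weak_partial \<Omega> j (weak_partial \<Omega> i \<psi>)))" for i j
  proof -
    obtain B B' where B: "AE x in lebesgue_on \<Omega>. \<bar>partial j (a i j) x\<bar> \<le> B" "AE x in lebesgue_on \<Omega>. \<bar>a i j x\<bar> \<le> B'"
      using da_bd a_bd by metis
    show ?thesis
      unfolding T(3) mult_L2_of[OF dom_sets da_meas B(1) T(6)] mult_L2_of[OF dom_sets a_meas B(2) T(7)]
      by (rule L2_of_add(2)[OF dom_sets L2_fun_mult_bounded(1)[OF dom_sets T(6) da_meas B(1)] L2_fun_mult_bounded(1)[OF dom_sets T(7) a_meas B(2)]])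
  qed
  with 1 show "L2_of \<Omega> (elliptic_op \<Omega> a c \<psi>) = - (\<Sum>i\<in>UNIV. \<Sum>j\<in>UNIV. mult_L2 \<Omega> (partial j (a i j)) (L2_of \<Omega> (weak_partial \<Omega> i \<psi>))
         + mult_L2 \<Omega> (a i j) (L2_of \<Omega> (weak_partial \<Omega> j (weak_partial \<Omega> i \<psi>))))
       + mult_L2 \<Omega> c (L2_of \<Omega> \<psi>)" by simp
qed

text \<open>Second weak derivatives are taken of a chosen representative of the first ones, so a
  change on a null set must not disturb them.\<close>

lemma has_weak_partial_cong_AE:
  assumes w: "has_weak_partial \<Omega> i f g" and ae: "AE x in lebesgue_on \<Omega>. f x = f' x" and l: "locally_integrable \<Omega> f'"
  shows "has_weak_partial \<Omega> i f' g"
  unfolding has_weak_partial_def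
proof (intro conjI allI impI l)
  show "locally_integrable \<Omega> g" using w by (simp add: has_weak_partial_def)
  have lf: "locally_integrable \<Omega> f" using w by (simp add: has_weak_partial_def)
  fix \<phi> :: "real^'d \<Rightarrow> real" assume t: "test_fun \<Omega> \<phi>"
  have "(LINT x|lebesgue_on \<Omega>. partial i \<phi> x *\<^sub>R f' x) = (LINT x|lebesgue_on \<Omega>. partial i \<phi> x *\<^sub>R f x)"
    by (rule integral_cong_AE)
       (use ae test_integrable[OF dom_sets test_fun_partial[OF t] l] test_integrable[OF dom_sets test_fun_partial[OF t] lf]
        in \<open>auto elim!: AE_mp dest: borel_measurable_integrable\<close>)
  then show "(LINT x|lebesgue_on \<Omega>. partial i \<phi> x *\<^sub>R f' x) = - (LINT x|lebesgue_on \<Omega>. \<phi> x *\<^sub>R g x)"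
    using w t by (simp add: has_weak_partial_def)
qed

lemma weak_partial_diff:
  assumes w: "has_weak_partial \<Omega> i f g" "has_weak_partial \<Omega> i f' g'" and g: "L2_fun \<Omega> g" "L2_fun \<Omega> g'"
  shows "has_weak_partial \<Omega> i (\<lambda>x. f x - f' x) (\<lambda>x. g x - g' x)"
    "L2_of \<Omega> (weak_partial \<Omega> i (\<lambda>x. f x - f' x)) = L2_of \<Omega> g - L2_of \<Omega> g'"
proof -
  show *: "has_weak_partial \<Omega> i (\<lambda>x. f x - f' x) (\<lambda>x. g x - g' x)"
    using has_weak_partial_lincomb[OF dom_sets w, of "-1"] by simp
  show "L2_of \<Omega> (weak_partial \<Omega> i (\<lambda>x. f x - f' x)) = L2_of \<Omega> g - L2_of \<Omega> g'"
    using weak_partial_L2(2)[OF open_dom *] L2_of_diff[OF dom_sets g] by simp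
qed

text \<open>The norm of a difference involves the chosen weak derivatives of that difference; their
  classes are the differences of the classes.\<close>

lemma H1_norm_diff_bounds:
  assumes "L2_fun \<Omega> f" "L2_fun \<Omega> f'" "\<And>i. has_weak_partial \<Omega> i f (g i)" "\<And>i. has_weak_partial \<Omega> i f' (g' i)"
    "\<And>i. L2_fun \<Omega> (g i)" "\<And>i. L2_fun \<Omega> (g' i)"
  shows "norm (L2_of \<Omega> f - L2_of \<Omega> f') \<le> H1_norm \<Omega> (\<lambda>x. f x - f' x)"
    "norm (L2_of \<Omega> (g i) - L2_of \<Omega> (g' i)) \<le> H1_norm \<Omega> (\<lambda>x. f x - f' x)"
proof -
  have e: "H1_norm \<Omega> (\<lambda>x. f x - f' x) = sqrt ((norm (L2_of \<Omega> f - L2_of \<Omega> f'))\<^sup>2 + (\<Sum>i\<in>UNIV. (norm (L2_of \<Omega> (g i) - L2_of \<Omega> (g' i)))\<^sup>2))"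
    unfolding H1_norm_def using weak_partial_diff(2)[OF assms(3,4,5,6)] L2_of_diff(2)[OF dom_sets assms(1,2)] by simp
  show "norm (L2_of \<Omega> f - L2_of \<Omega> f') \<le> H1_norm \<Omega> (\<lambda>x. f x - f' x)"
    unfolding e by (rule real_le_rsqrt) (simp add: sum_nonneg)
  have "(norm (L2_of \<Omega> (g i) - L2_of \<Omega> (g' i)))\<^sup>2 \<le> (\<Sum>i\<in>UNIV. (norm (L2_of \<Omega> (g i) - L2_of \<Omega> (g' i)))\<^sup>2)"
    by (rule member_le_sum) auto
  then show "norm (L2_of \<Omega> (g i) - L2_of \<Omega> (g' i)) \<le> H1_norm \<Omega> (\<lambda>x. f x - f' x)"
    unfolding e by (intro real_le_rsqrt) (simp add: add_increasing)
qed

lemma H2_norm_diff_bounds: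
  assumes "\<psi> \<in> H2 \<Omega>" "\<psi>' \<in> H2 \<Omega>"
  shows "norm (L2_of \<Omega> \<psi> - L2_of \<Omega> \<psi>') \<le> H2_norm \<Omega> (\<lambda>x. \<psi> x - \<psi>' x)"
    "norm (L2_of \<Omega> (weak_partial \<Omega> i \<psi>) - L2_of \<Omega> (weak_partial \<Omega> i \<psi>')) \<le> H2_norm \<Omega> (\<lambda>x. \<psi> x - \<psi>' x)"
    "norm (L2_of \<Omega> (weak_partial \<Omega> j (weak_partial \<Omega> i \<psi>)) - L2_of \<Omega> (weak_partial \<Omega> j (weak_partial \<Omega> i \<psi>'))) \<le> H2_norm \<Omega> (\<lambda>x. \<psi> x - \<psi>' x)"
proof -
  note T = elliptic_term[OF assms(1)] and T' = elliptic_term[OF assms(2)]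
  let ?d = "\<lambda>i. weak_partial \<Omega> i (\<lambda>x. \<psi> x - \<psi>' x)"
  note D1 = weak_partial_diff[OF T(8) T'(8) T(6) T'(6)]
  have D2: "L2_of \<Omega> (weak_partial \<Omega> j (?d i)) = L2_of \<Omega> (weak_partial \<Omega> j (weak_partial \<Omega> i \<psi>)) - L2_of \<Omega> (weak_partial \<Omega> j (weak_partial \<Omega> i \<psi>'))" for i j
  proof -
    note w2 = weak_partial_diff(1)[OF T(9) T'(9) T(7) T'(7), of j i i]
    have ae: "AE x in lebesgue_on \<Omega>. weak_partial \<Omega> i \<psi> x - weak_partial \<Omega> i \<psi>' x = ?d i x"
      by (rule weak_partial_AE(2)[OF open_dom D1(1)])
    have "L2_fun \<Omega> (?d i)" by (rule weak_partial_L2(1)[OF open_dom D1(1) L2_of_diff(1)[OF dom_sets T(6) T'(6)]])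
    then have "has_weak_partial \<Omega> j (?d i) (\<lambda>x. weak_partial \<Omega> j (weak_partial \<Omega> i \<psi>) x - weak_partial \<Omega> j (weak_partial \<Omega> i \<psi>') x)"
      by (intro has_weak_partial_cong_AE[OF w2 ae] L2_imp_locally_integrable dom_sets)
    from weak_partial_L2(2)[OF open_dom this L2_of_diff(1)[OF dom_sets T(7) T'(7)]] show ?thesis
      by (simp add: L2_of_diff(2)[OF dom_sets T(7) T'(7)])
  qed
  define p where "p = norm (L2_of \<Omega> \<psi> - L2_of \<Omega> \<psi>')"
  define f where "f i = norm (L2_of \<Omega> (weak_partial \<Omega> i \<psi>) - L2_of \<Omega> (weak_partial \<Omega> i \<psi>'))" for i
  define s where "s i j = norm (L2_of \<Omega> (weak_partial \<Omega> j (weak_partial \<Omega> i \<psi>)) - L2_of \<Omega> (weak_partial \<Omega> j (weak_partial \<Omega> i \<psi>')))" for i j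
  have e: "H2_norm \<Omega> (\<lambda>x. \<psi> x - \<psi>' x) = sqrt (p\<^sup>2 + (\<Sum>i\<in>UNIV. (f i)\<^sup>2) + (\<Sum>i\<in>UNIV. \<Sum>j\<in>UNIV. (s i j)\<^sup>2))"
    unfolding H2_norm_def p_def f_def s_def D2 D1(2) L2_of_diff(2)[OF dom_sets T(5) T'(5)] ..
  have n: "0 \<le> (\<Sum>i\<in>UNIV. (f i)\<^sup>2)" "0 \<le> (\<Sum>i\<in>UNIV. \<Sum>j\<in>UNIV. (s i j)\<^sup>2)" "0 \<le> p\<^sup>2"
    by (auto intro!: sum_nonneg)
  have fi: "(f i)\<^sup>2 \<le> (\<Sum>i\<in>UNIV. (f i)\<^sup>2)" by (rule member_le_sum) auto
  have "(s i j)\<^sup>2 \<le> (\<Sum>j\<in>UNIV. (s i j)\<^sup>2)" by (rule member_le_sum) auto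
  also have "\<dots> \<le> (\<Sum>i\<in>UNIV. \<Sum>j\<in>UNIV. (s i j)\<^sup>2)" by (rule member_le_sum) (auto intro: sum_nonneg)
  finally have si: "(s i j)\<^sup>2 \<le> (\<Sum>i\<in>UNIV. \<Sum>j\<in>UNIV. (s i j)\<^sup>2)" .
  have "p \<le> H2_norm \<Omega> (\<lambda>x. \<psi> x - \<psi>' x)" "f i \<le> H2_norm \<Omega> (\<lambda>x. \<psi> x - \<psi>' x)" "s i j \<le> H2_norm \<Omega> (\<lambda>x. \<psi> x - \<psi>' x)"
    unfolding e by (intro real_le_rsqrt; use n fi si in linarith)+
  then show "norm (L2_of \<Omega> \<psi> - L2_of \<Omega> \<psi>') \<le> H2_norm \<Omega> (\<lambda>x. \<psi> x - \<psi>' x)"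
    "norm (L2_of \<Omega> (weak_partial \<Omega> i \<psi>) - L2_of \<Omega> (weak_partial \<Omega> i \<psi>')) \<le> H2_norm \<Omega> (\<lambda>x. \<psi> x - \<psi>' x)"
    "norm (L2_of \<Omega> (weak_partial \<Omega> j (weak_partial \<Omega> i \<psi>)) - L2_of \<Omega> (weak_partial \<Omega> j (weak_partial \<Omega> i \<psi>'))) \<le> H2_norm \<Omega> (\<lambda>x. \<psi> x - \<psi>' x)"
    by (simp_all add: p_def f_def s_def)
qed

text \<open>Every derivative up to order two is controlled by \<open>H2_norm\<close>, and A combines
  these derivatives through bounded operators.\<close>

lemma continuous_into_H2_H10_L2:
  assumes "continuous_into_H2_H10 \<Omega> I v"
  shows "continuous_on I (\<lambda>t. L2_of \<Omega> (v t))" "continuous_on I (\<lambda>t. L2_of \<Omega> (elliptic_op \<Omega> a c (v t)))"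
proof -
  have h: "v t \<in> H2 \<Omega>" if "t \<in> I" for t using assms that by (auto simp: continuous_into_H2_H10_def)
  have lim: "(F \<longlongrightarrow> F t) (at t within I)"
    if t: "t \<in> I" and b: "\<And>r. r \<in> I \<Longrightarrow> norm (F r - F t) \<le> H2_norm \<Omega> (\<lambda>x. v r x - v t x)" for t and F :: "real \<Rightarrow> (real^'d) L2"
  proof -
    have "((\<lambda>r. H2_norm \<Omega> (\<lambda>x. v r x - v t x)) \<longlongrightarrow> 0) (at t within I)"
      using assms t by (auto simp: continuous_into_H2_H10_def)
    then have "((\<lambda>r. F r - F t) \<longlongrightarrow> 0) (at t within I)"
      by (rule Lim_null_comparison[rotated]) (use b in \<open>auto simp: eventually_at_filter\<close>)
    then show ?thesis by (rule LIM_zero_cancel)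
  qed
  have l0: "((\<lambda>r. L2_of \<Omega> (v r)) \<longlongrightarrow> L2_of \<Omega> (v t)) (at t within I)" if "t \<in> I" for t
    by (rule lim[OF that]) (intro H2_norm_diff_bounds h that)
  have l1: "((\<lambda>r. L2_of \<Omega> (weak_partial \<Omega> i (v r))) \<longlongrightarrow> L2_of \<Omega> (weak_partial \<Omega> i (v t))) (at t within I)" if "t \<in> I" for t i
    by (rule lim[OF that]) (intro H2_norm_diff_bounds h that)
  have l2: "((\<lambda>r. L2_of \<Omega> (weak_partial \<Omega> j (weak_partial \<Omega> i (v r)))) \<longlongrightarrow> L2_of \<Omega> (weak_partial \<Omega> j (weak_partial \<Omega> i (v t)))) (at t within I)" if "t \<in> I" for t i j
    by (rule lim[OF that]) (intro H2_norm_diff_bounds h that)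
  show c0: "continuous_on I (\<lambda>t. L2_of \<Omega> (v t))" using l0 by (simp add: continuous_on_def)
  have c1: "continuous_on I (\<lambda>t. L2_of \<Omega> (weak_partial \<Omega> i (v t)))" for i using l1 by (simp add: continuous_on_def)
  have c2: "continuous_on I (\<lambda>t. L2_of \<Omega> (weak_partial \<Omega> j (weak_partial \<Omega> i (v t))))" for i j using l2 by (simp add: continuous_on_def)
  have "continuous_on I (\<lambda>t. - (\<Sum>i\<in>UNIV. \<Sum>j\<in>UNIV. mult_L2 \<Omega> (partial j (a i j)) (L2_of \<Omega> (weak_partial \<Omega> i (v t)))
         + mult_L2 \<Omega> (a i j) (L2_of \<Omega> (weak_partial \<Omega> j (weak_partial \<Omega> i (v t)))))
       + mult_L2 \<Omega> c (L2_of \<Omega> (v t)))"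
    by (intro continuous_intros bounded_linear.continuous_on[OF bl_da] bounded_linear.continuous_on[OF bl_a] bounded_linear.continuous_on[OF bl_c] c0 c1 c2)
  then show "continuous_on I (\<lambda>t. L2_of \<Omega> (elliptic_op \<Omega> a c (v t)))"
    by (rule continuous_on_eq) (use elliptic_op_L2(3)[OF h] in auto)
qed

text \<open>Membership in \<open>H10\<close> supplies approximating test functions with
  \<open>H1_norm\<close> error below 1/(n+1); integrating the divergence term by parts against a
  test function produces the form.\<close>

lemma elliptic_op_in_weak_graph:
  assumes "\<psi> \<in> H2 \<Omega> \<inter> H10 \<Omega>"
  shows "(L2_of \<Omega> \<psi>, L2_of \<Omega> (elliptic_op \<Omega> a c \<psi>)) \<in> weak_graph \<Omega> a c"
proof -
  have h: "\<psi> \<in> H2 \<Omega>" "\<psi> \<in> H10 \<Omega>" using assms by auto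
  note T = elliptic_term[OF h(1)]
  have "\<exists>\<phi>. test_fun \<Omega> \<phi> \<and> H1_norm \<Omega> (\<lambda>x. \<psi> x - \<phi> x) < 1 / real (Suc n)" for n
    using h(2) unfolding H10_def by simp
  then obtain \<phi> where \<phi>: "\<And>n. test_fun \<Omega> (\<phi> n)" "\<And>n. H1_norm \<Omega> (\<lambda>x. \<psi> x - \<phi> n x) < 1 / real (Suc n)"
    by metis
  note L = test_fun_L2[OF \<phi>(1) dom_sets] test_fun_L2[OF test_fun_partial[OF \<phi>(1)] dom_sets]
  have b: "norm (L2_of \<Omega> \<psi> - L2_of \<Omega> (\<phi> n)) \<le> H1_norm \<Omega> (\<lambda>x. \<psi> x - \<phi> n x)"
    "norm (L2_of \<Omega> (weak_partial \<Omega> i \<psi>) - L2_of \<Omega> (partial i (\<phi> n))) \<le> H1_norm \<Omega> (\<lambda>x. \<psi> x - \<phi> n x)" for n i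
    by (rule H1_norm_diff_bounds[OF T(5) L(1) T(8) test_fun_weak_partial[OF dom_sets \<phi>(1)] T(6) L(2)])+
  have lim: "F \<longlonglongrightarrow> X" if "\<And>n. norm (X - F n) \<le> H1_norm \<Omega> (\<lambda>x. \<psi> x - \<phi> n x)" for F :: "nat \<Rightarrow> (real^'d) L2" and X
  proof -
    have "(\<lambda>n. F n - X) \<longlonglongrightarrow> 0"
    proof (rule Lim_null_comparison)
      show "(\<lambda>n. 1 / real (Suc n)) \<longlonglongrightarrow> 0" by (rule LIMSEQ_Suc[OF lim_1_over_n])
      show "\<forall>\<^sub>F n in sequentially. norm (F n - X) \<le> 1 / real (Suc n)"
        by (intro always_eventually allI) (metis \<phi>(2) norm_minus_commute less_imp_le order.trans that)
    qed
    then show ?thesis by (rule LIM_zero_cancel)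
  qed
  have id: "L2_of \<Omega> (elliptic_op \<Omega> a c \<psi>) \<bullet> L2_of \<Omega> \<zeta> =
        elliptic_form \<Omega> a c (L2_of \<Omega> \<psi>) (\<lambda>i. L2_of \<Omega> (weak_partial \<Omega> i \<psi>)) (L2_of \<Omega> \<zeta>) (\<lambda>i. L2_of \<Omega> (partial i \<zeta>))"
    if t: "test_fun \<Omega> \<zeta>" for \<zeta>
  proof -
    have "L2_of \<Omega> (weak_partial \<Omega> j (\<lambda>y. a i j y *\<^sub>R weak_partial \<Omega> i \<psi> y)) \<bullet> L2_of \<Omega> \<zeta>
       = - (mult_L2 \<Omega> (a i j) (L2_of \<Omega> (weak_partial \<Omega> i \<psi>)) \<bullet> L2_of \<Omega> (partial j \<zeta>))" for i j
    proof -
      obtain B where B: "AE x in lebesgue_on \<Omega>. \<bar>a i j x\<bar> \<le> B" using a_bd by metis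
      show ?thesis
        unfolding mult_L2_of[OF dom_sets a_meas B T(6)] by (rule inner_weak_partial[OF T(1) T(4) T(2) t])
    qed
    then show ?thesis unfolding elliptic_op_L2(2)[OF h(1)] elliptic_form_def
      by (simp add: inner_diff_left inner_sum_left sum_negf)
  qed
  show ?thesis unfolding weak_graph_def mem_Collect_eq prod.case
    by (rule exI[of _ "\<lambda>i. L2_of \<Omega> (weak_partial \<Omega> i \<psi>)"], rule exI[of _ \<phi>])
       (intro conjI allI impI \<phi>(1) lim b id)
qed

end

subsection \<open>Closed accretive graphs\<close>

text \<open>The Riemann sums of a tagged division lie in S, and the integral is their limit.\<close>

lemma has_integral_in_closed_subspace:
  fixes f :: "real \<Rightarrow> 'b::real_normed_vector"
  assumes S: "subspace S" "closed S" and f: "(f has_integral y) {a..b}" and m: "\<And>t. t \<in> {a..b} \<Longrightarrow> f t \<in> S"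
  shows "y \<in> S"
proof -
  have "y \<in> closure S" unfolding closure_approachable
  proof (intro allI impI)
    fix e :: real assume "e > 0"
    then obtain \<gamma> where \<gamma>: "gauge \<gamma>" "\<And>\<D>. \<D> tagged_division_of (cbox a b) \<and> \<gamma> fine \<D> \<Longrightarrow> norm ((\<Sum>(x, k)\<in>\<D>. measure lborel k *\<^sub>R f x) - y) < e"
      using f[folded cbox_interval, unfolded has_integral] by meson
    obtain \<D> where D: "\<D> tagged_division_of (cbox a b)" "\<gamma> fine \<D>"
      using fine_division_exists[OF \<gamma>(1)] by blast
    have "(\<Sum>(x, k)\<in>\<D>. measure lborel k *\<^sub>R f x) \<in> S"
    proof (rule subspace_sum[OF S(1)])
      fix p assume p: "p \<in> \<D>"
      obtain x k where xk: "p = (x, k)" by fastforce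
      then have "x \<in> cbox a b" using tagged_division_ofD(2,3)[OF D(1)] p by blast
      then have "f x \<in> S" by (intro m) (simp add: cbox_interval)
      then show "(case p of (x, k) \<Rightarrow> measure lborel k *\<^sub>R f x) \<in> S" using S(1) by (simp add: xk subspace_scale)
    qed
    then show "\<exists>x\<in>S. dist x y < e" using \<gamma>(2)[of \<D>] D by (auto simp: dist_norm)
  qed
  then show ?thesis using S(2) by simp
qed

abbreviation laplace_upto :: "real \<Rightarrow> (real \<Rightarrow> 'h::real_normed_vector) \<Rightarrow> real \<Rightarrow> 'h" where
  "laplace_upto T F s \<equiv> integral {0..T} (\<lambda>t. exp (- s * t) *\<^sub>R F t)"

text \<open>A linear relation instead of an operator, so that the closure of any accretive linear
  graph is an instance.\<close>

locale accretive_graph =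
  fixes G :: "('h::{real_inner,banach} \<times> 'h) set"
  assumes subspace: "subspace G" and closed: "closed G"
    and accretive: "\<And>x y. (x, y) \<in> G \<Longrightarrow> 0 \<le> x \<bullet> y"
begin

text \<open>Pair p x + y with x: accretivity discards the term with y, and Cauchy-Schwarz leaves one
  factor norm x to cancel.\<close>

lemma resolvent_bound:
  assumes "(x, y) \<in> G" "p \<ge> 0"
  shows "p * norm x \<le> norm (p *\<^sub>R x + y)"
proof (cases "x = 0")
  case False
  have "p * norm x * norm x \<le> (p *\<^sub>R x + y) \<bullet> x" using accretive[OF assms(1)]
    by (simp add: inner_add_left inner_commute[of y] dot_square_norm power2_eq_square)
  also have "\<dots> \<le> norm (p *\<^sub>R x + y) * norm x" by (rule norm_cauchy_schwarz)
  finally show ?thesis using False by simp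
qed simp

lemma graph_lincomb: "(x, y) \<in> G \<Longrightarrow> (x', y') \<in> G \<Longrightarrow> (x + r *\<^sub>R x', y + r *\<^sub>R y') \<in> G"
  using subspace_add[OF subspace, of "(x, y)" "r *\<^sub>R (x', y')"] subspace_scale[OF subspace, of "(x', y')" r] by simp

lemma graph_zero: "(0, 0) \<in> G" using subspace_0[OF subspace] by (simp add: zero_prod_def)

lemma graph_limit:
  assumes "\<And>n. (X n, Y n) \<in> G" "X \<longlonglongrightarrow> x" "Y \<longlonglongrightarrow> y"
  shows "(x, y) \<in> G"
  using closed_sequentially[OF closed, of "\<lambda>n. (X n, Y n)" "(x, y)"] assms tendsto_Pair by blast

text \<open>A closed operator commutes with the integral: the curve of pairs is integrated in the
  product space.\<close>

lemma graph_integral: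
  fixes f g :: "real \<Rightarrow> 'h"
  assumes f: "(f has_integral x) {a..b}" and g: "(g has_integral y) {a..b}"
    and m: "\<And>t. t \<in> {a..b} \<Longrightarrow> (f t, g t) \<in> G"
  shows "(x, y) \<in> G"
proof -
  have bl: "bounded_linear (\<lambda>x. (x, 0))" "bounded_linear (\<lambda>y. (0, y))"
    by (auto intro: bounded_linear_Pair bounded_linear_ident bounded_linear_zero)
  have "((\<lambda>t. (f t, 0) + (0, g t)) has_integral (x, 0) + (0, y)) {a..b}"
    using has_integral_add[OF has_integral_linear[OF f bl(1)] has_integral_linear[OF g bl(2)]] by (simp add: o_def)
  then have "((\<lambda>t. (f t, g t)) has_integral (x, y)) {a..b}" by simp
  from has_integral_in_closed_subspace[OF subspace closed this m] show ?thesis .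
qed

end

text \<open>Solutions are not constrained at time \<open>0\<close>; their value there is replaced by the limit.\<close>

definition extend0 :: "'h \<Rightarrow> (real \<Rightarrow> 'h) \<Rightarrow> real \<Rightarrow> 'h" where
  "extend0 u0 u t = (if t \<le> 0 then u0 else u t)"

text \<open>At 0 the filter within I is finer than the right-hand one, because I lies in the
  nonnegative axis; near t > 0 the replaced values are out of sight.\<close>

lemma continuous_extend0:
  fixes u :: "real \<Rightarrow> 'h::topological_space"
  assumes c: "continuous_on (I \<inter> {0<..}) u" and l: "(u \<longlongrightarrow> u0) (at_right 0)" and I: "I \<subseteq> {0..}"
  shows "continuous_on I (extend0 u0 u)"
proof (rule continuous_on_eq_continuous_within[THEN iffD2], rule ballI)
  fix t assume t: "t \<in> I"
  show "continuous (at t within I) (extend0 u0 u)"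
  proof (cases "t = 0")
    case True
    have "(extend0 u0 u \<longlongrightarrow> u0) (at_right 0)"
      by (rule Lim_transform_eventually[OF l]) (auto simp: extend0_def eventually_at_filter)
    moreover have "at 0 within I \<le> at_right 0"
    proof -
      have "at 0 within I = at 0 within (I - {0})" by (simp add: at_within_def)
      also have "\<dots> \<le> at_right 0" by (rule at_le) (use I in force)
      finally show ?thesis .
    qed
    ultimately show ?thesis unfolding True continuous_within
      using tendsto_mono by (simp add: extend0_def) blast
  next
    case False
    then have t0: "t > 0" using t I by auto
    have "continuous (at t within (I \<inter> {0<..})) u"
      using c t t0 by (simp add: continuous_on_eq_continuous_within)
    then have "(u \<longlongrightarrow> u t) (at t within I)"
    proof -
      assume "continuous (at t within (I \<inter> {0<..})) u"
      moreover have "at t within (I \<inter> {0<..}) = at t within I"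
        by (rule at_within_nhd[of t "{0<..}"]) (use t0 in auto)
      ultimately show ?thesis by (simp add: continuous_within)
    qed
    then have "(extend0 u0 u \<longlongrightarrow> u t) (at t within I)"
    proof (rule Lim_transform_eventually)
      have "eventually (\<lambda>x. x \<in> {0<..}) (nhds t)" using t0 by (intro eventually_nhds_in_open) auto
      then show "\<forall>\<^sub>F x in at t within I. u x = extend0 u0 u x"
        unfolding eventually_at_filter by eventually_elim (auto simp: extend0_def)
    qed
    then show ?thesis using t0 by (simp add: continuous_within extend0_def)
  qed
qed

section \<open>Transforms of the heat and of the fractional solution in an accretive graph\<close>

context accretive_graph
begin

text \<open>The squared norm has derivative -2 W \<bullet> D \<le> 0. This gives monotonicity on
  (0,t]; the comparison with u0 is the limit of the left end point.\<close>

lemma heat_norm_bound: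
  assumes d: "\<And>t. t > 0 \<Longrightarrow> (W has_vector_derivative - D t) (at t)" and g: "\<And>t. t > 0 \<Longrightarrow> (W t, D t) \<in> G"
    and l: "(W \<longlongrightarrow> u0) (at_right 0)" and t: "t > 0"
  shows "norm (W t) \<le> norm u0"
proof -
  have "norm (W t) \<le> norm (W r)" if r: "0 < r" "r \<le> t" for r
  proof -
    have "(norm (W t))\<^sup>2 \<le> (norm (W r))\<^sup>2"
    proof (rule DERIV_nonpos_imp_nonincreasing[OF r(2)])
      fix x assume x: "r \<le> x" "x \<le> t"
      then have x0: "x > 0" using r by simp
      have "((\<lambda>t. W t \<bullet> W t) has_derivative (\<lambda>h. W x \<bullet> (h *\<^sub>R - D x) + (h *\<^sub>R - D x) \<bullet> W x)) (at x)"
        using d[OF x0] unfolding has_vector_derivative_def by (intro has_derivative_inner)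
      then have "((\<lambda>t. (norm (W t))\<^sup>2) has_real_derivative - 2 * (W x \<bullet> D x)) (at x)"
        unfolding has_field_derivative_def power2_norm_eq_inner
        by (rule has_derivative_eq_rhs) (auto simp: inner_commute)
      then show "\<exists>y. ((\<lambda>a. (norm (W a))\<^sup>2) has_real_derivative y) (at x) \<and> y \<le> 0"
        using accretive[OF g[OF x0]] by (intro exI[of _ "- 2 * (W x \<bullet> D x)"]) auto
    qed
    then show ?thesis by (simp add: abs_le_square_iff[symmetric])
  qed
  then have "\<forall>\<^sub>F r in at_right 0. norm (W t) \<le> norm (W r)"
    using t by (auto simp: eventually_at_right_field intro!: exI[of _ t])
  then show ?thesis by (intro tendsto_lowerbound[OF tendsto_norm[OF l]]) auto
qed

text \<open>Integration by parts of exp(-p t) W on (0,N): the second component is the integral of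
  exp(-p t) D. Although D may be unbounded near 0, the gauge integral of a derivative only asks for
  continuity of the primitive at the end points.\<close>

lemma heat_resolvent:
  fixes p :: real
  assumes d: "\<And>t. t > 0 \<Longrightarrow> (W has_vector_derivative - D t) (at t)" and g: "\<And>t. t > 0 \<Longrightarrow> (W t, D t) \<in> G"
    and l: "(W \<longlongrightarrow> u0) (at_right 0)" and N: "N > 0"
  defines "I \<equiv> laplace_upto N (extend0 u0 W) p"
  shows "(I, u0 - exp (- p * N) *\<^sub>R W N - p *\<^sub>R I) \<in> G"
proof -
  have c: "continuous_on {0<..} W"
    using d by (auto simp: continuous_on_eq_continuous_at intro!: has_vector_derivative_continuous)
  have cW: "continuous_on {0..N} (extend0 u0 W)"
    by (rule continuous_extend0[OF continuous_on_subset[OF c] l]) auto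
  let ?h = "\<lambda>\<tau>. exp (- p * \<tau>) *\<^sub>R extend0 u0 W \<tau>"
  \<comment> \<open>The value at time 0 does not influence the integral; 0 is chosen so that the
    pair at time 0 is (0,0), which lies in G.\<close>
  let ?h' = "\<lambda>\<tau>. if \<tau> \<le> 0 then 0 else - (p * exp (- p * \<tau>)) *\<^sub>R W \<tau> - exp (- p * \<tau>) *\<^sub>R D \<tau>"
  have ch: "continuous_on {0..N} ?h" by (intro continuous_intros cW)
  have 1: "(?h' has_integral ?h N - ?h 0) {0..N}"
  proof (rule fundamental_theorem_of_calculus_interior)
    fix x assume x: "x \<in> {0<..<N}"
    have "((\<lambda>\<tau>. exp (- p * \<tau>) *\<^sub>R W \<tau>) has_vector_derivative (exp (- p * x) *\<^sub>R (- D x) + (exp (- p * x) * - p) *\<^sub>R W x)) (at x)"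
      by (rule has_vector_derivative_scaleR) (use d[of x] x in \<open>auto intro!: derivative_eq_intros\<close>)
    then have "(?h has_vector_derivative (exp (- p * x) *\<^sub>R (- D x) + (exp (- p * x) * - p) *\<^sub>R W x)) (at x)"
      by (rule has_vector_derivative_transform_within_open[of _ _ _ "{0<..}"]) (use x in \<open>auto simp: extend0_def\<close>)
    then show "(?h has_vector_derivative ?h' x) (at x)"
      by (rule has_vector_derivative_eq_rhs) (use x in \<open>simp add: algebra_simps\<close>)
  qed (use N ch in auto)
  have 2: "(?h has_integral I) {0..N}" unfolding I_def by (intro integrable_integral integrable_continuous_interval ch)
  have 3: "((\<lambda>\<tau>. if \<tau> \<le> 0 then 0 else exp (- p * \<tau>) *\<^sub>R W \<tau>) has_integral I) {0..N}"
    by (rule has_integral_spike_finite[OF _ _ 2, of "{0}"]) (auto simp: extend0_def)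
  have 4: "((\<lambda>\<tau>. - ?h' \<tau> - p *\<^sub>R (if \<tau> \<le> 0 then 0 else exp (- p * \<tau>) *\<^sub>R W \<tau>)) has_integral (- (?h N - ?h 0) - p *\<^sub>R I)) {0..N}"
    by (intro has_integral_diff has_integral_neg has_integral_cmul 1 3)
  have "(I, - (?h N - ?h 0) - p *\<^sub>R I) \<in> G"
  proof (rule graph_integral[OF 3 4])
    fix t assume "t \<in> {0..N}"
    then show "(if t \<le> 0 then 0 else exp (- p * t) *\<^sub>R W t, - ?h' t - p *\<^sub>R (if t \<le> 0 then 0 else exp (- p * t) *\<^sub>R W t)) \<in> G"
      using subspace_scale[OF subspace g[of t], of "exp (- p * t)"] graph_zero by (auto simp: zero_prod_def)
  qed
  then show ?thesis using N by (simp add: extend0_def algebra_simps)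
qed

text \<open>B may fail to be integrable at 0, so its transform is obtained as a limit of integrals
  over [e,T]. The scalar functions n \<phi> are the antiderivatives of -B \<bullet> \<phi> that
  vanish at 0; in the application they are the tested Riemann-Liouville integrals of U - u0. Their
  bound by norm \<phi> times \<nu> is uniform in \<phi>, which makes the truncated integrals Cauchy
  in norm, and closedness keeps the limit pair in G.\<close>

lemma frac_resolvent:
  fixes n :: "'h \<Rightarrow> real \<Rightarrow> real" and \<nu> :: "real \<Rightarrow> real"
  assumes T: "T > 0" and cU: "continuous_on {0<..T} U" and lU: "(U \<longlongrightarrow> u0) (at_right 0)"
    and cB: "continuous_on {0<..T} B" and g: "\<And>t. t \<in> {0<..T} \<Longrightarrow> (U t, B t) \<in> G"
    and n: "\<And>\<phi> e t. 0 < e \<Longrightarrow> e \<le> t \<Longrightarrow> t \<le> T \<Longrightarrow> n \<phi> t - n \<phi> e = - integral {e..t} (\<lambda>r. B r \<bullet> \<phi>)"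
    and n0: "\<And>\<phi>. n \<phi> 0 = 0" and b: "\<And>\<phi> t. t \<in> {0..T} \<Longrightarrow> \<bar>n \<phi> t\<bar> \<le> norm \<phi> * \<nu> t"
    and \<nu>: "\<And>x y. 0 \<le> x \<Longrightarrow> x \<le> y \<Longrightarrow> \<nu> x \<le> \<nu> y" "(\<nu> \<longlongrightarrow> 0) (at_right 0)" "\<nu> 0 = 0" and s: "s > 0"
  defines "X \<equiv> laplace_upto T (extend0 u0 U) s"
  shows "\<exists>Y. (X, Y) \<in> G \<and> (\<forall>\<phi>. Y \<bullet> \<phi> = - exp (- s * T) * n \<phi> T - s * integral {0..T} (\<lambda>t. exp (- s * t) * n \<phi> t))"
proof -
  have \<nu>0: "\<nu> x \<ge> 0" if "x \<in> {0..T}" for x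
  proof -
    show ?thesis using \<nu>(1)[of 0 x] \<nu>(3) that by simp
  qed
  have cn': "continuous_on {0<..T} (n \<phi>)" and dn: "\<And>t e. 0 < e \<Longrightarrow> t \<in> {e..T} \<Longrightarrow> (n \<phi> has_vector_derivative - (B t \<bullet> \<phi>)) (at t within {e..T})" for \<phi>
  proof -
    show dn: "(n \<phi> has_vector_derivative - (B t \<bullet> \<phi>)) (at t within {e..T})" if e: "0 < e" "t \<in> {e..T}" for t e
    proof -
      have "((\<lambda>u. integral {e..u} (\<lambda>r. B r \<bullet> \<phi>)) has_vector_derivative B t \<bullet> \<phi>) (at t within {e..T})"
        by (rule integral_has_vector_derivative[OF _ e(2)])
           (use e in \<open>auto intro!: continuous_intros continuous_on_subset[OF cB]\<close>)
      then have "((\<lambda>u. n \<phi> e - integral {e..u} (\<lambda>r. B r \<bullet> \<phi>)) has_vector_derivative 0 - B t \<bullet> \<phi>) (at t within {e..T})"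
        by (intro has_vector_derivative_diff has_vector_derivative_const)
      then have "((\<lambda>u. n \<phi> e - integral {e..u} (\<lambda>r. B r \<bullet> \<phi>)) has_vector_derivative - (B t \<bullet> \<phi>)) (at t within {e..T})" by simp
      then show ?thesis
      proof (rule has_vector_derivative_transform[OF e(2), rotated])
        show "n \<phi> u = n \<phi> e - integral {e..u} (\<lambda>r. B r \<bullet> \<phi>)" if "u \<in> {e..T}" for u
          using n[of e u \<phi>] that e by simp
      qed
    qed
    show "continuous_on {0<..T} (n \<phi>)" unfolding continuous_on_eq_continuous_within
    proof
      fix t assume t: "t \<in> {0<..T}"
      have "continuous (at t within {t/2..T}) (n \<phi>)"
        using dn[of "t/2" t] t by (intro has_vector_derivative_continuous) auto
      moreover have "at t within {t/2..T} = at t within {0<..T}"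
        by (rule at_within_nhd[of t "{t/2<..}"]) (use t in auto)
      ultimately show "continuous (at t within {0<..T}) (n \<phi>)" by (simp add: continuous_within)
    qed
  qed
  have ln: "(n \<phi> \<longlongrightarrow> 0) (at_right 0)" for \<phi>
  proof (rule Lim_null_comparison)
    show "((\<lambda>t. norm \<phi> * \<nu> t) \<longlongrightarrow> 0) (at_right 0)" using tendsto_mult[OF tendsto_const \<nu>(2), of "norm \<phi>"] by simp
    show "\<forall>\<^sub>F t in at_right 0. norm (n \<phi> t) \<le> norm \<phi> * \<nu> t"
      using b T by (auto simp: eventually_at_right_field intro!: exI[of _ T])
  qed
  have cn: "continuous_on {0..T} (n \<phi>)" for \<phi>
  proof -
    have "continuous_on {0..T} (extend0 0 (n \<phi>))"
      by (rule continuous_extend0[OF continuous_on_subset[OF cn'] ln]) auto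
    then show ?thesis by (rule continuous_on_eq) (auto simp: extend0_def n0)
  qed
  have cU0: "continuous_on {0..T} (extend0 u0 U)"
    by (rule continuous_extend0[OF continuous_on_subset[OF cU] lU]) auto
  let ?Xf = "\<lambda>t. exp (- s * t) *\<^sub>R extend0 u0 U t" and ?Yf = "\<lambda>t. exp (- s * t) *\<^sub>R B t"
  define Xe where "Xe e = integral {e..T} ?Xf" for e
  define Ye where "Ye e = integral {e..T} ?Yf" for e
  have gr: "(Xe e, Ye e) \<in> G" if e: "0 < e" for e
  proof (rule graph_integral)
    show "(?Xf has_integral Xe e) {e..T}" "(?Yf has_integral Ye e) {e..T}" unfolding Xe_def Ye_def
      by (intro integrable_integral integrable_continuous_interval continuous_intros continuous_on_subset[OF cU0] continuous_on_subset[OF cB]; use e in auto)+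
    show "(?Xf t, ?Yf t) \<in> G" if "t \<in> {e..T}" for t
      using subspace_scale[OF subspace g[of t], of "exp (- s * t)"] that e by (auto simp: extend0_def)
  qed
  \<comment> \<open>Integration by parts, n \<phi> having derivative -B \<bullet> \<phi> on
    [e,T].\<close>
  have Yi: "Ye e \<bullet> \<phi> = - exp (- s * T) * n \<phi> T + exp (- s * e) * n \<phi> e - s * integral {e..T} (\<lambda>t. exp (- s * t) * n \<phi> t)"
    if e: "0 < e" "e \<le> T" for e \<phi>
  proof -
    have "(?Yf has_integral Ye e) {e..T}" unfolding Ye_def
      by (intro integrable_integral integrable_continuous_interval continuous_intros continuous_on_subset[OF cB]; use e in auto)
    from has_integral_linear[OF this bounded_linear_inner_left[of \<phi>]]
    have 1: "((\<lambda>t. exp (- s * t) * (B t \<bullet> \<phi>)) has_integral Ye e \<bullet> \<phi>) {e..T}" by (simp add: o_def)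
    have 2: "((\<lambda>t. exp (- s * t) * n \<phi> t) has_integral integral {e..T} (\<lambda>t. exp (- s * t) * n \<phi> t)) {e..T}"
      by (intro integrable_integral integrable_continuous_interval continuous_intros continuous_on_subset[OF cn]; use e in auto)
    have 3: "((\<lambda>t. - exp (- s * t) * (B t \<bullet> \<phi>) - s * (exp (- s * t) * n \<phi> t)) has_integral exp (- s * T) * n \<phi> T - exp (- s * e) * n \<phi> e) {e..T}"
    proof (rule fundamental_theorem_of_calculus[OF e(2)])
      fix t assume t: "t \<in> {e..T}"
      have "((\<lambda>t. exp (- s * t) *\<^sub>R n \<phi> t) has_vector_derivative (exp (- s * t) *\<^sub>R - (B t \<bullet> \<phi>) + (exp (- s * t) * - s) *\<^sub>R n \<phi> t)) (at t within {e..T})"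
        by (rule has_vector_derivative_scaleR[OF _ dn[OF e(1) t]]) (auto intro!: derivative_eq_intros)
      then show "((\<lambda>t. exp (- s * t) * n \<phi> t) has_vector_derivative - exp (- s * t) * (B t \<bullet> \<phi>) - s * (exp (- s * t) * n \<phi> t)) (at t within {e..T})"
        by (simp add: algebra_simps)
    qed
    have "((\<lambda>t. - exp (- s * t) * (B t \<bullet> \<phi>) - s * (exp (- s * t) * n \<phi> t)) has_integral - (Ye e \<bullet> \<phi>) - s * integral {e..T} (\<lambda>t. exp (- s * t) * n \<phi> t)) {e..T}"
      using has_integral_diff[OF has_integral_neg[OF 1] has_integral_mult_right[OF 2, of s]] by simp
    from has_integral_unique[OF 3 this] show ?thesis by simp
  qed
  have intb: "\<bar>integral {e..e'} (\<lambda>t. exp (- s * t) * n \<phi> t)\<bar> \<le> norm \<phi> * \<nu> e' * T" if e: "0 \<le> e" "e \<le> e'" "e' \<le> T" for e e' \<phi>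
  proof -
    have "norm (integral {e..e'} (\<lambda>t. exp (- s * t) * n \<phi> t)) \<le> norm \<phi> * \<nu> e' * (e' - e)"
    proof (rule integral_bound[OF e(2)])
      show "continuous_on {e..e'} (\<lambda>t. exp (- s * t) * n \<phi> t)"
        by (intro continuous_intros continuous_on_subset[OF cn]) (use e in auto)
      fix t assume t: "t \<in> {e..e'}"
      have "\<bar>n \<phi> t\<bar> \<le> norm \<phi> * \<nu> t" using b t e by auto
      also have "\<dots> \<le> norm \<phi> * \<nu> e'" using \<nu>(1)[of t e'] t e by (intro mult_left_mono) auto
      finally have "\<bar>n \<phi> t\<bar> \<le> norm \<phi> * \<nu> e'" .
      moreover have "exp (- s * t) \<le> 1" using s t e by simp
      ultimately have "exp (- s * t) * \<bar>n \<phi> t\<bar> \<le> 1 * (norm \<phi> * \<nu> e')" by (intro mult_mono) auto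
      then show "norm (exp (- s * t) * n \<phi> t) \<le> norm \<phi> * \<nu> e'" by (simp add: abs_mult)
    qed
    also have "\<dots> \<le> norm \<phi> * \<nu> e' * T" using \<nu>0[of e'] e by (intro mult_left_mono) auto
    finally show ?thesis by simp
  qed
  have hb: "\<bar>exp (- s * e) * n \<phi> e\<bar> \<le> norm \<phi> * \<nu> e" if "0 \<le> e" "e \<le> T" for e \<phi>
  proof -
    have "exp (- s * e) * \<bar>n \<phi> e\<bar> \<le> 1 * (norm \<phi> * \<nu> e)" using b[of e \<phi>] s that by (intro mult_mono) auto
    then show ?thesis by (simp add: abs_mult)
  qed
  have split: "integral {e..T} (\<lambda>t. exp (- s * t) * n \<phi> t) = integral {e..e'} (\<lambda>t. exp (- s * t) * n \<phi> t) + integral {e'..T} (\<lambda>t. exp (- s * t) * n \<phi> t)"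
    if "0 \<le> e" "e \<le> e'" "e' \<le> T" for e e' \<phi>
    using that by (intro Henstock_Kurzweil_Integration.integral_combine[symmetric] integrable_continuous_interval continuous_intros continuous_on_subset[OF cn]) auto
  \<comment> \<open>The difference is tested with itself. The two boundary terms contribute \<nu> e'
    each and the integral over [e,e'] contributes s T \<nu> e'; hence the constant 2 + s T.\<close>
  have cau: "norm (Ye e - Ye e') \<le> (2 + s * T) * \<nu> e'" if e: "0 < e" "e \<le> e'" "e' \<le> T" for e e'
  proof -
    define \<phi> where "\<phi> = Ye e - Ye e'"
    have "norm \<phi> * norm \<phi> = (Ye e - Ye e') \<bullet> \<phi>" by (simp add: \<phi>_def power2_norm_eq_inner[symmetric] power2_eq_square)
    also have "\<dots> = exp (- s * e) * n \<phi> e - exp (- s * e') * n \<phi> e' - s * integral {e..e'} (\<lambda>t. exp (- s * t) * n \<phi> t)"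
      using e Yi[of e \<phi>] Yi[of e' \<phi>] split[of e e' \<phi>] by (simp add: inner_diff_left algebra_simps)
    also have "\<dots> \<le> norm \<phi> * \<nu> e' + norm \<phi> * \<nu> e' + s * (norm \<phi> * \<nu> e' * T)"
    proof -
      have "norm \<phi> * \<nu> e \<le> norm \<phi> * \<nu> e'" using \<nu>(1)[of e e'] e by (intro mult_left_mono) auto
      moreover have "s * \<bar>integral {e..e'} (\<lambda>t. exp (- s * t) * n \<phi> t)\<bar> \<le> s * (norm \<phi> * \<nu> e' * T)"
        using intb[of e e' \<phi>] e s by (intro mult_left_mono) auto
      moreover have "- s * integral {e..e'} (\<lambda>t. exp (- s * t) * n \<phi> t) \<le> s * \<bar>integral {e..e'} (\<lambda>t. exp (- s * t) * n \<phi> t)\<bar>"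
        using s mult_left_mono[of "- integral {e..e'} (\<lambda>t. exp (- s * t) * n \<phi> t)" "\<bar>integral {e..e'} (\<lambda>t. exp (- s * t) * n \<phi> t)\<bar>" s] by simp
      ultimately show ?thesis using hb[of e \<phi>] hb[of e' \<phi>] e by auto
    qed
    also have "\<dots> = norm \<phi> * ((2 + s * T) * \<nu> e')" by (simp add: algebra_simps)
    finally have *: "norm \<phi> * norm \<phi> \<le> norm \<phi> * ((2 + s * T) * \<nu> e')" .
    show ?thesis
    proof (cases "\<phi> = 0")
      case True
      then show ?thesis using \<nu>0[of e'] e s T unfolding \<phi>_def[symmetric] by simp
    next
      case False
      then show ?thesis using * unfolding \<phi>_def[symmetric] by simp
    qed
  qed
  define \<epsilon> where "\<epsilon> k = T * (1 / real (Suc k))" for k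
  have \<epsilon>: "0 < \<epsilon> k" "\<epsilon> k \<le> T" for k using T by (auto simp: \<epsilon>_def field_simps)
  have \<epsilon>m: "\<epsilon> m \<le> \<epsilon> k" if "k \<le> m" for k m using T that unfolding \<epsilon>_def by (intro mult_left_mono divide_left_mono) auto
  have \<epsilon>0: "\<epsilon> \<longlonglongrightarrow> 0"
    using tendsto_mult[OF tendsto_const LIMSEQ_Suc[OF lim_1_over_n], of T] by (simp add: \<epsilon>_def[abs_def])
  then have \<epsilon>r: "filterlim \<epsilon> (at_right 0) sequentially"
    using \<epsilon>(1) by (intro tendsto_imp_filterlim_at_right) auto
  have \<nu>\<epsilon>: "(\<lambda>k. \<nu> (\<epsilon> k)) \<longlonglongrightarrow> 0" by (rule filterlim_compose[OF \<nu>(2) \<epsilon>r])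
  have "Cauchy (\<lambda>k. Ye (\<epsilon> k))"
  proof (rule CauchyI)
    fix r :: real assume r: "r > 0"
    have "(\<lambda>k. (2 + s * T) * \<nu> (\<epsilon> k)) \<longlonglongrightarrow> (2 + s * T) * 0" by (intro tendsto_intros \<nu>\<epsilon>)
    then have "\<forall>\<^sub>F k in sequentially. (2 + s * T) * \<nu> (\<epsilon> k) < r/2" by (rule order_tendstoD) (use r in simp)
    then obtain M where M: "(2 + s * T) * \<nu> (\<epsilon> M) < r/2" by (auto simp: eventually_sequentially)
    have lt: "norm (Ye (\<epsilon> m) - Ye (\<epsilon> M)) < r/2" if "m \<ge> M" for m
      using cau[of "\<epsilon> m" "\<epsilon> M"] \<epsilon> \<epsilon>m[OF that] M by (meson le_less_trans)
    then have "norm (Ye (\<epsilon> m) - Ye (\<epsilon> k)) < r" if "m \<ge> M" "k \<ge> M" for m k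
    proof -
      have "norm (Ye (\<epsilon> m) - Ye (\<epsilon> k)) \<le> norm (Ye (\<epsilon> m) - Ye (\<epsilon> M)) + norm (Ye (\<epsilon> k) - Ye (\<epsilon> M))"
        using norm_triangle_ineq4[of "Ye (\<epsilon> m) - Ye (\<epsilon> M)" "Ye (\<epsilon> k) - Ye (\<epsilon> M)"] by simp
      then show ?thesis using lt[OF that(1)] lt[OF that(2)] by simp
    qed
    then show "\<exists>M. \<forall>m\<ge>M. \<forall>n\<ge>M. norm (Ye (\<epsilon> m) - Ye (\<epsilon> n)) < r" by blast
  qed
  then obtain Y where Y: "(\<lambda>k. Ye (\<epsilon> k)) \<longlonglongrightarrow> Y" by (auto simp: Cauchy_convergent_iff convergent_def)
  have Xlim: "(\<lambda>k. Xe (\<epsilon> k)) \<longlonglongrightarrow> X"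
  proof -
    have ch: "continuous_on {0..T} ?Xf" by (intro continuous_intros cU0)
    have "((\<lambda>e. integral {e..T} ?Xf) \<longlongrightarrow> integral {0..T} ?Xf) (at 0 within {0..T})"
      using indefinite_integral_continuous_1'[OF integrable_continuous_interval[OF ch]] T
      by (auto simp: continuous_on_def)
    moreover have "filterlim \<epsilon> (at 0 within {0..T}) sequentially"
      using \<epsilon> \<epsilon>0 by (auto simp: filterlim_at less_imp_le intro!: always_eventually) (metis less_irrefl)
    ultimately show ?thesis unfolding Xe_def X_def by (rule filterlim_compose)
  qed
  have "(X, Y) \<in> G" by (rule graph_limit[OF gr[OF \<epsilon>(1)] Xlim Y])
  moreover have "Y \<bullet> \<phi> = - exp (- s * T) * n \<phi> T - s * integral {0..T} (\<lambda>t. exp (- s * t) * n \<phi> t)" for \<phi>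
  proof (rule LIMSEQ_unique[OF tendsto_inner[OF Y tendsto_const]])
    have 1: "(\<lambda>k. exp (- s * \<epsilon> k) * n \<phi> (\<epsilon> k)) \<longlonglongrightarrow> 0"
    proof (rule Lim_null_comparison)
      show "(\<lambda>k. norm \<phi> * \<nu> (\<epsilon> k)) \<longlonglongrightarrow> 0" using tendsto_mult[OF tendsto_const \<nu>\<epsilon>, of "norm \<phi>"] by simp
      show "\<forall>\<^sub>F k in sequentially. norm (exp (- s * \<epsilon> k) * n \<phi> (\<epsilon> k)) \<le> norm \<phi> * \<nu> (\<epsilon> k)"
        using hb[OF less_imp_le[OF \<epsilon>(1)] \<epsilon>(2)] by (intro always_eventually allI) simp
    qed
    have 2: "(\<lambda>k. integral {0..\<epsilon> k} (\<lambda>t. exp (- s * t) * n \<phi> t)) \<longlonglongrightarrow> 0"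
    proof (rule Lim_null_comparison)
      show "(\<lambda>k. norm \<phi> * \<nu> (\<epsilon> k) * T) \<longlonglongrightarrow> 0"
        using tendsto_mult[OF tendsto_mult[OF tendsto_const \<nu>\<epsilon>] tendsto_const, of "norm \<phi>" T] by simp
      show "\<forall>\<^sub>F k in sequentially. norm (integral {0..\<epsilon> k} (\<lambda>t. exp (- s * t) * n \<phi> t)) \<le> norm \<phi> * \<nu> (\<epsilon> k) * T"
        using intb[OF order_refl less_imp_le[OF \<epsilon>(1)] \<epsilon>(2)] by (intro always_eventually allI) simp
    qed
    have "(\<lambda>k. - exp (- s * T) * n \<phi> T + exp (- s * \<epsilon> k) * n \<phi> (\<epsilon> k) - s * (integral {0..T} (\<lambda>t. exp (- s * t) * n \<phi> t) - integral {0..\<epsilon> k} (\<lambda>t. exp (- s * t) * n \<phi> t)))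
       \<longlonglongrightarrow> - exp (- s * T) * n \<phi> T + 0 - s * (integral {0..T} (\<lambda>t. exp (- s * t) * n \<phi> t) - 0)"
      by (intro tendsto_intros 1 2)
    moreover have "Ye (\<epsilon> k) \<bullet> \<phi> = - exp (- s * T) * n \<phi> T + exp (- s * \<epsilon> k) * n \<phi> (\<epsilon> k) - s * (integral {0..T} (\<lambda>t. exp (- s * t) * n \<phi> t) - integral {0..\<epsilon> k} (\<lambda>t. exp (- s * t) * n \<phi> t))" for k
      using Yi[OF \<epsilon>] split[of 0 "\<epsilon> k" \<phi>] \<epsilon>[of k] by simp
    ultimately show "(\<lambda>k. Ye (\<epsilon> k) \<bullet> \<phi>) \<longlonglongrightarrow> - exp (- s * T) * n \<phi> T - s * integral {0..T} (\<lambda>t. exp (- s * t) * n \<phi> t)"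
      by simp
  qed
  ultimately show ?thesis by blast
qed

end

subsection \<open>The subordination kernel\<close>

locale subordination =
  fixes l :: nat and q \<alpha> :: "nat \<Rightarrow> real" and s0 :: real
  assumes l: "l \<ge> 1" and q: "\<And>j. j \<in> {1..l} \<Longrightarrow> q j > 0"
    and \<alpha>_pos: "\<And>j. j \<in> {1..l} \<Longrightarrow> 0 < \<alpha> j" and \<alpha>_le: "\<And>j. j \<in> {1..l} \<Longrightarrow> \<alpha> j \<le> \<alpha> 1"
    and \<alpha>1: "\<alpha> 1 < 1" and s0: "s0 > 0"
begin

abbreviation Q where "Q \<equiv> Q_sym l q \<alpha>"
abbreviation b where "b \<equiv> \<alpha> 1"

definition Q' :: "complex \<Rightarrow> complex" where "Q' s = (\<Sum>j=1..l. of_real (q j) * (of_real (\<alpha> j) * s powr (of_real (\<alpha> j) - 1)))"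

text \<open>In the right half-plane |arg s| < pi/2, so the leading term of Q has real part at least
  \<open>ell\<close> times |s|^b. For |s| \<ge> s0 every lower power is at most a constant multiple
  of |s|^b, and \<open>C1\<close> adds up these constants. Thus Q is of order b on the contour, from
  below and from above.\<close>

definition ell where "ell = q 1 * cos (b * (pi / 2))"
definition C1 where "C1 = (\<Sum>j=1..l. q j * s0 powr (\<alpha> j - b))"

lemma b_bounds: "0 < b" "b < 1" using \<alpha>_pos[of 1] \<alpha>1 l by auto

lemma ell_pos: "ell > 0"
proof -
  have "b * (pi/2) < pi/2" using b_bounds by simp
  moreover have "b * (pi/2) > 0" using b_bounds by simp
  ultimately have "cos (b * (pi/2)) > 0" by (intro cos_gt_zero_pi) linarith+
  then show ?thesis using q[of 1] l by (simp add: ell_def)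
qed

lemma C1_pos: "C1 > 0"
  unfolding C1_def using l q s0 by (intro sum_pos) auto

text \<open>The argument of s^a is a arg s, of modulus at most b pi/2 < pi/2, and the cosine
  decreases on that range.\<close>

lemma Re_powr_ge:
  assumes "Re s > 0" "0 < a" "a \<le> b"
  shows "Re (s powr of_real a) \<ge> 0" "Re (s powr of_real a) \<ge> norm s powr a * cos (b * (pi / 2))"
proof -
  have s: "s \<noteq> 0" using assms(1) by auto
  have im: "\<bar>Im (Ln s)\<bar> < pi/2" using Re_Ln_pos_lt[OF s] assms(1) by simp
  have e: "Re (s powr of_real a) = norm s powr a * cos (a * Im (Ln s))"
    using s by (simp add: powr_def Re_exp powr_def)
  have "\<bar>a * Im (Ln s)\<bar> \<le> b * (pi/2)" unfolding abs_mult using assms im by (intro mult_mono) auto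
  moreover have "b * (pi/2) \<le> pi/2" using b_bounds by simp
  ultimately have "cos (b * (pi/2)) \<le> cos \<bar>a * Im (Ln s)\<bar>"
    using b_bounds pi_gt_zero by (intro cos_monotone_0_pi_le) linarith+
  then have c: "cos (b * (pi/2)) \<le> cos (a * Im (Ln s))" by simp
  then show "Re (s powr of_real a) \<ge> norm s powr a * cos (b * (pi / 2))"
    unfolding e by (intro mult_left_mono) auto
  have "cos (b * (pi/2)) > 0" using ell_pos q[of 1] l by (simp add: ell_def zero_less_mult_iff)
  then show "Re (s powr of_real a) \<ge> 0" unfolding e using c by simp
qed

lemma Re_Q_ge:
  assumes "Re s > 0"
  shows "Re (Q s) \<ge> ell * norm s powr b"
proof -
  have "ell * norm s powr b \<le> Re (of_real (q 1) * s powr of_real b)"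
    using Re_powr_ge(2)[OF assms b_bounds(1)] q[of 1] l by (simp add: ell_def mult_ac mult_left_mono)
  also have "\<dots> \<le> (\<Sum>j=1..l. Re (of_real (q j) * s powr of_real (\<alpha> j)))"
  proof (rule member_le_sum)
    fix j assume "j \<in> {1..l} - {1}"
    then have j: "j \<in> {1..l}" by simp
    show "0 \<le> Re (of_real (q j) * s powr of_real (\<alpha> j))"
      using Re_powr_ge(1)[OF assms \<alpha>_pos[OF j] \<alpha>_le[OF j]] q[OF j] by simp
  qed (use l in auto)
  finally show ?thesis by (simp add: Q_sym_def)
qed

lemma powr_mono_exponent:
  assumes "s0 \<le> r" "a \<le> b"
  shows "r powr a \<le> s0 powr (a - b) * r powr b"
proof -
  have "r powr (a - b) \<le> s0 powr (a - b)" using s0 assms by (intro powr_mono2') auto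
  then have "r powr (a - b) * r powr b \<le> s0 powr (a - b) * r powr b" by (intro mult_right_mono) auto
  then show ?thesis using s0 assms by (simp add: powr_add[symmetric])
qed

lemma norm_Q_le:
  assumes "s0 \<le> norm s"
  shows "norm (Q s) \<le> C1 * norm s powr b"
proof -
  have "norm (Q s) \<le> (\<Sum>j=1..l. q j * norm s powr \<alpha> j)" unfolding Q_sym_def
    by (rule order_trans[OF norm_sum], rule sum_mono) (use q in \<open>auto simp: norm_mult norm_powr_real_powr' less_imp_le\<close>)
  also have "\<dots> \<le> (\<Sum>j=1..l. q j * (s0 powr (\<alpha> j - b) * norm s powr b))"
    using q \<alpha>_le powr_mono_exponent[OF assms] by (intro sum_mono mult_left_mono) (auto simp: less_imp_le)
  also have "\<dots> = C1 * norm s powr b" by (simp add: C1_def sum_distrib_right mult.assoc)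
  finally show ?thesis .
qed

lemma norm_Q'_le:
  assumes "s0 \<le> norm s"
  shows "norm (Q' s) \<le> C1 * norm s powr (b - 1)"
proof -
  have r: "norm s > 0" using assms s0 by linarith
  have "norm (Q' s) \<le> (\<Sum>j=1..l. q j * norm s powr (\<alpha> j - 1))" unfolding Q'_def
  proof (rule order_trans[OF norm_sum], rule sum_mono)
    fix j assume j: "j \<in> {1..l}"
    have "norm (s powr (of_real (\<alpha> j) - 1)) = norm s powr (\<alpha> j - 1)"
      using norm_powr_real_powr'[of "of_real (\<alpha> j) - 1" s] by simp
    moreover have "\<alpha> j \<le> 1" using \<alpha>_le[OF j] \<alpha>1 by simp
    ultimately show "norm (of_real (q j) * (of_real (\<alpha> j) * s powr (of_real (\<alpha> j) - 1))) \<le> q j * norm s powr (\<alpha> j - 1)"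
      using q[OF j] \<alpha>_pos[OF j] by (simp add: norm_mult mult_left_le_one_le)
  qed
  also have "\<dots> \<le> (\<Sum>j=1..l. q j * (s0 powr (\<alpha> j - b) * norm s powr (b - 1)))"
  proof (intro sum_mono mult_left_mono)
    fix j assume j: "j \<in> {1..l}"
    have "norm s powr (\<alpha> j - 1) = norm s powr \<alpha> j / norm s" using r by (simp add: powr_diff)
    also have "\<dots> \<le> (s0 powr (\<alpha> j - b) * norm s powr b) / norm s"
      using powr_mono_exponent[OF assms \<alpha>_le[OF j]] r by (intro divide_right_mono) auto
    also have "\<dots> = s0 powr (\<alpha> j - b) * norm s powr (b - 1)" using r by (simp add: powr_diff)
    finally show "norm s powr (\<alpha> j - 1) \<le> s0 powr (\<alpha> j - b) * norm s powr (b - 1)" .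
  qed (use q in \<open>auto simp: less_imp_le\<close>)
  also have "\<dots> = C1 * norm s powr (b - 1)" by (simp add: C1_def sum_distrib_right mult.assoc)
  finally show ?thesis .
qed

lemma Q_deriv: "Re s > 0 \<Longrightarrow> (Q has_field_derivative Q' s) (at s)"
  unfolding Q_sym_def[abs_def] Q'_def
  by (intro DERIV_sum DERIV_cmult has_field_derivative_powr) (auto simp: complex_nonpos_Reals_iff)

lemma Q_cnj: "Re s > 0 \<Longrightarrow> Q (cnj s) = cnj (Q s)"
  unfolding Q_sym_def by (simp add: cnj_sum cnj_powr)

text \<open>The symbol which the kernel is to have as Laplace transform in t; \<open>F'\<close>
  below is its derivative in s, for the integration by parts along the contour.\<close>

definition F where "F \<tau> s = inverse s * Q s * exp (- (Q s * of_real \<tau>))"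
definition F' where "F' \<tau> s = (Q' s * inverse s - Q s * inverse s * inverse s - of_real \<tau> * Q' s * (inverse s * Q s)) * exp (- (Q s * of_real \<tau>))"

lemma kernel_eq: "kernel_integrand l q \<alpha> t \<tau> s = F \<tau> s * exp (s * of_real t)"
  by (simp add: kernel_integrand_def F_def exp_diff exp_minus field_simps)

lemma F_deriv: "Re s > 0 \<Longrightarrow> (F \<tau> has_field_derivative F' \<tau> s) (at s)"
proof -
  assume s: "Re s > 0"
  then have nz: "s \<noteq> 0" by auto
  have "(F \<tau> has_field_derivative (- (inverse s ^ Suc (Suc 0)) * Q s + Q' s * inverse s) * exp (- (Q s * of_real \<tau>))
      + exp (- (Q s * of_real \<tau>)) * (- (Q' s * of_real \<tau>)) * (inverse s * Q s)) (at s)"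
    unfolding F_def[abs_def]
    by (intro DERIV_mult DERIV_inverse nz Q_deriv s DERIV_fun_exp DERIV_minus DERIV_cmult_right)
  then show ?thesis by (rule DERIV_cong) (simp add: F'_def algebra_simps)
qed

lemma norm_exp_Q_le:
  assumes "Re s > 0" "\<tau> \<ge> 0"
  shows "norm (exp (- (Q s * of_real \<tau>))) \<le> exp (- (ell * \<tau> * norm s powr b))"
  using mult_right_mono[OF Re_Q_ge[OF assms(1)] assms(2)] by (simp add: mult_ac)

lemma norm_F_le:
  assumes "Re s > 0" "s0 \<le> norm s" "\<tau> \<ge> 0"
  shows "norm (F \<tau> s) \<le> C1 * norm s powr (b - 1) * exp (- (ell * \<tau> * norm s powr b))"
proof -
  have r: "norm s > 0" using assms s0 by linarith
  have "norm (F \<tau> s) = norm (Q s) / norm s * norm (exp (- (Q s * of_real \<tau>)))"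
    by (simp add: F_def norm_mult norm_inverse divide_inverse mult_ac del: norm_exp_eq_Re)
  also have "\<dots> \<le> (C1 * norm s powr b) / norm s * exp (- (ell * \<tau> * norm s powr b))"
    using norm_Q_le[OF assms(2)] norm_exp_Q_le[OF assms(1,3)] r C1_pos
    by (intro mult_mono divide_right_mono) auto
  finally show ?thesis using r by (simp add: powr_diff)
qed

definition C2 where "C2 = C1 + C1 + C1 * C1 / ell"

text \<open>The three summands of \<open>F'\<close> contribute C1, C1 and C1^2/ell to
  \<open>C2\<close>. In the third, the factor \<tau> is absorbed by x exp(-x) \<le> 1 with x = ell
  \<tau> |s|^b, which makes the bound uniform in \<tau> \<ge> 0. The power b - 2 < -1 is integrable
  along a vertical line.\<close>

lemma norm_F'_le:
  assumes "Re s > 0" "s0 \<le> norm s" "\<tau> \<ge> 0"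
  shows "norm (F' \<tau> s) \<le> C2 * norm s powr (b - 2)"
proof -
  have r: "norm s > 0" using assms s0 by linarith
  let ?e = "exp (- (ell * \<tau> * norm s powr b))" and ?p = "norm s powr (b - 2)"
  have p: "norm s powr (b - 1) / norm s = ?p" "norm s powr b / norm s / norm s = ?p"
    using r by (simp_all add: powr_diff power2_eq_square powr_numeral)
  have e1: "?e \<le> 1" using ell_pos assms(3) by simp
  have xe: "(ell * \<tau> * norm s powr b) * ?e \<le> 1"
  proof -
    have "x * exp (- x) \<le> 1" for x :: real
    proof -
      have "x \<le> exp x" using exp_ge_add_one_self[of x] by linarith
      then have "x * exp (-x) \<le> exp x * exp (-x)" by (intro mult_right_mono) auto
      then show ?thesis by (simp add: exp_add[symmetric])
    qed
    then show ?thesis .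
  qed
  have q0: "norm (Q s) \<le> C1 * norm s powr b" "norm (Q' s) \<le> C1 * norm s powr (b - 1)"
    using norm_Q_le norm_Q'_le assms by auto
  have 1: "norm (Q' s * inverse s) \<le> C1 * ?p"
  proof -
    have "norm (Q' s * inverse s) = norm (Q' s) / norm s" by (simp add: norm_mult norm_inverse divide_inverse)
    also have "\<dots> \<le> C1 * norm s powr (b - 1) / norm s" using q0 r by (intro divide_right_mono) auto
    also have "\<dots> = C1 * ?p" using p(1) by (metis times_divide_eq_right)
    finally show ?thesis .
  qed
  have 2: "norm (Q s * inverse s * inverse s) \<le> C1 * ?p"
  proof -
    have "norm (Q s * inverse s * inverse s) = norm (Q s) / norm s / norm s" by (simp only: norm_mult norm_inverse divide_inverse)
    also have "\<dots> \<le> C1 * norm s powr b / norm s / norm s" using q0 r by (intro divide_right_mono) auto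
    also have "\<dots> = C1 * ?p" using p(2) by (metis times_divide_eq_right)
    finally show ?thesis .
  qed
  have 3: "norm (of_real \<tau> * Q' s * (inverse s * Q s)) * ?e \<le> C1 * C1 / ell * ?p"
  proof -
    have "norm (of_real \<tau> * Q' s * (inverse s * Q s)) = \<tau> * (norm (Q' s) / norm s) * norm (Q s)"
      using assms by (simp add: norm_mult norm_inverse divide_inverse mult_ac)
    also have "\<dots> \<le> \<tau> * (C1 * norm s powr (b - 1) / norm s) * (C1 * norm s powr b)"
      using q0 r assms C1_pos by (intro mult_mono divide_right_mono) auto
    also have "\<dots> = C1 * C1 * ?p * (\<tau> * norm s powr b)" unfolding p(1)[symmetric] by simp
    finally have "norm (of_real \<tau> * Q' s * (inverse s * Q s)) * ?e \<le> C1 * C1 * ?p * (\<tau> * norm s powr b) * ?e"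
      by (intro mult_right_mono) auto
    also have "\<dots> = C1 * C1 / ell * ?p * ((ell * \<tau> * norm s powr b) * ?e)" using ell_pos by simp
    also have "\<dots> \<le> C1 * C1 / ell * ?p * 1" using xe ell_pos C1_pos by (intro mult_left_mono) auto
    finally show ?thesis by simp
  qed
  have "norm (F' \<tau> s) = norm (Q' s * inverse s - Q s * inverse s * inverse s - of_real \<tau> * Q' s * (inverse s * Q s)) * norm (exp (- (Q s * of_real \<tau>)))"
    by (simp add: F'_def norm_mult)
  also have "\<dots> \<le> (norm (Q' s * inverse s) + norm (Q s * inverse s * inverse s) + norm (of_real \<tau> * Q' s * (inverse s * Q s))) * ?e"
    by (intro mult_mono norm_exp_Q_le assms order_trans[OF norm_triangle_ineq4] add_mono) auto
  also have "\<dots> \<le> C1 * ?p * 1 + C1 * ?p * 1 + C1 * C1 / ell * ?p"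
    unfolding distrib_right using 3 mult_mono[OF 1 e1] mult_mono[OF 2 e1] C1_pos by (intro add_mono) auto
  also have "\<dots> = C2 * ?p" by (simp add: C2_def algebra_simps)
  finally show ?thesis .
qed

section \<open>The kernel on the vertical line\<close>

abbreviation vl where "vl y \<equiv> Complex s0 y"

lemma vl_bounds: "Re (vl y) > 0" "s0 \<le> norm (vl y)" "\<bar>y\<bar> \<le> norm (vl y)"
  using s0 complex_Re_le_cmod[of "vl y"] abs_Im_le_cmod[of "vl y"] by auto

text \<open>The exponent is negative and the modulus is at least |y| away from [-s0,s0] and at least
  s0 on that interval.\<close>

lemma integrable_norm_powr:
  assumes e: "e < -1"
  shows "integrable lborel (\<lambda>y. norm (vl y) powr e)"
proof -
  define g where "g x = indicator {s0..} x * x powr e" for x :: real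
  have "(\<lambda>x. x powr e) integrable_on {s0..}" using has_integral_powr_to_inf[OF e s0] by blast
  then have "(\<lambda>x. x powr e) absolutely_integrable_on {s0..}"
    by (intro nonnegative_absolutely_integrable_1) auto
  then have "integrable lborel g"
    unfolding g_def set_integrable_def by (subst (asm) integrable_completion) auto
  then have g: "integrable lborel g" "integrable lborel (\<lambda>x. g (0 + (-1) * x))"
    using lborel_integrable_real_affine[of g "-1" 0] by auto
  have i: "integrable lborel (\<lambda>x. indicator {-s0..s0} x * s0 powr e)"
    using borel_integrable_compact[of "{-s0..s0}" "\<lambda>_. s0 powr e"] by simp
  show ?thesis
  proof (rule Bochner_Integration.integrable_bound)
    show "integrable lborel (\<lambda>x. g x + g (0 + (-1) * x) + indicator {-s0..s0} x * s0 powr e)"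
      by (intro Bochner_Integration.integrable_add g i)
    show "(\<lambda>y. norm (vl y) powr e) \<in> borel_measurable lborel" by (simp add: cmod_def)
    have "norm (vl y) powr e \<le> g y + g (- y) + indicator {-s0..s0} y * s0 powr e" for y
    proof (cases "\<bar>y\<bar> \<le> s0")
      case True
      have "norm (vl y) powr e \<le> s0 powr e" using vl_bounds(2)[of y] s0 e by (intro powr_mono2') auto
      moreover have "g y \<ge> 0" "g (- y) \<ge> 0" by (auto simp: g_def)
      moreover have "indicator {-s0..s0} y = (1::real)" using True by (auto simp: indicator_def)
      ultimately show ?thesis by simp
    next
      case False
      have "norm (vl y) powr e \<le> \<bar>y\<bar> powr e" using vl_bounds(3)[of y] s0 e False by (intro powr_mono2') auto
      then show ?thesis using False s0 by (cases "y \<ge> 0") (auto simp: g_def indicator_def abs_if)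
    qed
    then show "AE x in lborel. norm (norm (vl x) powr e) \<le> norm (g x + g (0 + (-1) * x) + indicator {-s0..s0} x * s0 powr e)"
      by (intro AE_I2) (simp add: g_def)
  qed
qed

lemma Q_line_cont: "continuous_on UNIV (\<lambda>y. Q (vl y))"
  unfolding continuous_on_eq_continuous_at[OF open_UNIV]
proof
  fix y :: real
  have "isCont Q (vl y)" using Q_deriv[OF vl_bounds(1)] DERIV_isCont by blast
  moreover have "isCont vl y" unfolding Complex_eq by (intro continuous_intros)
  ultimately show "isCont (\<lambda>y. Q (vl y)) y" using isCont_o2 by blast
qed

lemma Q'_line_cont: "continuous_on UNIV (\<lambda>y. Q' (vl y))"
  unfolding Q'_def using s0
  by (intro continuous_intros continuous_on_powr_complex) (auto simp: complex_nonpos_Reals_iff complex_eq_iff)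

lemma vl_nz: "vl y \<noteq> 0" using s0 by (auto simp: complex_eq_iff)

definition g where "g t \<tau> y = kernel_integrand l q \<alpha> t \<tau> (vl y)"
definition g' where "g' t \<tau> y = F' \<tau> (vl y) * exp (vl y * of_real t)"

lemma g_cont: "continuous_on UNIV (\<lambda>((t, \<tau>), y). g t \<tau> y)"
  unfolding g_def kernel_integrand_def case_prod_unfold
  by (intro continuous_intros continuous_on_compose2[OF Q_line_cont]) (auto simp: vl_nz)

lemma g'_cont: "continuous_on UNIV (\<lambda>((t, \<tau>), y). g' t \<tau> y)"
  unfolding g'_def F'_def case_prod_unfold
  by (intro continuous_intros continuous_on_compose2[OF Q_line_cont] continuous_on_compose2[OF Q'_line_cont]) (auto simp: vl_nz)

lemma g_meas[measurable]: "(\<lambda>((t, \<tau>), y). g t \<tau> y) \<in> borel_measurable borel"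
  using g_cont by (rule borel_measurable_continuous_onI)

definition A1 where "A1 = 2 * C1 * (ell / 2) powr (- 3/2)"

text \<open>The exponent 3/2 is taken between 1 and 2. With x proportional to \<tau> |s|^b it must
  exceed 1 for |s|^(b-1) x^(-3/2) to be integrable along the line, and it must stay below 2 for the
  square root of \<tau>^(-3/2) to be integrable at 0.\<close>

lemma exp_powr_bound: "x > 0 \<Longrightarrow> exp (- x) \<le> 2 * x powr (- 3/2)" for x :: real
proof -
  assume x: "x > 0"
  have "x powr (3/2) \<le> 1 + x\<^sup>2"
  proof (cases "x \<le> 1")
    case True
    then have "x powr (3/2) \<le> 1 powr (3/2)" using x by (intro powr_mono2) auto
    then show ?thesis by (simp add: add_increasing2)
  next
    case False
    then have "x powr (3/2) \<le> x powr 2" by (intro powr_mono) auto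
    then show ?thesis using x by (simp add: powr_numeral)
  qed
  also have "\<dots> \<le> 2 * exp x" using exp_lower_Taylor_quadratic[of x] x by simp
  finally have "x powr (3/2) * exp (-x) \<le> 2 * exp x * exp (- x)" by (intro mult_right_mono) auto
  moreover have "2 * exp x * exp (- x) = 2" by (simp add: exp_minus)
  ultimately have "x powr (3/2) * exp (-x) \<le> 2" by linarith
  then have "x powr (-3/2) * (x powr (3/2) * exp (-x)) \<le> x powr (-3/2) * 2" by (intro mult_left_mono) auto
  moreover have "x powr (-3/2) * x powr (3/2) = 1" using x by (simp add: powr_add[symmetric])
  then have "x powr (-3/2) * (x powr (3/2) * exp (-x)) = exp (-x)" by (metis mult.assoc mult_1)
  ultimately show ?thesis by linarith
qed

text \<open>The exponential is split in half: one half is kept as decay in \<tau>, using |s| \<ge>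
  s0, and the other is traded for the power \<tau>^(-3/2) |s|^(-3b/2).\<close>

lemma norm_g_le:
  assumes "\<tau> > 0"
  shows "norm (g t \<tau> y) \<le> A1 * exp (s0 * t) * exp (- (ell / 2 * s0 powr b * \<tau>)) * \<tau> powr (- 3/2) * norm (vl y) powr (- 1 - b / 2)"
proof -
  let ?r = "norm (vl y)"
  have r: "?r > 0" "s0 powr b \<le> ?r powr b" using vl_bounds(2)[of y] s0 b_bounds by (auto intro: powr_mono2)
  have "exp (- (ell * \<tau> * ?r powr b)) = exp (- (ell / 2 * \<tau> * ?r powr b)) * exp (- (ell / 2 * \<tau> * ?r powr b))"
    by (simp add: exp_add[symmetric])
  also have "\<dots> \<le> exp (- (ell / 2 * s0 powr b * \<tau>)) * (2 * (ell / 2 * \<tau> * ?r powr b) powr (- 3/2))"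
    using r ell_pos assms by (intro mult_mono exp_powr_bound) (auto simp: mult_ac intro!: mult_left_mono)
  also have "(ell / 2 * \<tau> * ?r powr b) powr (- 3/2) = (ell/2) powr (-3/2) * \<tau> powr (-3/2) * ?r powr (- 3/2 * b)"
  proof -
    have "(x * y * z) powr e = x powr e * y powr e * z powr e" if "x \<ge> 0" "y \<ge> 0" "z \<ge> 0" for x y z e :: real
      using that by (simp add: powr_mult)
    from this[of "ell / 2" \<tau> "?r powr b" "- 3/2"] show ?thesis
      using ell_pos assms by (simp add: powr_powr mult.commute)
  qed
  finally have e: "exp (- (ell * \<tau> * ?r powr b)) \<le> exp (- (ell / 2 * s0 powr b * \<tau>)) * (2 * ((ell/2) powr (-3/2) * \<tau> powr (-3/2) * ?r powr (- 3/2 * b)))" .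
  have "norm (g t \<tau> y) = norm (F \<tau> (vl y)) * exp (s0 * t)" by (simp add: g_def kernel_eq norm_mult)
  also have "\<dots> \<le> C1 * ?r powr (b - 1) * exp (- (ell * \<tau> * ?r powr b)) * exp (s0 * t)"
    using norm_F_le[OF vl_bounds(1,2), of \<tau>] assms by (intro mult_right_mono) auto
  also have "\<dots> \<le> C1 * ?r powr (b - 1) * (exp (- (ell / 2 * s0 powr b * \<tau>)) * (2 * ((ell/2) powr (-3/2) * \<tau> powr (-3/2) * ?r powr (- 3/2 * b)))) * exp (s0 * t)"
    using e C1_pos by (intro mult_right_mono mult_left_mono) auto
  also have "\<dots> = A1 * exp (s0 * t) * exp (- (ell / 2 * s0 powr b * \<tau>)) * \<tau> powr (- 3/2) * (?r powr (b - 1) * ?r powr (- 3/2 * b))"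
    by (simp add: A1_def)
  also have "?r powr (b - 1) * ?r powr (- 3/2 * b) = ?r powr (- 1 - b / 2)"
    by (simp add: powr_add[symmetric] algebra_simps)
  finally show ?thesis .
qed

lemma g_borel: "g t \<tau> \<in> borel_measurable borel" "g' t \<tau> \<in> borel_measurable borel"
proof -
  have c: "continuous_on UNIV (\<lambda>y::real. ((t, \<tau>), y))" by (intro continuous_intros)
  have "continuous_on UNIV (g t \<tau>)" "continuous_on UNIV (g' t \<tau>)"
    using continuous_on_compose2[OF g_cont c] continuous_on_compose2[OF g'_cont c] by auto
  then show "g t \<tau> \<in> borel_measurable borel" "g' t \<tau> \<in> borel_measurable borel"
    by (auto intro: borel_measurable_continuous_onI)
qed

lemma g_integrable: "\<tau> > 0 \<Longrightarrow> integrable lborel (g t \<tau>)"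
proof (rule Bochner_Integration.integrable_bound)
  assume t: "\<tau> > 0"
  show "integrable lborel (\<lambda>y. A1 * exp (s0 * t) * exp (- (ell / 2 * s0 powr b * \<tau>)) * \<tau> powr (- 3/2) * norm (vl y) powr (- 1 - b / 2))"
    using b_bounds by (intro integrable_mult_right integrable_norm_powr) auto
  show "AE y in lborel. norm (g t \<tau> y) \<le> norm (A1 * exp (s0 * t) * exp (- (ell / 2 * s0 powr b * \<tau>)) * \<tau> powr (- 3/2) * norm (vl y) powr (- 1 - b / 2))"
    using norm_g_le[OF t, of t] by (intro AE_I2) (smt (verit) real_norm_def)
qed (use g_borel in simp)

lemma norm_g'_le: "\<tau> \<ge> 0 \<Longrightarrow> norm (g' t \<tau> y) \<le> C2 * exp (s0 * t) * norm (vl y) powr (b - 2)"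
  using mult_right_mono[OF norm_F'_le[OF vl_bounds(1,2), of \<tau> y], of "exp (s0 * t)"]
  by (simp add: g'_def norm_mult mult_ac)

lemma g'_integrable: "\<tau> \<ge> 0 \<Longrightarrow> integrable lborel (g' t \<tau>)"
proof (rule Bochner_Integration.integrable_bound)
  assume t: "\<tau> \<ge> 0"
  show "integrable lborel (\<lambda>y. C2 * exp (s0 * t) * norm (vl y) powr (b - 2))"
    using b_bounds by (intro integrable_mult_right integrable_norm_powr) auto
  show "AE y in lborel. norm (g' t \<tau> y) \<le> norm (C2 * exp (s0 * t) * norm (vl y) powr (b - 2))"
    using norm_g'_le[OF t, of t] by (intro AE_I2) (smt (verit) real_norm_def)
qed (use g_borel in simp)

definition kap where "kap t \<tau> = (LBINT y. g t \<tau> y) / (2 * pi)"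
text \<open>The kernel after an integration by parts in \<open>y\<close>. This integral converges uniformly down to \<open>\<tau> = 0\<close>, and
  the factor \<open>1/t\<close>, combined with the direct bound, gives integrability in both \<open>t\<close> and \<open>\<tau>\<close>.\<close>

definition kap' where "kap' t \<tau> = - (LBINT y. g' t \<tau> y) / (2 * pi * t)"

lemma g_F: "g t \<tau> y = F \<tau> (vl y) * exp (vl y * of_real t)"
  by (simp add: g_def kernel_eq)

lemma g_tendsto_0:
  assumes "\<tau> > 0"
  shows "((\<lambda>R. g t \<tau> R) \<longlongrightarrow> 0) at_top" "((\<lambda>R. g t \<tau> (- R)) \<longlongrightarrow> 0) at_top"
proof -
  define C where "C = A1 * exp (s0 * t) * exp (- (ell / 2 * s0 powr b * \<tau>)) * \<tau> powr (- 3/2)"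
  have C: "C \<ge> 0" using C1_pos by (simp add: C_def A1_def)
  have lim: "((\<lambda>R. C * R powr (- 1 - b / 2)) \<longlongrightarrow> 0) at_top"
    by (rule tendsto_mult_right_zero[OF tendsto_neg_powr[OF _ filterlim_ident]]) (use b_bounds in simp)
  have le: "norm (g t \<tau> y) \<le> C * R powr (- 1 - b / 2)" if "R > 0" "R \<le> \<bar>y\<bar>" for y R
  proof -
    have "norm (vl y) powr (- 1 - b / 2) \<le> R powr (- 1 - b / 2)"
      using that vl_bounds(3)[of y] b_bounds by (intro powr_mono2') auto
    then have "C * norm (vl y) powr (- 1 - b / 2) \<le> C * R powr (- 1 - b / 2)" using C by (intro mult_left_mono)
    then show ?thesis using norm_g_le[OF assms, of t y] by (simp add: C_def)
  qed
  show "((\<lambda>R. g t \<tau> R) \<longlongrightarrow> 0) at_top"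
    by (rule Lim_null_comparison[OF _ lim]) (use le in \<open>auto intro!: eventually_mono[OF eventually_gt_at_top[of 0]]\<close>)
  show "((\<lambda>R. g t \<tau> (- R)) \<longlongrightarrow> 0) at_top"
    by (rule Lim_null_comparison[OF _ lim]) (use le in \<open>auto intro!: eventually_mono[OF eventually_gt_at_top[of 0]]\<close>)
qed

text \<open>Relates the Bochner integral over the line to the symmetric limits through which
  integrals along the vertical line are defined.\<close>

lemma integral_symmetric_tendsto:
  fixes f :: "real \<Rightarrow> complex"
  assumes f: "integrable lborel f"
  shows "((\<lambda>R. integral {-R..R} f) \<longlongrightarrow> (LBINT y. f y)) at_top"
proof -
  have [measurable]: "f \<in> borel_measurable borel" using borel_measurable_integrable[OF f] by simp
  have "((\<lambda>R. LBINT y. indicator {-R..R} y *\<^sub>R f y) \<longlongrightarrow> (LBINT y. f y)) at_top"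
  proof (rule integral_dominated_convergence_at_top[where w = "\<lambda>y. norm (f y)"])
    show "AE y in lborel. ((\<lambda>R. indicator {-R..R} y *\<^sub>R f y) \<longlongrightarrow> f y) at_top"
    proof (rule AE_I2)
      fix y
      show "((\<lambda>R. indicator {-R..R} y *\<^sub>R f y) \<longlongrightarrow> f y) at_top"
      proof (rule tendsto_eventually)
        show "\<forall>\<^sub>F R in at_top. indicator {-R..R} y *\<^sub>R f y = f y"
          using eventually_ge_at_top[of "\<bar>y\<bar>"] by eventually_elim (auto simp: indicator_def abs_le_iff)
      qed
    qed
    show "\<forall>\<^sub>F R in at_top. AE y in lborel. norm (indicator {-R..R} y *\<^sub>R f y) \<le> norm (f y)"
      by (intro always_eventually allI AE_I2) (auto simp: indicator_def)
  qed (use f in auto)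
  moreover have "(LBINT y. indicator {-R..R} y *\<^sub>R f y) = integral {-R..R} f" for R
  proof -
    have "set_integrable lborel {-R..R} f" unfolding set_integrable_def by (rule integrable_mult_indicator) (use f in auto)
    from set_borel_integral_eq_integral(2)[OF this] show ?thesis by (simp add: set_lebesgue_integral_def)
  qed
  ultimately show ?thesis by simp
qed

text \<open>The y-derivative of g is \<i> (g' + t g), and g vanishes at both ends of the line, so
  the integral of g' + t g is 0.\<close>

lemma kap_by_parts:
  assumes \<tau>: "\<tau> > 0" and t: "t \<noteq> 0"
  shows "kap t \<tau> = kap' t \<tau>"
proof -
  have d: "((\<lambda>y. g t \<tau> y) has_vector_derivative \<i> * (g' t \<tau> y + of_real t * g t \<tau> y)) (at y within S)" for y S
  proof -
    have "((\<lambda>s. F \<tau> s * exp (s * of_real t)) has_field_derivative (F' \<tau> (vl y) * exp (vl y * of_real t) + (exp (vl y * of_real t) * of_real t) * F \<tau> (vl y))) (at (vl y))"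
      by (intro DERIV_mult F_deriv vl_bounds DERIV_fun_exp DERIV_cmult_right DERIV_ident[THEN DERIV_cmult_right, THEN DERIV_cong]) auto
    moreover have "(vl has_vector_derivative \<i>) (at y)"
      unfolding Complex_eq by (auto intro!: derivative_eq_intros)
    ultimately have "((\<lambda>s. F \<tau> s * exp (s * of_real t)) \<circ> vl has_vector_derivative \<i> * (F' \<tau> (vl y) * exp (vl y * of_real t) + (exp (vl y * of_real t) * of_real t) * F \<tau> (vl y))) (at y)"
      by (intro field_vector_diff_chain_at)
    then have "((\<lambda>y. g t \<tau> y) has_vector_derivative \<i> * (g' t \<tau> y + of_real t * g t \<tau> y)) (at y)"
      by (simp add: o_def g_F[abs_def] g'_def mult_ac)
    then show ?thesis by (rule has_vector_derivative_at_within)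
  qed
  have i1: "integrable lborel (g t \<tau>)" and i2: "integrable lborel (g' t \<tau>)" using g_integrable g'_integrable \<tau> by auto
  have "((\<lambda>R. integral {-R..R} (\<lambda>y. \<i> * (g' t \<tau> y + of_real t * g t \<tau> y))) \<longlongrightarrow> (LBINT y. \<i> * (g' t \<tau> y + of_real t * g t \<tau> y))) at_top"
    by (rule integral_symmetric_tendsto) (intro integrable_mult_right Bochner_Integration.integrable_add i1 i2)
  moreover have "((\<lambda>R. integral {-R..R} (\<lambda>y. \<i> * (g' t \<tau> y + of_real t * g t \<tau> y))) \<longlongrightarrow> 0) at_top"
  proof (rule Lim_transform_eventually)
    show "((\<lambda>R. g t \<tau> R - g t \<tau> (- R)) \<longlongrightarrow> 0) at_top" using tendsto_diff[OF g_tendsto_0[OF \<tau>]] by simp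
    show "\<forall>\<^sub>F R in at_top. g t \<tau> R - g t \<tau> (- R) = integral {-R..R} (\<lambda>y. \<i> * (g' t \<tau> y + of_real t * g t \<tau> y))"
      using eventually_ge_at_top[of 0]
    proof eventually_elim
      case (elim R)
      then show ?case by (intro integral_unique[symmetric] fundamental_theorem_of_calculus d) auto
    qed
  qed
  ultimately have "(LBINT y. \<i> * (g' t \<tau> y + of_real t * g t \<tau> y)) = 0"
    using tendsto_unique trivial_limit_at_top_linorder by blast
  also have "(LBINT y. \<i> * (g' t \<tau> y + of_real t * g t \<tau> y)) = \<i> * ((LBINT y. g' t \<tau> y) + of_real t * (LBINT y. g t \<tau> y))"
    using i1 i2 by simp
  finally have "(LBINT y. g' t \<tau> y) = - of_real t * (LBINT y. g t \<tau> y)"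
    by (simp add: eq_neg_iff_add_eq_0)
  then show ?thesis using t by (simp add: kap_def kap'_def)
qed

lemma has_vline_kernel:
  assumes "\<tau> > 0"
  shows "has_vline_integral (kernel_integrand l q \<alpha> t \<tau>) s0 (2 * of_real pi * \<i> * kap t \<tau>)"
  unfolding has_vline_integral_def
proof (rule Lim_transform_eventually)
  show "((\<lambda>R. \<i> * integral {-R..R} (g t \<tau>)) \<longlongrightarrow> 2 * of_real pi * \<i> * kap t \<tau>) at_top"
    using tendsto_mult[OF tendsto_const integral_symmetric_tendsto[OF g_integrable[OF assms, of t]], of \<i>]
    by (simp add: kap_def field_simps)
  show "\<forall>\<^sub>F R in at_top. \<i> * integral {-R..R} (g t \<tau>) = contour_integral (linepath (Complex s0 (- R)) (Complex s0 R)) (kernel_integrand l q \<alpha> t \<tau>)"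
    using eventually_gt_at_top[of 0]
    by eventually_elim (subst contour_integral_linepath_same_Re[where c = s0], auto simp: g_def[abs_def])
qed

text \<open>\<open>vline_integral\<close> is a definite description: existence is
  \<open>has_vline_kernel\<close>, and uniqueness is that of limits.\<close>

lemma subordination_kernel_eq:
  assumes "\<tau> > 0"
  shows "subordination_kernel l q \<alpha> s0 t \<tau> = kap t \<tau>"
proof -
  have "vline_integral s0 (kernel_integrand l q \<alpha> t \<tau>) = 2 * of_real pi * \<i> * kap t \<tau>"
    unfolding vline_integral_def
  proof (rule the_equality)
    show "has_vline_integral (kernel_integrand l q \<alpha> t \<tau>) s0 (2 * of_real pi * \<i> * kap t \<tau>)"
      by (rule has_vline_kernel[OF assms])
    fix I assume "has_vline_integral (kernel_integrand l q \<alpha> t \<tau>) s0 I"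
    then show "I = 2 * of_real pi * \<i> * kap t \<tau>"
      using has_vline_kernel[OF assms, of t] tendsto_unique[OF trivial_limit_at_top_linorder]
      unfolding has_vline_integral_def by blast
  qed
  then show ?thesis by (simp add: subordination_kernel_def)
qed

lemma g_cnj: "g t \<tau> (- y) = cnj (g t \<tau> y)"
proof -
  have c: "vl (- y) = cnj (vl y)" by (simp add: complex_eq_iff)
  show ?thesis unfolding g_def kernel_integrand_def c Q_cnj[OF vl_bounds(1)] by (simp add: exp_cnj)
qed

text \<open>Conjugation reflects the contour, and Q commutes with it in the right half-plane.
  Realness lets the kernel act by \<open>scaleR\<close> on the real inner product space.\<close>

lemma kap_real: "Im (kap t \<tau>) = 0"
proof -
  have "(LBINT y. g t \<tau> y) = (LBINT y. g t \<tau> (0 + (-1) * y))"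
    using lborel_integral_real_affine[of "-1" "g t \<tau>" 0] by simp
  also have "\<dots> = (LBINT y. cnj (g t \<tau> y))" by (simp add: g_cnj)
  also have "\<dots> = cnj (LBINT y. g t \<tau> y)" by simp
  finally have "(LBINT y. g t \<tau> y) = cnj (LBINT y. g t \<tau> y)" .
  then have "Im (LBINT y. g t \<tau> y) = 0" by (metis Im_complex_of_real Reals_cnj_iff complex_is_Real_iff)
  then show ?thesis by (simp add: kap_def)
qed

definition \<kappa> where "\<kappa> t \<tau> = Re (kap t \<tau>)"

lemma kap_\<kappa>: "kap t \<tau> = of_real (\<kappa> t \<tau>)"
  by (simp add: complex_eq_iff kap_real \<kappa>_def)

end

lemma integrable_pair_bound:
  fixes f :: "real \<times> real \<Rightarrow> 'b::{banach, second_countable_topology}"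
  assumes f[measurable]: "f \<in> borel_measurable (lborel \<Otimes>\<^sub>M lborel)"
    and u: "integrable lborel u" and v: "integrable lborel v"
    and b: "\<And>x y. norm (f (x, y)) \<le> u x * v y"
  shows "integrable (lborel \<Otimes>\<^sub>M lborel) f"
proof (rule Bochner_Integration.integrable_bound[OF _ f])
  have [measurable]: "u \<in> borel_measurable borel" "v \<in> borel_measurable borel"
    using u v by (auto dest: borel_measurable_integrable)
  show "integrable (lborel \<Otimes>\<^sub>M lborel) (\<lambda>(x, y). u x * v y)"
  proof (rule lborel_pair.Fubini_integrable)
    show "integrable lborel (\<lambda>x. LBINT y. norm (case (x, y) of (x, y) \<Rightarrow> u x * v y))"
      using integrable_mult_left[OF integrable_norm[OF u], of "LBINT y. \<bar>v y\<bar>"] v by (simp add: abs_mult)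
    show "AE x in lborel. integrable lborel (\<lambda>y. case (x, y) of (x, y) \<Rightarrow> u x * v y)" using v by simp
  qed measurable
  show "AE x in lborel \<Otimes>\<^sub>M lborel. norm (f x) \<le> norm (case x of (x, y) \<Rightarrow> u x * v y)"
    using b by (intro AE_I2) (auto simp: split_beta' intro: order_trans[OF _ abs_ge_self])
qed

lemma integrable_exp_minus:
  fixes a :: real
  assumes "a > 0"
  shows "integrable lborel (\<lambda>t. indicator {0<..} t * exp (- a * t))"
proof -
  have "(\<lambda>t. exp (- a * t)) integrable_on {0..}" using has_integral_exp_minus_to_infinity[OF assms, of 0] by blast
  then have "(\<lambda>t. exp (- a * t)) absolutely_integrable_on {0..}"
    by (intro nonnegative_absolutely_integrable_1) auto
  then have "(\<lambda>t. exp (- a * t)) absolutely_integrable_on {0<..}" by (rule set_integrable_subset) auto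
  then show ?thesis unfolding set_integrable_def by (subst (asm) integrable_completion) auto
qed

lemma integral_exp_complex:
  assumes z: "Re z > 0"
  shows "integrable lborel (\<lambda>t. indicator {0<..} t *\<^sub>R exp (- z * of_real t))"
    "(LBINT t. indicator {0<..} t *\<^sub>R exp (- z * of_real t)) = 1 / z"
proof -
  let ?f = "\<lambda>t. indicator {0<..} t *\<^sub>R exp (- z * of_real t)"
  have nz: "z \<noteq> 0" using z by auto
  show i: "integrable lborel ?f"
    by (rule Bochner_Integration.integrable_bound[OF integrable_exp_minus[OF z]]) (auto simp: indicator_def)
  \<comment> \<open>The lemma on symmetric limits lives inside the locale; the parameters 1, 1, 1/2,
    1 are an arbitrary instance that gives access to it.\<close>
  have "((\<lambda>R. integral {-R..R} ?f) \<longlongrightarrow> (LBINT t. ?f t)) at_top"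
    by (rule subordination.integral_symmetric_tendsto[OF _ i]) (rule subordination.intro[of 1 "\<lambda>_. 1" "\<lambda>_. 1/2" 1], auto)
  moreover have "((\<lambda>R. integral {-R..R} ?f) \<longlongrightarrow> 1 / z) at_top"
  proof (rule Lim_transform_eventually)
    have "((\<lambda>R. exp (- (Re z * R))) \<longlongrightarrow> 0) at_top"
    proof (rule filterlim_compose[OF exp_at_bot])
      show "filterlim (\<lambda>R. - (Re z * R)) at_bot at_top" unfolding filterlim_uminus_at_bot minus_minus
        by (rule filterlim_tendsto_pos_mult_at_top[OF tendsto_const z filterlim_ident])
    qed
    then have "((\<lambda>R. exp (- z * of_real R)) \<longlongrightarrow> 0) at_top" by (rule_tac tendsto_norm_zero_cancel) simp
    then have "((\<lambda>R. (1 - exp (- z * of_real R)) / z) \<longlongrightarrow> (1 - 0) / z) at_top" by (intro tendsto_intros nz)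
    then show "((\<lambda>R. (1 - exp (- z * of_real R)) / z) \<longlongrightarrow> 1 / z) at_top" by simp
    show "\<forall>\<^sub>F R in at_top. (1 - exp (- z * of_real R)) / z = integral {-R..R} ?f"
      using eventually_ge_at_top[of 0]
    proof eventually_elim
      case (elim R)
      note R = elim
      have "((\<lambda>t. exp (- z * of_real t)) has_integral (- exp (- z * of_real R) / z - (- exp (- z * of_real 0) / z))) {0..R}"
        using R nz by (intro fundamental_theorem_of_calculus)
          (auto intro!: derivative_eq_intros has_vector_derivative_real_field simp: has_real_derivative_iff_has_vector_derivative)
      then have "((\<lambda>t. exp (- z * of_real t)) has_integral ((1 - exp (- z * of_real R)) / z)) {0..R}"
        by (simp add: diff_divide_distrib)
      then have "((\<lambda>t. if t \<in> {0..R} then exp (- z * of_real t) else 0) has_integral ((1 - exp (- z * of_real R)) / z)) {-R..R}"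
        by (subst has_integral_restrict) (use R in auto)
      then have "(?f has_integral ((1 - exp (- z * of_real R)) / z)) {-R..R}"
        by (rule has_integral_spike_finite[of "{0}", rotated 2]) (auto simp: indicator_def)
      then show ?case by (simp add: integral_unique)
    qed
  qed
  ultimately show "(LBINT t. ?f t) = 1 / z" using tendsto_unique trivial_limit_at_top_linorder by blast
qed

section \<open>Bounds and continuity of the kernel, and Cauchy's formula in the half-plane\<close>

context subordination
begin

definition P1 where "P1 = (LBINT y. norm (vl y) powr (- 1 - b / 2))"
definition P2 where "P2 = (LBINT y. norm (vl y) powr (b - 2))"
definition c0 where "c0 = ell / 2 * s0 powr b"

lemma c0_pos: "c0 > 0" using ell_pos s0 by (simp add: c0_def)

lemma \<kappa>_bound1:
  assumes "\<tau> > 0"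
  shows "\<bar>\<kappa> t \<tau>\<bar> \<le> A1 * P1 * exp (s0 * t) * exp (- c0 * \<tau>) * \<tau> powr (- 3/2)"
proof -
  let ?C = "A1 * exp (s0 * t) * exp (- (ell / 2 * s0 powr b * \<tau>)) * \<tau> powr (- 3/2)"
  have A: "A1 \<ge> 0" "P1 \<ge> 0" using C1_pos by (auto simp: A1_def P1_def intro!: Bochner_Integration.integral_nonneg)
  have i: "integrable lborel (\<lambda>y. ?C * norm (vl y) powr (- 1 - b / 2))"
    using b_bounds by (intro integrable_mult_right integrable_norm_powr) auto
  have "norm (LBINT y. g t \<tau> y) \<le> (LBINT y. ?C * norm (vl y) powr (- 1 - b / 2))"
    by (rule order_trans[OF integral_norm_bound])
       (intro integral_mono integrable_norm g_integrable assms i norm_g_le)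
  also have "\<dots> = A1 * P1 * exp (s0 * t) * exp (- c0 * \<tau>) * \<tau> powr (- 3/2)" by (simp add: P1_def c0_def)
  finally have *: "norm (LBINT y. g t \<tau> y) \<le> A1 * P1 * exp (s0 * t) * exp (- c0 * \<tau>) * \<tau> powr (- 3/2)" .
  have "\<bar>\<kappa> t \<tau>\<bar> \<le> norm (kap t \<tau>)" unfolding \<kappa>_def by (rule abs_Re_le_cmod)
  also have "\<dots> = norm (LBINT y. g t \<tau> y) / (2 * pi)" by (simp add: kap_def norm_divide norm_mult)
  also have "\<dots> \<le> norm (LBINT y. g t \<tau> y) / 1" using pi_gt3 by (intro divide_left_mono) auto
  finally show ?thesis using * by simp
qed

lemma kap'_bound:
  assumes "\<tau> \<ge> 0" "t > 0"
  shows "norm (kap' t \<tau>) \<le> C2 * P2 * exp (s0 * t) / t"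
proof -
  have A: "C2 \<ge> 0" "P2 \<ge> 0" using C1_pos ell_pos by (auto simp: C2_def P2_def intro!: Bochner_Integration.integral_nonneg)
  have i: "integrable lborel (\<lambda>y. C2 * exp (s0 * t) * norm (vl y) powr (b - 2))"
    using b_bounds by (intro integrable_mult_right integrable_norm_powr) auto
  have "norm (LBINT y. g' t \<tau> y) \<le> (LBINT y. C2 * exp (s0 * t) * norm (vl y) powr (b - 2))"
    by (rule order_trans[OF integral_norm_bound])
       (intro integral_mono integrable_norm g'_integrable assms i norm_g'_le)
  also have "\<dots> = C2 * P2 * exp (s0 * t)" by (simp add: P2_def)
  finally have *: "norm (LBINT y. g' t \<tau> y) \<le> C2 * P2 * exp (s0 * t)" .
  have "norm (kap' t \<tau>) = norm (LBINT y. g' t \<tau> y) / (2 * pi * t)"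
    using assms by (simp add: kap'_def norm_divide norm_mult)
  also have "\<dots> \<le> norm (LBINT y. g' t \<tau> y) / t" using pi_gt3 assms by (intro divide_left_mono) auto
  also have "\<dots> \<le> C2 * P2 * exp (s0 * t) / t" using * assms by (intro divide_right_mono) auto
  finally show ?thesis .
qed

lemma \<kappa>_bound2:
  assumes "\<tau> > 0" "t > 0"
  shows "\<bar>\<kappa> t \<tau>\<bar> \<le> C2 * P2 * exp (s0 * t) / t"
  using kap'_bound[of \<tau> t] kap_by_parts[of \<tau> t] abs_Re_le_cmod[of "kap t \<tau>"] assms by (simp add: \<kappa>_def)

definition K_maj where "K_maj = sqrt (A1 * P1 * (C2 * P2))"
definition majorant where "majorant \<tau> = indicator {0<..} \<tau> * (exp (- c0 / 2 * \<tau>) * \<tau> powr (- 3/4))" for \<tau> :: real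

lemma K_maj_nonneg: "K_maj \<ge> 0"
  using C1_pos ell_pos by (auto simp: K_maj_def A1_def P1_def C2_def P2_def intro!: Bochner_Integration.integral_nonneg mult_nonneg_nonneg)

text \<open>The geometric mean of \<open>\<kappa>_bound1\<close>, of order \<tau>^(-3/2), and
  \<open>\<kappa>_bound2\<close>, of order 1/t. It is a product of a function of t and a function of
  \<tau> with the integrable singularities t^(-1/2) and \<tau>^(-3/4), which makes Fubini available
  in these two variables.\<close>

lemma \<kappa>_bound:
  assumes "\<tau> > 0" "t > 0"
  shows "\<bar>\<kappa> t \<tau>\<bar> \<le> K_maj * exp (s0 * t) * t powr (- 1/2) * majorant \<tau>"
proof -
  have A: "A1 \<ge> 0" "P1 \<ge> 0" using C1_pos by (auto simp: A1_def P1_def intro!: Bochner_Integration.integral_nonneg)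
  have B: "C2 \<ge> 0" "P2 \<ge> 0" using C1_pos ell_pos by (auto simp: C2_def P2_def intro!: Bochner_Integration.integral_nonneg)
  have "\<bar>\<kappa> t \<tau>\<bar>\<^sup>2 \<le> (A1 * P1 * exp (s0 * t) * exp (- c0 * \<tau>) * \<tau> powr (- 3/2)) * (C2 * P2 * exp (s0 * t) / t)"
    unfolding power2_eq_square using A B assms by (intro mult_mono \<kappa>_bound1 \<kappa>_bound2) auto
  also have "\<dots> = (K_maj * exp (s0 * t) * t powr (- 1/2) * majorant \<tau>)\<^sup>2"
  proof -
    have 1: "K_maj\<^sup>2 = A1 * P1 * (C2 * P2)" using A B by (simp add: K_maj_def)
    have 2: "(t powr (- 1/2))\<^sup>2 = 1 / t" using assms unfolding power2_eq_square powr_add[symmetric] by (simp add: powr_minus_divide)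
    have 3: "(majorant \<tau>)\<^sup>2 = exp (- c0 * \<tau>) * \<tau> powr (- 3/2)"
      using assms by (simp add: majorant_def power_mult_distrib powr_power exp_of_nat_mult[symmetric] exp_double[symmetric])
    show ?thesis unfolding power_mult_distrib 1 2 3 by (simp add: power2_eq_square)
  qed
  finally have "\<bar>\<kappa> t \<tau>\<bar>\<^sup>2 \<le> (K_maj * exp (s0 * t) * t powr (- 1/2) * majorant \<tau>)\<^sup>2" .
  moreover have "0 \<le> K_maj * exp (s0 * t) * t powr (- 1/2) * majorant \<tau>" using K_maj_nonneg by (simp add: majorant_def)
  ultimately show ?thesis by (rule power2_le_imp_le)
qed

text \<open>Up to 1 the power is integrable because e > -1; beyond 1 it is at most 1 and the
  exponential takes over.\<close>

lemma integrable_powr_exp: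
  fixes a e :: real
  assumes "a > 0" "e > -1" "e \<le> 0"
  shows "integrable lborel (\<lambda>x. indicator {0<..} x * (exp (- a * x) * x powr e))"
proof -
  have h: "((\<lambda>x. x powr e) has_integral (1 powr (e + 1) / (e + 1) - 0 powr (e + 1) / (e + 1))) {0..1}"
    using has_integral_powr_from_0[of e 1] assms by simp
  have "(\<lambda>x. x powr e) absolutely_integrable_on {0..1}"
    using h by (intro nonnegative_absolutely_integrable_1) auto
  then have i1: "integrable lborel (\<lambda>x. indicator {0..1} x * x powr e)"
    unfolding set_integrable_def by (subst (asm) integrable_completion) auto
  have "integrable lborel (\<lambda>x. indicator {0..1} x * x powr e + indicator {0<..} x * exp (- a * x))"
    by (intro Bochner_Integration.integrable_add i1 integrable_exp_minus assms)
  then show ?thesis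
  proof (rule Bochner_Integration.integrable_bound)
    have "x powr e \<le> 1" if "x > 1" for x :: real using powr_mono[of e 0 x] assms that by simp
    then have "norm (indicator {0<..} x * (exp (- a * x) * x powr e)) \<le> norm (indicator {0..1} x * x powr e + indicator {0<..} x * exp (- a * x))" for x :: real
      using assms by (cases "x \<le> 1") (auto simp: indicator_def abs_mult intro!: mult_left_le_one_le add_increasing2 mult_left_le)
    then show "AE x in lborel. norm (indicator {0<..} x * (exp (- a * x) * x powr e)) \<le> norm (indicator {0..1} x * x powr e + indicator {0<..} x * exp (- a * x))"
      by simp
  qed measurable
qed

lemma majorant_integrable: "integrable lborel majorant"
  using integrable_powr_exp[of "c0/2" "-3/4"] c0_pos by (simp add: majorant_def[abs_def])

text \<open>Dominated convergence with the bound of \<open>norm_g'_le\<close>, uniform down to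
  \<tau> = 0. Continuity at 0 is what makes the vector-valued integrand integrable on intervals that
  start at 0.\<close>

lemma kap'_cont:
  assumes "t > 0"
  shows "continuous_on {0..} (\<lambda>\<tau>. kap' t \<tau>)"
proof -
  have "continuous_on {0..} (\<lambda>\<tau>. LBINT y. g' t \<tau> y)" unfolding continuous_on_sequentially
  proof (intro ballI allI impI, unfold o_def)
    fix x :: "nat \<Rightarrow> real" and a :: real
    assume a: "(\<forall>n. x n \<in> {0..}) \<and> x \<longlonglongrightarrow> a"
    show "(\<lambda>n. LBINT y. g' t (x n) y) \<longlonglongrightarrow> (LBINT y. g' t a y)"
    proof (rule integral_dominated_convergence)
      show "integrable lborel (\<lambda>y. C2 * exp (s0 * t) * norm (vl y) powr (b - 2))"
        using b_bounds by (intro integrable_mult_right integrable_norm_powr) auto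
      show "AE y in lborel. norm (g' t (x n) y) \<le> C2 * exp (s0 * t) * norm (vl y) powr (b - 2)" for n
        using a by (intro AE_I2 norm_g'_le) auto
      show "AE y in lborel. (\<lambda>n. g' t (x n) y) \<longlonglongrightarrow> g' t a y"
      proof (rule AE_I2)
        fix y
        have "isCont (\<lambda>((t, \<tau>), y). g' t \<tau> y) ((t, a), y)" using g'_cont by (simp add: continuous_on_eq_continuous_at)
        moreover have "(\<lambda>n. ((t, x n), y)) \<longlonglongrightarrow> ((t, a), y)" using a by (intro tendsto_intros) auto
        ultimately show "(\<lambda>n. g' t (x n) y) \<longlonglongrightarrow> g' t a y"
          using isCont_tendsto_compose[of "((t, a), y)" "\<lambda>((t, \<tau>), y). g' t \<tau> y" "\<lambda>n. ((t, x n), y)"] by simp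
      qed
    qed (use g_borel in simp_all)
  qed
  then show ?thesis unfolding kap'_def using assms by (intro continuous_intros) auto
qed

lemma \<kappa>_cont_t:
  assumes "\<tau> > 0"
  shows "continuous_on UNIV (\<lambda>t. \<kappa> t \<tau>)"
proof -
  have "continuous_on UNIV (\<lambda>t. LBINT y. g t \<tau> y)" unfolding continuous_on_sequentially
  proof (intro ballI allI impI, unfold o_def)
    fix x :: "nat \<Rightarrow> real" and a :: real
    assume a: "(\<forall>n. x n \<in> UNIV) \<and> x \<longlonglongrightarrow> a"
    then have "bounded (range x)" using convergent_imp_bounded by blast
    then obtain M where M: "\<And>n. x n \<le> M" unfolding bounded_iff real_norm_def by (meson abs_le_D1 rangeI)
    let ?C = "\<lambda>t. A1 * exp (s0 * t) * exp (- (ell / 2 * s0 powr b * \<tau>)) * \<tau> powr (- 3/2)"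
    show "(\<lambda>n. LBINT y. g (x n) \<tau> y) \<longlonglongrightarrow> (LBINT y. g a \<tau> y)"
    proof (rule integral_dominated_convergence)
      show "integrable lborel (\<lambda>y. ?C M * norm (vl y) powr (- 1 - b / 2))"
        using b_bounds by (intro integrable_mult_right integrable_norm_powr) auto
      show "AE y in lborel. norm (g (x n) \<tau> y) \<le> ?C M * norm (vl y) powr (- 1 - b / 2)" for n
      proof (rule AE_I2)
        fix y
        have "exp (s0 * x n) \<le> exp (s0 * M)" using M s0 by simp
        then have "?C (x n) * norm (vl y) powr (- 1 - b / 2) \<le> ?C M * norm (vl y) powr (- 1 - b / 2)"
          using C1_pos by (intro mult_right_mono mult_left_mono) (auto simp: A1_def)
        then show "norm (g (x n) \<tau> y) \<le> ?C M * norm (vl y) powr (- 1 - b / 2)"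
          using norm_g_le[OF assms, of "x n" y] by linarith
      qed
      show "AE y in lborel. (\<lambda>n. g (x n) \<tau> y) \<longlonglongrightarrow> g a \<tau> y"
      proof (rule AE_I2)
        fix y
        have "isCont (\<lambda>((t, \<tau>), y). g t \<tau> y) ((a, \<tau>), y)" using g_cont by (simp add: continuous_on_eq_continuous_at)
        moreover have "(\<lambda>n. ((x n, \<tau>), y)) \<longlonglongrightarrow> ((a, \<tau>), y)" using a by (intro tendsto_intros) auto
        ultimately show "(\<lambda>n. g (x n) \<tau> y) \<longlonglongrightarrow> g a \<tau> y"
          using isCont_tendsto_compose[of "((a, \<tau>), y)" "\<lambda>((t, \<tau>), y). g t \<tau> y" "\<lambda>n. ((x n, \<tau>), y)"] by simp
      qed
    qed (use g_borel in simp_all)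
  qed
  then show ?thesis unfolding kap_def \<kappa>_def by (intro continuous_intros) auto
qed

lemma \<kappa>_meas[measurable]: "(\<lambda>(t, \<tau>). \<kappa> t \<tau>) \<in> borel_measurable (lborel \<Otimes>\<^sub>M lborel)"
proof -
  have "(\<lambda>x. LBINT y. (case x of (t, \<tau>) \<Rightarrow> g t \<tau> y)) \<in> borel_measurable (lborel \<Otimes>\<^sub>M lborel :: (real \<times> real) measure)"
  proof (rule lborel.borel_measurable_lebesgue_integral)
    have "(\<lambda>((t, \<tau>), y). g t \<tau> y) \<in> borel_measurable ((lborel \<Otimes>\<^sub>M lborel) \<Otimes>\<^sub>M lborel)"
      using g_meas by (simp add: lborel_prod)
    then show "(\<lambda>(x, y). case x of (t, \<tau>) \<Rightarrow> g t \<tau> y) \<in> borel_measurable ((lborel \<Otimes>\<^sub>M lborel) \<Otimes>\<^sub>M lborel)"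
      by (simp add: case_prod_unfold)
  qed
  then have "(\<lambda>x. Re ((LBINT y. (case x of (t, \<tau>) \<Rightarrow> g t \<tau> y)) / (2 * pi))) \<in> borel_measurable (lborel \<Otimes>\<^sub>M lborel)"
    by measurable
  then show ?thesis by (simp add: \<kappa>_def kap_def case_prod_unfold)
qed

lemma F_line_integrable:
  assumes "\<tau> > 0" "p > s0"
  shows "integrable lborel (\<lambda>y. F \<tau> (vl y) / (of_real p - vl y))"
proof (rule Bochner_Integration.integrable_bound[OF integrable_mult_right[OF integrable_norm[OF g_integrable[OF assms(1), of 0]], of "1 / (p - s0)"]])
  have "norm (F \<tau> (vl y) / (of_real p - vl y)) \<le> norm (1 / (p - s0) * norm (g 0 \<tau> y))" for y
  proof -
    have "p - s0 \<le> norm (of_real p - vl y)" using complex_Re_le_cmod[of "of_real p - vl y"] by simp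
    then show ?thesis using assms by (simp add: g_F norm_divide frac_le)
  qed
  then show "AE y in lborel. norm (F \<tau> (vl y) / (of_real p - vl y)) \<le> norm (1 / (p - s0) * norm (g 0 \<tau> y))" by simp
  have "(\<lambda>y. g 0 \<tau> y / (of_real p - (of_real s0 + \<i> * of_real y))) \<in> borel_measurable borel"
    using g_borel(1) by measurable
  then show "(\<lambda>y. F \<tau> (vl y) / (of_real p - vl y)) \<in> borel_measurable lborel" by (simp add: g_F Complex_eq)
qed

text \<open>Cauchy's formula on the rectangle with left side on Re s = s0 and right side on Re s =
  R. On the other three sides F is O(R^(b-1)), while 1/(s - p) times their length stays bounded. The
  denominator p - s absorbs the sign that arises because the left side is traversed
  downwards.\<close>

lemma cauchy_half_plane:
  assumes \<tau>: "\<tau> > 0" and p: "p > s0"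
  shows "(LBINT y. F \<tau> (vl y) / (of_real p - vl y)) = 2 * pi * F \<tau> (of_real p)"
proof -
  let ?I = "\<lambda>R. integral {-R..R} (\<lambda>y. F \<tau> (vl y) / (of_real p - vl y))"
  have 1: "(?I \<longlongrightarrow> (LBINT y. F \<tau> (vl y) / (of_real p - vl y))) at_top"
    by (rule integral_symmetric_tendsto[OF F_line_integrable[OF assms]])
  let ?f = "\<lambda>w. F \<tau> w / (w - of_real p)"
  \<comment> \<open>A bound for the integrand on the three far sides, C1 R^(b-1)/(R - p), times
    their total length.\<close>
  define E where "E R = C1 * R powr (b - 1) / (R - p) * (2 * (R - s0) + 2 * R)" for R
  have est: "norm (?I R - 2 * pi * F \<tau> (of_real p)) \<le> E R" if R: "R > p" for R
  proof -
    have R0: "R > s0" "R > 0" using R p s0 by auto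
    define a1 where "a1 = Complex s0 (-R)"
    define a2 where "a2 = Complex R (-R)"
    define a3 where "a3 = Complex R R"
    define a4 where "a4 = Complex s0 R"
    define S where "S = {w. Re w > 0}"
    have S: "convex S" "open S" using convex_halfspace_Re_gt[of 0] open_halfspace_Re_gt[of 0] by (auto simp: S_def)
    have hol: "F \<tau> holomorphic_on S"
      using F_deriv by (auto simp: S_def holomorphic_on_def field_differentiable_def intro: has_field_derivative_at_within)
    have rp: "rectpath a1 a3 = linepath a1 a2 +++ linepath a2 a3 +++ linepath a3 a4 +++ linepath a4 a1"
      by (simp add: rectpath_def Let_def a1_def a2_def a3_def a4_def)
    have pbox: "of_real p \<in> box a1 a3" using R p R0 by (simp add: in_box_complex_iff a1_def a3_def)
    have img: "path_image (rectpath a1 a3) \<subseteq> S - {of_real p}"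
    proof -
      have "path_image (rectpath a1 a3) \<subseteq> cbox a1 a3" using R0 by (intro path_image_rectpath_subset_cbox) (auto simp: a1_def a3_def)
      moreover have "cbox a1 a3 \<subseteq> S" using s0 by (auto simp: in_cbox_complex_iff a1_def S_def)
      moreover have "of_real p \<notin> path_image (rectpath a1 a3)"
        using path_image_rectpath_inter_box[of a1 a3] pbox R0 by (auto simp: a1_def a3_def)
      ultimately show ?thesis by blast
    qed
    have "(?f has_contour_integral (2 * pi * \<i> * winding_number (rectpath a1 a3) (of_real p) * F \<tau> (of_real p))) (rectpath a1 a3)"
      by (rule Cauchy_integral_formula_convex_simple[OF S(1) hol _ _ img])
         (use p s0 S(2) in \<open>auto simp: interior_open S_def\<close>)
    then have tot: "(?f has_contour_integral (2 * pi * \<i> * F \<tau> (of_real p))) (rectpath a1 a3)"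
      by (simp add: winding_number_rectpath[OF pbox])
    have seg: "closed_segment a1 a2 \<subseteq> S - {of_real p}" "closed_segment a2 a3 \<subseteq> S - {of_real p}"
      "closed_segment a3 a4 \<subseteq> S - {of_real p}" "closed_segment a4 a1 \<subseteq> S - {of_real p}"
      using img unfolding rp by (auto simp: path_image_join)
    have cont: "continuous_on (S - {of_real p}) ?f"
      by (intro continuous_intros holomorphic_on_imp_continuous_on[OF holomorphic_on_subset[OF hol]]) auto
    have ci: "?f contour_integrable_on linepath u v" if "closed_segment u v \<subseteq> S - {of_real p}" for u v
      by (rule contour_integrable_continuous_linepath[OF continuous_on_subset[OF cont that]])
    define I where "I u v = contour_integral (linepath u v) ?f" for u v
    have hI: "(?f has_contour_integral I u v) (linepath u v)" if "closed_segment u v \<subseteq> S - {of_real p}" for u v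
      unfolding I_def using ci[OF that] by (rule has_contour_integral_integral)
    have "(?f has_contour_integral (I a1 a2 + (I a2 a3 + (I a3 a4 + I a4 a1)))) (rectpath a1 a3)"
      unfolding rp by (intro has_contour_integral_join hI seg) auto
    with tot have sum: "I a1 a2 + (I a2 a3 + (I a3 a4 + I a4 a1)) = 2 * pi * \<i> * F \<tau> (of_real p)"
      using has_contour_integral_unique by blast
    have "I a1 a4 = \<i> * integral {-R..R} (\<lambda>y. ?f (Complex s0 y))"
      unfolding I_def by (rule contour_integral_linepath_same_Re) (use R0 in \<open>auto simp: a1_def a4_def\<close>)
    also have "integral {-R..R} (\<lambda>y. ?f (Complex s0 y)) = - ?I R"
    proof -
      have "F \<tau> (vl y) / (vl y - of_real p) = - (F \<tau> (vl y) / (of_real p - vl y))" for y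
        by (metis minus_diff_eq minus_divide_right)
      then show ?thesis by simp
    qed
    finally have "I a1 a4 = - \<i> * ?I R" by simp
    moreover have "I a4 a1 = - I a1 a4"
      unfolding I_def by (rule contour_integral_reverse_linepath) (rule continuous_on_subset[OF cont], use seg(4) in \<open>simp add: closed_segment_commute\<close>)
    ultimately have "I a4 a1 = \<i> * ?I R" by simp
    with sum have "\<i> * (?I R - 2 * pi * F \<tau> (of_real p)) = - (I a1 a2 + (I a2 a3 + I a3 a4))"
      by (simp add: algebra_simps)
    then have "norm (\<i> * (?I R - 2 * pi * F \<tau> (of_real p))) = norm (I a1 a2 + (I a2 a3 + I a3 a4))" by (metis norm_minus_cancel)
    then have n: "norm (?I R - 2 * pi * F \<tau> (of_real p)) \<le> norm (I a1 a2) + (norm (I a2 a3) + norm (I a3 a4))"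
      by (simp add: norm_mult) (metis (no_types) add_left_mono norm_triangle_ineq order_trans)
    define B where "B = C1 * R powr (b - 1) / (R - p)"
    have B0: "B \<ge> 0" using R C1_pos by (simp add: B_def)
    have fb: "norm (?f w) \<le> B" if w: "w \<in> S" "norm w \<ge> R" for w
    proof -
      have w': "Re w > 0" "s0 \<le> norm w" using w R0 by (auto simp: S_def)
      have "norm (F \<tau> w) \<le> C1 * norm w powr (b - 1) * exp (- (ell * \<tau> * norm w powr b))"
        by (rule norm_F_le) (use w' \<tau> in auto)
      also have "\<dots> \<le> C1 * R powr (b - 1) * 1"
        using C1_pos ell_pos \<tau> R0 w b_bounds by (intro mult_mono powr_mono2') auto
      finally have 1: "norm (F \<tau> w) \<le> C1 * R powr (b - 1)" by simp
      have "R - p \<le> norm (w - of_real p)" using norm_triangle_ineq2[of w "of_real p"] w p s0 by simp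
      then show ?thesis unfolding B_def norm_divide using 1 R C1_pos by (intro frac_le) auto
    qed
    have sb: "norm (I u v) \<le> B * norm (v - u)" if "closed_segment u v \<subseteq> S - {of_real p}" "\<And>w. w \<in> closed_segment u v \<Longrightarrow> norm w \<ge> R" for u v
      unfolding I_def by (rule contour_integral_bound_linepath[OF ci[OF that(1)] B0]) (use that fb in blast)
    have "norm (I a1 a2) \<le> B * norm (a2 - a1)"
    proof (rule sb[OF seg(1)])
      fix w assume "w \<in> closed_segment a1 a2"
      then have "Im w = - R" using closed_segment_same_Im[of a1 a2] by (auto simp: a1_def a2_def)
      then show "R \<le> norm w" using abs_Im_le_cmod[of w] by simp
    qed
    moreover have "norm (I a2 a3) \<le> B * norm (a3 - a2)"
    proof (rule sb[OF seg(2)])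
      fix w assume "w \<in> closed_segment a2 a3"
      then have "Re w = R" using closed_segment_same_Re[of a2 a3] by (auto simp: a3_def a2_def)
      then show "R \<le> norm w" using abs_Re_le_cmod[of w] by simp
    qed
    moreover have "norm (I a3 a4) \<le> B * norm (a4 - a3)"
    proof (rule sb[OF seg(3)])
      fix w assume "w \<in> closed_segment a3 a4"
      then have "Im w = R" using closed_segment_same_Im[of a3 a4] by (auto simp: a3_def a4_def)
      then show "R \<le> norm w" using abs_Im_le_cmod[of w] by simp
    qed
    moreover have "norm (a2 - a1) = R - s0" "norm (a3 - a2) = 2 * R" "norm (a4 - a3) = R - s0"
      using R0 by (auto simp: a1_def a2_def a3_def a4_def cmod_def real_sqrt_mult)
    ultimately have "norm (?I R - 2 * pi * F \<tau> (of_real p)) \<le> B * (R - s0) + (B * (2 * R) + B * (R - s0))"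
      using n by simp
    also have "\<dots> = B * (2 * (R - s0) + 2 * R)" by (simp add: algebra_simps)
    also have "\<dots> = E R" by (simp only: E_def B_def)
    finally show ?thesis .
  qed
  have "(E \<longlongrightarrow> 0) at_top"
  proof -
    have "((\<lambda>R. R powr (b - 1)) \<longlongrightarrow> 0) at_top"
      using b_bounds by (intro tendsto_neg_powr filterlim_ident) auto
    then have lim: "((\<lambda>R. 8 * C1 * R powr (b - 1)) \<longlongrightarrow> 0) at_top" by (rule tendsto_mult_right_zero)
    have "norm (E R) \<le> 8 * C1 * R powr (b - 1)" if R: "R \<ge> 2 * p" for R
    proof -
      have R0: "R > 0" "R - p \<ge> R / 2" "R > s0" using R p s0 by auto
      have "E R = C1 * R powr (b - 1) * ((2 * (R - s0) + 2 * R) / (R - p))" by (simp add: E_def)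
      also have "\<dots> \<le> C1 * R powr (b - 1) * ((4 * R) / (R / 2))"
        using R0 s0 C1_pos by (intro mult_left_mono frac_le) auto
      also have "\<dots> = 8 * C1 * R powr (b - 1)" using R0 by simp
      finally have "E R \<le> 8 * C1 * R powr (b - 1)" .
      moreover have "E R \<ge> 0" using R0 C1_pos p s0 R by (simp add: E_def)
      ultimately show ?thesis by simp
    qed
    then show ?thesis
      by (intro Lim_null_comparison[OF _ lim]) (auto intro!: eventually_mono[OF eventually_ge_at_top[of "2 * p"]])
  qed
  then have "((\<lambda>R. ?I R - 2 * pi * F \<tau> (of_real p)) \<longlongrightarrow> 0) at_top"
    by (rule Lim_null_comparison[rotated]) (use est in \<open>auto intro!: eventually_mono[OF eventually_gt_at_top[of p]]\<close>)
  then have "(?I \<longlongrightarrow> 2 * pi * F \<tau> (of_real p)) at_top" by (rule LIM_zero_cancel)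
  with 1 show ?thesis using tendsto_unique trivial_limit_at_top_linorder by blast
qed

end

section \<open>The transform of the kernel and of subordinated functions\<close>

context subordination
begin

definition Qr where "Qr p = (\<Sum>j=1..l. q j * p powr \<alpha> j)" for p :: real

lemma Q_of_real: "p > 0 \<Longrightarrow> Q (of_real p) = of_real (Qr p)"
  by (simp add: Q_sym_def Qr_def powr_of_real)

lemma Qr_pos: "p > 0 \<Longrightarrow> Qr p > 0"
  unfolding Qr_def using l q by (intro sum_pos) auto

lemma Qr_le: "p \<ge> 1 \<Longrightarrow> Qr p \<le> (\<Sum>j=1..l. q j) * p"
proof -
  assume p: "p \<ge> 1"
  have "q j * p powr \<alpha> j \<le> q j * p" if j: "j \<in> {1..l}" for j
    using powr_mono[of "\<alpha> j" 1 p] \<alpha>_le[OF j] \<alpha>1 q[OF j] p by (intro mult_left_mono) auto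
  then show ?thesis unfolding Qr_def sum_distrib_right by (intro sum_mono)
qed

text \<open>Fubini in t and y: integrating exp(-(p - s) t) over t > 0 gives 1/(p - s), since Re s =
  s0 < p on the contour, and \<open>cauchy_half_plane\<close> evaluates what remains.\<close>

lemma \<kappa>_laplace:
  assumes \<tau>: "\<tau> > 0" and p: "p > s0"
  shows "(LBINT t. indicator {0<..} t * (exp (- p * t) * \<kappa> t \<tau>)) = Qr p / p * exp (- Qr p * \<tau>)"
proof -
  let ?D = "A1 * exp (- (ell / 2 * s0 powr b * \<tau>)) * \<tau> powr (- 3/2)"
  define f where "f x = (case x of (t, y) \<Rightarrow> indicator {0<..} t *\<^sub>R (exp (- of_real p * of_real t) * g t \<tau> y))" for x
  have p0: "p > 0" using p s0 by simp
  have fm: "f \<in> borel_measurable (lborel \<Otimes>\<^sub>M lborel)"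
  proof -
    have "continuous_on UNIV (\<lambda>(t::real, y::real). ((t, \<tau>), y))" by (auto intro!: continuous_intros simp: case_prod_unfold)
    from continuous_on_compose2[OF g_cont this] have "continuous_on UNIV (\<lambda>(t, y). g t \<tau> y)" by (simp add: case_prod_unfold)
    then have [measurable]: "(\<lambda>(t, y). g t \<tau> y) \<in> borel_measurable (lborel \<Otimes>\<^sub>M lborel)"
      by (simp add: lborel_prod borel_measurable_continuous_onI)
    show ?thesis unfolding f_def by measurable
  qed
  have fi: "integrable (lborel \<Otimes>\<^sub>M lborel) f"
  proof (rule integrable_pair_bound[OF fm])
    show "integrable lborel (\<lambda>t. indicator {0<..} t * exp (- (p - s0) * t))" using p by (intro integrable_exp_minus) simp
    show "integrable lborel (\<lambda>y. ?D * norm (vl y) powr (- 1 - b / 2))"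
      using b_bounds by (intro integrable_mult_right integrable_norm_powr) auto
    fix t y
    show "norm (f (t, y)) \<le> indicator {0<..} t * exp (- (p - s0) * t) * (?D * norm (vl y) powr (- 1 - b / 2))"
    proof (cases "t > 0")
      case True
      have "norm (f (t, y)) = exp (- p * t) * norm (g t \<tau> y)" using True by (simp add: f_def norm_mult)
      also have "\<dots> \<le> exp (- p * t) * (A1 * exp (s0 * t) * exp (- (ell / 2 * s0 powr b * \<tau>)) * \<tau> powr (- 3/2) * norm (vl y) powr (- 1 - b / 2))"
        by (intro mult_left_mono norm_g_le \<tau>) auto
      also have "\<dots> = (exp (- p * t) * exp (s0 * t)) * (?D * norm (vl y) powr (- 1 - b / 2))" by simp
      also have "exp (- p * t) * exp (s0 * t) = exp (- (p - s0) * t)" by (simp add: exp_add[symmetric] algebra_simps)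
      finally show ?thesis using True by simp
    qed (simp add: f_def)
  qed
  have 1: "(LBINT y. f (t, y)) = 2 * pi * of_real (indicator {0<..} t * (exp (- p * t) * \<kappa> t \<tau>))" for t
  proof -
    have "(LBINT y. f (t, y)) = indicator {0<..} t *\<^sub>R (exp (- of_real p * of_real t) * (LBINT y. g t \<tau> y))"
      unfolding f_def prod.case by simp
    also have "(LBINT y. g t \<tau> y) = 2 * pi * kap t \<tau>" by (simp add: kap_def)
    also have "kap t \<tau> = of_real (\<kappa> t \<tau>)" by (rule kap_\<kappa>)
    finally show ?thesis by (simp add: scaleR_conv_of_real exp_of_real[symmetric])
  qed
  have 2: "(LBINT t. f (t, y)) = F \<tau> (vl y) / (of_real p - vl y)" for y
  proof -
    have "(LBINT t. f (t, y)) = (LBINT t. F \<tau> (vl y) * (indicator {0<..} t *\<^sub>R exp (- (of_real p - vl y) * of_real t)))"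
      unfolding f_def prod.case
    proof (rule Bochner_Integration.integral_cong[OF refl])
      fix t :: real
      have "exp (- of_real p * of_real t) * exp (vl y * of_real t) = exp (- (of_real p - vl y) * of_real t)"
        by (simp add: exp_add[symmetric] algebra_simps)
      then show "indicator {0<..} t *\<^sub>R (exp (- of_real p * of_real t) * g t \<tau> y) = F \<tau> (vl y) * (indicator {0<..} t *\<^sub>R exp (- (of_real p - vl y) * of_real t))"
        by (simp add: g_F indicator_def mult_ac)
    qed
    also have "\<dots> = F \<tau> (vl y) * (1 / (of_real p - vl y))"
    proof -
      have z: "Re (of_real p - vl y) > 0" using p by simp
      show ?thesis by (simp only: integral_mult_right_zero integral_exp_complex(2)[OF z])
    qed
    finally show ?thesis by simp
  qed
  have "2 * pi * of_real (LBINT t. indicator {0<..} t * (exp (- p * t) * \<kappa> t \<tau>)) = (LBINT t. LBINT y. f (t, y))"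
    unfolding 1 by (simp del: of_real_mult)
  also have "\<dots> = (LBINT y. LBINT t. f (t, y))"
    using lborel_pair.Fubini_integral[of "\<lambda>t y. f (t, y)"] fi by (simp add: case_prod_unfold)
  also have "\<dots> = 2 * pi * F \<tau> (of_real p)" unfolding 2 by (rule cauchy_half_plane[OF \<tau> p])
  also have "F \<tau> (of_real p) = of_real (Qr p / p * exp (- Qr p * \<tau>))"
    by (simp add: F_def Q_of_real[OF p0] exp_of_real[symmetric] divide_inverse mult_ac)
  finally have "of_real (2 * pi * (LBINT t. indicator {0<..} t * (exp (- p * t) * \<kappa> t \<tau>))) = complex_of_real (2 * pi * (Qr p / p * exp (- Qr p * \<tau>)))"
    by simp
  then have "2 * pi * (LBINT t. indicator {0<..} t * (exp (- p * t) * \<kappa> t \<tau>)) = 2 * pi * (Qr p / p * exp (- Qr p * \<tau>))"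
    by (rule of_real_eq_iff[THEN iffD1])
  then show ?thesis by (rule mult_left_cancel[THEN iffD1, rotated]) simp
qed

text \<open>Formulated for a bounded real function w, which will be W \<bullet> \<phi> for a fixed
  \<phi>, bounded by the contraction property of the heat equation.\<close>

lemma subord_integrable:
  assumes w: "w \<in> borel_measurable borel" "\<And>\<tau>. \<tau> > 0 \<Longrightarrow> \<bar>w \<tau>\<bar> \<le> M" and t: "t > 0"
  shows "integrable lborel (\<lambda>\<tau>. indicator {0<..} \<tau> * (w \<tau> * \<kappa> t \<tau>))"
    "\<bar>LBINT \<tau>. indicator {0<..} \<tau> * (w \<tau> * \<kappa> t \<tau>)\<bar> \<le> M * K_maj * (LBINT \<tau>. majorant \<tau>) * (exp (s0 * t) * t powr (- 1/2))"
proof -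
  have [measurable]: "w \<in> borel_measurable borel" by fact
  have M: "M \<ge> 0" using w(2)[of 1] by simp
  have [measurable]: "(\<lambda>\<tau>. \<kappa> t \<tau>) \<in> borel_measurable borel"
    using measurable_compose[OF _ \<kappa>_meas, of "\<lambda>\<tau>. (t, \<tau>)" borel] by simp
  let ?C = "M * K_maj * (exp (s0 * t) * t powr (- 1/2))"
  have i: "integrable lborel (\<lambda>\<tau>. ?C * majorant \<tau>)" by (intro integrable_mult_right majorant_integrable)
  have b: "norm (indicator {0<..} \<tau> * (w \<tau> * \<kappa> t \<tau>)) \<le> ?C * majorant \<tau>" for \<tau>
  proof (cases "\<tau> > 0")
    case True
    have "\<bar>w \<tau>\<bar> * \<bar>\<kappa> t \<tau>\<bar> \<le> M * (K_maj * exp (s0 * t) * t powr (- 1/2) * majorant \<tau>)"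
      using w(2) \<kappa>_bound True t M by (intro mult_mono) auto
    then show ?thesis using True by (simp add: abs_mult mult_ac)
  qed (simp add: majorant_def)
  show i2: "integrable lborel (\<lambda>\<tau>. indicator {0<..} \<tau> * (w \<tau> * \<kappa> t \<tau>))"
  proof (rule Bochner_Integration.integrable_bound[OF i])
    show "AE \<tau> in lborel. norm (indicator {0<..} \<tau> * (w \<tau> * \<kappa> t \<tau>)) \<le> norm (?C * majorant \<tau>)"
      using b by (intro AE_I2) (smt (verit) real_norm_def)
  qed measurable
  have "norm (LBINT \<tau>. indicator {0<..} \<tau> * (w \<tau> * \<kappa> t \<tau>)) \<le> (LBINT \<tau>. ?C * majorant \<tau>)"
    by (rule order_trans[OF integral_norm_bound]) (intro integral_mono integrable_norm i2 i b)
  then show "\<bar>LBINT \<tau>. indicator {0<..} \<tau> * (w \<tau> * \<kappa> t \<tau>)\<bar> \<le> M * K_maj * (LBINT \<tau>. majorant \<tau>) * (exp (s0 * t) * t powr (- 1/2))"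
    by (simp add: mult_ac)
qed

text \<open>Along positive times with a positive limit the factor exp(s0 t) t^(-1/2) is bounded, so
  a multiple of \<open>majorant\<close> dominates.\<close>

lemma subord_continuous:
  assumes w: "w \<in> borel_measurable borel" "\<And>\<tau>. \<tau> > 0 \<Longrightarrow> \<bar>w \<tau>\<bar> \<le> M"
  shows "continuous_on {0<..} (\<lambda>t. LBINT \<tau>. indicator {0<..} \<tau> * (w \<tau> * \<kappa> t \<tau>))"
  unfolding continuous_on_sequentially
proof (intro ballI allI impI, unfold o_def)
  fix x :: "nat \<Rightarrow> real" and a :: real
  assume a: "a \<in> {0<..}" and "(\<forall>n. x n \<in> {0<..}) \<and> x \<longlonglongrightarrow> a"
  then have x: "\<And>n. x n > 0" "x \<longlonglongrightarrow> a" by auto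
  have M: "M \<ge> 0" using w(2)[of 1] by simp
  have [measurable]: "w \<in> borel_measurable borel" by fact
  have [measurable]: "(\<lambda>\<tau>. \<kappa> t \<tau>) \<in> borel_measurable borel" for t
    using measurable_compose[OF _ \<kappa>_meas, of "\<lambda>\<tau>. (t, \<tau>)" borel] by simp
  have "(\<lambda>n. exp (s0 * x n) * x n powr (- 1/2)) \<longlonglongrightarrow> exp (s0 * a) * a powr (- 1/2)"
    using a by (intro tendsto_intros x) auto
  then have "bounded (range (\<lambda>n. exp (s0 * x n) * x n powr (- 1/2)))" using convergent_imp_bounded by blast
  then obtain B where B: "\<And>n. exp (s0 * x n) * x n powr (- 1/2) \<le> B" unfolding bounded_iff real_norm_def by (meson abs_le_D1 rangeI)
  show "(\<lambda>n. LBINT \<tau>. indicator {0<..} \<tau> * (w \<tau> * \<kappa> (x n) \<tau>)) \<longlonglongrightarrow> (LBINT \<tau>. indicator {0<..} \<tau> * (w \<tau> * \<kappa> a \<tau>))"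
  proof (rule integral_dominated_convergence)
    show "integrable lborel (\<lambda>\<tau>. M * K_maj * B * majorant \<tau>)" by (intro integrable_mult_right majorant_integrable)
    show "AE \<tau> in lborel. norm (indicator {0<..} \<tau> * (w \<tau> * \<kappa> (x n) \<tau>)) \<le> M * K_maj * B * majorant \<tau>" for n
    proof (rule AE_I2)
      fix \<tau> :: real
      show "norm (indicator {0<..} \<tau> * (w \<tau> * \<kappa> (x n) \<tau>)) \<le> M * K_maj * B * majorant \<tau>"
      proof (cases "\<tau> > 0")
        case True
        have u: "majorant \<tau> \<ge> 0" by (simp add: majorant_def)
        have "\<bar>w \<tau>\<bar> * \<bar>\<kappa> (x n) \<tau>\<bar> \<le> M * (K_maj * exp (s0 * x n) * x n powr (- 1/2) * majorant \<tau>)"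
          using w(2) \<kappa>_bound True x M by (intro mult_mono) auto
        also have "\<dots> = (M * K_maj * majorant \<tau>) * (exp (s0 * x n) * x n powr (- 1/2))" by simp
        also have "\<dots> \<le> (M * K_maj * majorant \<tau>) * B" using M K_maj_nonneg u by (intro mult_left_mono B) auto
        finally show ?thesis using True by (simp add: abs_mult mult_ac)
      qed (simp add: majorant_def)
    qed
    show "AE \<tau> in lborel. (\<lambda>n. indicator {0<..} \<tau> * (w \<tau> * \<kappa> (x n) \<tau>)) \<longlonglongrightarrow> indicator {0<..} \<tau> * (w \<tau> * \<kappa> a \<tau>)"
    proof (rule AE_I2)
      fix \<tau> :: real
      show "(\<lambda>n. indicator {0<..} \<tau> * (w \<tau> * \<kappa> (x n) \<tau>)) \<longlonglongrightarrow> indicator {0<..} \<tau> * (w \<tau> * \<kappa> a \<tau>)"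
      proof (cases "\<tau> > 0")
        case True
        have "isCont (\<lambda>t. \<kappa> t \<tau>) a" using \<kappa>_cont_t[OF True] by (simp add: continuous_on_eq_continuous_at)
        then have "(\<lambda>n. \<kappa> (x n) \<tau>) \<longlonglongrightarrow> \<kappa> a \<tau>" by (rule isCont_tendsto_compose) (rule x)
        then show ?thesis by (intro tendsto_intros)
      qed simp
    qed
  qed measurable
qed

text \<open>The majorant in t and \<tau> is a product, so Fubini applies, and the inner integral
  over t is \<open>\<kappa>_laplace\<close>.\<close>

lemma subord_laplace:
  assumes w: "w \<in> borel_measurable borel" "\<And>\<tau>. \<tau> > 0 \<Longrightarrow> \<bar>w \<tau>\<bar> \<le> M" and p: "p > s0"
  defines "v \<equiv> \<lambda>t. LBINT \<tau>. indicator {0<..} \<tau> * (w \<tau> * \<kappa> t \<tau>)"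
  shows "integrable lborel (\<lambda>t. indicator {0<..} t * (exp (- p * t) * v t))"
    "(LBINT t. indicator {0<..} t * (exp (- p * t) * v t)) = Qr p / p * (LBINT \<tau>. indicator {0<..} \<tau> * (w \<tau> * exp (- Qr p * \<tau>)))"
proof -
  have M: "M \<ge> 0" using w(2)[of 1] by simp
  have [measurable]: "w \<in> borel_measurable borel" by fact
  define f where "f x = (case x of (t, \<tau>) \<Rightarrow> indicator {0<..} t * (exp (- p * t) * (indicator {0<..} \<tau> * (w \<tau> * \<kappa> t \<tau>))))" for x
  have fm: "f \<in> borel_measurable (lborel \<Otimes>\<^sub>M lborel)"
  proof -
    have "(\<lambda>x. \<kappa> (fst x) (snd x)) \<in> borel_measurable (lborel \<Otimes>\<^sub>M lborel)" using \<kappa>_meas by (simp add: case_prod_unfold)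
    then show ?thesis unfolding f_def case_prod_unfold by measurable
  qed
  have fi: "integrable (lborel \<Otimes>\<^sub>M lborel) f"
  proof (rule integrable_pair_bound[OF fm])
    show "integrable lborel (\<lambda>t. M * K_maj * (indicator {0<..} t * (exp (- (p - s0) * t) * t powr (- 1/2))))"
      using p by (intro integrable_mult_right integrable_powr_exp) auto
    show "integrable lborel majorant" by (rule majorant_integrable)
    fix t \<tau>
    show "norm (f (t, \<tau>)) \<le> M * K_maj * (indicator {0<..} t * (exp (- (p - s0) * t) * t powr (- 1/2))) * majorant \<tau>"
    proof (cases "t > 0 \<and> \<tau> > 0")
      case True
      have "exp (- p * t) * (\<bar>w \<tau>\<bar> * \<bar>\<kappa> t \<tau>\<bar>) \<le> exp (- p * t) * (M * (K_maj * exp (s0 * t) * t powr (- 1/2) * majorant \<tau>))"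
        using w(2) \<kappa>_bound True M by (intro mult_left_mono mult_mono) auto
      also have "\<dots> = M * K_maj * ((exp (- p * t) * exp (s0 * t)) * t powr (- 1/2)) * majorant \<tau>" by simp
      also have "exp (- p * t) * exp (s0 * t) = exp (- (p - s0) * t)" by (simp add: exp_add[symmetric] algebra_simps)
      finally show ?thesis using True by (simp add: f_def abs_mult)
    qed (use M K_maj_nonneg in \<open>auto simp: f_def majorant_def\<close>)
  qed
  have 1: "(LBINT \<tau>. f (t, \<tau>)) = indicator {0<..} t * (exp (- p * t) * v t)" for t
    unfolding f_def v_def prod.case by simp
  have 2: "(LBINT t. f (t, \<tau>)) = Qr p / p * (indicator {0<..} \<tau> * (w \<tau> * exp (- Qr p * \<tau>)))" for \<tau>
  proof (cases "\<tau> > 0")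
    case True
    have "(LBINT t. f (t, \<tau>)) = (LBINT t. w \<tau> * (indicator {0<..} t * (exp (- p * t) * \<kappa> t \<tau>)))"
      unfolding f_def using True by (intro Bochner_Integration.integral_cong) (auto simp: mult_ac)
    also have "\<dots> = w \<tau> * (Qr p / p * exp (- Qr p * \<tau>))" by (simp only: integral_mult_right_zero \<kappa>_laplace[OF True p])
    finally show ?thesis using True by simp
  qed (simp add: f_def)
  show "integrable lborel (\<lambda>t. indicator {0<..} t * (exp (- p * t) * v t))"
    using lborel_pair.integrable_fst'[OF fi] unfolding 1 .
  have "(LBINT t. LBINT \<tau>. f (t, \<tau>)) = (LBINT \<tau>. LBINT t. f (t, \<tau>))"
    using lborel_pair.Fubini_integral[of "\<lambda>t y. f (t, y)"] fi by (simp add: case_prod_unfold)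
  then show "(LBINT t. indicator {0<..} t * (exp (- p * t) * v t)) = Qr p / p * (LBINT \<tau>. indicator {0<..} \<tau> * (w \<tau> * exp (- Qr p * \<tau>)))"
    unfolding 1 2 by simp
qed

end

subsection \<open>Uniqueness for the truncated Laplace transform\<close>

text \<open>The combination \<open>\<Sum>\<^sub>k (-1)\<^sup>k\<^sup>+\<^sup>1 e\<^bsup>(k+1)ny\<^esup> e\<^bsup>-(k+1)nt\<^esup> / (k+1)!\<close> equals \<open>exp(-e\<^bsup>n(y-t)\<^esup>) - 1\<close>, which
  tends to \<open>-1\<close> for \<open>t < y\<close> and to \<open>0\<close> for \<open>t > y\<close> as \<open>n \<rightarrow> \<infinity>\<close>.\<close>

lemma finite_laplace_unique_aux:
  fixes H :: "real \<Rightarrow> real"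
  assumes H: "integrable lborel H" and H0: "\<And>t. t \<notin> {0<..T} \<Longrightarrow> H t = 0"
    and b: "\<And>s. s \<ge> s1 \<Longrightarrow> \<bar>LBINT t. exp (- s * t) * H t\<bar> \<le> C * s * exp (- s * T)"
    and y: "0 < y" "y < T"
  shows "(LBINT t. indicator {..<y} t * H t) = 0"
proof -
  have [measurable]: "H \<in> borel_measurable borel" using H by (auto dest: borel_measurable_integrable)
  \<comment> \<open>C may be negative, whereas the bounds below are enlarged and summed; hence a
    nonnegative constant.\<close>
  define K where "K = max C 0"
  have bK: "\<bar>LBINT t. exp (- s * t) * H t\<bar> \<le> K * s * exp (- s * T)" if "s \<ge> s1" "s > 0" for s
  proof -
    have "C * s * exp (- s * T) \<le> K * s * exp (- s * T)" using that by (intro mult_right_mono) (auto simp: K_def)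
    then show ?thesis using b[OF that(1)] by linarith
  qed
  have Hexp: "integrable lborel (\<lambda>t. exp (- s * t) * H t)" if "s \<ge> 0" for s
  proof (rule Bochner_Integration.integrable_bound[OF H])
    have "norm (exp (- s * t) * H t) \<le> norm (H t)" for t
      using that H0[of t] by (cases "t > 0") (auto simp: abs_mult intro!: mult_left_le_one_le)
    then show "AE t in lborel. norm (exp (- s * t) * H t) \<le> norm (H t)" by simp
  qed measurable
  define x where "x n t = exp (real n * (y - t))" for n t
  have est: "\<bar>LBINT t. (exp (- x n t) - 1) * H t\<bar> \<le> K * real n * exp (- real n * (T - y)) * exp 1"
    if n: "n \<ge> 1" "real n \<ge> s1" for n
  proof -
    define r where "r = exp (- real n * (T - y))"
    have r: "0 < r" "r \<le> 1" using y by (auto simp: r_def)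
    \<comment> \<open>Partial sums of the exponential series without its constant term, times H.
      Their integrals combine transforms of H at the points (k+1) n, where the hypothesis on H is
      available.\<close>
    define P where "P m t = (\<Sum>k<m. (- x n t) ^ Suc k / fact (Suc k)) * H t" for m t
    have lim: "(\<lambda>m. LBINT t. P m t) \<longlonglongrightarrow> (LBINT t. (exp (- x n t) - 1) * H t)"
    proof (rule integral_dominated_convergence)
      show "integrable lborel (\<lambda>t. exp (exp (real n * y)) * norm (H t))" using H by (intro integrable_mult_right integrable_norm)
      show "AE t in lborel. (\<lambda>m. P m t) \<longlonglongrightarrow> (exp (- x n t) - 1) * H t"
      proof (rule AE_I2)
        fix t
        have "(\<lambda>k. (- x n t) ^ k /\<^sub>R fact k) sums exp (- x n t)" by (rule exp_converges)
        then have "(\<lambda>k. (- x n t) ^ Suc k /\<^sub>R fact (Suc k)) sums (exp (- x n t) - 1)"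
          by (subst sums_Suc_iff) simp
        then have "(\<lambda>m. \<Sum>k<m. (- x n t) ^ Suc k / fact (Suc k)) \<longlonglongrightarrow> exp (- x n t) - 1"
          unfolding sums_def by (simp only: real_scaleR_def divide_inverse mult.commute)
        then show "(\<lambda>m. P m t) \<longlonglongrightarrow> (exp (- x n t) - 1) * H t" unfolding P_def by (intro tendsto_intros)
      qed
      show "AE t in lborel. norm (P m t) \<le> exp (exp (real n * y)) * norm (H t)" for m
      proof (rule AE_I2)
        fix t
        show "norm (P m t) \<le> exp (exp (real n * y)) * norm (H t)"
        proof (cases "t > 0")
          case True
          have xp: "x n t > 0" "x n t \<le> exp (real n * y)" using True by (auto simp: x_def mult_left_mono)
          have "\<bar>\<Sum>k<m. (- x n t) ^ Suc k / fact (Suc k)\<bar> \<le> (\<Sum>k<m. x n t ^ Suc k / fact (Suc k))"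
            by (rule order_trans[OF sum_abs]) (use xp in \<open>auto simp: power_abs abs_mult simp del: fact_Suc\<close>)
          also have "\<dots> \<le> (\<Sum>k. x n t ^ Suc k / fact (Suc k))"
          proof (rule sum_le_suminf)
            show "summable (\<lambda>k. x n t ^ Suc k / fact (Suc k))"
              using summable_Suc_iff[THEN iffD2, OF summable_exp_generic[of "x n t"]]
              by (simp only: real_scaleR_def divide_inverse mult.commute)
          qed (use xp in \<open>auto simp del: fact_Suc\<close>)
          also have "\<dots> \<le> exp (x n t)"
          proof -
            have "(\<lambda>k. x n t ^ k /\<^sub>R fact k) sums exp (x n t)" by (rule exp_converges)
            then have "(\<lambda>k. x n t ^ Suc k /\<^sub>R fact (Suc k)) sums (exp (x n t) - 1)"
              by (subst sums_Suc_iff) simp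
            then have "(\<lambda>k. x n t ^ Suc k / fact (Suc k)) sums (exp (x n t) - 1)"
              by (simp only: real_scaleR_def divide_inverse mult.commute)
            then show ?thesis using sums_unique by fastforce
          qed
          also have "\<dots> \<le> exp (exp (real n * y))" using xp by simp
          finally show ?thesis by (simp add: P_def abs_mult mult_right_mono)
        qed (simp add: P_def H0)
      qed
      show "(\<lambda>t. (exp (- x n t) - 1) * H t) \<in> borel_measurable lborel" unfolding x_def by measurable
      show "P m \<in> borel_measurable lborel" for m unfolding P_def[abs_def] x_def by measurable
    qed
    have bnd: "\<bar>LBINT t. P m t\<bar> \<le> K * real n * r * exp 1" for m
    proof -
      have term_eq: "(- x n t) ^ Suc k / fact (Suc k) * H t = ((-1) ^ Suc k * exp (real (Suc k) * real n * y) / fact (Suc k)) * (exp (- (real (Suc k) * real n) * t) * H t)" for k t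
      proof -
        have "x n t ^ Suc k = exp (real (Suc k) * real n * y) * exp (- (real (Suc k) * real n) * t)"
          unfolding x_def exp_of_nat_mult[symmetric] exp_add[symmetric] by (simp add: algebra_simps)
        then show ?thesis by (simp add: power_minus[of "x n t"] del: fact_Suc power_Suc of_nat_Suc)
      qed
      have "(LBINT t. P m t) = (\<Sum>k<m. ((-1) ^ Suc k * exp (real (Suc k) * real n * y) / fact (Suc k)) * (LBINT t. exp (- (real (Suc k) * real n) * t) * H t))"
      proof -
        have Peq: "P m = (\<lambda>t. \<Sum>k<m. ((-1) ^ Suc k * exp (real (Suc k) * real n * y) / fact (Suc k)) * (exp (- (real (Suc k) * real n) * t) * H t))"
          unfolding P_def[abs_def] sum_distrib_right term_eq ..
        have int: "integrable lborel (\<lambda>t. ((-1) ^ Suc k * exp (real (Suc k) * real n * y) / fact (Suc k)) * (exp (- (real (Suc k) * real n) * t) * H t))" for k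
          by (intro integrable_mult_right Hexp) simp
        show ?thesis by (simp only: Peq Bochner_Integration.integral_sum[OF int] integral_mult_right_zero)
      qed
      \<comment> \<open>At s = (k+1) n the bound K s exp(-s T) meets the coefficient exp(s
        y)/(k+1)!. The exponentials combine to r^(k+1), and (k+1) n/(k+1)! = n/k!, so the sum is at
        most K n r exp r.\<close>
      also have "\<bar>\<dots>\<bar> \<le> (\<Sum>k<m. K * real n * r * (r ^ k / fact k))"
      proof (rule order_trans[OF sum_abs], rule sum_mono)
        fix k
        let ?s = "real (Suc k) * real n"
        have s: "?s \<ge> s1" "?s > 0"
        proof -
          have "1 * real n \<le> ?s" by (intro mult_right_mono) auto
          then show "?s \<ge> s1" using n by linarith
          show "?s > 0" using n by simp
        qed
        have "\<bar>((-1) ^ Suc k * exp (?s * y) / fact (Suc k)) * (LBINT t. exp (- ?s * t) * H t)\<bar>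
          = exp (?s * y) / fact (Suc k) * \<bar>LBINT t. exp (- ?s * t) * H t\<bar>"
          by (simp add: abs_mult power_abs del: fact_Suc of_nat_Suc)
        also have "\<dots> \<le> exp (?s * y) / fact (Suc k) * (K * ?s * exp (- ?s * T))"
          by (intro mult_left_mono bK s) auto
        also have "\<dots> = K * real n * (real (Suc k) / fact (Suc k)) * (exp (?s * y) * exp (- ?s * T))" by simp
        also have "exp (?s * y) * exp (- ?s * T) = r ^ Suc k"
          unfolding r_def exp_of_nat_mult[symmetric] exp_add[symmetric] by (simp add: algebra_simps)
        also have "real (Suc k) / fact (Suc k) = 1 / fact k"
          by (simp only: fact_Suc of_nat_mult) (simp del: of_nat_Suc)
        finally show "\<bar>((-1) ^ Suc k * exp (?s * y) / fact (Suc k)) * (LBINT t. exp (- ?s * t) * H t)\<bar> \<le> K * real n * r * (r ^ k / fact k)"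
          by (simp add: mult_ac)
      qed
      also have "\<dots> = K * real n * r * (\<Sum>k<m. r ^ k / fact k)" by (simp add: sum_distrib_left)
      also have "\<dots> \<le> K * real n * r * exp 1"
      proof (intro mult_left_mono)
        have "(\<lambda>k. r ^ k / fact k) sums exp r" using exp_converges[of r] by (simp add: divide_inverse mult.commute)
        then have "(\<Sum>k<m. r ^ k / fact k) \<le> exp r"
          using sum_le_suminf[of "\<lambda>k. r ^ k / fact k" "{..<m}"] r by (auto simp: sums_iff)
        also have "exp r \<le> exp 1" using r by simp
        finally show "(\<Sum>k<m. r ^ k / fact k) \<le> exp 1" .
      qed (use r in \<open>auto simp: K_def\<close>)
      finally show ?thesis .
    qed
    show ?thesis by (rule tendsto_upperbound[OF tendsto_rabs[OF lim]]) (use bnd in \<open>auto simp: r_def\<close>)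
  qed
  have lim1: "(\<lambda>n. LBINT t. (exp (- x n t) - 1) * H t) \<longlonglongrightarrow> (LBINT t. - (indicator {..<y} t * H t))"
  proof (rule integral_dominated_convergence)
    show "integrable lborel (\<lambda>t. norm (H t))" using H by simp
    have "AE t in lborel. t \<noteq> y" by (rule AE_lborel_singleton)
    then show "AE t in lborel. (\<lambda>n. (exp (- x n t) - 1) * H t) \<longlonglongrightarrow> - (indicator {..<y} t * H t)"
    proof eventually_elim
      case (elim t)
      note t = elim
      have "(\<lambda>n. exp (- x n t) - 1) \<longlonglongrightarrow> - indicator {..<y} t"
      proof (cases "t < y")
        case True
        then have c: "0 < y - t" by simp
        have "filterlim (\<lambda>n. x n t) at_top sequentially"
          unfolding x_def by (rule filterlim_compose[OF exp_at_top], rule filterlim_at_top_mult_tendsto_pos[OF tendsto_const c filterlim_real_sequentially])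
        then have "filterlim (\<lambda>n. - x n t) at_bot sequentially" unfolding filterlim_uminus_at_bot by simp
        then have "(\<lambda>n. exp (- x n t)) \<longlonglongrightarrow> 0" by (rule filterlim_compose[OF exp_at_bot])
        then have "(\<lambda>n. exp (- x n t) - 1) \<longlonglongrightarrow> 0 - 1" by (intro tendsto_intros)
        then show ?thesis using True by simp
      next
        case False
        then have c: "t - y > 0" using t by simp
        have "filterlim (\<lambda>n. real n * (t - y)) at_top sequentially"
          by (rule filterlim_at_top_mult_tendsto_pos[OF tendsto_const c filterlim_real_sequentially])
        then have "filterlim (\<lambda>n. - (real n * (t - y))) at_bot sequentially" unfolding filterlim_uminus_at_bot by simp
        then have "(\<lambda>n. exp (- (real n * (t - y)))) \<longlonglongrightarrow> 0" by (rule filterlim_compose[OF exp_at_bot])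
        then have "(\<lambda>n. x n t) \<longlonglongrightarrow> 0" by (simp add: x_def algebra_simps)
        then have "(\<lambda>n. exp (- x n t) - 1) \<longlonglongrightarrow> exp (- 0) - 1" by (intro tendsto_intros)
        then show ?thesis using False by simp
      qed
      from tendsto_mult[OF this tendsto_const[of "H t"]]
      show ?case by simp
    qed
    show "AE t in lborel. norm ((exp (- x n t) - 1) * H t) \<le> norm (H t)" for n
    proof (rule AE_I2)
      fix t
      have "x n t > 0" by (simp add: x_def)
      then have "\<bar>exp (- x n t) - 1\<bar> \<le> 1" by (simp add: abs_le_iff)
      then show "norm ((exp (- x n t) - 1) * H t) \<le> norm (H t)" by (simp add: abs_mult mult_left_le_one_le)
    qed
    show "(\<lambda>t. (exp (- x n t) - 1) * H t) \<in> borel_measurable lborel" for n unfolding x_def by measurable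
  qed measurable
  moreover have "(\<lambda>n. LBINT t. (exp (- x n t) - 1) * H t) \<longlonglongrightarrow> 0"
  proof (rule Lim_null_comparison)
    define c where "c = T - y"
    have c: "c > 0" using y by (simp add: c_def)
    have "((\<lambda>z. z ^ 1 / exp z) \<longlongrightarrow> (0::real)) at_top" by (rule tendsto_power_div_exp_0)
    moreover have "filterlim (\<lambda>n. real n * c) at_top sequentially"
      by (rule filterlim_at_top_mult_tendsto_pos[OF tendsto_const c filterlim_real_sequentially])
    ultimately have "(\<lambda>n. (real n * c) ^ 1 / exp (real n * c)) \<longlonglongrightarrow> 0" by (rule filterlim_compose)
    then have "(\<lambda>n. (K * exp 1 / c) * ((real n * c) ^ 1 / exp (real n * c))) \<longlonglongrightarrow> (K * exp 1 / c) * 0" by (intro tendsto_intros)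
    moreover have "(K * exp 1 / c) * ((real n * c) ^ 1 / exp (real n * c)) = K * real n * exp (- real n * c) * exp 1" for n
      using c by (simp add: exp_minus field_simps)
    ultimately show "(\<lambda>n. K * real n * exp (- real n * c) * exp 1) \<longlonglongrightarrow> 0" by simp
    obtain N where N: "real N \<ge> s1" using real_arch_simple by blast
    show "\<forall>\<^sub>F n in sequentially. norm (LBINT t. (exp (- x n t) - 1) * H t) \<le> K * real n * exp (- real n * c) * exp 1"
      using eventually_ge_at_top[of "max N 1"] by eventually_elim (use est N in \<open>auto simp: c_def\<close>)
  qed
  ultimately have "(LBINT t. - (indicator {..<y} t * H t)) = 0" using LIMSEQ_unique by blast
  then show ?thesis by simp
qed

text \<open>The integrals of h over all intervals [e,y] inside (0,T) vanish, so h is 0 there by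
  differentiation; the value at T is a limit.\<close>

lemma finite_laplace_unique:
  fixes h :: "real \<Rightarrow> real"
  assumes T: "T > 0" and c: "continuous_on {0<..T} h" and i: "integrable lborel (\<lambda>t. indicator {0<..T} t * h t)"
    and b: "\<And>s. s \<ge> s1 \<Longrightarrow> \<bar>LBINT t. exp (- s * t) * (indicator {0<..T} t * h t)\<bar> \<le> C * s * exp (- s * T)"
    and t: "t \<in> {0<..T}"
  shows "h t = 0"
proof -
  let ?H = "\<lambda>t. indicator {0<..T} t * h t"
  have z: "(LBINT t. indicator {..<y} t * ?H t) = 0" if "0 < y" "y < T" for y
    by (rule finite_laplace_unique_aux[OF i _ b that]) (auto simp: indicator_def)
  have HK: "integral {e..y} h = 0" if e: "0 < e" "e \<le> y" "y < T" for e y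
  proof -
    have s: "set_integrable lborel {e..<y} h"
    proof -
      have "integrable lborel (\<lambda>t. indicator {e..<y} t *\<^sub>R ?H t)" by (rule integrable_mult_indicator[OF _ i]) simp
      also have "(\<lambda>t. indicator {e..<y} t *\<^sub>R ?H t) = (\<lambda>t. indicator {e..<y} t *\<^sub>R h t)" using e by (auto simp: indicator_def)
      finally show ?thesis by (simp add: set_integrable_def)
    qed
    have i1: "integrable lborel (\<lambda>t. indicator {..<r} t * ?H t)" for r
      using integrable_mult_indicator[OF _ i, of "{..<r}"] by simp
    have "(LBINT t. indicator {e..<y} t *\<^sub>R h t) = (LBINT t. indicator {..<y} t * ?H t - indicator {..<e} t * ?H t)"
      by (rule Bochner_Integration.integral_cong) (use e in \<open>auto simp: indicator_def\<close>)
    also have "\<dots> = 0" using z e i1 by (subst Bochner_Integration.integral_diff) auto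
    finally have "integral {e..<y} h = 0"
      using set_borel_integral_eq_integral(2)[OF s] by (simp add: set_lebesgue_integral_def)
    moreover have "integral {e..<y} h = integral {e..y} h"
      by (rule integral_subset_negligible) (auto intro: negligible_subset[of "{y}"])
    ultimately show ?thesis by simp
  qed
  have in0: "h r = 0" if r: "0 < r" "r < T" for r
  proof -
    define e where "e = r / 2" define y where "y = (r + T) / 2"
    have ey: "0 < e" "e < r" "r < y" "y < T" using r by (auto simp: e_def y_def)
    have "((\<lambda>u. integral {e..u} h) has_vector_derivative h r) (at r within {e..y})"
      by (rule integral_has_vector_derivative[OF continuous_on_subset[OF c]]) (use ey in auto)
    moreover have "((\<lambda>u. 0) has_vector_derivative h r) (at r within {e..y})"
      by (rule has_vector_derivative_transform[OF _ _ calculation]) (use ey HK in auto)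
    moreover have "((\<lambda>u. 0::real) has_vector_derivative 0) (at r within {e..y})" by (rule has_vector_derivative_const)
    ultimately show ?thesis
      using vector_derivative_unique_within_closed_interval[of e y r] ey by (metis (no_types, lifting) atLeastAtMost_iff box_real(2) less_imp_le less_trans)
  qed
  show ?thesis
  proof (cases "t < T")
    case False
    then have "t = T" using t by simp
    have "(h \<longlongrightarrow> h T) (at T within {0<..T})" using c T by (simp add: continuous_on_def)
    then have "(h \<longlongrightarrow> h T) (at T within {0<..<T})" by (rule tendsto_within_subset) auto
    moreover have "(h \<longlongrightarrow> 0) (at T within {0<..<T})"
      by (rule Lim_transform_eventually[OF tendsto_const]) (auto simp: eventually_at_filter in0)
    moreover have "at T within {0<..<T} \<noteq> bot" using T by (simp add: at_within_eq_bot_iff)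
    ultimately show ?thesis using tendsto_unique \<open>t = T\<close> by blast
  qed (use in0 t in auto)
qed

section \<open>Borel versions of Lebesgue measurable functions\<close>

lemma AE_lebesgue_on_iff: "S \<in> sets lebesgue \<Longrightarrow> (AE x in lebesgue_on S. P x) \<longleftrightarrow> (AE x in lborel. x \<in> S \<longrightarrow> P x)"
  by (simp add: AE_restrict_space_iff AE_completion_iff)

lemma borel_version:
  fixes f :: "'a::euclidean_space \<Rightarrow> complex"
  assumes "f \<in> borel_measurable lebesgue"
  obtains f' where "f' \<in> borel_measurable borel" "AE x in lborel. f x = f' x"
proof -
  have "(\<lambda>x. Re (f x)) \<in> borel_measurable lebesgue" "(\<lambda>x. Im (f x)) \<in> borel_measurable lebesgue"
    using assms by measurable
  then obtain u v where u: "u \<in> borel_measurable lborel" "AE x in lborel. Re (f x) = u x"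
    and v: "v \<in> borel_measurable lborel" "AE x in lborel. Im (f x) = v x"
    using completion_ex_borel_measurable_real by metis
  have "(\<lambda>x. Complex (u x) (v x)) \<in> borel_measurable borel"
    using u(1) v(1) unfolding Complex_eq by measurable
  moreover have "AE x in lborel. f x = Complex (u x) (v x)"
    using u(2) v(2) by eventually_elim (simp add: complex_eq_iff)
  ultimately show ?thesis using that by blast
qed

text \<open>Product measures are formed with \<open>lborel\<close>, so Lebesgue measurable data on S
  are exchanged for a Borel function that vanishes off S.\<close>

lemma borel_version_on:
  fixes f :: "'a::euclidean_space \<Rightarrow> complex"
  assumes S: "S \<in> sets borel" and f: "f \<in> borel_measurable (lebesgue_on S)"
  shows "\<exists>f'. f' \<in> borel_measurable borel \<and> (AE x in lborel. x \<in> S \<longrightarrow> f x = f' x) \<and> (\<forall>x. x \<notin> S \<longrightarrow> f' x = 0)"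
proof -
  have "(\<lambda>x. if x \<in> S then f x else 0) \<in> borel_measurable lebesgue"
    by (rule borel_measurable_if_I[OF f]) (use S in simp)
  then obtain g where g: "g \<in> borel_measurable borel" "AE x in lborel. (if x \<in> S then f x else 0) = g x"
    by (rule borel_version)
  have "(\<lambda>x. indicator S x *\<^sub>R g x) \<in> borel_measurable borel" using g(1) S by measurable
  moreover have "AE x in lborel. x \<in> S \<longrightarrow> f x = indicator S x *\<^sub>R g x" using g(2) by eventually_elim auto
  ultimately show ?thesis by (intro exI[of _ "\<lambda>x. indicator S x *\<^sub>R g x"]) simp
qed

lemma lebesgue_integral_cong_AE_borel:
  fixes f g :: "'a::euclidean_space \<Rightarrow> 'b::euclidean_space"
  assumes g: "g \<in> borel_measurable borel" and ae: "AE x in lborel. f x = g x"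
  shows "integral\<^sup>L lebesgue f = integral\<^sup>L lborel g" "integrable lebesgue f \<longleftrightarrow> integrable lborel g"
proof -
  have ae': "AE x in lebesgue. f x = g x" using ae by (simp add: AE_completion_iff)
  have gl: "g \<in> borel_measurable lebesgue" using g by (intro measurable_completion) simp
  have ae'': "AE x in lebesgue. g x = f x" using ae' by eventually_elim simp
  have fl: "f \<in> borel_measurable lebesgue" by (rule borel_measurable_AE[OF gl ae''])
  have "integral\<^sup>L lebesgue f = integral\<^sup>L lebesgue g" by (rule integral_cong_AE[OF fl gl ae'])
  then show "integral\<^sup>L lebesgue f = integral\<^sup>L lborel g" using g by (simp add: integral_completion)
  have "integrable lebesgue f \<longleftrightarrow> integrable lebesgue g" by (rule integrable_cong_AE[OF fl gl ae'])
  then show "integrable lebesgue f \<longleftrightarrow> integrable lborel g" using g by (simp add: integrable_completion)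
qed

subsection \<open>Riemann-Liouville kernels\<close>

text \<open>The causal Riemann-Liouville kernel, extended by 0 to the negative axis, so that
  \<open>RL_conv\<close> is a convolution on the whole line and composing fractional integrals is
  its associativity.\<close>

definition kern :: "real \<Rightarrow> real \<Rightarrow> real" where
  "kern a r = (if r > 0 then r powr (a - 1) / Gamma a else 0)"

definition RL_conv :: "real \<Rightarrow> (real \<Rightarrow> complex) \<Rightarrow> real \<Rightarrow> complex" where
  "RL_conv a g t = (LBINT \<sigma>. kern a (t - \<sigma>) *\<^sub>R g \<sigma>)"

lemma kern_nonneg: "a > 0 \<Longrightarrow> 0 \<le> kern a r"
  using Gamma_real_pos[of a] by (simp add: kern_def)

lemma kern_meas[measurable]: "kern a \<in> borel_measurable borel"
  unfolding kern_def[abs_def] by measurable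

lemma kern_nonpos: "r \<le> 0 \<Longrightarrow> kern a r = 0"
  by (simp add: kern_def)

lemma kern_1: "kern 1 r = indicator {0<..} r"
  by (simp add: kern_def indicator_def)

text \<open>The substitution \<tau> = t x turns the convolution into the Beta integral, and Beta b a
  is Gamma a Gamma b/Gamma (a + b).\<close>

lemma kern_conv_0:
  assumes a: "a > 0" and b: "b > 0" and t: "t > 0"
  shows "(\<integral>\<^sup>+\<tau>. ennreal (kern a (t - \<tau>) * kern b \<tau>) \<partial>lborel) = ennreal (kern (a + b) t)"
proof -
  have G: "Gamma a > 0" "Gamma b > 0" "Gamma (a + b) > 0" using a b by (auto intro: Gamma_real_pos)
  have B: "(\<integral>\<^sup>+x. ennreal (indicator {0..1} x * (x powr (b - 1) * (1 - x) powr (a - 1))) \<partial>lborel) = ennreal (Beta b a)"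
    using nn_integral_has_integral_lebesgue[OF _ has_integral_Beta_real[OF b a]] by (simp add: mult_ac)
  have "(\<integral>\<^sup>+\<tau>. ennreal (kern a (t - \<tau>) * kern b \<tau>) \<partial>lborel) = ennreal t * (\<integral>\<^sup>+x. ennreal (kern a (t - (0 + t * x)) * kern b (0 + t * x)) \<partial>lborel)"
    using nn_integral_real_affine[of "\<lambda>\<tau>. ennreal (kern a (t - \<tau>) * kern b \<tau>)" t 0] t by simp
  also have "(\<integral>\<^sup>+x. ennreal (kern a (t - (0 + t * x)) * kern b (0 + t * x)) \<partial>lborel)
     = (\<integral>\<^sup>+x. ennreal (t powr (a + b - 2) / (Gamma a * Gamma b)) * ennreal (indicator {0..1} x * (x powr (b - 1) * (1 - x) powr (a - 1))) \<partial>lborel)"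
  proof (rule nn_integral_cong_AE)
    have "AE x in lborel. x \<noteq> (0::real)" "AE x in lborel. x \<noteq> (1::real)" by (rule AE_lborel_singleton)+
    then show "AE x in lborel. ennreal (kern a (t - (0 + t * x)) * kern b (0 + t * x))
       = ennreal (t powr (a + b - 2) / (Gamma a * Gamma b)) * ennreal (indicator {0..1} x * (x powr (b - 1) * (1 - x) powr (a - 1)))"
    proof eventually_elim
      case (elim x)
      note x = elim
      show ?case
      proof (cases "0 < x \<and> x < 1")
        case True
        have e: "t - t * x = t * (1 - x)" by (simp add: algebra_simps)
        have "t powr (a - 1) * t powr (b - 1) = t powr (a + b - 2)" by (simp add: powr_add[symmetric])
        then have "kern a (t - t * x) * kern b (t * x) = t powr (a + b - 2) / (Gamma a * Gamma b) * (x powr (b - 1) * (1 - x) powr (a - 1))"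
          using True t unfolding e by (simp add: kern_def powr_mult mult_ac)
        then show ?thesis using True G by (simp add: ennreal_mult[symmetric])
      next
        case False
        then have "x < 0 \<or> x > 1" using x by linarith
        moreover have "t - t * x \<le> 0" if "x > 1" using t that by (simp add: mult_le_cancel_left1)
        moreover have "t * x \<le> 0" if "x < 0" using t that by (simp add: mult_le_0_iff)
        ultimately have e: "kern a (t - (0 + t * x)) * kern b (0 + t * x) = 0"
          by (metis add_0 kern_nonpos mult_zero_left mult_zero_right)
        have "indicator {0..1} x = (0::real)" using \<open>x < 0 \<or> x > 1\<close> by (auto simp: indicator_def)
        then show ?thesis unfolding e by simp
      qed
    qed
  qed
  also have "\<dots> = ennreal (t powr (a + b - 2) / (Gamma a * Gamma b)) * ennreal (Beta b a)"
    by (subst nn_integral_cmult) (auto simp: B)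
  also have "ennreal t * \<dots> = ennreal (t * (t powr (a + b - 2) / (Gamma a * Gamma b) * Beta b a))"
  proof -
    have "0 \<le> t powr (a + b - 2) / (Gamma a * Gamma b)" "0 \<le> Beta b a" using G by (auto simp: Beta_def add.commute)
    then show ?thesis using t by (simp add: ennreal_mult del: times_divide_eq_right times_divide_eq_left)
  qed
  also have "t * (t powr (a + b - 2) / (Gamma a * Gamma b) * Beta b a) = kern (a + b) t"
  proof -
    have "t * t powr (a + b - 2) = t powr (a + b - 1)" using t powr_add[of t 1 "a + b - 2"] by simp
    then show ?thesis using t G by (simp add: kern_def Beta_def add.commute[of b a] field_simps)
  qed
  finally show ?thesis .
qed

lemma kern_conv:
  assumes a: "a > 0" and b: "b > 0"
  shows "(\<integral>\<^sup>+\<tau>. ennreal (kern a (t - \<tau>) * kern b (\<tau> - \<sigma>)) \<partial>lborel) = ennreal (kern (a + b) (t - \<sigma>))"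
proof -
  have "(\<integral>\<^sup>+\<tau>. ennreal (kern a (t - \<tau>) * kern b (\<tau> - \<sigma>)) \<partial>lborel) = (\<integral>\<^sup>+\<tau>. ennreal (kern a (t - \<sigma> - \<tau>) * kern b \<tau>) \<partial>lborel)"
    using nn_integral_real_affine[of "\<lambda>\<tau>. ennreal (kern a (t - \<tau>) * kern b (\<tau> - \<sigma>))" 1 \<sigma>] by (simp add: algebra_simps)
  also have "\<dots> = ennreal (kern (a + b) (t - \<sigma>))"
  proof (cases "t - \<sigma> > 0")
    case False
    have "(\<lambda>\<tau>. ennreal (kern a (t - \<sigma> - \<tau>) * kern b \<tau>)) = (\<lambda>_. 0)"
    proof
      fix \<tau> show "ennreal (kern a (t - \<sigma> - \<tau>) * kern b \<tau>) = 0"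
        using False by (cases "\<tau> > 0") (auto simp: kern_def)
    qed
    then show ?thesis using False by (simp only: nn_integral_const) (simp add: kern_def)
  qed (rule kern_conv_0[OF a b])
  finally show ?thesis .
qed

text \<open>Fubini and the semigroup law of the kernels. Finiteness is required at the single point
  t: for integrable g supported in the time interval it holds at almost every t there, and at every
  t if a + b = 1, where the kernel is an indicator.\<close>

lemma cv_assoc:
  assumes a: "a > 0" and b: "b > 0" and g[measurable]: "g \<in> borel_measurable borel"
    and fin: "(\<integral>\<^sup>+\<sigma>. ennreal (kern (a + b) (t - \<sigma>) * norm (g \<sigma>)) \<partial>lborel) < \<infinity>"
  shows "RL_conv a (RL_conv b g) t = RL_conv (a + b) g t"
proof -
  define F where "F \<tau> \<sigma> = (kern a (t - \<tau>) * kern b (\<tau> - \<sigma>)) *\<^sub>R g \<sigma>" for \<tau> \<sigma>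
  have Fm[measurable]: "case_prod F \<in> borel_measurable (lborel \<Otimes>\<^sub>M lborel)"
    unfolding F_def[abs_def] by measurable
  have "(\<integral>\<^sup>+x. ennreal (norm (case_prod F x)) \<partial>(lborel \<Otimes>\<^sub>M lborel)) = (\<integral>\<^sup>+\<sigma>. \<integral>\<^sup>+\<tau>. ennreal (norm (F \<tau> \<sigma>)) \<partial>lborel \<partial>lborel)"
    by (subst lborel_pair.nn_integral_snd[symmetric]) (auto simp: case_prod_unfold)
  also have "\<dots> = (\<integral>\<^sup>+\<sigma>. ennreal (kern (a + b) (t - \<sigma>) * norm (g \<sigma>)) \<partial>lborel)"
  proof (rule nn_integral_cong)
    fix \<sigma>
    have "(\<integral>\<^sup>+\<tau>. ennreal (norm (F \<tau> \<sigma>)) \<partial>lborel) = (\<integral>\<^sup>+\<tau>. ennreal (kern a (t - \<tau>) * kern b (\<tau> - \<sigma>)) * ennreal (norm (g \<sigma>)) \<partial>lborel)"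
      using kern_nonneg[OF a] kern_nonneg[OF b]
      by (intro nn_integral_cong) (simp add: F_def ennreal_mult[symmetric] abs_mult)
    also have "\<dots> = ennreal (kern (a + b) (t - \<sigma>)) * ennreal (norm (g \<sigma>))"
      by (subst nn_integral_multc) (auto simp: kern_conv[OF a b])
    finally show "(\<integral>\<^sup>+\<tau>. ennreal (norm (F \<tau> \<sigma>)) \<partial>lborel) = ennreal (kern (a + b) (t - \<sigma>) * norm (g \<sigma>))"
      using kern_nonneg[of "a + b"] a b by (simp add: ennreal_mult)
  qed
  finally have Fi: "integrable (lborel \<Otimes>\<^sub>M lborel) (case_prod F)"
    using fin by (intro integrableI_bounded) auto
  have 1: "(LBINT \<sigma>. F \<tau> \<sigma>) = kern a (t - \<tau>) *\<^sub>R RL_conv b g \<tau>" for \<tau>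
    unfolding F_def RL_conv_def by (subst integral_scaleR_right[symmetric]) (simp)
  have 2: "(LBINT \<tau>. F \<tau> \<sigma>) = kern (a + b) (t - \<sigma>) *\<^sub>R g \<sigma>" for \<sigma>
  proof -
    have nn: "0 \<le> kern a (t - \<tau>) * kern b (\<tau> - \<sigma>)" for \<tau>
      using kern_nonneg[OF a] kern_nonneg[OF b] by simp
    have i: "integrable lborel (\<lambda>\<tau>. kern a (t - \<tau>) * kern b (\<tau> - \<sigma>))"
      by (rule integrableI_nonneg) (use nn kern_conv[OF a b, of t \<sigma>] in auto)
    have "(LBINT \<tau>. kern a (t - \<tau>) * kern b (\<tau> - \<sigma>)) = kern (a + b) (t - \<sigma>)"
      by (subst integral_eq_nn_integral) (use nn kern_conv[OF a b, of t \<sigma>] kern_nonneg[of "a + b"] a b in auto)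
    then show ?thesis unfolding F_def using integral_scaleR_left[OF i] by simp
  qed
  have "RL_conv a (RL_conv b g) t = (LBINT \<tau>. LBINT \<sigma>. F \<tau> \<sigma>)" unfolding 1 RL_conv_def[of a "RL_conv b g"] ..
  also have "\<dots> = (LBINT \<sigma>. LBINT \<tau>. F \<tau> \<sigma>)" by (rule lborel_pair.Fubini_integral[symmetric, OF Fi])
  also have "\<dots> = RL_conv (a + b) g t" unfolding 2 RL_conv_def ..
  finally show ?thesis .
qed

lemma cv_cong_AE:
  assumes [measurable]: "g \<in> borel_measurable borel" "h \<in> borel_measurable borel" and ae: "AE \<sigma> in lborel. \<sigma> < t \<longrightarrow> g \<sigma> = h \<sigma>"
  shows "RL_conv a g t = RL_conv a h t"
  unfolding RL_conv_def
proof (rule integral_cong_AE)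
  show "AE \<sigma> in lborel. kern a (t - \<sigma>) *\<^sub>R g \<sigma> = kern a (t - \<sigma>) *\<^sub>R h \<sigma>"
    using ae by eventually_elim (auto simp: kern_def)
qed measurable

lemma cv_meas[measurable]: "g \<in> borel_measurable borel \<Longrightarrow> RL_conv a g \<in> borel_measurable borel"
proof -
  assume [measurable]: "g \<in> borel_measurable borel"
  have "(\<lambda>t. LBINT \<sigma>. kern a (t - \<sigma>) *\<^sub>R g \<sigma>) \<in> borel_measurable borel"
    by (rule lborel.borel_measurable_lebesgue_integral) measurable
  then show ?thesis by (simp add: RL_conv_def[abs_def])
qed

lemma kern_integral:
  assumes a: "a > 0" and T: "T \<ge> 0"
  shows "(\<integral>\<^sup>+r. ennreal (indicator {0<..<T} r * kern a r) \<partial>lborel) = ennreal (T powr a / Gamma (a + 1))"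
proof -
  have G: "Gamma a > 0" "Gamma (a + 1) = a * Gamma a" using a by (auto intro!: Gamma_real_pos Gamma_plus1 elim!: nonpos_Ints_cases)
  have "((\<lambda>x. x powr (a - 1)) has_integral (T powr (a - 1 + 1) / (a - 1 + 1))) {0..T}"
    by (rule has_integral_powr_from_0) (use a T in auto)
  then have h: "((\<lambda>x. x powr (a - 1) / Gamma a) has_integral (T powr a / a / Gamma a)) {0..T}"
    using has_integral_divide[of "\<lambda>x. x powr (a - 1)" "T powr a / a" "{0..T}" "Gamma a"] by simp
  have "(\<integral>\<^sup>+r. ennreal (indicator {0<..<T} r * kern a r) \<partial>lborel) = (\<integral>\<^sup>+r. ennreal (indicator {0..T} r * (r powr (a - 1) / Gamma a)) \<partial>lborel)"
  proof (rule nn_integral_cong_AE)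
    have "AE x in lborel. x \<noteq> (0::real)" "AE x in lborel. x \<noteq> T" by (rule AE_lborel_singleton)+
    then show "AE r in lborel. ennreal (indicator {0<..<T} r * kern a r) = ennreal (indicator {0..T} r * (r powr (a - 1) / Gamma a))"
      by eventually_elim (auto simp: indicator_def kern_def)
  qed
  also have "\<dots> = ennreal (T powr a / a / Gamma a)"
    using nn_integral_has_integral_lebesgue[OF _ h] G(1) by (simp add: mult.commute)
  finally show ?thesis using G by simp
qed

text \<open>Young's inequality on a bounded interval: the integrals are swapped and the mass of each
  shifted kernel is bounded by that on (0,T).\<close>

lemma kern_young:
  assumes a: "a > 0" and f[measurable]: "f \<in> borel_measurable borel" and f0: "\<And>x. x \<notin> {0<..<T} \<Longrightarrow> f x = (0::ennreal)" and T: "T > 0"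
  shows "(\<integral>\<^sup>+t. indicator {0<..<T} t * (\<integral>\<^sup>+\<sigma>. ennreal (kern a (t - \<sigma>)) * f \<sigma> \<partial>lborel) \<partial>lborel) \<le> ennreal (T powr a / Gamma (a + 1)) * (\<integral>\<^sup>+\<sigma>. f \<sigma> \<partial>lborel)"
proof -
  have "(\<integral>\<^sup>+t. indicator {0<..<T} t * (\<integral>\<^sup>+\<sigma>. ennreal (kern a (t - \<sigma>)) * f \<sigma> \<partial>lborel) \<partial>lborel)
     = (\<integral>\<^sup>+t. \<integral>\<^sup>+\<sigma>. indicator {0<..<T} t * (ennreal (kern a (t - \<sigma>)) * f \<sigma>) \<partial>lborel \<partial>lborel)"
    by (intro nn_integral_cong nn_integral_cmult[symmetric]) measurable
  also have "\<dots> = (\<integral>\<^sup>+\<sigma>. \<integral>\<^sup>+t. indicator {0<..<T} t * (ennreal (kern a (t - \<sigma>)) * f \<sigma>) \<partial>lborel \<partial>lborel)"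
    by (rule lborel_pair.Fubini'[symmetric]) measurable
  also have "\<dots> \<le> (\<integral>\<^sup>+\<sigma>. ennreal (T powr a / Gamma (a + 1)) * f \<sigma> \<partial>lborel)"
  proof (rule nn_integral_mono)
    fix \<sigma>
    show "(\<integral>\<^sup>+t. indicator {0<..<T} t * (ennreal (kern a (t - \<sigma>)) * f \<sigma>) \<partial>lborel) \<le> ennreal (T powr a / Gamma (a + 1)) * f \<sigma>"
    proof (cases "\<sigma> \<in> {0<..<T}")
      case True
      have "(\<integral>\<^sup>+t. indicator {0<..<T} t * (ennreal (kern a (t - \<sigma>)) * f \<sigma>) \<partial>lborel)
         = (\<integral>\<^sup>+t. indicator {0<..<T} t * ennreal (kern a (t - \<sigma>)) \<partial>lborel) * f \<sigma>"
        by (subst nn_integral_multc[symmetric]) (auto simp: mult_ac)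
      also have "(\<integral>\<^sup>+t. indicator {0<..<T} t * ennreal (kern a (t - \<sigma>)) \<partial>lborel) = (\<integral>\<^sup>+r. indicator {0<..<T} (\<sigma> + r) * ennreal (kern a r) \<partial>lborel)"
        using nn_integral_real_affine[of "\<lambda>t. indicator {0<..<T} t * ennreal (kern a (t - \<sigma>))" 1 \<sigma>] by simp
      also have "\<dots> \<le> (\<integral>\<^sup>+r. ennreal (indicator {0<..<T} r * kern a r) \<partial>lborel)"
        using True by (intro nn_integral_mono) (auto simp: indicator_def kern_def)
      also have "\<dots> = ennreal (T powr a / Gamma (a + 1))" using T by (intro kern_integral[OF a]) simp
      finally show ?thesis by (simp add: mult_right_mono)
    qed (simp add: f0)
  qed
  also have "\<dots> = ennreal (T powr a / Gamma (a + 1)) * (\<integral>\<^sup>+\<sigma>. f \<sigma> \<partial>lborel)"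
    by (rule nn_integral_cmult) measurable
  finally show ?thesis .
qed

text \<open>Cauchy-Schwarz with the kernel split into two square roots, then
  \<open>kern_young\<close> applied to |g|^2.\<close>

lemma cv_L2:
  assumes a: "a > 0" and T: "T > 0" and g[measurable]: "g \<in> borel_measurable borel" and g0: "\<And>x. x \<notin> {0<..<T} \<Longrightarrow> g x = 0"
    and gi: "(\<integral>\<^sup>+x. ennreal ((norm (g x))\<^sup>2) \<partial>lborel) < \<infinity>"
  shows "(\<integral>\<^sup>+t. ennreal ((norm (indicator {0<..<T} t *\<^sub>R RL_conv a g t))\<^sup>2) \<partial>lborel) < \<infinity>"
proof -
  let ?K = "ennreal (T powr a / Gamma (a + 1))"
  have pw: "ennreal ((norm (indicator {0<..<T} t *\<^sub>R RL_conv a g t))\<^sup>2) \<le> ?K * (indicator {0<..<T} t * (\<integral>\<^sup>+\<sigma>. ennreal (kern a (t - \<sigma>)) * ennreal ((norm (g \<sigma>))\<^sup>2) \<partial>lborel))" for t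
  proof (cases "t \<in> {0<..<T}")
    case True
    have "ennreal (norm (RL_conv a g t)) \<le> (\<integral>\<^sup>+\<sigma>. ennreal (norm (kern a (t - \<sigma>) *\<^sub>R g \<sigma>)) \<partial>lborel)"
    proof (cases "integrable lborel (\<lambda>\<sigma>. kern a (t - \<sigma>) *\<^sub>R g \<sigma>)")
      case True
      then show ?thesis unfolding RL_conv_def by (rule integral_norm_bound_ennreal)
    qed (simp add: RL_conv_def not_integrable_integral_eq)
    also have "\<dots> = (\<integral>\<^sup>+\<sigma>. ennreal (indicator {0<..<T} \<sigma> * sqrt (kern a (t - \<sigma>))) * ennreal (sqrt (kern a (t - \<sigma>)) * norm (g \<sigma>)) \<partial>lborel)"
    proof (rule nn_integral_cong)
      fix \<sigma>
      show "ennreal (norm (kern a (t - \<sigma>) *\<^sub>R g \<sigma>)) = ennreal (indicator {0<..<T} \<sigma> * sqrt (kern a (t - \<sigma>))) * ennreal (sqrt (kern a (t - \<sigma>)) * norm (g \<sigma>))"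
        using kern_nonneg[OF a, of "t - \<sigma>"] g0[of \<sigma>] by (cases "\<sigma> \<in> {0<..<T}") (simp_all add: ennreal_mult[symmetric])
    qed
    finally have "(ennreal (norm (RL_conv a g t)))\<^sup>2 \<le> (\<dots>)\<^sup>2" by (rule power_mono) simp
    also have "\<dots> \<le> (\<integral>\<^sup>+\<sigma>. (ennreal (indicator {0<..<T} \<sigma> * sqrt (kern a (t - \<sigma>))))\<^sup>2 \<partial>lborel) * (\<integral>\<^sup>+\<sigma>. (ennreal (sqrt (kern a (t - \<sigma>)) * norm (g \<sigma>)))\<^sup>2 \<partial>lborel)"
      by (rule Cauchy_Schwarz_nn_integral) measurable
    also have "(\<integral>\<^sup>+\<sigma>. (ennreal (indicator {0<..<T} \<sigma> * sqrt (kern a (t - \<sigma>))))\<^sup>2 \<partial>lborel) = (\<integral>\<^sup>+\<sigma>. ennreal (indicator {0<..<T} \<sigma> * kern a (t - \<sigma>)) \<partial>lborel)"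
      using kern_nonneg[OF a] by (intro nn_integral_cong) (auto simp: ennreal_power indicator_def)
    also have "\<dots> = (\<integral>\<^sup>+r. ennreal (indicator {0<..<T} (t - r) * kern a r) \<partial>lborel)"
      using nn_integral_real_affine[of "\<lambda>\<sigma>. ennreal (indicator {0<..<T} \<sigma> * kern a (t - \<sigma>))" "-1" t] by simp
    also have "\<dots> \<le> (\<integral>\<^sup>+r. ennreal (indicator {0<..<T} r * kern a r) \<partial>lborel)"
    proof (rule nn_integral_mono, rule ennreal_leI)
      fix r show "indicator {0<..<T} (t - r) * kern a r \<le> indicator {0<..<T} r * kern a r"
        using True kern_nonneg[OF a, of r] kern_nonpos[of r a] by (cases "r > 0") (auto simp: indicator_def)
    qed
    also have "\<dots> = ?K" using T by (intro kern_integral[OF a]) simp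
    finally have "(ennreal (norm (RL_conv a g t)))\<^sup>2 \<le> ?K * (\<integral>\<^sup>+\<sigma>. (ennreal (sqrt (kern a (t - \<sigma>)) * norm (g \<sigma>)))\<^sup>2 \<partial>lborel)"
      by (simp add: mult_right_mono)
    also have "(\<integral>\<^sup>+\<sigma>. (ennreal (sqrt (kern a (t - \<sigma>)) * norm (g \<sigma>)))\<^sup>2 \<partial>lborel) = (\<integral>\<^sup>+\<sigma>. ennreal (kern a (t - \<sigma>)) * ennreal ((norm (g \<sigma>))\<^sup>2) \<partial>lborel)"
      using kern_nonneg[OF a] by (intro nn_integral_cong) (auto simp: ennreal_power power_mult_distrib ennreal_mult)
    finally show ?thesis using True by (simp add: ennreal_power)
  qed simp
  have "(\<integral>\<^sup>+t. ennreal ((norm (indicator {0<..<T} t *\<^sub>R RL_conv a g t))\<^sup>2) \<partial>lborel)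
     \<le> (\<integral>\<^sup>+t. ?K * (indicator {0<..<T} t * (\<integral>\<^sup>+\<sigma>. ennreal (kern a (t - \<sigma>)) * ennreal ((norm (g \<sigma>))\<^sup>2) \<partial>lborel)) \<partial>lborel)"
    by (intro nn_integral_mono pw)
  also have "\<dots> = ?K * (\<integral>\<^sup>+t. indicator {0<..<T} t * (\<integral>\<^sup>+\<sigma>. ennreal (kern a (t - \<sigma>)) * ennreal ((norm (g \<sigma>))\<^sup>2) \<partial>lborel) \<partial>lborel)"
    by (rule nn_integral_cmult) measurable
  also have "\<dots> \<le> ?K * (?K * (\<integral>\<^sup>+\<sigma>. ennreal ((norm (g \<sigma>))\<^sup>2) \<partial>lborel))"
    by (intro mult_left_mono kern_young a T) (use g0 in auto)
  also have "\<dots> < \<infinity>" using gi by (simp add: ennreal_mult_less_top)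
  finally show ?thesis .
qed

text \<open>On a bounded interval square integrability implies integrability, by |g| \<le> 1 +
  |g|^2.\<close>

lemma L2_borel_version:
  fixes g :: "real \<Rightarrow> complex" and T :: real
  assumes T: "T > 0" and g: "L2_fun {0<..<T} g"
  obtains g' where "g' \<in> borel_measurable borel" "AE x in lborel. x \<in> {0<..<T} \<longrightarrow> g x = g' x" "\<And>x. x \<notin> {0<..<T} \<Longrightarrow> g' x = 0"
    "(\<integral>\<^sup>+x. ennreal ((norm (g' x))\<^sup>2) \<partial>lborel) < \<infinity>" "integrable lborel g'"
proof -
  have gm: "g \<in> borel_measurable (lebesgue_on {0<..<T})" and gi: "integrable (lebesgue_on {0<..<T}) (\<lambda>x. (norm (g x))\<^sup>2)"
    using g by (auto simp: L2_fun_def)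
  have S: "{0<..<T} \<in> sets borel" by simp
  obtain g' where g': "g' \<in> borel_measurable borel" "AE x in lborel. x \<in> {0<..<T} \<longrightarrow> g x = g' x" "\<And>x. x \<notin> {0<..<T} \<Longrightarrow> g' x = 0"
    using borel_version_on[OF S gm] by blast
  have [measurable]: "g' \<in> borel_measurable borel" by fact
  have "integrable lebesgue (\<lambda>x. if x \<in> {0<..<T} then (norm (g x))\<^sup>2 else 0)"
    using gi by (subst Lebesgue_Measure.integrable_restrict_UNIV) auto
  then have i2: "integrable lborel (\<lambda>x. (norm (g' x))\<^sup>2)"
  proof (subst (asm) lebesgue_integral_cong_AE_borel(2)[of "\<lambda>x. (norm (g' x))\<^sup>2"])
    show "AE x in lborel. (if x \<in> {0<..<T} then (norm (g x))\<^sup>2 else 0) = (norm (g' x))\<^sup>2"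
      using g'(2) by eventually_elim (use g'(3) in auto)
  qed auto
  have n: "(\<integral>\<^sup>+x. ennreal ((norm (g' x))\<^sup>2) \<partial>lborel) < \<infinity>" using i2 by (simp add: integrable_iff_bounded)
  have i1: "integrable lborel (\<lambda>x. indicator {0..T} x *\<^sub>R (1::real))" by (rule borel_integrable_compact) auto
  have "integrable lborel g'"
  proof (rule Bochner_Integration.integrable_bound[OF Bochner_Integration.integrable_add[OF i1 i2]])
    have "norm (g' x) \<le> norm (indicator {0..T} x *\<^sub>R 1 + (norm (g' x))\<^sup>2)" for x
    proof (cases "x \<in> {0<..<T}")
      case True
      have "norm (g' x) \<le> 1 + (norm (g' x))\<^sup>2"
        using sum_squares_bound[of 1 "norm (g' x)"] norm_ge_zero[of "g' x"] unfolding one_power2 by linarith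
      then show ?thesis using True by simp
    qed (simp add: g'(3))
    then show "AE x in lborel. norm (g' x) \<le> norm (indicator {0..T} x *\<^sub>R 1 + (norm (g' x))\<^sup>2)" by simp
  qed measurable
  with g' n that show ?thesis by blast
qed

text \<open>\<open>RL_integral\<close> runs over the closed interval [0,t] while the kernel is
  supported on \<sigma> < t; the two end points form a null set.\<close>

lemma RL_integral_eq_cv:
  assumes a: "a > 0" and g'[measurable]: "g' \<in> borel_measurable borel" and ae: "AE x in lborel. x \<in> {0<..<T} \<longrightarrow> g x = g' x"
    and g0: "\<And>x. x \<notin> {0<..<T} \<Longrightarrow> g' x = 0" and t: "0 < t" "t \<le> T"
  shows "RL_integral a g t = RL_conv a g' t"
proof -
  have "RL_integral a g t = (1 / Gamma a) *\<^sub>R (LINT \<tau>|lebesgue. (if \<tau> \<in> {0..t} then (t - \<tau>) powr (a - 1) *\<^sub>R g \<tau> else 0))"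
    unfolding RL_integral_def by (subst Lebesgue_Measure.integral_restrict_UNIV) auto
  also have "(LINT \<tau>|lebesgue. (if \<tau> \<in> {0..t} then (t - \<tau>) powr (a - 1) *\<^sub>R g \<tau> else 0)) = (LINT \<tau>|lborel. (Gamma a * kern a (t - \<tau>)) *\<^sub>R g' \<tau>)"
  proof (rule lebesgue_integral_cong_AE_borel(1))
    have "AE x in lborel. x \<noteq> (0::real)" "AE x in lborel. x \<noteq> t" by (rule AE_lborel_singleton)+
    with ae show "AE \<tau> in lborel. (if \<tau> \<in> {0..t} then (t - \<tau>) powr (a - 1) *\<^sub>R g \<tau> else 0) = (Gamma a * kern a (t - \<tau>)) *\<^sub>R g' \<tau>"
    proof eventually_elim
      case (elim \<tau>)
      note h = elim
      show ?case
      proof (cases "0 < \<tau> \<and> \<tau> < t")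
        case True
        then show ?thesis using h t Gamma_real_pos[OF a] by (simp add: kern_def)
      next
        case False
        then have "\<tau> < 0 \<or> \<tau> > t" using h by linarith
        then show ?thesis using g0[of \<tau>] t by (auto simp: kern_def)
      qed
    qed
  qed measurable
  also have "\<dots> = Gamma a *\<^sub>R RL_conv a g' t" unfolding RL_conv_def
    by (subst integral_scaleR_right[symmetric]) (simp add: mult.commute)
  finally show ?thesis using Gamma_real_pos[OF a] by simp
qed

lemma cv_AE_finite:
  fixes g :: "real \<Rightarrow> complex"
  assumes a: "a > 0" and T: "T > 0" and g[measurable]: "g \<in> borel_measurable borel" and g0: "\<And>x. x \<notin> {0<..<T} \<Longrightarrow> g x = 0"
    and gi: "integrable lborel g"
  shows "AE t in lborel. t \<in> {0<..<T} \<longrightarrow> (\<integral>\<^sup>+\<sigma>. ennreal (kern a (t - \<sigma>) * norm (g \<sigma>)) \<partial>lborel) < \<infinity>"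
proof -
  have "(\<integral>\<^sup>+t. indicator {0<..<T} t * (\<integral>\<^sup>+\<sigma>. ennreal (kern a (t - \<sigma>)) * ennreal (norm (g \<sigma>)) \<partial>lborel) \<partial>lborel) \<le> ennreal (T powr a / Gamma (a + 1)) * (\<integral>\<^sup>+\<sigma>. ennreal (norm (g \<sigma>)) \<partial>lborel)"
    by (rule kern_young[OF a _ _ T]) (use g0 in auto)
  also have "\<dots> < \<infinity>"
  proof -
    have "(\<integral>\<^sup>+\<sigma>. ennreal (norm (g \<sigma>)) \<partial>lborel) < \<infinity>" using gi by (simp only: integrable_iff_bounded)
    then show ?thesis by (simp add: ennreal_mult_less_top)
  qed
  finally have "AE t in lborel. indicator {0<..<T} t * (\<integral>\<^sup>+\<sigma>. ennreal (kern a (t - \<sigma>)) * ennreal (norm (g \<sigma>)) \<partial>lborel) \<noteq> \<infinity>"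
    by (intro nn_integral_noteq_infinite) auto
  then show ?thesis
  proof eventually_elim
    case (elim t)
    note h = elim
    show ?case using h kern_nonneg[OF a] by (auto simp: ennreal_mult less_top)
  qed
qed

text \<open>J^a G = J^b (J^(a-b) G), and J^(a-b) G is again square integrable on (0,T). Cutting it
  off outside (0,T) does not change J^b of it before T.\<close>

lemma RL_preimage_smaller:
  assumes T: "T > 0" and ab: "0 < b" "b < a" and p: "RL_preimage a T \<phi> G"
  shows "\<exists>G'. RL_preimage b T \<phi> G'"
proof -
  have G: "L2_fun {0<..<T} G" and ae: "AE t in lborel. t \<in> {0<..<T} \<longrightarrow> \<phi> t = RL_integral a G t"
    using p by (auto simp: RL_preimage_def AE_lebesgue_on_iff)
  obtain g where g: "g \<in> borel_measurable borel" "AE x in lborel. x \<in> {0<..<T} \<longrightarrow> G x = g x" "\<And>x. x \<notin> {0<..<T} \<Longrightarrow> g x = 0"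
    "(\<integral>\<^sup>+x. ennreal ((norm (g x))\<^sup>2) \<partial>lborel) < \<infinity>" "integrable lborel g"
    using L2_borel_version[OF T G] by blast
  have [measurable]: "g \<in> borel_measurable borel" by fact
  define h where "h t = indicator {0<..<T} t *\<^sub>R RL_conv (a - b) g t" for t
  have hm[measurable]: "h \<in> borel_measurable borel" unfolding h_def[abs_def] by measurable
  have h0: "\<And>x. x \<notin> {0<..<T} \<Longrightarrow> h x = 0" by (simp add: h_def)
  have hL: "L2_fun {0<..<T} h"
  proof -
    have n: "(\<integral>\<^sup>+t. ennreal ((norm (h t))\<^sup>2) \<partial>lborel) < \<infinity>"
      unfolding h_def by (rule cv_L2[OF _ T g(1,3,4)]) (use ab in simp)
    have "integrable lborel (\<lambda>x. (norm (h x))\<^sup>2)" using n by (simp add: integrable_iff_bounded)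
    then have "L2_fun UNIV h" by (simp add: L2_fun_UNIV integrable_completion measurable_completion)
    then show ?thesis by (rule L2_fun_UNIV_restrict[rotated]) simp
  qed
  have fin: "AE t in lborel. t \<in> {0<..<T} \<longrightarrow> (\<integral>\<^sup>+\<sigma>. ennreal (kern a (t - \<sigma>) * norm (g \<sigma>)) \<partial>lborel) < \<infinity>"
    by (rule cv_AE_finite) (use ab T g in auto)
  have "AE t in lborel. t \<in> {0<..<T} \<longrightarrow> \<phi> t = RL_integral b h t" using ae fin
  proof eventually_elim
    case (elim t)
    note 1 = elim(1) and 2 = elim(2)
    show ?case
    proof
      assume t: "t \<in> {0<..<T}"
      have "\<phi> t = RL_conv a g t" using 1 t RL_integral_eq_cv[OF _ g(1,2,3), of a t] ab by simp
      also have "\<dots> = RL_conv b (RL_conv (a - b) g) t" using cv_assoc[of b "a - b" g t] 2 t ab by simp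
      also have "\<dots> = RL_conv b h t"
      proof (rule cv_cong_AE)
        have "RL_conv (a - b) g \<sigma> = 0" if "\<sigma> \<le> 0" for \<sigma>
        proof -
          have "(\<lambda>r. kern (a - b) (\<sigma> - r) *\<^sub>R g r) = (\<lambda>_. 0)"
          proof
            fix r show "kern (a - b) (\<sigma> - r) *\<^sub>R g r = 0"
              using that g(3)[of r] by (cases "r > 0") (auto simp: kern_def)
          qed
          then show ?thesis by (simp only: RL_conv_def Bochner_Integration.integral_zero)
        qed
        then show "AE \<sigma> in lborel. \<sigma> < t \<longrightarrow> RL_conv (a - b) g \<sigma> = h \<sigma>"
          using t by (intro AE_I2) (auto simp: h_def indicator_def)
      qed measurable
      also have "\<dots> = RL_integral b h t" by (rule RL_integral_eq_cv[symmetric]) (use ab t h0 in auto)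
      finally show "\<phi> t = RL_integral b h t" .
    qed
  qed
  then show ?thesis using hL by (auto simp: RL_preimage_def AE_lebesgue_on_iff)
qed

text \<open>J^(1-a) J^a = J^1, so the fractional integral of \<phi> is the ordinary primitive of its
  fractional derivative. Here f and g are Borel versions of \<phi> and of the preimage G; the
  identity holds at every t, not just almost every t, because the combined kernel is
  bounded.\<close>

lemma RL_preimage_primitive:
  assumes T: "T > 0" and a: "0 < a" "a < 1" and p: "RL_preimage a T \<phi> G"
    and f[measurable]: "f \<in> borel_measurable borel" and fae: "AE x in lborel. x \<in> {0<..<T} \<longrightarrow> \<phi> x = f x" and f0: "\<And>x. x \<notin> {0<..<T} \<Longrightarrow> f x = 0"
    and g[measurable]: "g \<in> borel_measurable borel" and gae: "AE x in lborel. x \<in> {0<..<T} \<longrightarrow> G x = g x" and g0: "\<And>x. x \<notin> {0<..<T} \<Longrightarrow> g x = 0"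
    and t: "0 < t" "t \<le> T"
  shows "integrable lborel g" "RL_conv (1 - a) f t = (LBINT \<sigma>. indicator {..<t} \<sigma> *\<^sub>R g \<sigma>)"
proof -
  have G: "L2_fun {0<..<T} G" and ae: "AE t in lborel. t \<in> {0<..<T} \<longrightarrow> \<phi> t = RL_integral a G t"
    using p by (auto simp: RL_preimage_def AE_lebesgue_on_iff)
  obtain g' where g': "g' \<in> borel_measurable borel" "AE x in lborel. x \<in> {0<..<T} \<longrightarrow> G x = g' x" "\<And>x. x \<notin> {0<..<T} \<Longrightarrow> g' x = 0" "integrable lborel g'"
    using L2_borel_version[OF T G] by blast
  have [measurable]: "g' \<in> borel_measurable borel" by fact
  have "AE x in lborel. g' x = g x" using gae g'(2) by eventually_elim (use g0 g'(3) in metis)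
  then show gi: "integrable lborel g" using g'(4) by (subst (asm) integrable_cong_AE[of _ _ g]) auto
  have "RL_conv (1 - a) f t = RL_conv (1 - a) (RL_conv a g) t"
  proof (rule cv_cong_AE)
    have z: "RL_conv a g \<sigma> = 0" if "\<sigma> \<le> 0" for \<sigma>
    proof -
      have "(\<lambda>r. kern a (\<sigma> - r) *\<^sub>R g r) = (\<lambda>_. 0)"
      proof
        fix r show "kern a (\<sigma> - r) *\<^sub>R g r = 0"
          using that g0[of r] by (cases "r > 0") (auto simp: kern_def)
      qed
      then show ?thesis by (simp only: RL_conv_def Bochner_Integration.integral_zero)
    qed
    show "AE \<sigma> in lborel. \<sigma> < t \<longrightarrow> f \<sigma> = RL_conv a g \<sigma>" using ae fae
    proof eventually_elim
      case (elim \<sigma>)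
      note h = elim
      show ?case
        using h z[of \<sigma>] f0[of \<sigma>] RL_integral_eq_cv[OF a(1) g gae g0, of \<sigma>] t by (cases "\<sigma> > 0") auto
    qed
  qed measurable
  also have "\<dots> = RL_conv (1 - a + a) g t"
  proof (rule cv_assoc)
    have "(\<integral>\<^sup>+\<sigma>. ennreal (kern (1 - a + a) (t - \<sigma>) * norm (g \<sigma>)) \<partial>lborel) \<le> (\<integral>\<^sup>+\<sigma>. ennreal (norm (g \<sigma>)) \<partial>lborel)"
      by (intro nn_integral_mono) (auto simp: kern_1 indicator_def)
    also have "\<dots> < \<infinity>" using gi by (simp add: integrable_iff_bounded)
    finally show "(\<integral>\<^sup>+\<sigma>. ennreal (kern (1 - a + a) (t - \<sigma>) * norm (g \<sigma>)) \<partial>lborel) < \<infinity>" .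
  qed (use a in auto)
  also have "\<dots> = (LBINT \<sigma>. indicator {..<t} \<sigma> *\<^sub>R g \<sigma>)"
    unfolding RL_conv_def by (intro Bochner_Integration.integral_cong) (auto simp: kern_1 indicator_def)
  finally show "RL_conv (1 - a) f t = (LBINT \<sigma>. indicator {..<t} \<sigma> *\<^sub>R g \<sigma>)" .
qed

text \<open>A function in \<open>H_frac a T\<close> has fractional derivatives of all lower orders,
  so the choice in \<open>frac_deriv\<close> is a genuine preimage for each of them.\<close>

lemma frac_deriv_preimage:
  assumes "\<phi> \<in> H_frac a T" "T > 0" "0 < b" "b \<le> a"
  shows "RL_preimage b T \<phi> (frac_deriv b T \<phi>)"
proof -
  have "\<exists>G. RL_preimage b T \<phi> G"
    using assms RL_preimage_smaller[of T b a \<phi>] by (cases "a = b") (auto simp: H_frac_def)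
  then show ?thesis unfolding frac_deriv_def by (rule someI_ex)
qed

section \<open>Bounds and truncated transforms of real Riemann-Liouville integrals\<close>

definition RL_conv_real :: "real \<Rightarrow> (real \<Rightarrow> real) \<Rightarrow> real \<Rightarrow> real" where
  "RL_conv_real b h t = (LBINT \<tau>. kern b (t - \<tau>) * h \<tau>)"

lemma has_bochner_integral_exp_tail:
  fixes s T :: real
  assumes s: "s > 0"
  shows "has_bochner_integral lborel (\<lambda>t. indicator {T..} t * exp (- s * t)) (exp (- s * T) / s)"
proof (rule has_bochner_integral_nn_integral)
  show "(\<integral>\<^sup>+t. ennreal (indicator {T..} t * exp (- s * t)) \<partial>lborel) = ennreal (exp (- s * T) / s)"
    using nn_integral_has_integral_lebesgue[OF _ has_integral_exp_minus_to_infinity[OF s, of T]] by (simp add: mult.commute)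
qed (use s in auto)

lemma kern_antimono: "0 < b \<Longrightarrow> b \<le> 1 \<Longrightarrow> 0 < r \<Longrightarrow> r \<le> r' \<Longrightarrow> kern b r' \<le> kern b r"
  using Gamma_real_pos[of b] by (auto simp: kern_def intro!: divide_right_mono powr_mono2')

lemma kern_window:
  assumes b: "b > 0" and t: "0 \<le> t" "t \<le> T"
  shows "(\<integral>\<^sup>+\<tau>. ennreal (indicator {0<..<T} \<tau> * kern b (t - \<tau>)) \<partial>lborel) = ennreal (t powr b / Gamma (b + 1))"
proof -
  have "(\<integral>\<^sup>+\<tau>. ennreal (indicator {0<..<T} \<tau> * kern b (t - \<tau>)) \<partial>lborel) = (\<integral>\<^sup>+r. ennreal (indicator {0<..<T} (t - r) * kern b r) \<partial>lborel)"
    using nn_integral_real_affine[of "\<lambda>\<tau>. ennreal (indicator {0<..<T} \<tau> * kern b (t - \<tau>))" "-1" t] by simp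
  also have "\<dots> = (\<integral>\<^sup>+r. ennreal (indicator {0<..<t} r * kern b r) \<partial>lborel)"
    using t by (intro nn_integral_cong) (auto simp: indicator_def kern_def)
  also have "\<dots> = ennreal (t powr b / Gamma (b + 1))" by (rule kern_integral[OF b t(1)])
  finally show ?thesis .
qed

context
  fixes b T K :: real and h :: "real \<Rightarrow> real"
  assumes b: "0 < b" "b \<le> 1" and T: "T > 0" and hm[measurable]: "h \<in> borel_measurable borel"
    and hK: "\<And>t. t \<in> {0<..<T} \<Longrightarrow> \<bar>h t\<bar> \<le> K" and h0: "\<And>t. t \<notin> {0<..<T} \<Longrightarrow> h t = 0"
begin

lemma K_nonneg: "K \<ge> 0" using hK[of "T / 2"] T by (auto simp: abs_le_iff)

text \<open>The times t and t' are kept apart to cover two cases: t' = t up to time T, and t' = T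
  beyond, where the kernel seen from t is smaller than the one seen from T.\<close>

lemma rl_bound_aux:
  assumes t': "0 \<le> t'" "t' \<le> T" and le: "\<And>\<tau>. \<tau> \<in> {0<..<T} \<Longrightarrow> kern b (t - \<tau>) \<le> kern b (t' - \<tau>)"
  shows "\<bar>RL_conv_real b h t\<bar> \<le> K * (t' powr b / Gamma (b + 1))"
proof -
  note kern_nonneg[OF b(1), simp]
  have G: "Gamma (b + 1) > 0" using b by (intro Gamma_real_pos) simp
  have i: "integrable lborel (\<lambda>\<tau>. K * (indicator {0<..<T} \<tau> * kern b (t' - \<tau>)))"
    by (intro integrable_mult_right integrableI_nonneg) (use kern_window[OF b(1) t'] in auto)
  have bd: "norm (kern b (t - \<tau>) * h \<tau>) \<le> K * (indicator {0<..<T} \<tau> * kern b (t' - \<tau>))" for \<tau>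
  proof (cases "\<tau> \<in> {0<..<T}")
    case True
    have "\<bar>h \<tau>\<bar> * kern b (t - \<tau>) \<le> K * kern b (t' - \<tau>)"
      by (intro mult_mono hK[OF True] le[OF True] K_nonneg) simp
    then show ?thesis using True by (simp add: abs_mult mult_ac)
  qed (simp add: h0)
  have int: "integrable lborel (\<lambda>\<tau>. kern b (t - \<tau>) * h \<tau>)"
    by (rule Bochner_Integration.integrable_bound[OF i]) (use bd in \<open>auto intro!: AE_I2 intro: order_trans[OF _ abs_ge_self]\<close>)
  have "\<bar>RL_conv_real b h t\<bar> \<le> (LBINT \<tau>. K * (indicator {0<..<T} \<tau> * kern b (t' - \<tau>)))"
    unfolding RL_conv_real_def by (intro integral_abs_bound[THEN order_trans] integral_mono i integrable_abs[OF int]) (use bd in auto)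
  also have "\<dots> = K * (LBINT \<tau>. indicator {0<..<T} \<tau> * kern b (t' - \<tau>))" by simp
  also have "(LBINT \<tau>. indicator {0<..<T} \<tau> * kern b (t' - \<tau>)) = t' powr b / Gamma (b + 1)"
    by (subst integral_eq_nn_integral) (use kern_window[OF b(1) t'] G in auto)
  finally show ?thesis .
qed

lemma rl_bound: "0 \<le> t \<Longrightarrow> t \<le> T \<Longrightarrow> \<bar>RL_conv_real b h t\<bar> \<le> K * (t powr b / Gamma (b + 1))"
  by (rule rl_bound_aux) auto

lemma rl_bound_tail: "T \<le> t \<Longrightarrow> \<bar>RL_conv_real b h t\<bar> \<le> K * (T powr b / Gamma (b + 1))"
  by (rule rl_bound_aux) (use T b in \<open>auto intro!: kern_antimono\<close>)

lemma rl_nonpos: "t \<le> 0 \<Longrightarrow> RL_conv_real b h t = 0"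
proof -
  assume t: "t \<le> 0"
  have "(\<lambda>\<tau>. kern b (t - \<tau>) * h \<tau>) = (\<lambda>_. 0)"
  proof
    fix \<tau> show "kern b (t - \<tau>) * h \<tau> = 0" using t h0[of \<tau>] by (cases "\<tau> > 0") (auto simp: kern_nonpos)
  qed
  then show ?thesis by (simp only: RL_conv_real_def Bochner_Integration.integral_zero)
qed

text \<open>A shift by \<tau> and a scaling by s lead to the Gamma integral.\<close>

lemma laplace_kern:
  assumes s: "s > 0"
  shows "(\<integral>\<^sup>+t. ennreal (exp (- s * t) * kern b (t - \<tau>)) \<partial>lborel) = ennreal (exp (- s * \<tau>) * s powr (- b))"
proof -
  have G: "Gamma b > 0" using b by (intro Gamma_real_pos)
  have sb: "s powr (- b) > 0" using s by simp
  have "(\<integral>\<^sup>+t. ennreal (exp (- s * t) * kern b (t - \<tau>)) \<partial>lborel)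
     = ennreal (1 / s) * (\<integral>\<^sup>+x. ennreal (exp (- s * (\<tau> + 1 / s * x)) * kern b (1 / s * x)) \<partial>lborel)"
    using nn_integral_real_affine[of "\<lambda>t. ennreal (exp (- s * t) * kern b (t - \<tau>))" "1 / s" \<tau>] s by simp
  also have "(\<integral>\<^sup>+x. ennreal (exp (- s * (\<tau> + 1 / s * x)) * kern b (1 / s * x)) \<partial>lborel)
     = (\<integral>\<^sup>+x. ennreal (exp (- s * \<tau>) * s powr (1 - b) / Gamma b) * ennreal (indicator {0..} x * x powr (b - 1) / exp x) \<partial>lborel)"
  proof (rule nn_integral_cong_AE)
    have "AE x in lborel. x \<noteq> (0::real)" by (rule AE_lborel_singleton)
    then show "AE x in lborel. ennreal (exp (- s * (\<tau> + 1 / s * x)) * kern b (1 / s * x))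
      = ennreal (exp (- s * \<tau>) * s powr (1 - b) / Gamma b) * ennreal (indicator {0..} x * x powr (b - 1) / exp x)"
    proof eventually_elim
      case (elim x)
      note x = elim
      show ?case
      proof (cases "x > 0")
        case True
        have "exp (- s * (\<tau> + 1 / s * x)) = exp (- s * \<tau>) / exp x"
          using s by (simp add: exp_diff[symmetric] algebra_simps)
        moreover have "kern b (1 / s * x) = s powr (1 - b) * x powr (b - 1) / Gamma b"
        proof -
          have "(1 / s * x) powr (b - 1) = (1 / s) powr (b - 1) * x powr (b - 1)" using s True by (intro powr_mult)
          also have "(1 / s) powr (b - 1) = s powr (1 - b)" using s by (simp add: powr_divide powr_minus_divide[symmetric])
          finally show ?thesis using s True by (simp add: kern_def)
        qed
        ultimately show ?thesis using True G by (simp add: ennreal_mult[symmetric] mult_ac)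
      next
        case False
        then have "x < 0" using x by simp
        then have "1 / s * x \<le> 0" using s by (simp add: mult_le_0_iff divide_le_0_iff)
        then show ?thesis using \<open>x < 0\<close> by (simp add: kern_nonpos)
      qed
    qed
  qed
  also have "\<dots> = ennreal (exp (- s * \<tau>) * s powr (1 - b) / Gamma b) * ennreal (Gamma b)"
    by (subst nn_integral_cmult) (auto simp: Gamma_conv_nn_integral_real[OF b(1)])
  also have "ennreal (1 / s) * \<dots> = ennreal (1 / s * (exp (- s * \<tau>) * s powr (1 - b) / Gamma b * Gamma b))"
    using s G by (simp add: ennreal_mult[symmetric])
  also have "1 / s * (exp (- s * \<tau>) * s powr (1 - b) / Gamma b * Gamma b) = exp (- s * \<tau>) * s powr (- b)"
    using s G by (simp add: powr_diff powr_minus divide_inverse)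
  finally show ?thesis .
qed

lemma h_integrable: "integrable lborel h"
proof (rule Bochner_Integration.integrable_bound)
  show "integrable lborel (\<lambda>x. K * indicator {0<..<T} x)" by (intro integrable_mult_right integrable_real_indicator) (use T in auto)
  show "AE x in lborel. norm (h x) \<le> norm (K * indicator {0<..<T} x)"
    using hK h0 K_nonneg by (intro AE_I2) (auto simp: indicator_def)
qed measurable

lemma exp_h_integrable: "s > 0 \<Longrightarrow> integrable lborel (\<lambda>\<tau>. exp (- s * \<tau>) * h \<tau>)"
proof (rule Bochner_Integration.integrable_bound[OF h_integrable])
  assume s: "s > 0"
  have "exp (- s * x) \<le> 1" if "x \<in> {0<..<T}" for x using s that by simp
  then show "AE x in lborel. norm (exp (- s * x) * h x) \<le> norm (h x)"
    using h0 by (intro AE_I2) (metis abs_exp_cancel abs_ge_zero abs_mult mult_eq_0_iff mult_left_le_one_le norm_zero order_refl real_norm_def zero_le_mult_iff)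
qed measurable

text \<open>On the half-line the transform of J^b h is exactly s^(-b) times that of h. Cutting at T
  removes the integral over [T,\<infinity>), where \<open>rl_bound_tail\<close> applies, so the
  error is a multiple of exp(-s T)/s.\<close>

lemma rl_laplace:
  assumes s: "s > 0"
  shows "integrable lborel (\<lambda>t. indicator {0<..<T} t * (exp (- s * t) * RL_conv_real b h t))"
    "\<bar>s * (LBINT t. indicator {0<..<T} t * (exp (- s * t) * RL_conv_real b h t)) - s powr (1 - b) * (LBINT \<tau>. exp (- s * \<tau>) * h \<tau>)\<bar>
      \<le> exp (- s * T) * (K * (T powr b / Gamma (b + 1)))"
proof -
  note kern_nonneg[OF b(1), simp]
  define F where "F t \<tau> = exp (- s * t) * (kern b (t - \<tau>) * h \<tau>)" for t \<tau>
  have Fm[measurable]: "case_prod F \<in> borel_measurable (lborel \<Otimes>\<^sub>M lborel)" unfolding F_def[abs_def] by measurable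
  have "(\<integral>\<^sup>+x. ennreal (norm (case_prod F x)) \<partial>(lborel \<Otimes>\<^sub>M lborel)) = (\<integral>\<^sup>+\<tau>. \<integral>\<^sup>+t. ennreal (norm (F t \<tau>)) \<partial>lborel \<partial>lborel)"
    by (subst lborel_pair.nn_integral_snd[symmetric]) (auto simp: case_prod_unfold)
  also have "\<dots> = (\<integral>\<^sup>+\<tau>. ennreal (s powr (- b)) * ennreal (norm (exp (- s * \<tau>) * h \<tau>)) \<partial>lborel)"
  proof (rule nn_integral_cong)
    fix \<tau>
    have "(\<integral>\<^sup>+t. ennreal (norm (F t \<tau>)) \<partial>lborel) = (\<integral>\<^sup>+t. ennreal (exp (- s * t) * kern b (t - \<tau>)) * ennreal \<bar>h \<tau>\<bar> \<partial>lborel)"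
      by (intro nn_integral_cong) (simp add: F_def ennreal_mult[symmetric] abs_mult)
    also have "\<dots> = ennreal (exp (- s * \<tau>) * s powr (- b)) * ennreal \<bar>h \<tau>\<bar>"
      by (subst nn_integral_multc) (auto simp: laplace_kern[OF s, simplified])
    finally show "(\<integral>\<^sup>+t. ennreal (norm (F t \<tau>)) \<partial>lborel) = ennreal (s powr (- b)) * ennreal (norm (exp (- s * \<tau>) * h \<tau>))"
      by (simp add: ennreal_mult[symmetric] abs_mult mult_ac)
  qed
  also have "\<dots> < \<infinity>"
  proof -
    have "(\<integral>\<^sup>+\<tau>. ennreal (norm (exp (- s * \<tau>) * h \<tau>)) \<partial>lborel) < \<infinity>"
      using exp_h_integrable[OF s] by (simp only: integrable_iff_bounded)
    then show ?thesis by (subst nn_integral_cmult) (auto simp: ennreal_mult_less_top)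
  qed
  finally have Fi: "integrable (lborel \<Otimes>\<^sub>M lborel) (case_prod F)" by (intro integrableI_bounded) auto
  have 1: "(LBINT \<tau>. F t \<tau>) = exp (- s * t) * RL_conv_real b h t" for t unfolding F_def RL_conv_real_def by simp
  have 2: "(LBINT t. F t \<tau>) = s powr (- b) * (exp (- s * \<tau>) * h \<tau>)" for \<tau>
  proof -
    have "(LBINT t. exp (- s * t) * kern b (t - \<tau>)) = exp (- s * \<tau>) * s powr (- b)"
      by (subst integral_eq_nn_integral) (use laplace_kern[OF s] in auto)
    moreover have "F t \<tau> = h \<tau> * (exp (- s * t) * kern b (t - \<tau>))" for t by (simp add: F_def)
    ultimately show ?thesis by simp
  qed
  have tot_i: "integrable lborel (\<lambda>t. exp (- s * t) * RL_conv_real b h t)"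
    using lborel_pair.integrable_fst'[OF Fi] by (simp only: split_conv 1)
  have tot: "(LBINT t. exp (- s * t) * RL_conv_real b h t) = s powr (- b) * (LBINT \<tau>. exp (- s * \<tau>) * h \<tau>)"
  proof -
    have "(LBINT t. exp (- s * t) * RL_conv_real b h t) = (LBINT t. LBINT \<tau>. F t \<tau>)" unfolding 1 ..
    also have "\<dots> = (LBINT \<tau>. LBINT t. F t \<tau>)" by (rule lborel_pair.Fubini_integral[symmetric, OF Fi])
    finally show ?thesis unfolding 2 by simp
  qed
  have mi: "integrable lborel (\<lambda>t. indicator S t * (exp (- s * t) * RL_conv_real b h t))" if "S \<in> sets borel" for S
    using integrable_mult_indicator[OF _ tot_i, of S] that by simp
  show "integrable lborel (\<lambda>t. indicator {0<..<T} t * (exp (- s * t) * RL_conv_real b h t))" by (rule mi) simp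
  have split: "(LBINT t. exp (- s * t) * RL_conv_real b h t) = (LBINT t. indicator {0<..<T} t * (exp (- s * t) * RL_conv_real b h t))
      + (LBINT t. indicator {T..} t * (exp (- s * t) * RL_conv_real b h t))"
  proof -
    have "(\<lambda>t. exp (- s * t) * RL_conv_real b h t) = (\<lambda>t. indicator {0<..<T} t * (exp (- s * t) * RL_conv_real b h t) + indicator {T..} t * (exp (- s * t) * RL_conv_real b h t))"
      using rl_nonpos T by (auto simp: indicator_def fun_eq_iff)
    then show ?thesis using Bochner_Integration.integral_add[OF mi[of "{0<..<T}"] mi[of "{T..}"]] by simp
  qed
  let ?K = "K * (T powr b / Gamma (b + 1))"
  note ti = has_bochner_integral_exp_tail[OF s, of T]
  have "\<bar>LBINT t. indicator {T..} t * (exp (- s * t) * RL_conv_real b h t)\<bar> \<le> (LBINT t. ?K * (indicator {T..} t * exp (- s * t)))"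
  proof (intro integral_abs_bound[THEN order_trans] integral_mono integrable_abs mi integrable_mult_right)
    show "integrable lborel (\<lambda>t. indicator {T..} t * exp (- s * t))" using ti by (rule integrable.intros)
    show "\<bar>indicator {T..} t * (exp (- s * t) * RL_conv_real b h t)\<bar> \<le> ?K * (indicator {T..} t * exp (- s * t))" for t
      using mult_left_mono[OF rl_bound_tail[of t], of "exp (- s * t)"] by (cases "T \<le> t") (simp_all add: abs_mult mult_ac)
  qed simp
  also have "\<dots> = ?K * (exp (- s * T) / s)" using has_bochner_integral_integral_eq[OF ti] by simp
  finally have "\<bar>LBINT t. indicator {T..} t * (exp (- s * t) * RL_conv_real b h t)\<bar> \<le> ?K * (exp (- s * T) / s)" .
  from mult_left_mono[OF this, of s] have tail: "\<bar>s * (LBINT t. indicator {T..} t * (exp (- s * t) * RL_conv_real b h t))\<bar> \<le> exp (- s * T) * ?K"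
    using s by (simp add: abs_mult mult_ac)
  have "s * s powr (- b) = s powr (1 - b)" using s by (simp add: powr_diff powr_minus divide_inverse)
  then have "s * (LBINT t. indicator {0<..<T} t * (exp (- s * t) * RL_conv_real b h t)) - s powr (1 - b) * (LBINT \<tau>. exp (- s * \<tau>) * h \<tau>)
     = - (s * (LBINT t. indicator {T..} t * (exp (- s * t) * RL_conv_real b h t)))"
    using arg_cong[OF split[unfolded tot], of "\<lambda>x. s * x"] by (simp add: distrib_left mult.assoc[symmetric])
  then show "\<bar>s * (LBINT t. indicator {0<..<T} t * (exp (- s * t) * RL_conv_real b h t)) - s powr (1 - b) * (LBINT \<tau>. exp (- s * \<tau>) * h \<tau>)\<bar>
      \<le> exp (- s * T) * ?K" using tail by simp
qed

end


context subordination
begin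

text \<open>Testing produces scalar statements with constants uniform in \<phi>: the transform of n
  \<phi> is Qr s/s times that of (U - U0) \<bullet> \<phi>, up to multiples of exp(-s T) norm
  \<phi>. Taking \<phi> to be the residual itself converts this into a bound for its norm.\<close>

lemma frac_transform_estimate:
  fixes G :: "('h::{real_inner,banach} \<times> 'h) set"
  assumes G: "accretive_graph G" and T: "T > 0" and cU: "continuous_on {0<..T} U" and lU: "(U \<longlongrightarrow> U0) (at_right 0)"
    and cB: "continuous_on {0<..T} B" and g: "\<And>t. t \<in> {0<..T} \<Longrightarrow> (U t, B t) \<in> G"
  defines "h \<equiv> \<lambda>\<phi> \<tau>. indicator {0<..<T} \<tau> * ((U \<tau> - U0) \<bullet> \<phi>)"
  defines "n \<equiv> \<lambda>\<phi> t. \<Sum>j=1..l. q j * RL_conv_real (1 - \<alpha> j) (h \<phi>) t"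
  assumes n: "\<And>\<phi> e t. 0 < e \<Longrightarrow> e \<le> t \<Longrightarrow> t \<le> T \<Longrightarrow> n \<phi> t - n \<phi> e = - integral {e..t} (\<lambda>r. B r \<bullet> \<phi>)"
  shows "\<exists>C. \<forall>s\<ge>1. \<exists>Y. (laplace_upto T (extend0 U0 U) s, Y) \<in> G \<and>
    norm (Y + Qr s *\<^sub>R laplace_upto T (extend0 U0 U) s - (Qr s / s) *\<^sub>R U0) \<le> C * exp (- s * T)"
proof -
  interpret accretive_graph G by fact
  have bpos: "0 < 1 - \<alpha> j" "1 - \<alpha> j \<le> 1" if "j \<in> {1..l}" for j
    using \<alpha>_pos[OF that] \<alpha>_le[OF that] \<alpha>1 by auto
  have cU0: "continuous_on {0..T} (extend0 U0 U)"
    by (rule continuous_extend0[OF continuous_on_subset[OF cU] lU]) auto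
  obtain M where M: "\<And>t. t \<in> {0..T} \<Longrightarrow> norm (extend0 U0 U t - U0) \<le> M"
  proof -
    have "compact ((\<lambda>t. extend0 U0 U t - U0) ` {0..T})"
      by (intro compact_continuous_image continuous_intros cU0) auto
    then obtain M where "\<forall>x\<in>(\<lambda>t. extend0 U0 U t - U0) ` {0..T}. norm x \<le> M"
      using compact_imp_bounded bounded_iff by metis
    then have "norm (extend0 U0 U t - U0) \<le> M" if "t \<in> {0..T}" for t using that by blast
    then show ?thesis using that by blast
  qed
  have M0: "M \<ge> 0" using order_trans[OF norm_ge_zero M[of 0]] T by simp
  have hm: "h \<phi> \<in> borel_measurable borel" for \<phi>
  proof -
    have "continuous_on {0<..<T} (\<lambda>\<tau>. (U \<tau> - U0) \<bullet> \<phi>)"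
      by (intro continuous_intros continuous_on_subset[OF cU]) auto
    then show ?thesis
      using borel_measurable_continuous_on_indicator[of "{0<..<T}" "\<lambda>\<tau>. (U \<tau> - U0) \<bullet> \<phi>"] unfolding h_def by simp
  qed
  have hK: "\<bar>h \<phi> t\<bar> \<le> M * norm \<phi>" if "t \<in> {0<..<T}" for \<phi> t
  proof -
    have "\<bar>(U t - U0) \<bullet> \<phi>\<bar> \<le> norm (U t - U0) * norm \<phi>" by (rule Cauchy_Schwarz_ineq2)
    also have "\<dots> \<le> M * norm \<phi>" using M[of t] that by (intro mult_right_mono) (auto simp: extend0_def)
    finally show ?thesis using that by (simp add: h_def)
  qed
  have h0: "h \<phi> t = 0" if "t \<notin> {0<..<T}" for \<phi> t using that by (simp add: h_def)
  \<comment> \<open>The modulus at time 0 demanded by \<open>frac_resolvent\<close>: each summand is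
    the bound of \<open>rl_bound\<close> for J^(1 - \<alpha> j), with the factor norm \<phi> taken
    out.\<close>
  define \<nu> where "\<nu> t = M * (\<Sum>j=1..l. q j * (t powr (1 - \<alpha> j) / Gamma (1 - \<alpha> j + 1)))" for t
  have Gp: "Gamma (1 - \<alpha> j + 1) > 0" if "j \<in> {1..l}" for j
    using bpos[OF that] by (intro Gamma_real_pos) simp
  have nb: "\<bar>n \<phi> t\<bar> \<le> norm \<phi> * \<nu> t" if t: "t \<in> {0..T}" for \<phi> t
  proof -
    have "\<bar>n \<phi> t\<bar> \<le> (\<Sum>j=1..l. \<bar>q j * RL_conv_real (1 - \<alpha> j) (h \<phi>) t\<bar>)" unfolding n_def by (rule sum_abs)
    also have "\<dots> \<le> (\<Sum>j=1..l. q j * (M * norm \<phi> * (t powr (1 - \<alpha> j) / Gamma (1 - \<alpha> j + 1))))"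
    proof (rule sum_mono)
      fix j assume j: "j \<in> {1..l}"
      have "\<bar>RL_conv_real (1 - \<alpha> j) (h \<phi>) t\<bar> \<le> M * norm \<phi> * (t powr (1 - \<alpha> j) / Gamma (1 - \<alpha> j + 1))"
        using rl_bound[OF bpos[OF j] T hm hK h0] t by simp
      then have "q j * \<bar>RL_conv_real (1 - \<alpha> j) (h \<phi>) t\<bar> \<le> q j * (M * norm \<phi> * (t powr (1 - \<alpha> j) / Gamma (1 - \<alpha> j + 1)))"
        by (rule mult_left_mono) (use q[OF j] in simp)
      then show "\<bar>q j * RL_conv_real (1 - \<alpha> j) (h \<phi>) t\<bar> \<le> q j * (M * norm \<phi> * (t powr (1 - \<alpha> j) / Gamma (1 - \<alpha> j + 1)))"
        using q[OF j] by (simp only: abs_mult abs_of_pos)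
    qed
    also have "\<dots> = norm \<phi> * \<nu> t" by (simp add: \<nu>_def sum_distrib_left mult_ac)
    finally show ?thesis .
  qed
  have n0: "n \<phi> 0 = 0" for \<phi> unfolding n_def using rl_nonpos[OF bpos T hm hK h0, of _ 0 \<phi>] by simp
  have \<nu>mono: "\<nu> x \<le> \<nu> y" if "0 \<le> x" "x \<le> y" for x y unfolding \<nu>_def
  proof (intro mult_left_mono sum_mono divide_right_mono M0)
    fix j assume j: "j \<in> {1..l}"
    show "x powr (1 - \<alpha> j) \<le> y powr (1 - \<alpha> j)" using bpos[OF j] that by (intro powr_mono2) auto
    show "0 \<le> Gamma (1 - \<alpha> j + 1)" "0 \<le> q j" using Gp[OF j] q[OF j] by auto
  qed
  have \<nu>lim: "(\<nu> \<longlongrightarrow> 0) (at_right 0)"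
  proof -
    have "((\<lambda>t. t powr (1 - \<alpha> j)) \<longlongrightarrow> 0) (at_right 0)" if "j \<in> {1..l}" for j
    proof -
      have "((\<lambda>t. t powr (1 - \<alpha> j)) \<longlongrightarrow> 0 powr (1 - \<alpha> j)) (at_right 0)"
        by (rule tendsto_powr') (use bpos[OF that] in \<open>auto simp: eventually_at_filter\<close>)
      then show ?thesis by simp
    qed
    then have "((\<lambda>t. \<Sum>j=1..l. q j * (t powr (1 - \<alpha> j) / Gamma (1 - \<alpha> j + 1))) \<longlongrightarrow> (\<Sum>j=1..l. q j * (0 / Gamma (1 - \<alpha> j + 1)))) (at_right 0)"
      using Gp by (intro tendsto_sum tendsto_mult tendsto_divide tendsto_const) (auto simp: less_imp_neq[symmetric])
    then show ?thesis unfolding \<nu>_def by (intro tendsto_mult_right_zero) simp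
  qed
  have \<nu>0: "\<nu> 0 = 0" by (simp add: \<nu>_def)
  define X where "X s = laplace_upto T (extend0 U0 U) s" for s :: real
  \<comment> \<open>\<open>rl_laplace\<close> with b = 1 - \<alpha> j yields the factor s^(\<alpha>
    j); summation with the weights q j produces Qr s.\<close>
  have laplace_n: "\<bar>s * integral {0..T} (\<lambda>t. exp (- s * t) * n \<phi> t) - Qr s * (LBINT \<tau>. exp (- s * \<tau>) * h \<phi> \<tau>)\<bar> \<le> exp (- s * T) * (norm \<phi> * \<nu> T)"
    if s: "s > 0" for s \<phi>
  proof -
    define L where "L j = (LBINT t. indicator {0<..<T} t * (exp (- s * t) * RL_conv_real (1 - \<alpha> j) (h \<phi>) t))" for j
    let ?H = "LBINT \<tau>. exp (- s * \<tau>) * h \<phi> \<tau>"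
    have Li: "integrable lborel (\<lambda>t. q j * (indicator {0<..<T} t * (exp (- s * t) * RL_conv_real (1 - \<alpha> j) (h \<phi>) t)))" if "j \<in> {1..l}" for j
      by (intro integrable_mult_right rl_laplace(1)[OF bpos[OF that] T hm hK h0 s])
    have Lb: "\<bar>s * L j - s powr \<alpha> j * ?H\<bar> \<le> exp (- s * T) * (M * norm \<phi> * (T powr (1 - \<alpha> j) / Gamma (1 - \<alpha> j + 1)))" if "j \<in> {1..l}" for j
      using rl_laplace(2)[OF bpos[OF that] T hm hK h0 s] unfolding L_def by simp
    have eq: "indicator {0<..<T} t * (exp (- s * t) * n \<phi> t) = (\<Sum>j=1..l. q j * (indicator {0<..<T} t * (exp (- s * t) * RL_conv_real (1 - \<alpha> j) (h \<phi>) t)))" for t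
      unfolding n_def by (simp add: sum_distrib_left mult_ac)
    have si: "set_integrable lborel {0<..<T} (\<lambda>t. exp (- s * t) * n \<phi> t)"
      unfolding set_integrable_def real_scaleR_def eq by (intro Bochner_Integration.integrable_sum Li)
    have "integral {0..T} (\<lambda>t. exp (- s * t) * n \<phi> t) = integral {0<..<T} (\<lambda>t. exp (- s * t) * n \<phi> t)"
      by (rule integral_open_interval_real)
    also have "\<dots> = (LBINT t. indicator {0<..<T} t * (exp (- s * t) * n \<phi> t))"
      using set_borel_integral_eq_integral(2)[OF si] by (simp add: set_lebesgue_integral_def)
    also have "\<dots> = (\<Sum>j=1..l. q j * L j)"
      unfolding eq by (subst Bochner_Integration.integral_sum[OF Li]) (auto simp: L_def)
    finally have e: "s * integral {0..T} (\<lambda>t. exp (- s * t) * n \<phi> t) - Qr s * ?H = (\<Sum>j=1..l. q j * (s * L j - s powr \<alpha> j * ?H))"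
      by (simp add: Qr_def sum_distrib_left sum_distrib_right right_diff_distrib sum_subtractf mult_ac)
    have "\<bar>\<Sum>j=1..l. q j * (s * L j - s powr \<alpha> j * ?H)\<bar> \<le> (\<Sum>j=1..l. q j * (exp (- s * T) * (M * norm \<phi> * (T powr (1 - \<alpha> j) / Gamma (1 - \<alpha> j + 1)))))"
    proof (rule order_trans[OF sum_abs], rule sum_mono)
      fix j assume j: "j \<in> {1..l}"
      show "\<bar>q j * (s * L j - s powr \<alpha> j * ?H)\<bar> \<le> q j * (exp (- s * T) * (M * norm \<phi> * (T powr (1 - \<alpha> j) / Gamma (1 - \<alpha> j + 1))))"
        unfolding abs_mult using Lb[OF j] q[OF j] by (intro mult_mono) auto
    qed
    also have "\<dots> = exp (- s * T) * (norm \<phi> * \<nu> T)" by (simp add: \<nu>_def sum_distrib_left mult_ac)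
    finally show ?thesis unfolding e .
  qed
  \<comment> \<open>U is split into U - U0 and the constant U0, whose truncated transform is
    explicit.\<close>
  have laplace_X: "X s \<bullet> \<phi> = (LBINT \<tau>. exp (- s * \<tau>) * h \<phi> \<tau>) + (1 - exp (- s * T)) / s * (U0 \<bullet> \<phi>)" if s: "s > 0" for s \<phi>
  proof -
    have i1: "((\<lambda>t. exp (- s * t)) has_integral (- exp (- s * T) / s) - (- exp (- s * 0) / s)) {0..T}"
      using T s by (intro fundamental_theorem_of_calculus) (auto intro!: derivative_eq_intros simp: has_real_derivative_iff_has_vector_derivative[symmetric])
    then have i2: "((\<lambda>t. exp (- s * t) * (U0 \<bullet> \<phi>)) has_integral (1 - exp (- s * T)) / s * (U0 \<bullet> \<phi>)) {0..T}"
      using has_integral_mult_left[OF i1, of "U0 \<bullet> \<phi>"] by (simp add: diff_divide_distrib)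
    let ?k = "\<lambda>t. exp (- s * t) * ((extend0 U0 U t - U0) \<bullet> \<phi>)"
    have ck: "continuous_on {0..T} ?k" by (intro continuous_intros cU0)
    have i3: "(?k has_integral integral {0..T} ?k) {0..T}" by (intro integrable_integral integrable_continuous_interval ck)
    have "((\<lambda>t. (exp (- s * t) *\<^sub>R extend0 U0 U t) \<bullet> \<phi>) has_integral X s \<bullet> \<phi>) {0..T}"
      unfolding X_def using has_integral_linear[OF integrable_integral bounded_linear_inner_left, of "\<lambda>t. exp (- s * t) *\<^sub>R extend0 U0 U t" "{0..T}" \<phi>]
      by (simp add: o_def integrable_continuous_interval continuous_intros cU0)
    moreover have "((\<lambda>t. (exp (- s * t) *\<^sub>R extend0 U0 U t) \<bullet> \<phi>) has_integral integral {0..T} ?k + (1 - exp (- s * T)) / s * (U0 \<bullet> \<phi>)) {0..T}"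
      using has_integral_add[OF i3 i2] by (simp add: algebra_simps)
    ultimately have "X s \<bullet> \<phi> = integral {0..T} ?k + (1 - exp (- s * T)) / s * (U0 \<bullet> \<phi>)" by (rule has_integral_unique)
    moreover have "integral {0..T} ?k = (LBINT \<tau>. exp (- s * \<tau>) * h \<phi> \<tau>)"
    proof -
      have si: "set_integrable lborel {0<..<T} ?k"
        by (rule set_integrable_subset[OF borel_integrable_atLeastAtMost']) (use ck in auto)
      have "integral {0..T} ?k = integral {0<..<T} ?k" by (rule integral_open_interval_real)
      also have "\<dots> = (LBINT t. indicator {0<..<T} t * ?k t)"
        using set_borel_integral_eq_integral(2)[OF si] by (simp add: set_lebesgue_integral_def)
      also have "\<dots> = (LBINT \<tau>. exp (- s * \<tau>) * h \<phi> \<tau>)"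
        by (intro Bochner_Integration.integral_cong) (auto simp: h_def extend0_def indicator_def)
      finally show ?thesis .
    qed
    ultimately show ?thesis by simp
  qed
  \<comment> \<open>One \<nu> T comes from the boundary term n \<phi> T, the other from cutting the
    transforms of the fractional integrals at T. The last term comes from cutting the transform of
    U0, where Qr s/s is at most the sum of the q j for s \<ge> 1.\<close>
  define C where "C = 2 * \<nu> T + (\<Sum>j=1..l. q j) * norm U0"
  have "\<exists>Y. (X s, Y) \<in> G \<and> norm (Y + Qr s *\<^sub>R X s - (Qr s / s) *\<^sub>R U0) \<le> C * exp (- s * T)" if s1: "s \<ge> 1" for s
  proof -
    have s: "s > 0" using s1 by simp
    obtain Y where Y: "(X s, Y) \<in> G" "\<And>\<phi>. Y \<bullet> \<phi> = - exp (- s * T) * n \<phi> T - s * integral {0..T} (\<lambda>t. exp (- s * t) * n \<phi> t)"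
      using frac_resolvent[where n = n, OF T cU lU cB g n n0 nb \<nu>mono \<nu>lim \<nu>0 s] unfolding X_def by blast
    define Z where "Z = Y + Qr s *\<^sub>R X s - (Qr s / s) *\<^sub>R U0"
    have "\<bar>Z \<bullet> Z\<bar> \<le> exp (- s * T) * (norm Z * \<nu> T) + exp (- s * T) * (norm Z * \<nu> T) + exp (- s * T) * ((\<Sum>j=1..l. q j) * (norm U0 * norm Z))"
    proof -
      have e: "Z \<bullet> Z = - (exp (- s * T) * n Z T) - (s * integral {0..T} (\<lambda>t. exp (- s * t) * n Z t) - Qr s * (LBINT \<tau>. exp (- s * \<tau>) * h Z \<tau>))
          - exp (- s * T) * (Qr s / s * (U0 \<bullet> Z))" (is "_ = - ?a - ?b - ?c")
      proof -
        have "Z \<bullet> Z = Y \<bullet> Z + Qr s * (X s \<bullet> Z) - (Qr s / s) * (U0 \<bullet> Z)"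
          unfolding Z_def by (simp add: inner_add_left inner_diff_left)
        then show ?thesis unfolding Y(2) laplace_X[OF s] by (simp add: algebra_simps diff_divide_distrib)
      qed
      have "\<bar>?a\<bar> \<le> exp (- s * T) * (norm Z * \<nu> T)" unfolding abs_mult using nb[of T Z] T by simp
      moreover have "\<bar>?b\<bar> \<le> exp (- s * T) * (norm Z * \<nu> T)" by (rule laplace_n[OF s])
      moreover have "\<bar>?c\<bar> \<le> exp (- s * T) * ((\<Sum>j=1..l. q j) * (norm U0 * norm Z))"
      proof -
        have "Qr s / s \<le> (\<Sum>j=1..l. q j)" "0 \<le> Qr s / s" using Qr_le[OF s1] Qr_pos[OF s] s by (auto simp: field_simps)
        then have "\<bar>Qr s / s * (U0 \<bullet> Z)\<bar> \<le> (\<Sum>j=1..l. q j) * (norm U0 * norm Z)"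
          unfolding abs_mult using Cauchy_Schwarz_ineq2[of U0 Z] by (intro mult_mono) auto
        then show ?thesis unfolding abs_mult abs_exp_cancel by (intro mult_left_mono) auto
      qed
      ultimately show ?thesis unfolding e by linarith
    qed
    also have "\<dots> = norm Z * (C * exp (- s * T))" by (simp add: C_def algebra_simps)
    finally have "norm Z * norm Z \<le> norm Z * (C * exp (- s * T))" by (simp add: dot_square_norm power2_eq_square)
    moreover have "0 \<le> C * exp (- s * T)"
      unfolding C_def using \<nu>mono[of 0 T] \<nu>0 T q by (intro mult_nonneg_nonneg add_nonneg_nonneg sum_nonneg) (auto intro: less_imp_le)
    ultimately have "norm Z \<le> C * exp (- s * T)" by (cases "norm Z = 0") auto
    then show ?thesis using Y(1) unfolding Z_def by blast
  qed
  then show ?thesis unfolding X_def by blast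
qed

end

subsection \<open>The weak form of the fractional equation\<close>

lemma AE_lborel_pair:
  assumes "AE z in lborel. P (z :: 'a::euclidean_space \<times> 'b::euclidean_space)"
  shows "AE x in lborel. AE y in lborel. P (x, y)" "AE y in lborel. AE x in lborel. P (x, y)"
proof -
  have p: "AE z in lborel \<Otimes>\<^sub>M lborel. P z" using assms by (simp only: lborel_prod)
  show "AE x in lborel. AE y in lborel. P (x, y)" by (rule lborel_pair.AE_pair[OF p])
  have "AE z in distr (lborel \<Otimes>\<^sub>M lborel) (lborel \<Otimes>\<^sub>M lborel) (\<lambda>(x :: 'b, y :: 'a). (y, x)). P z"
    using p by (subst (asm) lborel_pair.distr_pair_swap)
  then have "AE z in lborel \<Otimes>\<^sub>M lborel. P ((\<lambda>(x :: 'b, y :: 'a). (y, x)) z)" by (rule AE_distrD[rotated]) measurable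
  then show "AE y in lborel. AE x in lborel. P (x, y)" using lborel_pair.AE_pair by fastforce
qed

text \<open>Makes pairings with a class computable through Borel functions. The product of the
  moduli is controlled by ab \<le> a^2 + b^2, which is the integrability input for
  \<open>weighted_pairing\<close>.\<close>

lemma L2_of_borel_version:
  fixes p p' f :: "'a::euclidean_space \<Rightarrow> complex"
  assumes S: "S \<in> sets lebesgue" and p: "L2_fun S p" and p'[measurable]: "p' \<in> borel_measurable borel"
    and ae: "AE x in lborel. x \<in> S \<longrightarrow> p x = p' x" and p0: "\<forall>x. x \<notin> S \<longrightarrow> p' x = 0"
    and f[measurable]: "f \<in> borel_measurable borel" and fae: "AE x in lborel. rep_L2 \<phi> x = f x"
  shows "L2_of S p \<bullet> \<phi> = (LBINT x. p' x \<bullet> f x)"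
    "(\<integral>\<^sup>+x. ennreal (norm (p' x) * norm (f x)) \<partial>lborel) \<le> ennreal ((norm (L2_of S p))\<^sup>2 + (norm \<phi>)\<^sup>2)"
proof -
  have "AE x in lborel. (if x \<in> S then p x \<bullet> rep_L2 \<phi> x else 0) = p' x \<bullet> f x"
    using ae fae by eventually_elim (use p0 in auto)
  then show "L2_of S p \<bullet> \<phi> = (LBINT x. p' x \<bullet> f x)"
    unfolding inner_L2_of_left[OF S p] by (intro lebesgue_integral_cong_AE_borel) measurable
  have "AE x in lebesgue. rep_L2 (L2_of S p) x = p' x"
  proof -
    have "AE x in lebesgue. x \<in> S \<longrightarrow> p x = p' x" using ae by (simp add: AE_completion_iff)
    with rep_L2_of[OF S p] show ?thesis by eventually_elim (use p0 in auto)
  qed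
  then have rae: "AE x in lborel. rep_L2 (L2_of S p) x = p' x" by (simp add: AE_completion_iff)
  have sq: "integrable lborel (\<lambda>x. (norm (r x))\<^sup>2) \<and> (LBINT x. (norm (r x))\<^sup>2) = (norm \<psi>)\<^sup>2"
    if r[measurable]: "r \<in> borel_measurable borel" and e: "AE x in lborel. rep_L2 \<psi> x = r x" for r and \<psi> :: "'a L2"
  proof -
    have ae2: "AE x in lborel. rep_L2 \<psi> x \<bullet> rep_L2 \<psi> x = (norm (r x))\<^sup>2"
      using e by eventually_elim (simp add: power2_norm_eq_inner)
    have m: "(\<lambda>x. (norm (r x))\<^sup>2) \<in> borel_measurable borel" by measurable
    show ?thesis
      using lebesgue_integral_cong_AE_borel[OF m ae2] L2_fun_inner[OF L2_fun_rep L2_fun_rep, of \<psi> \<psi>]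
      by (simp add: inner_L2_rep[symmetric] power2_norm_eq_inner)
  qed
  note 1 = sq[OF p' rae] and 2 = sq[OF f fae]
  have "(\<integral>\<^sup>+x. ennreal (norm (p' x) * norm (f x)) \<partial>lborel) \<le> (\<integral>\<^sup>+x. ennreal ((norm (p' x))\<^sup>2 + (norm (f x))\<^sup>2) \<partial>lborel)"
  proof (rule nn_integral_mono, rule ennreal_leI)
    fix x
    show "norm (p' x) * norm (f x) \<le> (norm (p' x))\<^sup>2 + (norm (f x))\<^sup>2"
      using sum_squares_bound[of "norm (p' x)" "norm (f x)"] mult_nonneg_nonneg[OF norm_ge_zero[of "p' x"] norm_ge_zero[of "f x"]]
      by linarith
  qed
  also have "\<dots> = ennreal (LBINT x. (norm (p' x))\<^sup>2 + (norm (f x))\<^sup>2)"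
    by (rule nn_integral_eq_integral) (use 1 2 in auto)
  also have "(LBINT x. (norm (p' x))\<^sup>2 + (norm (f x))\<^sup>2) = (norm (L2_of S p))\<^sup>2 + (norm \<phi>)\<^sup>2"
    using 1 2 by simp
  finally show "(\<integral>\<^sup>+x. ennreal (norm (p' x) * norm (f x)) \<partial>lborel) \<le> ennreal ((norm (L2_of S p))\<^sup>2 + (norm \<phi>)\<^sup>2)" .
qed

text \<open>Fubini between a weighted time integral and the pairing in space; the bound K, uniform
  where the weight is nonzero, makes the double integral finite. The weights will be the kernel of
  J^(1 - \<alpha> j) and the indicator of a time interval.\<close>

lemma weighted_pairing:
  fixes v :: "'a::euclidean_space \<times> real \<Rightarrow> complex" and f :: "'a \<Rightarrow> complex" and k :: "real \<Rightarrow> real"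
  assumes k[measurable]: "k \<in> borel_measurable borel" and k0: "\<And>r. 0 \<le> k r" and ki: "(\<integral>\<^sup>+r. ennreal (k r) \<partial>lborel) < \<infinity>"
    and v[measurable]: "v \<in> borel_measurable (borel \<Otimes>\<^sub>M borel)" and f[measurable]: "f \<in> borel_measurable borel"
    and K: "AE r in lborel. k r \<noteq> 0 \<longrightarrow> (\<integral>\<^sup>+x. ennreal (norm (v (x, r)) * norm (f x)) \<partial>lborel) \<le> ennreal K"
  shows "integrable lborel (\<lambda>x. (LBINT r. k r *\<^sub>R v (x, r)) \<bullet> f x)"
    "(LBINT x. (LBINT r. k r *\<^sub>R v (x, r)) \<bullet> f x) = (LBINT r. k r * (LBINT x. v (x, r) \<bullet> f x))"
proof -
  define F where "F x r = k r * (v (x, r) \<bullet> f x)" for x r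
  define H where "H x r = k r * (norm (v (x, r)) * norm (f x))" for x r
  have Fm[measurable]: "case_prod F \<in> borel_measurable (lborel \<Otimes>\<^sub>M lborel)" unfolding F_def[abs_def] by measurable
  have Hm[measurable]: "case_prod H \<in> borel_measurable (lborel \<Otimes>\<^sub>M lborel)" unfolding H_def[abs_def] by measurable
  have "(\<integral>\<^sup>+z. ennreal (norm (case_prod H z)) \<partial>(lborel \<Otimes>\<^sub>M lborel)) = (\<integral>\<^sup>+r. \<integral>\<^sup>+x. ennreal (norm (H x r)) \<partial>lborel \<partial>lborel)"
    by (subst lborel_pair.nn_integral_snd[symmetric]) (auto simp: case_prod_unfold)
  also have "\<dots> \<le> (\<integral>\<^sup>+r. ennreal (k r) * ennreal K \<partial>lborel)"
  proof (rule nn_integral_mono_AE)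
    show "AE r in lborel. (\<integral>\<^sup>+x. ennreal (norm (H x r)) \<partial>lborel) \<le> ennreal (k r) * ennreal K" using K
    proof eventually_elim
      case (elim r)
      note h = elim
      have "(\<integral>\<^sup>+x. ennreal (norm (H x r)) \<partial>lborel) = (\<integral>\<^sup>+x. ennreal (k r) * ennreal (norm (v (x, r)) * norm (f x)) \<partial>lborel)"
        using k0[of r] by (intro nn_integral_cong) (simp add: H_def ennreal_mult[symmetric] abs_mult)
      also have "\<dots> = ennreal (k r) * (\<integral>\<^sup>+x. ennreal (norm (v (x, r)) * norm (f x)) \<partial>lborel)"
        by (rule nn_integral_cmult) measurable
      also have "\<dots> \<le> ennreal (k r) * ennreal K" using h by (cases "k r = 0") (auto intro: mult_left_mono)
      finally show ?case .
    qed
  qed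
  also have "\<dots> < \<infinity>" using ki by (subst nn_integral_multc) (auto simp: ennreal_mult_less_top)
  finally have Hi: "integrable (lborel \<Otimes>\<^sub>M lborel) (case_prod H)" by (intro integrableI_bounded) auto
  have Fi: "integrable (lborel \<Otimes>\<^sub>M lborel) (case_prod F)"
  proof (rule Bochner_Integration.integrable_bound[OF Hi Fm], rule AE_I2)
    fix z
    show "norm (case_prod F z) \<le> norm (case_prod H z)"
      using k0 Cauchy_Schwarz_ineq2[of "v z" "f (fst z)"]
      by (cases z) (auto simp: F_def H_def abs_mult intro!: mult_left_mono)
  qed
  have HAE: "AE x in lborel. integrable lborel (\<lambda>r. H x r)"
    using lborel_pair.AE_integrable_fst'[OF Hi] by simp
  have inner: "AE x in lborel. (LBINT r. F x r) = (LBINT r. k r *\<^sub>R v (x, r)) \<bullet> f x" using HAE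
  proof eventually_elim
    case (elim x)
    note h = elim
    \<comment> \<open>Where f x = 0 both sides vanish; elsewhere division by norm (f x) gives
      integrability of the vector-valued integrand.\<close>
    have i: "integrable lborel (\<lambda>r. k r *\<^sub>R v (x, r))" if fx: "f x \<noteq> 0"
    proof (rule Bochner_Integration.integrable_bound)
      show "integrable lborel (\<lambda>r. (1 / norm (f x)) * H x r)" by (intro integrable_mult_right h)
      show "AE r in lborel. norm (k r *\<^sub>R v (x, r)) \<le> norm ((1 / norm (f x)) * H x r)"
        using k0 fx by (intro AE_I2) (simp add: H_def abs_mult)
    qed measurable
    have "(LBINT r. (k r *\<^sub>R v (x, r)) \<bullet> f x) = (LBINT r. k r *\<^sub>R v (x, r)) \<bullet> f x"
      by (rule integral_inner_left) (rule i)
    then show ?case by (simp add: F_def)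
  qed
  have iF: "integrable lborel (\<lambda>x. LBINT r. F x r)" using lborel_pair.integrable_fst'[OF Fi] by (simp only: split_conv)
  have m: "(\<lambda>x. (LBINT r. k r *\<^sub>R v (x, r)) \<bullet> f x) \<in> borel_measurable lborel" by measurable
  show "integrable lborel (\<lambda>x. (LBINT r. k r *\<^sub>R v (x, r)) \<bullet> f x)"
    using iF integrable_cong_AE[OF borel_measurable_integrable[OF iF] m inner] by simp
  have "(LBINT x. (LBINT r. k r *\<^sub>R v (x, r)) \<bullet> f x) = (LBINT x. LBINT r. F x r)"
    by (rule integral_cong_AE[OF borel_measurable_integrable[OF iF] m inner, symmetric])
  also have "\<dots> = (LBINT r. LBINT x. F x r)" by (rule lborel_pair.Fubini_integral[symmetric, OF Fi])
  finally show "(LBINT x. (LBINT r. k r *\<^sub>R v (x, r)) \<bullet> f x) = (LBINT r. k r * (LBINT x. v (x, r) \<bullet> f x))"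
    by (simp add: F_def)
qed


context elliptic
begin

text \<open>For almost every x the Riemann-Liouville integrals of u - u0 are primitives of the
  fractional derivatives. Summing with the weights q j, inserting the equation and pairing with
  \<phi> in x gives the identity. The lower limit e > 0 keeps the norm of A u bounded on the range
  of integration.\<close>

lemma fractional_weak_form:
  fixes T e t :: real and l :: nat and q \<alpha> :: "nat \<Rightarrow> real" and \<phi> :: "(real^'d) L2"
  assumes T: "T > 0" and \<alpha>: "\<And>j. j \<in> {1..l} \<Longrightarrow> 0 < \<alpha> j" "\<And>j. j \<in> {1..l} \<Longrightarrow> \<alpha> j \<le> \<alpha> 1" "\<alpha> 1 < 1"
    and u0: "L2_fun \<Omega> u0" and sol: "fractional_solution \<Omega> T a c l q \<alpha> u0 u" and et: "0 < e" "e \<le> t" "t \<le> T"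
  defines "h \<equiv> \<lambda>\<tau>. indicator {0<..<T} \<tau> * ((L2_of \<Omega> (u \<tau>) - L2_of \<Omega> u0) \<bullet> \<phi>)"
  shows "(\<Sum>j=1..l. q j * RL_conv_real (1 - \<alpha> j) h t) - (\<Sum>j=1..l. q j * RL_conv_real (1 - \<alpha> j) h e)
    = - integral {e..t} (\<lambda>r. L2_of \<Omega> (elliptic_op \<Omega> a c (u r)) \<bullet> \<phi>)"
proof -
  define \<Omega>T where "\<Omega>T = \<Omega> \<times> {0<..<T}"
  define b where "b j = 1 - \<alpha> j" for j
  define B where "B r = L2_of \<Omega> (elliptic_op \<Omega> a c (u r))" for r
  have \<Omega>b: "\<Omega> \<in> sets borel" using open_dom by simp
  have \<Omega>Tb: "\<Omega>T \<in> sets borel" unfolding \<Omega>T_def by (intro borel_open open_Times open_dom) simp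
  have um: "(\<lambda>(x, t). u t x) \<in> borel_measurable (lebesgue_on \<Omega>T)"
    and uH: "AE x in lebesgue_on \<Omega>. (\<lambda>t. u t x - u0 x) \<in> H_frac (\<alpha> 1) T"
    and cont: "continuous_into_H2_H10 \<Omega> {0<..T} u"
    and lim: "((\<lambda>t. L2_of \<Omega> (u t)) \<longlongrightarrow> L2_of \<Omega> u0) (at_right 0)"
    using sol by (auto simp: fractional_solution_def \<Omega>T_def)
  obtain g where gm: "\<And>j. j \<in> {1..l} \<Longrightarrow> (\<lambda>(x, t). g j t x) \<in> borel_measurable (lebesgue_on \<Omega>T)"
    and gd: "\<And>j. j \<in> {1..l} \<Longrightarrow> AE x in lebesgue_on \<Omega>. AE t in lebesgue_on {0<..<T}. g j t x = frac_deriv (\<alpha> j) T (\<lambda>t. u t x - u0 x) t"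
    and geq: "AE t in lebesgue_on {0<..<T}. AE x in lebesgue_on \<Omega>. (\<Sum>j=1..l. q j *\<^sub>R g j t x) + elliptic_op \<Omega> a c (u t) x = 0"
    using sol unfolding fractional_solution_def \<Omega>T_def by blast
  note AEon = AE_lebesgue_on_iff[OF dom_sets] AE_lebesgue_on_iff[of "{0<..<T}", simplified]
  have "rep_L2 \<phi> \<in> borel_measurable lebesgue" using L2_fun_rep[of \<phi>] by (simp add: L2_fun_UNIV)
  then obtain f where f: "f \<in> borel_measurable borel" and fae: "AE x in lborel. rep_L2 \<phi> x = f x"
    by (rule borel_version)
  obtain w where w: "w \<in> borel_measurable borel" and wae: "AE x in lborel. x \<in> \<Omega> \<longrightarrow> u0 x = w x"
    using borel_version_on[OF \<Omega>b, of u0] u0 unfolding L2_fun_def by blast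
  obtain y where y: "y \<in> borel_measurable borel" and yae: "AE z in lborel. z \<in> \<Omega>T \<longrightarrow> (case z of (x, t) \<Rightarrow> u t x) = y z"
    using borel_version_on[OF \<Omega>Tb um] by blast
  have "\<forall>j\<in>{1..l}. \<exists>G. G \<in> borel_measurable borel \<and> (AE z in lborel. z \<in> \<Omega>T \<longrightarrow> (case z of (x, t) \<Rightarrow> g j t x) = G z) \<and> (\<forall>z. z \<notin> \<Omega>T \<longrightarrow> G z = 0)"
    by (intro ballI borel_version_on \<Omega>Tb gm)
  from bchoice[OF this] obtain G where "\<forall>j\<in>{1..l}. G j \<in> borel_measurable borel \<and> (AE z in lborel. z \<in> \<Omega>T \<longrightarrow> (case z of (x, t) \<Rightarrow> g j t x) = G j z) \<and> (\<forall>z. z \<notin> \<Omega>T \<longrightarrow> G j z = 0)"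
    by blast
  then have G: "\<And>j. j \<in> {1..l} \<Longrightarrow> G j \<in> borel_measurable borel"
    and Gae: "\<And>j. j \<in> {1..l} \<Longrightarrow> AE z in lborel. z \<in> \<Omega>T \<longrightarrow> (case z of (x, t) \<Rightarrow> g j t x) = G j z"
    and G0: "\<And>j z. j \<in> {1..l} \<Longrightarrow> z \<notin> \<Omega>T \<Longrightarrow> G j z = 0"
    by blast+
  note [measurable] = f w
  have ym[measurable]: "y \<in> borel_measurable (borel \<Otimes>\<^sub>M borel)" using y by (simp only: borel_prod)
  have Gm[measurable]: "G j \<in> borel_measurable (borel \<Otimes>\<^sub>M borel)" if "j \<in> {1..l}" for j using G[OF that] by (simp only: borel_prod)
  have \<Omega>Tm[measurable]: "\<Omega>T \<in> sets (borel \<Otimes>\<^sub>M borel)" using \<Omega>Tb by (simp only: borel_prod)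
  \<comment> \<open>A jointly Borel version of u - u0, cut off outside the cylinder.
    \<open>V1\<close> reads it in time for fixed x, as the fractional calculus requires, and
    \<open>V2\<close> in space for fixed t, as the classes require.\<close>
  define v where "v z = indicator \<Omega>T z *\<^sub>R (y z - w (fst z))" for z
  have vm[measurable]: "v \<in> borel_measurable (borel \<Otimes>\<^sub>M borel)" unfolding v_def[abs_def] by measurable
  have v0: "v z = 0" if "z \<notin> \<Omega>T" for z using that by (simp add: v_def)
  have V1: "AE x in lborel. AE t in lborel. x \<in> \<Omega> \<and> t \<in> {0<..<T} \<longrightarrow> u t x - u0 x = v (x, t)"
    using AE_lborel_pair(1)[OF yae] wae
  proof eventually_elim
    case (elim x)
    note 1 = elim(1) and 2 = elim(2)
    from 1 show ?case by eventually_elim (use 2 in \<open>auto simp: v_def \<Omega>T_def\<close>)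
  qed
  have V2: "AE t in lborel. t \<in> {0<..<T} \<longrightarrow> (AE x in lborel. x \<in> \<Omega> \<longrightarrow> u t x - u0 x = v (x, t))"
    using AE_lborel_pair(2)[OF yae]
  proof eventually_elim
    case (elim t)
    note 1 = elim
    have "t \<in> {0<..<T} \<Longrightarrow> AE x in lborel. x \<in> \<Omega> \<longrightarrow> u t x - u0 x = v (x, t)"
      using 1 wae by eventually_elim (auto simp: v_def \<Omega>T_def)
    then show ?case by blast
  qed
  \<comment> \<open>\<open>RL_preimage_primitive\<close> for almost every x. The exceptional set of
    x is the same for all times t'.\<close>
  have prim: "AE x in lborel. x \<in> \<Omega> \<longrightarrow> integrable lborel (\<lambda>r. G j (x, r)) \<and>
      (\<forall>t'. 0 < t' \<and> t' \<le> T \<longrightarrow> RL_conv (b j) (\<lambda>r. v (x, r)) t' = (LBINT r. indicator {..<t'} r *\<^sub>R G j (x, r)))" if j: "j \<in> {1..l}" for j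
    using uH[unfolded AEon] gd[OF j, unfolded AEon] V1 AE_lborel_pair(1)[OF Gae[OF j]]
  proof eventually_elim
    case (elim x)
    note 1 = elim(1) and 2 = elim(2) and 3 = elim(3) and 4 = elim(4)
    show ?case
    proof
      assume x: "x \<in> \<Omega>"
      have p: "RL_preimage (\<alpha> j) T (\<lambda>t. u t x - u0 x) (frac_deriv (\<alpha> j) T (\<lambda>t. u t x - u0 x))"
        by (rule frac_deriv_preimage) (use 1 x T \<alpha> j in auto)
      have vx: "(\<lambda>r. v (x, r)) \<in> borel_measurable borel" by measurable
      have Gx: "(\<lambda>r. G j (x, r)) \<in> borel_measurable borel" using Gm[OF j] by measurable
      have vae: "AE r in lborel. r \<in> {0<..<T} \<longrightarrow> u r x - u0 x = v (x, r)" using 3 x by simp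
      have "AE r in lborel. 0 < r \<and> r < T \<longrightarrow> g j r x = frac_deriv (\<alpha> j) T (\<lambda>t. u t x - u0 x) r" using 2 x by simp
      then have gae: "AE r in lborel. r \<in> {0<..<T} \<longrightarrow> frac_deriv (\<alpha> j) T (\<lambda>t. u t x - u0 x) r = G j (x, r)"
        using 4 by eventually_elim (use x in \<open>auto simp: \<Omega>T_def\<close>)
      have a1: "\<alpha> j < 1" using \<alpha>(2)[OF j] \<alpha>(3) by simp
      have vz: "v (x, r) = 0" "G j (x, r) = 0" if "r \<notin> {0<..<T}" for r
        using that by (auto intro!: v0 G0[OF j] simp: \<Omega>T_def)
      have R: "integrable lborel (\<lambda>r. G j (x, r))" "RL_conv (b j) (\<lambda>r. v (x, r)) t' = (LBINT r. indicator {..<t'} r *\<^sub>R G j (x, r))"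
        if "0 < t'" "t' \<le> T" for t'
        unfolding b_def by (rule RL_preimage_primitive[OF T \<alpha>(1)[OF j] a1 p vx vae _ Gx gae]; use vz that in blast)+
      show "integrable lborel (\<lambda>r. G j (x, r)) \<and>
        (\<forall>t'. 0 < t' \<and> t' \<le> T \<longrightarrow> RL_conv (b j) (\<lambda>r. v (x, r)) t' = (LBINT r. indicator {..<t'} r *\<^sub>R G j (x, r)))"
        using R(1)[OF T] R(2) by simp
    qed
  qed
  \<comment> \<open>The weighted sum of the fractional derivatives; by the equation it is a Borel
    version of -A u, as recorded in \<open>E\<close>.\<close>
  define S where "S z = (\<Sum>j=1..l. q j *\<^sub>R G j z)" for z
  have Sm[measurable]: "S \<in> borel_measurable (borel \<Otimes>\<^sub>M borel)"
    unfolding S_def[abs_def] by (intro borel_measurable_sum borel_measurable_scaleR borel_measurable_const Gm)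
  have S0: "S z = 0" if "z \<notin> \<Omega>T" for z using G0[OF _ that] by (simp add: S_def)
  have E: "AE r in lborel. r \<in> {0<..<T} \<longrightarrow> (AE x in lborel. x \<in> \<Omega> \<longrightarrow> elliptic_op \<Omega> a c (u r) x = - S (x, r))"
  proof -
    have "AE r in lborel. \<forall>j\<in>{1..l}. AE x in lborel. (x, r) \<in> \<Omega>T \<longrightarrow> g j r x = G j (x, r)"
      by (rule AE_finite_allI) (use AE_lborel_pair(2)[OF Gae] in auto)
    with geq[unfolded AEon] show ?thesis
    proof eventually_elim
      case (elim r)
      note 1 = elim(1) and 2 = elim(2)
      have 3: "AE x in lborel. \<forall>j\<in>{1..l}. (x, r) \<in> \<Omega>T \<longrightarrow> g j r x = G j (x, r)"
        by (rule AE_finite_allI) (use 2 in auto)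
      show ?case
      proof
        assume r: "r \<in> {0<..<T}"
        then have "AE x in lborel. x \<in> \<Omega> \<longrightarrow> (\<Sum>j=1..l. q j *\<^sub>R g j r x) + elliptic_op \<Omega> a c (u r) x = 0" using 1 by simp
        then show "AE x in lborel. x \<in> \<Omega> \<longrightarrow> elliptic_op \<Omega> a c (u r) x = - S (x, r)" using 3
        proof eventually_elim
          case (elim x)
          note 4 = elim(1) and 5 = elim(2)
          show ?case
          proof
            assume x: "x \<in> \<Omega>"
            have "S (x, r) = (\<Sum>j=1..l. q j *\<^sub>R g j r x)"
              unfolding S_def using 5 x r by (intro sum.cong) (auto simp: \<Omega>T_def)
            then show "elliptic_op \<Omega> a c (u r) x = - S (x, r)" using 4 x by (simp add: eq_neg_iff_add_eq_0 add.commute)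
          qed
        qed
      qed
    qed
  qed
  have uH2: "u r \<in> H2 \<Omega>" if "r \<in> {0<..T}" for r using cont that by (auto simp: continuous_into_H2_H10_def)
  have cU: "continuous_on {0<..T} (\<lambda>r. L2_of \<Omega> (u r))" and cB: "continuous_on {0<..T} B"
    using continuous_into_H2_H10_L2[OF cont] by (auto simp: B_def)
  have comp: "\<exists>M. \<forall>x\<in>I. norm (z x) \<le> M" if "compact I" "continuous_on I z" for I :: "real set" and z :: "real \<Rightarrow> (real^'d) L2"
    using compact_imp_bounded[OF compact_continuous_image[OF that(2,1)]] unfolding bounded_iff by auto
  \<comment> \<open>The convergence of u to u0 bounds u - u0 on all of (0,T]; for A u a bound is
    available on [e,T] only.\<close>
  obtain M where M: "\<And>r. r \<in> {0<..T} \<Longrightarrow> norm (L2_of \<Omega> (u r) - L2_of \<Omega> u0) \<le> M"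
  proof -
    have "continuous_on {0..T} (\<lambda>r. extend0 (L2_of \<Omega> u0) (\<lambda>r. L2_of \<Omega> (u r)) r - L2_of \<Omega> u0)"
      by (intro continuous_intros continuous_extend0[OF continuous_on_subset[OF cU] lim]) auto
    from comp[OF compact_Icc this] obtain M where M: "\<forall>x\<in>{0..T}. norm (extend0 (L2_of \<Omega> u0) (\<lambda>r. L2_of \<Omega> (u r)) x - L2_of \<Omega> u0) \<le> M" by blast
    have "norm (L2_of \<Omega> (u r) - L2_of \<Omega> u0) \<le> M" if "r \<in> {0<..T}" for r
      using M[rule_format, of r] that by (simp add: extend0_def)
    then show ?thesis by (rule that)
  qed
  obtain MB where MB: "\<And>r. r \<in> {e..T} \<Longrightarrow> norm (B r) \<le> MB"
    using comp[OF compact_Icc continuous_on_subset[OF cB]] et by (metis atLeastAtMost_iff greaterThanAtMost_iff less_le_trans subsetI)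
  have hv: "AE r in lborel. r \<in> {0<..<T} \<longrightarrow> (LBINT x. v (x, r) \<bullet> f x) = h r \<and>
      (\<integral>\<^sup>+x. ennreal (norm (v (x, r)) * norm (f x)) \<partial>lborel) \<le> ennreal (M\<^sup>2 + (norm \<phi>)\<^sup>2)" using V2
  proof (eventually_elim, intro impI)
    fix r assume 1: "r \<in> {0<..<T} \<longrightarrow> (AE x in lborel. x \<in> \<Omega> \<longrightarrow> u r x - u0 x = v (x, r))" and r: "r \<in> {0<..<T}"
    have ur: "L2_fun \<Omega> (u r)" by (rule elliptic_term(5)) (use uH2 r in auto)
    have d: "L2_fun \<Omega> (\<lambda>x. u r x - u0 x)" "L2_of \<Omega> (\<lambda>x. u r x - u0 x) = L2_of \<Omega> (u r) - L2_of \<Omega> u0"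
      using L2_of_diff[OF dom_sets ur u0] by auto
    have vx: "(\<lambda>x. v (x, r)) \<in> borel_measurable borel" by measurable
    have v0x: "\<forall>x. x \<notin> \<Omega> \<longrightarrow> v (x, r) = 0" by (auto intro!: v0 simp: \<Omega>T_def)
    have ae: "AE x in lborel. x \<in> \<Omega> \<longrightarrow> u r x - u0 x = v (x, r)" using 1 r by simp
    note L = L2_of_borel_version[OF dom_sets d(1) vx ae v0x f fae]
    have "(norm (L2_of \<Omega> (u r) - L2_of \<Omega> u0))\<^sup>2 \<le> M\<^sup>2" using M[of r] r by (intro power_mono) auto
    then have "ennreal ((norm (L2_of \<Omega> (u r) - L2_of \<Omega> u0))\<^sup>2 + (norm \<phi>)\<^sup>2) \<le> ennreal (M\<^sup>2 + (norm \<phi>)\<^sup>2)"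
      by (intro ennreal_leI) simp
    with L(2)[unfolded d(2)] have "(\<integral>\<^sup>+x. ennreal (norm (v (x, r)) * norm (f x)) \<partial>lborel) \<le> ennreal (M\<^sup>2 + (norm \<phi>)\<^sup>2)"
      by (rule order_trans)
    then show "(LBINT x. v (x, r) \<bullet> f x) = h r \<and>
      (\<integral>\<^sup>+x. ennreal (norm (v (x, r)) * norm (f x)) \<partial>lborel) \<le> ennreal (M\<^sup>2 + (norm \<phi>)\<^sup>2)"
      using L(1)[unfolded d(2)] r by (simp add: h_def)
  qed
  have hS: "AE r in lborel. r \<in> {e..<t} \<longrightarrow> (LBINT x. S (x, r) \<bullet> f x) = - (B r \<bullet> \<phi>) \<and>
      (\<integral>\<^sup>+x. ennreal (norm (S (x, r)) * norm (f x)) \<partial>lborel) \<le> ennreal (MB\<^sup>2 + (norm \<phi>)\<^sup>2)" using E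
  proof (eventually_elim, intro impI)
    fix r assume 1: "r \<in> {0<..<T} \<longrightarrow> (AE x in lborel. x \<in> \<Omega> \<longrightarrow> elliptic_op \<Omega> a c (u r) x = - S (x, r))" and r: "r \<in> {e..<t}"
    have el: "L2_fun \<Omega> (elliptic_op \<Omega> a c (u r))" by (rule elliptic_op_L2(1)) (use uH2 r et in auto)
    have Sx: "(\<lambda>x. - S (x, r)) \<in> borel_measurable borel" by measurable
    have S0x: "\<forall>x. x \<notin> \<Omega> \<longrightarrow> - S (x, r) = 0" using S0 by (simp add: \<Omega>T_def)
    have ae: "AE x in lborel. x \<in> \<Omega> \<longrightarrow> elliptic_op \<Omega> a c (u r) x = - S (x, r)" using 1 r et by simp
    note L = L2_of_borel_version[OF dom_sets el Sx ae S0x f fae]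
    have "(norm (B r))\<^sup>2 \<le> MB\<^sup>2" using MB[of r] r et by (intro power_mono) auto
    then have "ennreal ((norm (B r))\<^sup>2 + (norm \<phi>)\<^sup>2) \<le> ennreal (MB\<^sup>2 + (norm \<phi>)\<^sup>2)"
      by (intro ennreal_leI) simp
    with L(2)[folded B_def] have "(\<integral>\<^sup>+x. ennreal (norm (- S (x, r)) * norm (f x)) \<partial>lborel) \<le> ennreal (MB\<^sup>2 + (norm \<phi>)\<^sup>2)"
      by (rule order_trans)
    then show "(LBINT x. S (x, r) \<bullet> f x) = - (B r \<bullet> \<phi>) \<and>
      (\<integral>\<^sup>+x. ennreal (norm (S (x, r)) * norm (f x)) \<partial>lborel) \<le> ennreal (MB\<^sup>2 + (norm \<phi>)\<^sup>2)"
      using L(1)[folded B_def] by simp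
  qed
  have bp: "b j > 0" if "j \<in> {1..l}" for j using \<alpha>(2)[OF that] \<alpha>(3) by (simp add: b_def)
  \<comment> \<open>J^(1 - \<alpha> j) in time commutes with the pairing in space, including at time
    t' = 0, where both sides are 0.\<close>
  have conv: "integrable lborel (\<lambda>x. RL_conv (b j) (\<lambda>r. v (x, r)) t' \<bullet> f x)"
    "(LBINT x. RL_conv (b j) (\<lambda>r. v (x, r)) t' \<bullet> f x) = RL_conv_real (b j) h t'" if j: "j \<in> {1..l}" and t': "0 \<le> t'" "t' \<le> T" for j t'
  proof -
    let ?k = "\<lambda>r. indicator {0<..<T} r * kern (b j) (t' - r)"
    have km: "?k \<in> borel_measurable borel" by measurable
    have k0: "0 \<le> ?k r" for r using kern_nonneg[OF bp[OF j]] by simp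
    have ki: "(\<integral>\<^sup>+r. ennreal (?k r) \<partial>lborel) < \<infinity>" using kern_window[OF bp[OF j] t'] by simp
    have kb: "AE r in lborel. ?k r \<noteq> 0 \<longrightarrow> (\<integral>\<^sup>+x. ennreal (norm (v (x, r)) * norm (f x)) \<partial>lborel) \<le> ennreal (M\<^sup>2 + (norm \<phi>)\<^sup>2)"
      using hv by eventually_elim (auto simp: indicator_def split: if_splits)
    note W = weighted_pairing[OF km k0 ki vm f kb]
    have c: "(LBINT r. ?k r *\<^sub>R v (x, r)) = RL_conv (b j) (\<lambda>r. v (x, r)) t'" for x unfolding RL_conv_def
    proof (intro Bochner_Integration.integral_cong refl)
      fix r show "?k r *\<^sub>R v (x, r) = kern (b j) (t' - r) *\<^sub>R v (x, r)"
        using v0[of "(x, r)"] by (cases "r \<in> {0<..<T}") (auto simp: \<Omega>T_def)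
    qed
    show "integrable lborel (\<lambda>x. RL_conv (b j) (\<lambda>r. v (x, r)) t' \<bullet> f x)" using W(1) unfolding c .
    have hm: "h \<in> borel_measurable borel"
    proof -
      have "continuous_on {0<..<T} (\<lambda>\<tau>. (L2_of \<Omega> (u \<tau>) - L2_of \<Omega> u0) \<bullet> \<phi>)"
        by (intro continuous_intros continuous_on_subset[OF cU]) auto
      then show ?thesis
        using borel_measurable_continuous_on_indicator[of "{0<..<T}" "\<lambda>\<tau>. (L2_of \<Omega> (u \<tau>) - L2_of \<Omega> u0) \<bullet> \<phi>"] unfolding h_def by simp
    qed
    have "(LBINT x. RL_conv (b j) (\<lambda>r. v (x, r)) t' \<bullet> f x) = (LBINT r. ?k r * (LBINT x. v (x, r) \<bullet> f x))"
      using W(2) unfolding c .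
    also have "\<dots> = (LBINT r. kern (b j) (t' - r) * h r)"
    proof (rule integral_cong_AE)
      show "AE r in lborel. ?k r * (LBINT x. v (x, r) \<bullet> f x) = kern (b j) (t' - r) * h r"
        using hv by eventually_elim (auto simp: h_def indicator_def)
      show "(\<lambda>r. kern (b j) (t' - r) * h r) \<in> borel_measurable lborel" using hm by measurable
    qed measurable
    finally show "(LBINT x. RL_conv (b j) (\<lambda>r. v (x, r)) t' \<bullet> f x) = RL_conv_real (b j) h t'" unfolding RL_conv_real_def .
  qed
  \<comment> \<open>Half-open, because the primitives at t and e are integrals over the open
    half-lines below t and below e.\<close>
  let ?k = "indicator {e..<t} :: real \<Rightarrow> real"
  have ki: "(\<integral>\<^sup>+r. ennreal (?k r) \<partial>lborel) < \<infinity>" using et by (simp add: ennreal_indicator)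
  have kb: "AE r in lborel. ?k r \<noteq> 0 \<longrightarrow> (\<integral>\<^sup>+x. ennreal (norm (S (x, r)) * norm (f x)) \<partial>lborel) \<le> ennreal (MB\<^sup>2 + (norm \<phi>)\<^sup>2)"
    using hS by eventually_elim (auto simp: indicator_def split: if_splits)
  have km: "?k \<in> borel_measurable borel" by measurable
  have k0: "0 \<le> ?k r" for r by simp
  note W = weighted_pairing[OF km k0 ki Sm f kb]
  have ptw: "AE x in lborel. (\<Sum>j=1..l. q j * (RL_conv (b j) (\<lambda>r. v (x, r)) t \<bullet> f x - RL_conv (b j) (\<lambda>r. v (x, r)) e \<bullet> f x))
      = (LBINT r. ?k r *\<^sub>R S (x, r)) \<bullet> f x"
  proof -
    have "AE x in lborel. \<forall>j\<in>{1..l}. x \<in> \<Omega> \<longrightarrow> integrable lborel (\<lambda>r. G j (x, r)) \<and>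
      (\<forall>t'. 0 < t' \<and> t' \<le> T \<longrightarrow> RL_conv (b j) (\<lambda>r. v (x, r)) t' = (LBINT r. indicator {..<t'} r *\<^sub>R G j (x, r)))"
      by (rule AE_finite_allI) (use prim in auto)
    then show ?thesis
    proof eventually_elim
      case (elim x)
      note h = elim
      show ?case
      proof (cases "x \<in> \<Omega>")
        case True
        have ii: "integrable lborel (\<lambda>r. indicator A r *\<^sub>R G j (x, r))" if "j \<in> {1..l}" "A \<in> sets borel" for j A
          using h True that by (intro integrable_mult_indicator) auto
        have d: "RL_conv (b j) (\<lambda>r. v (x, r)) t - RL_conv (b j) (\<lambda>r. v (x, r)) e = (LBINT r. ?k r *\<^sub>R G j (x, r))" if j: "j \<in> {1..l}" for j
        proof -
          have "RL_conv (b j) (\<lambda>r. v (x, r)) t - RL_conv (b j) (\<lambda>r. v (x, r)) e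
            = (LBINT r. indicator {..<t} r *\<^sub>R G j (x, r)) - (LBINT r. indicator {..<e} r *\<^sub>R G j (x, r))"
            using h True j et by simp
          also have "\<dots> = (LBINT r. indicator {..<t} r *\<^sub>R G j (x, r) - indicator {..<e} r *\<^sub>R G j (x, r))"
            by (rule Bochner_Integration.integral_diff[symmetric]; rule ii[OF j]) auto
          also have "\<dots> = (LBINT r. ?k r *\<^sub>R G j (x, r))"
            using et by (intro Bochner_Integration.integral_cong) (auto simp: indicator_def)
          finally show ?thesis .
        qed
        have "(LBINT r. ?k r *\<^sub>R S (x, r)) = (LBINT r. (\<Sum>j=1..l. q j *\<^sub>R (?k r *\<^sub>R G j (x, r))))"
          unfolding S_def scaleR_sum_right by (simp add: mult.commute)
        also have "\<dots> = (\<Sum>j=1..l. LBINT r. q j *\<^sub>R (?k r *\<^sub>R G j (x, r)))"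
          by (rule Bochner_Integration.integral_sum) (intro integrable_scaleR_right ii; simp)
        also have "\<dots> = (\<Sum>j=1..l. q j *\<^sub>R (RL_conv (b j) (\<lambda>r. v (x, r)) t - RL_conv (b j) (\<lambda>r. v (x, r)) e))"
          by (intro sum.cong refl) (simp only: d integral_scaleR_right)
        finally show ?thesis by (simp add: inner_sum_left inner_diff_left)
      next
        case False
        have z: "v (x, r) = 0" "S (x, r) = 0" for r using False v0 S0 by (auto simp: \<Omega>T_def)
        show ?thesis by (simp add: z RL_conv_def)
      qed
    qed
  qed
  have "(\<Sum>j=1..l. q j * RL_conv_real (1 - \<alpha> j) h t) - (\<Sum>j=1..l. q j * RL_conv_real (1 - \<alpha> j) h e)
    = (\<Sum>j=1..l. q j * ((LBINT x. RL_conv (b j) (\<lambda>r. v (x, r)) t \<bullet> f x) - (LBINT x. RL_conv (b j) (\<lambda>r. v (x, r)) e \<bullet> f x)))"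
    unfolding sum_subtractf[symmetric] right_diff_distrib[symmetric] using et by (intro sum.cong refl) (simp add: conv(2) b_def[symmetric])
  also have "\<dots> = (LBINT x. (\<Sum>j=1..l. q j * (RL_conv (b j) (\<lambda>r. v (x, r)) t \<bullet> f x - RL_conv (b j) (\<lambda>r. v (x, r)) e \<bullet> f x)))"
  proof -
    have "integrable lborel (\<lambda>x. q j * (RL_conv (b j) (\<lambda>r. v (x, r)) t \<bullet> f x - RL_conv (b j) (\<lambda>r. v (x, r)) e \<bullet> f x))" if "j \<in> {1..l}" for j
      by (intro integrable_mult_right Bochner_Integration.integrable_diff conv(1)[OF that]) (use et in auto)
    then show ?thesis
      using et by (subst Bochner_Integration.integral_sum) (auto intro!: sum.cong simp: Bochner_Integration.integral_diff[OF conv(1) conv(1)])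
  qed
  also have "\<dots> = (LBINT x. (LBINT r. ?k r *\<^sub>R S (x, r)) \<bullet> f x)"
  proof (rule integral_cong_AE[OF _ _ ptw])
    show "(\<lambda>x. \<Sum>j=1..l. q j * (RL_conv (b j) (\<lambda>r. v (x, r)) t \<bullet> f x - RL_conv (b j) (\<lambda>r. v (x, r)) e \<bullet> f x)) \<in> borel_measurable lborel"
      unfolding RL_conv_def by measurable
  qed measurable
  also have "\<dots> = (LBINT r. ?k r * (LBINT x. S (x, r) \<bullet> f x))" by (rule W(2))
  also have "\<dots> = (LBINT r. - (indicator {e..t} r *\<^sub>R (B r \<bullet> \<phi>)))"
  proof (rule integral_cong_AE)
    have "AE r in lborel. r \<noteq> t" by (rule AE_lborel_singleton)
    with hS show "AE r in lborel. ?k r * (LBINT x. S (x, r) \<bullet> f x) = - (indicator {e..t} r *\<^sub>R (B r \<bullet> \<phi>))"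
      by eventually_elim (auto simp: indicator_def)
    have "continuous_on {e..t} (\<lambda>r. B r \<bullet> \<phi>)" by (intro continuous_intros continuous_on_subset[OF cB]) (use et in auto)
    then show "(\<lambda>r. - (indicator {e..t} r *\<^sub>R (B r \<bullet> \<phi>))) \<in> borel_measurable lborel"
      using borel_measurable_continuous_on_indicator[of "{e..t}" "\<lambda>r. B r \<bullet> \<phi>"] by simp
  qed measurable
  also have "\<dots> = - integral {e..t} (\<lambda>r. B r \<bullet> \<phi>)"
  proof -
    have "set_integrable lborel {e..t} (\<lambda>r. B r \<bullet> \<phi>)"
      by (intro borel_integrable_atLeastAtMost' continuous_intros continuous_on_subset[OF cB]) (use et in auto)
    from set_borel_integral_eq_integral(2)[OF this] show ?thesis by (simp add: set_lebesgue_integral_def)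
  qed
  finally show ?thesis unfolding B_def .
qed

end

subsection \<open>The subordination formula\<close>

text \<open>Together with an integrable majorant, integrability of the zero extension on every
  bounded interval gives integrability on the open half-line.\<close>

lemma integrable_on_positive_part:
  fixes z :: "real \<Rightarrow> 'b::banach"
  assumes "continuous_on {0..} z"
  shows "(\<lambda>x. if x \<in> {0<..} then z x else 0) integrable_on cbox a b"
proof -
  let ?F = "\<lambda>x. if x \<in> {0<..} then z x else 0"
  let ?a = "min a 0" and ?b = "max b 0"
  have "z integrable_on {0..?b}" by (rule integrable_continuous_interval[OF continuous_on_subset[OF assms]]) auto
  then have 1: "?F integrable_on {0..?b}" by (rule integrable_spike_finite[of "{0}", rotated 2]) auto
  have "(\<lambda>_. 0 :: 'b) integrable_on {?a..0}" by (rule integrable_0)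
  then have 2: "?F integrable_on {?a..0}" by (rule integrable_eq) auto
  have "?F integrable_on {?a..?b}"
    by (rule Henstock_Kurzweil_Integration.integrable_combine[OF _ _ 2 1]) auto
  then have "?F integrable_on {a..b}" by (rule integrable_on_subinterval) auto
  then show ?thesis by simp
qed

context subordination
begin

lemma Qr_ge: "p \<ge> 1 \<Longrightarrow> q 1 \<le> Qr p"
proof -
  assume p: "p \<ge> 1"
  have "q 1 * 1 \<le> q 1 * p powr \<alpha> 1"
    using q[of 1] l p \<alpha>_pos[of 1] by (intro mult_left_mono ge_one_powr_ge_zero) auto
  also have "\<dots> \<le> Qr p"
    unfolding Qr_def using l q by (intro member_le_sum[of 1 "{1..l}" "\<lambda>j. q j * p powr \<alpha> j"]) (auto intro!: mult_nonneg_nonneg less_imp_le[OF q])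
  finally show ?thesis by simp
qed

text \<open>Pairing with a fixed \<phi> reduces the comparison to real functions of t. The truncated
  transforms of U \<bullet> \<phi> and of the candidate v agree up to a multiple of exp(-p T): the
  first is compared with the heat solution inside the graph, the second is computed by
  \<open>subord_laplace\<close>.\<close>

lemma subordination_formula:
  fixes G :: "('h::{real_inner,banach} \<times> 'h) set" and C :: real
  assumes G: "accretive_graph G" and T: "T > 0" and cU: "continuous_on {0<..T} U" and lU: "(U \<longlongrightarrow> U0) (at_right 0)"
    and est: "\<And>s. s \<ge> 1 \<Longrightarrow> \<exists>Y. (laplace_upto T (extend0 U0 U) s, Y) \<in> G \<and>
      norm (Y + Qr s *\<^sub>R laplace_upto T (extend0 U0 U) s - (Qr s / s) *\<^sub>R U0) \<le> C * exp (- s * T)"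
    and dW: "\<And>t. t > 0 \<Longrightarrow> (W has_vector_derivative - D t) (at t)" and gW: "\<And>t. t > 0 \<Longrightarrow> (W t, D t) \<in> G"
    and lW: "(W \<longlongrightarrow> U0) (at_right 0)" and t: "0 < t" "t \<le> T"
  shows "(\<lambda>\<tau>. norm (\<kappa> t \<tau> *\<^sub>R W \<tau>)) integrable_on {0<..}" "((\<lambda>\<tau>. \<kappa> t \<tau> *\<^sub>R W \<tau>) has_integral U t) {0<..}"
proof -
  interpret accretive_graph G by fact
  have nW: "norm (W \<tau>) \<le> norm U0" if "\<tau> > 0" for \<tau> by (rule heat_norm_bound[OF dW gW lW that])
  have cW: "continuous_on {0<..} W"
    using dW by (intro continuous_at_imp_continuous_on) (auto intro: has_vector_derivative_continuous)
  have cW0: "continuous_on {0..} (extend0 U0 W)"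
    by (rule continuous_extend0[OF continuous_on_subset[OF cW] lW]) auto
  have cU0: "continuous_on {0..T} (extend0 U0 U)"
    by (rule continuous_extend0[OF continuous_on_subset[OF cU] lU]) auto
  \<comment> \<open>Existence of the vector-valued integral: after integration by parts the kernel
    is continuous down to \<tau> = 0, so the integrand is integrable on bounded intervals, and
    \<open>majorant\<close> dominates it.\<close>
  have int: "(\<lambda>\<tau>. \<kappa> t \<tau> *\<^sub>R W \<tau>) integrable_on {0<..}" "(\<lambda>\<tau>. norm (\<kappa> t \<tau> *\<^sub>R W \<tau>)) integrable_on {0<..}" if t: "t > 0" for t
  proof -
    let ?z = "\<lambda>\<tau>. Re (kap' t \<tau>) *\<^sub>R extend0 U0 W \<tau>"
    let ?g = "\<lambda>\<tau>. K_maj * exp (s0 * t) * t powr (- 1/2) * norm U0 * majorant \<tau>"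
    have cz: "continuous_on {0..} ?z" "continuous_on {0..} (\<lambda>\<tau>. norm (?z \<tau>))"
      by (intro continuous_intros kap'_cont[OF t] cW0)+
    have eq: "?z \<tau> = \<kappa> t \<tau> *\<^sub>R W \<tau>" if "\<tau> > 0" for \<tau>
      using that t by (simp add: \<kappa>_def kap_by_parts extend0_def)
    have "set_integrable lborel {0<..} ?g"
    proof -
      have "(\<lambda>\<tau>. indicator {0<..} \<tau> *\<^sub>R ?g \<tau>) = ?g" by (auto simp: majorant_def indicator_def fun_eq_iff)
      then show ?thesis unfolding set_integrable_def by (simp only: integrable_mult_right majorant_integrable)
    qed
    then have gi: "?g integrable_on {0<..}" by (rule set_borel_integral_eq_integral(1))
    have b: "norm (\<kappa> t \<tau> *\<^sub>R W \<tau>) \<le> ?g \<tau>" if "\<tau> \<in> {0<..}" for \<tau>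
    proof -
      have "\<bar>\<kappa> t \<tau>\<bar> * norm (W \<tau>) \<le> (K_maj * exp (s0 * t) * t powr (- 1/2) * majorant \<tau>) * norm U0"
        using that nW[of \<tau>] \<kappa>_bound[of \<tau> t] t K_maj_nonneg by (intro mult_mono) (auto simp: majorant_def intro!: mult_nonneg_nonneg)
      then show ?thesis by (simp add: mult_ac)
    qed
    have F: "(\<lambda>x. if x \<in> {0<..} then \<kappa> t x *\<^sub>R W x else 0) = (\<lambda>x. if x \<in> {0<..} then ?z x else 0)"
      "(\<lambda>x. if x \<in> {0<..} then norm (\<kappa> t x *\<^sub>R W x) else 0) = (\<lambda>x. if x \<in> {0<..} then norm (?z x) else 0)"
      using eq by auto
    show "(\<lambda>\<tau>. \<kappa> t \<tau> *\<^sub>R W \<tau>) integrable_on {0<..}"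
      by (rule integrable_on_all_intervals_integrable_bound[OF _ b gi]) (unfold F, rule integrable_on_positive_part[OF cz(1)])
    show "(\<lambda>\<tau>. norm (\<kappa> t \<tau> *\<^sub>R W \<tau>)) integrable_on {0<..}"
      by (rule integrable_on_all_intervals_integrable_bound[OF _ _ gi]) (unfold F, rule integrable_on_positive_part[OF cz(2)], use b in simp)
  qed
  have key: "U t \<bullet> \<phi> = integral {0<..} (\<lambda>\<tau>. \<kappa> t \<tau> *\<^sub>R W \<tau>) \<bullet> \<phi>" for \<phi>
  proof -
    define w where "w \<tau> = indicator {0<..} \<tau> * (W \<tau> \<bullet> \<phi>)" for \<tau>
    define v where "v t = (LBINT \<tau>. indicator {0<..} \<tau> * (w \<tau> * \<kappa> t \<tau>))" for t
    define M where "M = norm U0 * norm \<phi>"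
    have wm[measurable]: "w \<in> borel_measurable borel"
    proof -
      have "continuous_on {0<..} (\<lambda>\<tau>. W \<tau> \<bullet> \<phi>)" by (intro continuous_intros cW)
      then show ?thesis
        using borel_measurable_continuous_on_indicator[of "{0<..}" "\<lambda>\<tau>. W \<tau> \<bullet> \<phi>"] unfolding w_def[abs_def] by simp
    qed
    have wb: "\<bar>w \<tau>\<bar> \<le> M" if "\<tau> > 0" for \<tau>
    proof -
      have "\<bar>W \<tau> \<bullet> \<phi>\<bar> \<le> norm (W \<tau>) * norm \<phi>" by (rule Cauchy_Schwarz_ineq2)
      also have "\<dots> \<le> M" unfolding M_def by (intro mult_right_mono nW that) simp
      finally show ?thesis using that by (simp add: w_def)
    qed
    have M0: "M \<ge> 0" by (simp add: M_def)
    have v_eq: "v t = integral {0<..} (\<lambda>\<tau>. \<kappa> t \<tau> *\<^sub>R W \<tau>) \<bullet> \<phi>" if t: "t > 0" for t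
    proof -
      have "set_integrable lborel {0<..} (\<lambda>\<tau>. w \<tau> * \<kappa> t \<tau>)"
        using subord_integrable(1)[OF wm wb t] by (simp add: set_integrable_def)
      from set_borel_integral_eq_integral(2)[OF this] have "v t = integral {0<..} (\<lambda>\<tau>. w \<tau> * \<kappa> t \<tau>)"
        by (simp add: v_def set_lebesgue_integral_def)
      also have "\<dots> = integral {0<..} (\<lambda>\<tau>. (\<kappa> t \<tau> *\<^sub>R W \<tau>) \<bullet> \<phi>)"
        by (rule integral_cong) (simp add: w_def mult.commute)
      also have "\<dots> = integral {0<..} (\<lambda>\<tau>. \<kappa> t \<tau> *\<^sub>R W \<tau>) \<bullet> \<phi>"
        using integral_linear[OF int(1)[OF t] bounded_linear_inner_left[of \<phi>]] by (simp add: o_def)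
      finally show ?thesis .
    qed
    define K where "K = M * K_maj * (LBINT \<tau>. majorant \<tau>)"
    have K0: "K \<ge> 0" unfolding K_def using M0 K_maj_nonneg by (intro mult_nonneg_nonneg Bochner_Integration.integral_nonneg) (auto simp: majorant_def)
    have vb: "\<bar>v t\<bar> \<le> K * (exp (s0 * t) * t powr (- 1/2))" if "t > 0" for t
      unfolding v_def K_def by (rule subord_integrable(2)[OF wm wb that])
    have vL: "integrable lborel (\<lambda>t. indicator {0<..} t * (exp (- p * t) * v t))"
      "(LBINT t. indicator {0<..} t * (exp (- p * t) * v t)) = Qr p / p * (LBINT \<tau>. indicator {0<..} \<tau> * (w \<tau> * exp (- Qr p * \<tau>)))" if "p > s0" for p
      unfolding v_def by (rule subord_laplace[OF wm wb that]; assumption)+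
    have vc: "continuous_on {0<..} v" unfolding v_def[abs_def] by (rule subord_continuous[OF wm wb])
    define h where "h t = U t \<bullet> \<phi> - v t" for t
    have hc: "continuous_on {0<..T} h"
      unfolding h_def[abs_def] by (intro continuous_intros cU continuous_on_subset[OF vc]) auto
    have Ui: "integrable lborel (\<lambda>t. exp (- p * t) * (indicator {0<..T} t * (U t \<bullet> \<phi>)))"
      "(LBINT t. exp (- p * t) * (indicator {0<..T} t * (U t \<bullet> \<phi>))) = laplace_upto T (extend0 U0 U) p \<bullet> \<phi>" for p
    proof -
      let ?k = "\<lambda>t. exp (- p * t) * (extend0 U0 U t \<bullet> \<phi>)"
      have c: "continuous_on {0..T} ?k" by (intro continuous_intros cU0)
      have si: "set_integrable lborel {0..T} ?k" by (rule borel_integrable_atLeastAtMost'[OF c])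
      have si': "set_integrable lborel {0<..T} ?k" by (rule set_integrable_subset[OF si]) auto
      have e: "(\<lambda>t. exp (- p * t) * (indicator {0<..T} t * (U t \<bullet> \<phi>))) = (\<lambda>t. indicator {0<..T} t *\<^sub>R ?k t)"
        by (auto simp: indicator_def extend0_def fun_eq_iff)
      show "integrable lborel (\<lambda>t. exp (- p * t) * (indicator {0<..T} t * (U t \<bullet> \<phi>)))"
        unfolding e using si' by (simp only: set_integrable_def)
      have "(LBINT t. exp (- p * t) * (indicator {0<..T} t * (U t \<bullet> \<phi>))) = (LINT t:{0<..T}|lborel. ?k t)"
        unfolding e set_lebesgue_integral_def ..
      also have "\<dots> = integral {0<..T} ?k" by (rule set_borel_integral_eq_integral(2)[OF si'])
      also have "\<dots> = integral {0..T} ?k"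
        by (rule integral_spike_set; rule negligible_subset[of "{0}"]) auto
      also have "\<dots> = laplace_upto T (extend0 U0 U) p \<bullet> \<phi>"
      proof -
        have "(\<lambda>t. exp (- p * t) *\<^sub>R extend0 U0 U t) integrable_on {0..T}"
          by (intro integrable_continuous_interval continuous_intros cU0)
        from integral_linear[OF this bounded_linear_inner_left[of \<phi>]] show ?thesis by (simp add: o_def)
      qed
      finally show "(LBINT t. exp (- p * t) * (indicator {0<..T} t * (U t \<bullet> \<phi>))) = laplace_upto T (extend0 U0 U) p \<bullet> \<phi>" .
    qed
    have vi: "integrable lborel (\<lambda>t. exp (- p * t) * (indicator S t * v t))" if "p > s0" "S \<in> sets borel" "S \<subseteq> {0<..}" for p S
    proof -
      have "integrable lborel (\<lambda>t. indicator S t *\<^sub>R (indicator {0<..} t * (exp (- p * t) * v t)))"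
        by (intro integrable_mult_indicator vL(1)) (use that in auto)
      moreover have "(\<lambda>t. indicator S t *\<^sub>R (indicator {0<..} t * (exp (- p * t) * v t))) = (\<lambda>t. exp (- p * t) * (indicator S t * v t))"
        using that by (auto simp: indicator_def fun_eq_iff)
      ultimately show ?thesis by simp
    qed
    \<comment> \<open>The pair for U minus Qr p/p times the pair of \<open>heat_resolvent\<close>
      lies in G. In \<open>resolvent_bound\<close> with parameter Qr p the two terms with U0 cancel.
      What remains is the residual of order exp(-p T) and the end term of the heat solution, which
      vanishes as the horizon n grows.\<close>
    have heat: "\<bar>laplace_upto T (extend0 U0 U) p \<bullet> \<phi> - Qr p / p * (LBINT \<tau>. indicator {0<..} \<tau> * (w \<tau> * exp (- Qr p * \<tau>)))\<bar>
      \<le> norm \<phi> * (\<bar>C\<bar> / q 1 * exp (- p * T))" if p: "p \<ge> 1" for p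
    proof -
      define r where "r = Qr p"
      have r: "r > 0" "q 1 \<le> r" using Qr_pos[of p] Qr_ge[OF p] p by (auto simp: r_def)
      define X where "X = laplace_upto T (extend0 U0 U) p"
      obtain Y where Y: "(X, Y) \<in> G" "norm (Y + r *\<^sub>R X - (r / p) *\<^sub>R U0) \<le> C * exp (- p * T)"
        using est[OF p] unfolding X_def r_def by blast
      define J where "J n = laplace_upto (real n) (extend0 U0 W) r" for n :: nat
      have bJ: "\<bar>(X - (r / p) *\<^sub>R J n) \<bullet> \<phi>\<bar> \<le> norm \<phi> * ((C * exp (- p * T) + (r / p) * exp (- r * real n) * norm U0) / r)" if n: "n \<ge> 1" for n
      proof -
        have g: "(J n, U0 - exp (- r * real n) *\<^sub>R W (real n) - r *\<^sub>R J n) \<in> G"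
          unfolding J_def by (rule heat_resolvent[OF dW gW lW]) (use n in auto)
        have "r * norm (X - (r / p) *\<^sub>R J n) \<le> norm (r *\<^sub>R (X + (- (r / p)) *\<^sub>R J n) + (Y + (- (r / p)) *\<^sub>R (U0 - exp (- r * real n) *\<^sub>R W (real n) - r *\<^sub>R J n)))"
          using resolvent_bound[OF graph_lincomb[OF Y(1) g, of "- (r / p)"], of r] r by simp
        also have "r *\<^sub>R (X + (- (r / p)) *\<^sub>R J n) + (Y + (- (r / p)) *\<^sub>R (U0 - exp (- r * real n) *\<^sub>R W (real n) - r *\<^sub>R J n))
          = (Y + r *\<^sub>R X - (r / p) *\<^sub>R U0) + ((r / p) * exp (- r * real n)) *\<^sub>R W (real n)"
          by (simp add: algebra_simps)
        also have "norm \<dots> \<le> C * exp (- p * T) + (r / p) * exp (- r * real n) * norm U0"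
        proof (rule order_trans[OF norm_triangle_ineq], rule add_mono[OF Y(2)])
          show "norm (((r / p) * exp (- r * real n)) *\<^sub>R W (real n)) \<le> (r / p) * exp (- r * real n) * norm U0"
            using mult_left_mono[OF nW[of "real n"], of "(r / p) * exp (- r * real n)"] n r p by (simp add: abs_mult)
        qed
        finally have "norm (X - (r / p) *\<^sub>R J n) \<le> (C * exp (- p * T) + (r / p) * exp (- r * real n) * norm U0) / r"
          using r by (simp add: pos_le_divide_eq mult.commute)
        then have "norm \<phi> * norm (X - (r / p) *\<^sub>R J n) \<le> norm \<phi> * ((C * exp (- p * T) + (r / p) * exp (- r * real n) * norm U0) / r)"
          by (rule mult_left_mono) simp
        moreover have "\<bar>(X - (r / p) *\<^sub>R J n) \<bullet> \<phi>\<bar> \<le> norm \<phi> * norm (X - (r / p) *\<^sub>R J n)"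
          using Cauchy_Schwarz_ineq2[of "X - (r / p) *\<^sub>R J n" \<phi>] by (simp add: mult.commute)
        ultimately show ?thesis by linarith
      qed
      define I where "I = (LBINT \<tau>. indicator {0<..} \<tau> * (w \<tau> * exp (- r * \<tau>)))"
      have limJ: "(\<lambda>n. J n \<bullet> \<phi>) \<longlonglongrightarrow> I"
      proof -
        have "J n \<bullet> \<phi> = (LBINT \<tau>. indicator {0<..<real n} \<tau> * (w \<tau> * exp (- r * \<tau>)))" for n
        proof -
          let ?k = "\<lambda>\<tau>. exp (- r * \<tau>) * (extend0 U0 W \<tau> \<bullet> \<phi>)"
          have c: "continuous_on {0..real n} (\<lambda>\<tau>. exp (- r * \<tau>) *\<^sub>R extend0 U0 W \<tau>)" "continuous_on {0..real n} ?k"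
            by (intro continuous_intros continuous_on_subset[OF cW0]; auto)+
          have "J n \<bullet> \<phi> = integral {0..real n} ?k"
            using integral_linear[OF integrable_continuous_interval[OF c(1)] bounded_linear_inner_left[of \<phi>]] by (simp add: J_def o_def)
          also have "\<dots> = integral {0<..<real n} ?k" by (rule integral_open_interval_real)
          also have "\<dots> = (LINT \<tau>:{0<..<real n}|lborel. ?k \<tau>)"
            by (rule set_borel_integral_eq_integral(2)[symmetric], rule set_integrable_subset[OF borel_integrable_atLeastAtMost'[OF c(2)]]) auto
          also have "\<dots> = (LBINT \<tau>. indicator {0<..<real n} \<tau> * (w \<tau> * exp (- r * \<tau>)))"
            unfolding set_lebesgue_integral_def by (intro Bochner_Integration.integral_cong) (auto simp: w_def extend0_def indicator_def)
          finally show ?thesis .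
        qed
        moreover have "(\<lambda>n. LBINT \<tau>. indicator {0<..<real n} \<tau> * (w \<tau> * exp (- r * \<tau>))) \<longlonglongrightarrow> I"
          unfolding I_def
        proof (rule integral_dominated_convergence)
          show "integrable lborel (\<lambda>\<tau>. M * (indicator {0<..} \<tau> * exp (- r * \<tau>)))"
            by (intro integrable_mult_right integrable_exp_minus r)
          show "AE \<tau> in lborel. (\<lambda>n. indicator {0<..<real n} \<tau> * (w \<tau> * exp (- r * \<tau>))) \<longlonglongrightarrow> indicator {0<..} \<tau> * (w \<tau> * exp (- r * \<tau>))"
          proof (rule AE_I2)
            fix \<tau> :: real
            obtain N where N: "\<tau> < real N" using reals_Archimedean2 by blast
            have "\<forall>\<^sub>F n in sequentially. indicator {0<..<real n} \<tau> * (w \<tau> * exp (- r * \<tau>)) = indicator {0<..} \<tau> * (w \<tau> * exp (- r * \<tau>))"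
              using eventually_ge_at_top[of N] by eventually_elim (use N in \<open>auto simp: indicator_def\<close>)
            then show "(\<lambda>n. indicator {0<..<real n} \<tau> * (w \<tau> * exp (- r * \<tau>))) \<longlonglongrightarrow> indicator {0<..} \<tau> * (w \<tau> * exp (- r * \<tau>))"
              by (rule tendsto_eventually)
          qed
          show "AE \<tau> in lborel. norm (indicator {0<..<real n} \<tau> * (w \<tau> * exp (- r * \<tau>))) \<le> M * (indicator {0<..} \<tau> * exp (- r * \<tau>))" for n
            using wb M0 by (intro AE_I2) (auto simp: indicator_def abs_mult mult_right_mono)
        qed measurable
        ultimately show ?thesis by simp
      qed
      have "(\<lambda>n. \<bar>X \<bullet> \<phi> - (r / p) * (J n \<bullet> \<phi>)\<bar>) \<longlonglongrightarrow> \<bar>X \<bullet> \<phi> - (r / p) * I\<bar>" by (intro tendsto_intros limJ)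
      moreover have "(\<lambda>n. norm \<phi> * ((C * exp (- p * T) + (r / p) * exp (- r * real n) * norm U0) / r)) \<longlonglongrightarrow> norm \<phi> * ((C * exp (- p * T) + (r / p) * 0 * norm U0) / r)"
      proof -
        have "(\<lambda>n. exp (- r * real n)) \<longlonglongrightarrow> 0"
          using LIMSEQ_power_zero[of "exp (- r)"] r by (simp add: exp_of_nat2_mult[symmetric] mult.commute)
        then show ?thesis using r by (intro tendsto_intros) auto
      qed
      ultimately have "\<bar>X \<bullet> \<phi> - (r / p) * I\<bar> \<le> norm \<phi> * ((C * exp (- p * T) + (r / p) * 0 * norm U0) / r)"
        by (rule LIMSEQ_le) (use bJ in \<open>auto intro!: exI[of _ 1] simp: inner_diff_left\<close>)
      also have "\<dots> \<le> norm \<phi> * (\<bar>C\<bar> / q 1 * exp (- p * T))"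
      proof (rule mult_left_mono)
        have "C / r \<le> \<bar>C\<bar> / q 1" using r q[of 1] l by (intro frac_le) auto
        then show "(C * exp (- p * T) + r / p * 0 * norm U0) / r \<le> \<bar>C\<bar> / q 1 * exp (- p * T)"
          using mult_right_mono[of "C / r" "\<bar>C\<bar> / q 1" "exp (- p * T)"] by simp
      qed simp
      finally show ?thesis unfolding X_def I_def r_def .
    qed
    \<comment> \<open>The constant for the part of v beyond T: t^(-1/2) is at most T^(-1/2) there,
      and exp(s0 T) is left over from the growth of v.\<close>
    define K' where "K' = K * T powr (- 1/2) * exp (s0 * T)"
    have K'0: "K' \<ge> 0" using K0 by (simp add: K'_def)
    have tail: "\<bar>LBINT t. exp (- p * t) * (indicator {T<..} t * v t)\<bar> \<le> K' * exp (- p * T)" if p: "p \<ge> s0 + 1" for p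
    proof -
      have d: "p - s0 > 0" using p by simp
      note ti = has_bochner_integral_exp_tail[OF d, of T]
      have i: "integrable lborel (\<lambda>t. exp (- p * t) * (indicator {T<..} t * v t))" using T p by (intro vi) auto
      have "\<bar>LBINT t. exp (- p * t) * (indicator {T<..} t * v t)\<bar> \<le> (LBINT t. (K * T powr (- 1/2)) * (indicator {T..} t * exp (- (p - s0) * t)))"
      proof (intro integral_abs_bound[THEN order_trans] integral_mono integrable_abs[OF i] integrable_mult_right)
        show "integrable lborel (\<lambda>t. indicator {T..} t * exp (- (p - s0) * t))" using ti by (rule integrable.intros)
        show "\<bar>exp (- p * t) * (indicator {T<..} t * v t)\<bar> \<le> (K * T powr (- 1/2)) * (indicator {T..} t * exp (- (p - s0) * t))" for t
        proof (cases "t > T")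
          case True
          have "t powr (- 1/2) \<le> T powr (- 1/2)" using True T by (intro powr_mono2') auto
          then have "K * (exp (s0 * t) * t powr (- 1/2)) \<le> K * (exp (s0 * t) * T powr (- 1/2))"
            using K0 by (intro mult_left_mono) auto
          with vb[of t] True T have "\<bar>v t\<bar> \<le> K * (exp (s0 * t) * T powr (- 1/2))" by simp
          then have "exp (- p * t) * \<bar>v t\<bar> \<le> exp (- p * t) * (K * (exp (s0 * t) * T powr (- 1/2)))" by (intro mult_left_mono) auto
          also have "\<dots> = (K * T powr (- 1/2)) * exp (- (p - s0) * t)"
          proof -
            have "exp (- (p - s0) * t) = exp (- p * t) * exp (s0 * t)" by (simp add: exp_add[symmetric] algebra_simps)
            then show ?thesis by simp
          qed
          finally show ?thesis using True by (simp add: abs_mult)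
        next
          case False
          then show ?thesis using K0 by (simp add: mult_nonneg_nonneg)
        qed
      qed
      also have "\<dots> = (K * T powr (- 1/2)) * (exp (- (p - s0) * T) / (p - s0))" using has_bochner_integral_integral_eq[OF ti] by simp
      also have "\<dots> \<le> (K * T powr (- 1/2)) * (exp (- (p - s0) * T) / 1)"
        using p K0 by (intro mult_left_mono divide_left_mono) auto
      also have "\<dots> = K' * exp (- p * T)"
      proof -
        have "exp (- (p - s0) * T) = exp (s0 * T) * exp (- p * T)" by (simp add: exp_add[symmetric] algebra_simps)
        then show ?thesis by (simp add: K'_def)
      qed
      finally show ?thesis .
    qed
    have "h t = 0"
    proof (rule finite_laplace_unique[OF T hc])
      show "integrable lborel (\<lambda>t. indicator {0<..T} t * h t)"
      proof -
        let ?p = "s0 + 1"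
        \<comment> \<open>On (0,T] the exponential weight is bounded below, so it can be divided
          out.\<close>
        have vi0: "integrable lborel (\<lambda>t. indicator {0<..T} t * v t)"
        proof (rule Bochner_Integration.integrable_bound)
          show "integrable lborel (\<lambda>t. exp (?p * T) * (exp (- ?p * t) * (indicator {0<..T} t * v t)))"
            by (intro integrable_mult_right vi) auto
          have "continuous_on {0<..T} v" by (rule continuous_on_subset[OF vc]) auto
          then show "(\<lambda>t. indicator {0<..T} t * v t) \<in> borel_measurable lborel"
            using borel_measurable_continuous_on_indicator[of "{0<..T}" v] by simp
          have "1 \<le> exp (?p * T) * exp (- ?p * t)" if "t \<le> T" for t
          proof -
            have "?p * t \<le> ?p * T" using that s0 by (intro mult_left_mono) auto
            then have "0 \<le> ?p * T + - ?p * t" by (simp add: algebra_simps)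
            then show ?thesis unfolding exp_add[symmetric] by (simp only: one_le_exp_iff)
          qed
          then have "\<bar>v t\<bar> \<le> exp (?p * T) * exp (- ?p * t) * \<bar>v t\<bar>" if "t \<le> T" for t
            using mult_right_mono[of 1 "exp (?p * T) * exp (- ?p * t)" "\<bar>v t\<bar>"] that by simp
          then show "AE t in lborel. norm (indicator {0<..T} t * v t) \<le> norm (exp (?p * T) * (exp (- ?p * t) * (indicator {0<..T} t * v t)))"
            by (intro AE_I2) (simp add: abs_mult indicator_def mult.assoc)
        qed
        have "(\<lambda>t. indicator {0<..T} t * h t) = (\<lambda>t. exp (- 0 * t) * (indicator {0<..T} t * (U t \<bullet> \<phi>)) - indicator {0<..T} t * v t)"
          by (auto simp: h_def algebra_simps)
        then show ?thesis using Bochner_Integration.integrable_diff[OF Ui(1)[of 0] vi0] by simp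
      qed
      show "t \<in> {0<..T}" using t by simp
      fix p assume p: "p \<ge> s0 + 1"
      then have p1: "p \<ge> 1" "p > s0" using s0 by auto
      let ?I = "LBINT \<tau>. indicator {0<..} \<tau> * (w \<tau> * exp (- Qr p * \<tau>))"
      have "(LBINT t. exp (- p * t) * (indicator {0<..T} t * h t))
        = (LBINT t. exp (- p * t) * (indicator {0<..T} t * (U t \<bullet> \<phi>))) - (LBINT t. exp (- p * t) * (indicator {0<..T} t * v t))"
        using p1 by (subst Bochner_Integration.integral_diff[symmetric, OF Ui(1) vi]) (auto simp: h_def algebra_simps)
      also have "(LBINT t. exp (- p * t) * (indicator {0<..T} t * v t)) = Qr p / p * ?I - (LBINT t. exp (- p * t) * (indicator {T<..} t * v t))"
      proof -
        have "(LBINT t. exp (- p * t) * (indicator {0<..T} t * v t)) + (LBINT t. exp (- p * t) * (indicator {T<..} t * v t))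
          = (LBINT t. exp (- p * t) * (indicator {0<..T} t * v t) + exp (- p * t) * (indicator {T<..} t * v t))"
          using p1 T by (intro Bochner_Integration.integral_add[symmetric] vi) auto
        also have "\<dots> = (LBINT t. indicator {0<..} t * (exp (- p * t) * v t))"
          using T by (intro Bochner_Integration.integral_cong) (auto simp: indicator_def)
        finally show ?thesis using vL(2)[OF p1(2)] by simp
      qed
      finally have e: "(LBINT t. exp (- p * t) * (indicator {0<..T} t * h t))
        = (laplace_upto T (extend0 U0 U) p \<bullet> \<phi> - Qr p / p * ?I) + (LBINT t. exp (- p * t) * (indicator {T<..} t * v t))"
        unfolding Ui(2) by simp
      have "\<bar>LBINT t. exp (- p * t) * (indicator {0<..T} t * h t)\<bar> \<le> norm \<phi> * (\<bar>C\<bar> / q 1 * exp (- p * T)) + K' * exp (- p * T)"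
        unfolding e by (rule order_trans[OF abs_triangle_ineq add_mono[OF heat[OF p1(1)] tail[OF p]]])
      also have "\<dots> = (norm \<phi> * (\<bar>C\<bar> / q 1) + K') * 1 * exp (- p * T)" by (simp add: algebra_simps)
      \<comment> \<open>The factor p \<ge> 1 brings the bound into the form expected by
        \<open>finite_laplace_unique\<close>.\<close>
      also have "\<dots> \<le> (norm \<phi> * (\<bar>C\<bar> / q 1) + K') * p * exp (- p * T)"
        using p1 K'0 q[of 1] l by (intro mult_right_mono mult_left_mono add_nonneg_nonneg mult_nonneg_nonneg) auto
      finally show "\<bar>LBINT t. exp (- p * t) * (indicator {0<..T} t * h t)\<bar> \<le> (norm \<phi> * (\<bar>C\<bar> / q 1) + K') * p * exp (- p * T)" .
    qed
    then show ?thesis using v_eq[OF t(1)] by (simp add: h_def)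
  qed
  have "U t = integral {0<..} (\<lambda>\<tau>. \<kappa> t \<tau> *\<^sub>R W \<tau>)"
    by (rule vector_eq_rdot[THEN iffD1]) (use key in blast)
  then show "((\<lambda>\<tau>. \<kappa> t \<tau> *\<^sub>R W \<tau>) has_integral U t) {0<..}" using int(1)[OF t(1)] by (simp add: integrable_integral)
  show "(\<lambda>\<tau>. norm (\<kappa> t \<tau> *\<^sub>R W \<tau>)) integrable_on {0<..}" by (rule int(2)[OF t(1)])
qed

end

text \<open>Linearity and accretivity pass to limits by continuity of the operations; passing to the
  closure thereby supplies the closedness on which integrals of pairs rely.\<close>

lemma closure_accretive_graph:
  fixes G :: "('h::{real_inner,banach} \<times> 'h) set"
  assumes z: "(0, 0) \<in> G" and lin: "\<And>x y x' y' r. (x, y) \<in> G \<Longrightarrow> (x', y') \<in> G \<Longrightarrow> (x + r *\<^sub>R x', y + r *\<^sub>R y') \<in> G"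
    and acc: "\<And>x y. (x, y) \<in> G \<Longrightarrow> 0 \<le> x \<bullet> y"
  shows "accretive_graph (closure G)"
proof
  have "subspace G" unfolding subspace_def
  proof (intro conjI ballI allI)
    show "0 \<in> G" using z by (simp add: zero_prod_def)
    fix p p' :: "'h \<times> 'h" and r :: real assume p: "p \<in> G"
    show "r *\<^sub>R p \<in> G" using lin[OF z, of "fst p" "snd p" r] p by (simp add: scaleR_prod_def)
    assume "p' \<in> G"
    then show "p + p' \<in> G" using lin[of "fst p" "snd p" "fst p'" "snd p'" 1] p by (simp add: plus_prod_def)
  qed
  then have sub: "0 \<in> G" "\<And>x y. x \<in> G \<Longrightarrow> y \<in> G \<Longrightarrow> x + y \<in> G" "\<And>r x. x \<in> G \<Longrightarrow> r *\<^sub>R x \<in> G"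
    by (auto simp: subspace_def)
  show "subspace (closure G)" unfolding subspace_def
  proof (intro conjI ballI allI)
    show "0 \<in> closure G" using sub(1) closure_subset by blast
    fix x y r assume "x \<in> closure G"
    then obtain f where f: "\<And>n. f n \<in> G" "f \<longlonglongrightarrow> x" unfolding closure_sequential by blast
    have "(\<lambda>n. r *\<^sub>R f n) \<longlonglongrightarrow> r *\<^sub>R x" by (intro tendsto_intros f(2))
    moreover have "\<forall>n. r *\<^sub>R f n \<in> G" using f(1) sub(3) by simp
    ultimately show "r *\<^sub>R x \<in> closure G"
      unfolding closure_sequential by (intro exI[of _ "\<lambda>n. r *\<^sub>R f n"]) simp
    assume "y \<in> closure G"
    then obtain g where g: "\<And>n. g n \<in> G" "g \<longlonglongrightarrow> y" unfolding closure_sequential by blast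
    have "(\<lambda>n. f n + g n) \<longlonglongrightarrow> x + y" by (intro tendsto_intros f(2) g(2))
    moreover have "\<forall>n. f n + g n \<in> G" using f(1) g(1) sub(2) by simp
    ultimately show "x + y \<in> closure G"
      unfolding closure_sequential by (intro exI[of _ "\<lambda>n. f n + g n"]) simp
  qed
  show "closed (closure G)" by simp
  fix x y assume "(x, y) \<in> closure G"
  then obtain f where f: "\<And>n. f n \<in> G" "f \<longlonglongrightarrow> (x, y)" unfolding closure_sequential by blast
  have "(\<lambda>n. fst (f n) \<bullet> snd (f n)) \<longlonglongrightarrow> fst (x, y) \<bullet> snd (x, y)" by (intro tendsto_intros f(2))
  moreover have "\<forall>n. 0 \<le> fst (f n) \<bullet> snd (f n)" using f(1) acc by (metis prod.collapse)
  ultimately show "0 \<le> x \<bullet> y" by (intro LIMSEQ_le_const[of "\<lambda>n. fst (f n) \<bullet> snd (f n)"]) auto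
qed

text \<open>The first conjunct makes the definite description in \<open>vline_integral\<close>
  denote a value, and the second makes the integral over \<tau> absolutely convergent; with them the
  last conjunct carries its intended meaning.\<close>

theorem lemma3p2:
  fixes \<Omega> :: "(real^'d::finite) set" and T :: real
    and a :: "'d \<Rightarrow> 'd \<Rightarrow> real^'d \<Rightarrow> real" and c :: "real^'d \<Rightarrow> real"
    and l :: nat and q \<alpha> :: "nat \<Rightarrow> real"
    and u0 :: "real^'d \<Rightarrow> complex" and u w :: "real \<Rightarrow> real^'d \<Rightarrow> complex"
    and s0 t :: real
  assumes "T > 0"
    and "open \<Omega>" and "connected \<Omega>" and "bounded \<Omega>" and "C2_boundary \<Omega>"
    and "admissible_coeffs \<Omega> a c"
    and "l \<ge> 1" and "\<forall>j\<in>{1..l}. q j > 0"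
    and "0 < \<alpha> l" and "\<forall>i\<in>{1..l}. \<forall>j\<in>{1..l}. i < j \<longrightarrow> \<alpha> j < \<alpha> i" and "\<alpha> 1 < 1"
    and "L2_fun \<Omega> u0"
    and "fractional_solution \<Omega> T a c l q \<alpha> u0 u"
    and "heat_solution \<Omega> a c u0 w"
    and "s0 > 0" and "0 < t" and "t \<le> T"
  shows "(\<forall>\<tau>>0. \<exists>I. has_vline_integral (kernel_integrand l q \<alpha> t \<tau>) s0 I) \<and>
    (\<lambda>\<tau>. norm (L2_of \<Omega> (\<lambda>x. w \<tau> x * subordination_kernel l q \<alpha> s0 t \<tau>))) integrable_on {0<..} \<and>
    ((\<lambda>\<tau>. L2_of \<Omega> (\<lambda>x. w \<tau> x * subordination_kernel l q \<alpha> s0 t \<tau>))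
       has_integral L2_of \<Omega> (u t)) {0<..}"
proof -
  interpret elliptic \<Omega> a c by unfold_locales fact+
  have \<alpha>_le1: "\<alpha> j \<le> \<alpha> 1" and \<alpha>_gt0: "0 < \<alpha> j" if j: "j \<in> {1..l}" for j
  proof -
    have "\<alpha> j = \<alpha> 1 \<or> \<alpha> j < \<alpha> 1" "\<alpha> j = \<alpha> l \<or> \<alpha> l < \<alpha> j"
      using j assms(7,10) by (cases "j = 1"; cases "j = l"; force)+
    then show "\<alpha> j \<le> \<alpha> 1" "0 < \<alpha> j" using assms(9) by auto
  qed
  interpret subordination l q \<alpha> s0 by unfold_locales (use assms \<alpha>_le1 \<alpha>_gt0 in auto)
  define G where "G = closure (weak_graph \<Omega> a c)"
  define U W B D where "U t = L2_of \<Omega> (u t)" and "W t = L2_of \<Omega> (w t)"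
    and "B t = L2_of \<Omega> (elliptic_op \<Omega> a c (u t))" and "D t = L2_of \<Omega> (elliptic_op \<Omega> a c (w t))" for t
  have cu: "continuous_into_H2_H10 \<Omega> {0<..T} u" and lU: "(U \<longlongrightarrow> L2_of \<Omega> u0) (at_right 0)"
    using assms(13) by (auto simp: fractional_solution_def U_def[abs_def])
  have cw: "continuous_into_H2_H10 \<Omega> {0<..} w" and lW: "(W \<longlongrightarrow> L2_of \<Omega> u0) (at_right 0)"
    and dW: "\<And>t. t > 0 \<Longrightarrow> (W has_vector_derivative - D t) (at t)"
    using assms(14) by (auto simp: heat_solution_def W_def[abs_def] D_def)
  have cU: "continuous_on {0<..T} U" and cB: "continuous_on {0<..T} B"
    using continuous_into_H2_H10_L2[OF cu] by (auto simp: U_def[abs_def] B_def[abs_def])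
  have gU: "(U t, B t) \<in> G" if "t \<in> {0<..T}" for t
    unfolding G_def U_def B_def
    by (rule closure_subset[THEN subsetD], rule elliptic_op_in_weak_graph) (use cu that in \<open>auto simp: continuous_into_H2_H10_def\<close>)
  have gW: "(W t, D t) \<in> G" if "t > 0" for t
    unfolding G_def W_def D_def
    by (rule closure_subset[THEN subsetD], rule elliptic_op_in_weak_graph) (use cw that in \<open>auto simp: continuous_into_H2_H10_def\<close>)
  have G: "accretive_graph G"
    unfolding G_def
  proof (rule closure_accretive_graph[OF _ weak_graph_lincomb weak_graph_accretive])
    have "u T \<in> H2 \<Omega> \<inter> H10 \<Omega>" using cu assms(1) by (auto simp: continuous_into_H2_H10_def)
    from elliptic_op_in_weak_graph[OF this] have p: "(U T, B T) \<in> weak_graph \<Omega> a c" unfolding U_def B_def .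
    \<comment> \<open>A pair minus itself; the solution at time T supplies one.\<close>
    show "(0, 0) \<in> weak_graph \<Omega> a c" using weak_graph_lincomb[OF p p, of "- 1"] by simp
  qed
  obtain C where C: "\<And>s. s \<ge> 1 \<Longrightarrow> \<exists>Y. (laplace_upto T (extend0 (L2_of \<Omega> u0) U) s, Y) \<in> G \<and>
      norm (Y + Qr s *\<^sub>R laplace_upto T (extend0 (L2_of \<Omega> u0) U) s - (Qr s / s) *\<^sub>R L2_of \<Omega> u0) \<le> C * exp (- s * T)"
    using frac_transform_estimate[OF G assms(1) cU lU cB gU fractional_weak_form[OF assms(1) \<alpha>_gt0 \<alpha>_le1 assms(11,12,13), folded U_def B_def]]
    by blast
  have F: "(\<lambda>\<tau>. norm (\<kappa> t \<tau> *\<^sub>R W \<tau>)) integrable_on {0<..}" "((\<lambda>\<tau>. \<kappa> t \<tau> *\<^sub>R W \<tau>) has_integral U t) {0<..}"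
    by (rule subordination_formula[OF G assms(1) cU lU C dW gW lW assms(16,17)]; assumption)+
  \<comment> \<open>The kernel is real for \<tau> > 0, so multiplying a representative by it is a
    real scaling of the class.\<close>
  have eq: "L2_of \<Omega> (\<lambda>x. w \<tau> x * subordination_kernel l q \<alpha> s0 t \<tau>) = \<kappa> t \<tau> *\<^sub>R W \<tau>" if \<tau>: "\<tau> \<in> {0<..}" for \<tau>
  proof -
    have "w \<tau> \<in> H2 \<Omega>" using cw \<tau> by (auto simp: continuous_into_H2_H10_def)
    then have "L2_fun \<Omega> (w \<tau>)" by (rule elliptic_term(5))
    moreover have "(\<lambda>x. w \<tau> x * subordination_kernel l q \<alpha> s0 t \<tau>) = (\<lambda>x. \<kappa> t \<tau> *\<^sub>R w \<tau> x)"
      using \<tau> by (simp add: subordination_kernel_eq kap_\<kappa> scaleR_conv_of_real mult.commute)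
    ultimately show ?thesis using L2_of_scaleR[OF dom_sets] by (simp add: W_def)
  qed
  have "(\<lambda>\<tau>. norm (L2_of \<Omega> (\<lambda>x. w \<tau> x * subordination_kernel l q \<alpha> s0 t \<tau>))) integrable_on {0<..}"
    by (rule integrable_eq[OF F(1)]) (simp only: eq)
  moreover have "((\<lambda>\<tau>. L2_of \<Omega> (\<lambda>x. w \<tau> x * subordination_kernel l q \<alpha> s0 t \<tau>)) has_integral L2_of \<Omega> (u t)) {0<..}"
    using F(2) unfolding U_def by (rule has_integral_eq[rotated]) (simp only: eq)
  ultimately show ?thesis using has_vline_kernel by blast
qed

end
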